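(* Let $L>0$, $\mu>0$, $\alpha>1/2$ and $f\in V^{\alpha}$. There exists $\nu_0>0$ such that for every viscosity $\nu\ge\nu_0$ there are $R,\rho>0$ for which the continuous dynamical system $(S(t,\cdot))_{t\ge 0}$ on $\mathcal Y^\mu_\alpha$ possesses a unique local attractor $\mathcal A^\mu$ relative to the ball $B_{\mathcal Y^\mu_\alpha}(R;\rho)$. Furthermore, there exists $\nu_1\ge\nu_0$ such that for every $\nu\ge\nu_1$ the local attractor of the discrete dynamical system $U$ relative to $B_{\mathcal X^\mu_\alpha}(R;\rho)$ consists of a single point and, for this choice of the viscosity, the attractor $\mathcal A^\mu$ of $S$ also consists of a single point.
   Context: Spaces. $\mathbb T^3_L$ is the 3-dimensional torus of side length $L$. For $s\in\mathbb R$, $V^s$ is the closed subspace of the periodic Sobolev space $H^s(\mathbb T^3_L)^3$ of real, zero-mean, divergence-free vector fields. $A=-\Delta$ is the Stokes operator (positive, selfadjoint on $V^0$), with norms $\|u\|_s=\|A^{s/2}u\|_0$, where $\|\cdot\|_0$ is the $L^2$ norm on $V^0$. $V^{-s}$ is the dual of $V^s$, with duality pairing $\langle\cdot,\cdot\rangle$ extending the $L^2$ inner product. The bilinear operator $B$ is defined by $\langle B(u,v),w\rangle=b(u,v,w)=\sum_{i,j=1}^3\int_{\mathbb T^3_L}u_j\,\partial_{x_j}v_i\,w_i\,dx$, extended by continuity. Phase spaces. $\mathcal X^\mu_\alpha=L_2(0,\mu,V^{1+\alpha})\times V^\alpha$ and $\mathcal Y^\mu_\alpha=L_2(-\mu,0,V^{1+\alpha})\times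 V^\alpha$. For $R,\rho>0$, $B_{\mathcal X^\mu_\alpha}(R;\rho)=B_{L_2(0,\mu,V^{1+\alpha})}(0,R)\times B_{V^\alpha}(0,\rho)$ and $B_{\mathcal Y^\mu_\alpha}(R;\rho)=B_{L_2(-\mu,0,V^{1+\alpha})}(0,R)\times B_{V^\alpha}(0,\rho)$ (products of closed balls centered at $0$). Delayed Navier-Stokes system. For $(\phi,u_0)\in\mathcal Y^\mu_\alpha$, let $u^\mu$ be the unique weak solution (known to exist globally, with $u^\mu|_{[0,T]}\in C([0,T],V^\alpha)$ and $u^\mu\in L_2(-\mu,T,V^{1+\alpha})$ for every $T>0$) of $$\frac{du^\mu}{dt}(t)+\nu Au^\mu(t)+B(u^\mu(t-\mu),u^\mu(t))=f\ (t\ge 0),\quad u^\mu(0)=u_0,\quad u^\mu(t)=\phi(t)\ (t\in[-\mu,0)),$$ the equation being understood weakly in time and tested against $v\in V^{1+\alpha}$. For $t\ge0$ define $S(t,\cdot):\mathcal Y^\mu_\alpha\to\mathcal Y^\mu_\alpha$ by $S(t,(\phi,u_0))=((u^\mu)_t,u^\mu(t))$, where $(u^\mu)_t(s)=u^\mu(t+s)$, $s\in(-\mu,0)$. It is a continuous semigroup. Linearized system. For $(\psi,u_0)\in\mathcal X^\mu_\alpha$, let $u\in C([0,\mu],V^\alpha)\cap L_2(0,\mu,V^{1+\alpha})$ be the unique weak solution of $\frac{du}{dt}+\nu Au+B(\psi(t),u(t))=f$ on $[0,\mu]$, $u(0)=u_0$. Define $U(1,(\psi,u_0))=(u,u(\mu))$,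 a continuous map of $\mathcal X^\mu_\alpha$ into itself, and let $U(n,\cdot)$ be its $n$-fold composition. Local attractor. A local attractor of $S$ relative to a ball $B=B_{\mathcal Y^\mu_\alpha}(R;\rho)$ is a nonempty compact set $\mathcal A^\mu\subset B$ with $S(t,\mathcal A^\mu)=\mathcal A^\mu$ for all $t\ge0$ and $\lim_{t\to\infty}\sup_{x\in B}\mathrm{dist}_{\mathcal Y^\mu_\alpha}(S(t,x),\mathcal A^\mu)=0$. A local attractor of $U$ relative to a ball $B=B_{\mathcal X^\mu_\alpha}(R;\rho)$ is a nonempty compact set $\mathcal A\subset B$ with $U(1,\mathcal A)=\mathcal A$ and $\lim_{n\to\infty}\sup_{x\in B}\mathrm{dist}_{\mathcal X^\mu_\alpha}(U(n,x),\mathcal A)=0$. *)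

theory Defs
  imports "HOL-Analysis.Analysis"
begin

section \<open>Periodic vector fields and the spaces \<open>V\<^sup>s\<close>\<close>

text \<open>
  A periodic (generalized) vector field on the torus of side length \<open>L\<close> is identified with the
  family of its Fourier coefficients with respect to the characters
  \<open>x \<mapsto> exp (2 \<pi> i k \<bullet> x / L)\<close>, \<open>k \<in> \<int>\<^sup>3\<close>.
\<close>

type_synonym field = "int ^ 3 \<Rightarrow> complex ^ 3"

definition wavevector :: "real \<Rightarrow> int ^ 3 \<Rightarrow> real ^ 3" where
  "wavevector L k = (\<chi> i. 2 * pi / L * of_int (k $ i))"

text \<open>
  \<open>- \<Delta>\<close> acts on the character of index \<open>k\<close> as multiplication by the square of the length of its
  wave vector.
\<close>

definition stokes :: "real \<Rightarrow> field \<Rightarrow> field" where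
  "stokes L u = (\<lambda>k. ((norm (wavevector L k))\<^sup>2) *\<^sub>R u k)"

definition stokes_power :: "real \<Rightarrow> real \<Rightarrow> field \<Rightarrow> field" where
  "stokes_power L r u = (\<lambda>k. ((norm (wavevector L k))\<^sup>2 powr r) *\<^sub>R u k)"

text \<open>
  The factor \<open>L\<^sup>3\<close> is the volume of the torus, so that by Parseval the following two are the
  \<open>L\<^sub>2\<close> norm and the \<open>L\<^sub>2\<close> inner product of real fields; the latter is also the duality pairing
  of \<open>V\<^sup>-\<^sup>s\<close> with \<open>V\<^sup>s\<close>. Here \<open>u k \<bullet> v k\<close> is the real part of the Hermitian product;
  the imaginary parts cancel in the sum because of \<open>u (- k) = cnj (u k)\<close>.
\<close>

definition L2_field_norm :: "real \<Rightarrow> field \<Rightarrow> real" where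
  "L2_field_norm L u = sqrt (L ^ 3 * (\<Sum>\<^sub>\<infinity>k. (norm (u k))\<^sup>2))"

definition pairing :: "real \<Rightarrow> field \<Rightarrow> field \<Rightarrow> real" where
  "pairing L u v = L ^ 3 * (\<Sum>\<^sub>\<infinity>k. u k \<bullet> v k)"

definition V_norm :: "real \<Rightarrow> real \<Rightarrow> field \<Rightarrow> real" where
  "V_norm L s u = L2_field_norm L (stokes_power L (s / 2) u)"

definition V_dist :: "real \<Rightarrow> real \<Rightarrow> field \<Rightarrow> field \<Rightarrow> real" where
  "V_dist L s u v = V_norm L s (\<lambda>k. u k - v k)"

text \<open>The four conditions: zero mean, divergence free, real valued, of Sobolev regularity \<open>s\<close>.\<close>

definition V :: "real \<Rightarrow> real \<Rightarrow> field set" where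
  "V L s = {u. u 0 = 0 \<and>
               (\<forall>k. (\<Sum>i\<in>UNIV. of_int (k $ i) * u k $ i) = 0) \<and>
               (\<forall>k i. u (- k) $ i = cnj (u k $ i)) \<and>
               (\<lambda>k. (norm (stokes_power L (s / 2) u k))\<^sup>2) summable_on UNIV}"

abbreviation V_topology :: "real \<Rightarrow> real \<Rightarrow> field topology" where
  "V_topology L s \<equiv> Metric_space.mtopology (V L s) (V_dist L s)"


section \<open>The trilinear form\<close>

definition field_value :: "real \<Rightarrow> field \<Rightarrow> real ^ 3 \<Rightarrow> real ^ 3" where
  "field_value L u x = (\<chi> i. Re (\<Sum>\<^sub>\<infinity>k. u k $ i * cis (wavevector L k \<bullet> x)))"

definition trig_fields :: "real \<Rightarrow> field set" where
  "trig_fields L = {u \<in> V L 0. finite {k. u k \<noteq> 0}}"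

definition partial :: "3 \<Rightarrow> (real ^ 3 \<Rightarrow> real) \<Rightarrow> real ^ 3 \<Rightarrow> real" where
  "partial j g x = frechet_derivative g (at x) (axis j 1)"

definition b_trig :: "real \<Rightarrow> field \<Rightarrow> field \<Rightarrow> field \<Rightarrow> real" where
  "b_trig L u v w =
     (\<Sum>i\<in>UNIV. \<Sum>j\<in>UNIV.
        LINT x:cbox 0 (\<chi> _. L)|lborel.
          field_value L u x $ j * partial j (\<lambda>y. field_value L v y $ i) x * field_value L w x $ i)"

text \<open>
  Extension by continuity from the dense subspace of trigonometric polynomials to \<open>V\<^sup>s\<close>
  (well defined for \<open>s > 3 / 2\<close>; it is used for \<open>s = 1 + \<alpha>\<close> with \<open>\<alpha> > 1 / 2\<close>).
\<close>

definition b_form :: "real \<Rightarrow> real \<Rightarrow> field \<Rightarrow> field \<Rightarrow> field \<Rightarrow> real" where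
  "b_form L s u v w =
     (THE c. \<forall>un vn wn :: nat \<Rightarrow> field.
        range un \<subseteq> trig_fields L \<longrightarrow> range vn \<subseteq> trig_fields L \<longrightarrow> range wn \<subseteq> trig_fields L \<longrightarrow>
        (\<lambda>n. V_dist L s (un n) u) \<longlonglongrightarrow> 0 \<longrightarrow>
        (\<lambda>n. V_dist L s (vn n) v) \<longlonglongrightarrow> 0 \<longrightarrow>
        (\<lambda>n. V_dist L s (wn n) w) \<longlonglongrightarrow> 0 \<longrightarrow>
        (\<lambda>n. b_trig L (un n) (vn n) (wn n)) \<longlonglongrightarrow> c)"


section \<open>The spaces \<open>L\<^sub>2(I, V\<^sup>s)\<close>\<close>

text \<open>
  Functions that agree almost everywhere on \<open>I\<close> with a Borel measurable, square integrable function
  with values in \<open>V\<^sup>s\<close>. As \<open>V\<^sup>s\<close> is separable, this is Bochner square integrability. Values outside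
  \<open>I\<close> are arbitrary.
\<close>

definition L2_funs :: "real \<Rightarrow> real \<Rightarrow> real set \<Rightarrow> (real \<Rightarrow> field) set" where
  "L2_funs L s I =
     {u. \<exists>w. w \<in> measurable (lebesgue_on I) (sigma (V L s) {W. openin (V_topology L s) W}) \<and>
             integrable (lebesgue_on I) (\<lambda>t. (V_norm L s (w t))\<^sup>2) \<and>
             (AE t in lebesgue_on I. u t = w t)}"

definition L2_rel :: "real \<Rightarrow> real \<Rightarrow> real set \<Rightarrow> ((real \<Rightarrow> field) \<times> (real \<Rightarrow> field)) set" where
  "L2_rel L s I = {(u, v). u \<in> L2_funs L s I \<and> v \<in> L2_funs L s I \<and>
                           (AE t in lebesgue_on I. u t = v t)}"

text \<open>Points of \<open>L\<^sub>2(I, V\<^sup>s)\<close> are equivalence classes, so that distinct points have positive distance.\<close>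

definition L2_space :: "real \<Rightarrow> real \<Rightarrow> real set \<Rightarrow> (real \<Rightarrow> field) set set" where
  "L2_space L s I = L2_funs L s I // L2_rel L s I"

definition L2_class :: "real \<Rightarrow> real \<Rightarrow> real set \<Rightarrow> (real \<Rightarrow> field) \<Rightarrow> (real \<Rightarrow> field) set" where
  "L2_class L s I u = L2_rel L s I `` {u}"

definition rep :: "(real \<Rightarrow> field) set \<Rightarrow> real \<Rightarrow> field" where
  "rep X = (SOME u. u \<in> X)"

definition L2_norm :: "real \<Rightarrow> real \<Rightarrow> real set \<Rightarrow> (real \<Rightarrow> field) set \<Rightarrow> real" where
  "L2_norm L s I X = sqrt (LINT t|lebesgue_on I. (V_norm L s (rep X t))\<^sup>2)"

definition L2_dist ::
    "real \<Rightarrow> real \<Rightarrow> real set \<Rightarrow> (real \<Rightarrow> field) set \<Rightarrow> (real \<Rightarrow> field) set \<Rightarrow> real" where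
  "L2_dist L s I X Y = sqrt (LINT t|lebesgue_on I. (V_dist L s (rep X t) (rep Y t))\<^sup>2)"


section \<open>Phase spaces\<close>

text \<open>
  \<open>L\<^sub>2(I, V\<^sup>1\<^sup>+\<^sup>\<alpha>) \<times> V\<^sup>\<alpha>\<close>: the interval \<open>I = (0, \<mu>)\<close> gives \<open>\<X>\<close> and \<open>I = (- \<mu>, 0)\<close> gives \<open>\<Y>\<close>.
\<close>


type_synonym state = "(real \<Rightarrow> field) set \<times> field"

definition phase_space :: "real \<Rightarrow> real \<Rightarrow> real set \<Rightarrow> state set" where
  "phase_space L \<alpha> I = L2_space L (1 + \<alpha>) I \<times> V L \<alpha>"

definition phase_dist :: "real \<Rightarrow> real \<Rightarrow> real set \<Rightarrow> state \<Rightarrow> state \<Rightarrow> real" where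
  "phase_dist L \<alpha> I = prod_dist (L2_dist L (1 + \<alpha>) I) (V_dist L \<alpha>)"

definition phase_ball :: "real \<Rightarrow> real \<Rightarrow> real set \<Rightarrow> real \<Rightarrow> real \<Rightarrow> state set" where
  "phase_ball L \<alpha> I R \<rho> =
     {X \<in> L2_space L (1 + \<alpha>) I. L2_norm L (1 + \<alpha>) I X \<le> R} \<times> {u \<in> V L \<alpha>. V_norm L \<alpha> u \<le> \<rho>}"


section \<open>Weak solutions\<close>

definition test_functions :: "real set \<Rightarrow> (real \<Rightarrow> real) set" where
  "test_functions J =
     {\<eta>. \<eta> C1_differentiable_on UNIV \<and> (\<exists>K. compact K \<and> K \<subseteq> J \<and> (\<forall>t. t \<notin> K \<longrightarrow> \<eta> t = 0))}"

text \<open>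
  \<open>du/dt + \<nu> A u + B(a, u) = f\<close> on the open interval \<open>J\<close>, with the time derivative taken in the
  weak sense and the equation tested against \<open>V\<^sup>1\<^sup>+\<^sup>\<alpha>\<close>.
\<close>

definition weak_equation ::
    "real \<Rightarrow> real \<Rightarrow> real \<Rightarrow> field \<Rightarrow> real set \<Rightarrow> (real \<Rightarrow> field) \<Rightarrow> (real \<Rightarrow> field) \<Rightarrow> bool" where
  "weak_equation L \<alpha> \<nu> f J a u \<longleftrightarrow>
     (\<forall>v \<in> V L (1 + \<alpha>). \<forall>\<eta> \<in> test_functions J.
        (LINT t|lebesgue_on J.
           - deriv \<eta> t * pairing L (u t) v
           + \<eta> t * (\<nu> * pairing L (stokes L (u t)) v + b_form L (1 + \<alpha>) (a t) (u t) v))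
        = (LINT t|lebesgue_on J. \<eta> t * pairing L f v))"

text \<open>
  The condition \<open>u \<in> \<Phi>\<close> below says that \<open>u\<close> restricted to \<open>(- \<mu>, 0)\<close> represents the initial
  history \<open>\<Phi>\<close>.
\<close>

definition delayed_solution ::
    "real \<Rightarrow> real \<Rightarrow> real \<Rightarrow> real \<Rightarrow> field \<Rightarrow> (real \<Rightarrow> field) set \<Rightarrow> field \<Rightarrow> (real \<Rightarrow> field) \<Rightarrow> bool" where
  "delayed_solution L \<mu> \<alpha> \<nu> f \<Phi> u0 u \<longleftrightarrow>
     u \<in> \<Phi> \<and> u 0 = u0 \<and>
     (\<forall>T>0. continuous_map (top_of_set {0..T}) (V_topology L \<alpha>) u \<and>
            u \<in> L2_funs L (1 + \<alpha>) {-\<mu><..<T}) \<and>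
     weak_equation L \<alpha> \<nu> f {0<..} (\<lambda>t. u (t - \<mu>)) u"

definition delayed_flow ::
    "real \<Rightarrow> real \<Rightarrow> real \<Rightarrow> real \<Rightarrow> field \<Rightarrow> real \<Rightarrow> state \<Rightarrow> state" where
  "delayed_flow L \<mu> \<alpha> \<nu> f t = (\<lambda>(\<Phi>, u0).
     THE y. \<exists>u. delayed_solution L \<mu> \<alpha> \<nu> f \<Phi> u0 u \<and>
                y = (L2_class L (1 + \<alpha>) {-\<mu><..<0} (\<lambda>s. u (t + s)), u t))"

definition linearized_solution ::
    "real \<Rightarrow> real \<Rightarrow> real \<Rightarrow> real \<Rightarrow> field \<Rightarrow> (real \<Rightarrow> field) \<Rightarrow> field \<Rightarrow> (real \<Rightarrow> field) \<Rightarrow> bool" where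
  "linearized_solution L \<mu> \<alpha> \<nu> f \<psi> u0 u \<longleftrightarrow>
     u 0 = u0 \<and>
     continuous_map (top_of_set {0..\<mu>}) (V_topology L \<alpha>) u \<and>
     u \<in> L2_funs L (1 + \<alpha>) {0<..<\<mu>} \<and>
     weak_equation L \<alpha> \<nu> f {0<..<\<mu>} \<psi> u"

definition linearized_map ::
    "real \<Rightarrow> real \<Rightarrow> real \<Rightarrow> real \<Rightarrow> field \<Rightarrow> state \<Rightarrow> state" where
  "linearized_map L \<mu> \<alpha> \<nu> f = (\<lambda>(\<Psi>, u0).
     THE y. \<exists>\<psi>\<in>\<Psi>. \<exists>u. linearized_solution L \<mu> \<alpha> \<nu> f \<psi> u0 u \<and>
                       y = (L2_class L (1 + \<alpha>) {0<..<\<mu>} u, u \<mu>))"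


section \<open>Local attractors\<close>

definition semidistance :: "('a \<Rightarrow> 'a \<Rightarrow> real) \<Rightarrow> 'a set \<Rightarrow> 'a set \<Rightarrow> ennreal" where
  "semidistance d X A = (SUP x\<in>X. INF a\<in>A. ennreal (d x a))"

definition local_attractor ::
    "'a set \<Rightarrow> ('a \<Rightarrow> 'a \<Rightarrow> real) \<Rightarrow> (real \<Rightarrow> 'a \<Rightarrow> 'a) \<Rightarrow> 'a set \<Rightarrow> 'a set \<Rightarrow> bool" where
  "local_attractor M d S B A \<longleftrightarrow>
     A \<noteq> {} \<and> compactin (Metric_space.mtopology M d) A \<and> A \<subseteq> B \<and>
     (\<forall>t\<ge>0. S t ` A = A) \<and>
     ((\<lambda>t. semidistance d (S t ` B) A) \<longlongrightarrow> 0) at_top"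

definition discrete_local_attractor ::
    "'a set \<Rightarrow> ('a \<Rightarrow> 'a \<Rightarrow> real) \<Rightarrow> ('a \<Rightarrow> 'a) \<Rightarrow> 'a set \<Rightarrow> 'a set \<Rightarrow> bool" where
  "discrete_local_attractor M d U B A \<longleftrightarrow>
     A \<noteq> {} \<and> compactin (Metric_space.mtopology M d) A \<and> A \<subseteq> B \<and>
     U ` A = A \<and>
     (\<lambda>n. semidistance d ((U ^^ n) ` B) A) \<longlonglongrightarrow> 0"

definition delayed_attractor ::
    "real \<Rightarrow> real \<Rightarrow> real \<Rightarrow> real \<Rightarrow> field \<Rightarrow> real \<Rightarrow> real \<Rightarrow> state set \<Rightarrow> bool" where
  "delayed_attractor L \<mu> \<alpha> \<nu> f R \<rho> A \<longleftrightarrow>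
     local_attractor (phase_space L \<alpha> {-\<mu><..<0}) (phase_dist L \<alpha> {-\<mu><..<0})
       (delayed_flow L \<mu> \<alpha> \<nu> f) (phase_ball L \<alpha> {-\<mu><..<0} R \<rho>) A"

definition linearized_attractor ::
    "real \<Rightarrow> real \<Rightarrow> real \<Rightarrow> real \<Rightarrow> field \<Rightarrow> real \<Rightarrow> real \<Rightarrow> state set \<Rightarrow> bool" where
  "linearized_attractor L \<mu> \<alpha> \<nu> f R \<rho> A \<longleftrightarrow>
     discrete_local_attractor (phase_space L \<alpha> {0<..<\<mu>}) (phase_dist L \<alpha> {0<..<\<mu>})
       (linearized_map L \<mu> \<alpha> \<nu> f) (phase_ball L \<alpha> {0<..<\<mu>} R \<rho>) A"

end

theory Submission
  imports Defs "HOL-Library.Nat_Bijection"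
begin

text \<open>
 For large viscosity the stationary problem \<open>\<nu> A p + B(p, p) = f\<close> has a small solution \<open>p\<close>, and every
 solution that starts in the unit ball of the phase space converges to \<open>p\<close> at the rate \<open>exp (- t)\<close>, uniformly
 over that ball. Hence the only candidate for an attractor, of \<open>S\<close> as well as of \<open>U\<close>, is the point
 \<open>P\<close> whose history is constantly \<open>p\<close> and whose present value is \<open>p\<close>; it is fixed by both systems.
 Any invariant subset of the ball reduces to \<open>P\<close>, because each of its points is the image at time \<open>t\<close> of another
 of its points, for every \<open>t\<close>. So \<open>R = \<rho> = 1\<close> works, with one viscosity threshold for all claims.

 Everything is done on Fourier coefficients \<open>u\<^sub>k\<close>. With \<open>\<lambda>\<^sub>k\<close> the eigenvalues of the Stokes
 operator, \<open>E s u\<close> is the sum of \<open>\<lambda>\<^sub>k\<^sup>s |u\<^sub>k|\<^sup>2\<close>, i.e. the squared norm of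
 \<open>V\<^sup>s\<close> up to the volume. Put \<open>\<beta> = 1 + \<alpha>\<close>. The hypothesis \<open>\<alpha> > 1/2\<close> makes
 the sum of \<open>\<lambda>\<^sub>k\<^sup>-\<^sup>\<beta>\<close> converge in three dimensions, which yields the one nonlinear estimate of
 the proof, \<open>E_PB_le\<close>: \<open>B\<close> maps \<open>V\<^sup>\<beta> \<times> V\<^sup>\<alpha>\<close> boundedly to
 \<open>V\<^sup>\<alpha>\<^sup>-\<^sup>1\<close>. The lemma \<open>b_form_eq\<close> identifies the trilinear form with the pairing against
 these coefficients, and \<open>weak_imp_mild\<close> and \<open>mild_imp_weak\<close> show that a weak solution is the same as a solution
 of the variation of constants formula in every Fourier mode.

 Both \<open>p\<close> and the solutions around it are fixed points of contractions (\<open>exists_stationary\<close>,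
 \<open>exists_perturbation\<close>). For the latter one writes \<open>u(t) = p + exp (- t) z(t)\<close> and looks for \<open>z\<close> in
 a space of functions bounded in \<open>V\<^sup>\<alpha>\<close> and square integrable in \<open>V\<^sup>\<beta>\<close> on the whole
 half-line; the decay is then part of the ansatz, and smallness comes from \<open>1 / \<nu>\<close>. Uniqueness holds window by window
 (\<open>weak_window_unique\<close>): on an interval of length \<open>\<mu>\<close> the delayed term is already known, and the equation is
 linear. The same observation shows that the \<open>n\<close>-th iterate of \<open>U\<close> reads off the \<open>n\<close>-th window of a
 delayed solution (\<open>linearized_map_power_traj\<close>), so that the two systems are controlled by the same family of solutions.
\<close>

section \<open>Sums over the lattice\<close>

text \<open>
 Sums over the lattice of frequencies are integrals against the counting measure, so that the convergence theorems, Tonelli and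
 Cauchy-Schwarz are available for them.
\<close>

abbreviation count_sum :: "('a \<Rightarrow> ennreal) \<Rightarrow> ennreal" (binder "\<Sum>\<^sup>+" 10) where
 "count_sum f \<equiv> integral\<^sup>N (count_space UNIV) f"

lemma summable_on_iff_nn_integral:
 fixes f :: "'a \<Rightarrow> real"
 assumes "\<And>k. 0 \<le> f k"
 shows "f summable_on UNIV \<longleftrightarrow> (\<Sum>\<^sup>+k. ennreal (f k)) < top"
proof -
 have "f summable_on UNIV \<longleftrightarrow> (\<lambda>k. norm (f k)) summable_on UNIV" using assms by simp
 also have "\<dots> \<longleftrightarrow> Infinite_Set_Sum.abs_summable_on f UNIV" using abs_summable_equivalent[of f UNIV] by blast
 also have "\<dots> \<longleftrightarrow> integrable (count_space UNIV) f" by (simp add: Infinite_Set_Sum.abs_summable_on_def)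
 also have "\<dots> \<longleftrightarrow> (\<Sum>\<^sup>+k. ennreal (f k)) < top" using assms by (simp add: integrable_iff_bounded)
 finally show ?thesis .
qed

lemma infsum_eq_integral_count_space:
 fixes f :: "'a \<Rightarrow> 'b :: {banach, second_countable_topology}"
 assumes "integrable (count_space UNIV) f"
 shows "(\<Sum>\<^sub>\<infinity>k. f k) = (\<integral>k. f k \<partial>count_space UNIV)"
proof -
 have "Infinite_Set_Sum.abs_summable_on f UNIV" using assms by (simp add: Infinite_Set_Sum.abs_summable_on_def)
 then have "infsetsum f UNIV = infsum f UNIV" by (rule infsetsum_infsum)
 then show ?thesis by (simp add: infsetsum_def)
qed

text \<open>
 Enumerating the integers by \<open>int_decode\<close> reduces the two-sided sum to the zeta series.
\<close>

lemma summable_int_powr: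
 assumes "p > (1::real)"
 shows "(\<Sum>\<^sup>+n. ennreal ((1 + \<bar>real_of_int n\<bar>) powr - p)) < top"
proof -
 have le: "(1 + \<bar>real_of_int (int_decode m)\<bar>) powr - p \<le> 2 powr p * real (Suc m) powr - p" for m
 proof -
  have "m \<le> 2 * nat \<bar>int_decode m\<bar> + 1"
  proof -
   have "int_encode (int_decode m) \<le> 2 * nat \<bar>int_decode m\<bar> + 1" unfolding int_encode_def sum_encode_def by auto
   then show ?thesis by simp
  qed
  then have "real m \<le> 2 * \<bar>real_of_int (int_decode m)\<bar> + 1" by linarith
  then have "real (Suc m) / 2 \<le> 1 + \<bar>real_of_int (int_decode m)\<bar>" by simp
  then have "(1 + \<bar>real_of_int (int_decode m)\<bar>) powr - p \<le> (real (Suc m) / 2) powr - p" using assms by (intro powr_mono2') auto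
  also have "\<dots> = 2 powr p * real (Suc m) powr - p" by (simp add: powr_divide powr_minus field_simps)
  finally show ?thesis .
 qed
 have "(\<Sum>\<^sup>+n. ennreal ((1 + \<bar>real_of_int n\<bar>) powr - p))
   = (\<Sum>\<^sup>+m. ennreal ((1 + \<bar>real_of_int (int_decode m)\<bar>) powr - p))"
  by (rule nn_integral_bij_count_space[symmetric]) (rule bij_int_decode)
 also have "\<dots> \<le> (\<Sum>\<^sup>+m. ennreal (2 powr p * real (Suc m) powr - p))" by (intro nn_integral_mono ennreal_leI le)
 also have "\<dots> < top"
 proof -
  have "summable (\<lambda>m. real (Suc m) powr - p)" using assms by (subst summable_Suc_iff) (simp add: summable_real_powr_iff)
  then have "summable (\<lambda>m. 2 powr p * real (Suc m) powr - p)" by (rule summable_mult)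
  then show ?thesis by (subst nn_integral_count_space_nat, subst suminf_ennreal2) auto
 qed
 finally show ?thesis .
qed

lemma nn_integral_count_space_prod3:
 fixes g :: "int \<Rightarrow> ennreal"
 shows "(\<integral>\<^sup>+k. (\<Prod>i\<in>UNIV. g (k $ i)) \<partial>count_space (UNIV :: (int^3) set))
    = (\<Sum>\<^sup>+n. g n) ^ 3"
proof -
 let ?v = "\<lambda>(a,b,c). vector [a,b,c] :: int^3"
 have bij: "bij_betw ?v UNIV UNIV"
 proof (rule bij_betwI[where g = "\<lambda>k. (k$1, k$2, k$3)"])
  show "?v (k$1, k$2, k$3) = k" for k unfolding vec_eq_iff forall_3 by simp
 qed auto
 have "(\<integral>\<^sup>+k. (\<Prod>i\<in>UNIV. g (k $ i)) \<partial>count_space (UNIV :: (int^3) set))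
   = (\<Sum>\<^sup>+k. (\<Prod>i\<in>UNIV. g (?v k $ i)))" by (rule nn_integral_bij_count_space[OF bij, symmetric])
 also have "\<dots> = (\<Sum>\<^sup>+k. g (fst k) * (g (fst (snd k)) * g (snd (snd k))))"
 proof (intro nn_integral_cong)
  fix q :: "int \<times> int \<times> int"
  have prod3: "(\<Prod>i\<in>UNIV. h i) = h 1 * (h 2 * h (3::3))" for h :: "3 \<Rightarrow> ennreal" unfolding UNIV_3 by (simp add: mult.assoc)
  show "(\<Prod>i\<in>UNIV. g (?v q $ i)) = g (fst q) * (g (fst (snd q)) * g (snd (snd q)))" unfolding prod3 by (simp add: split_beta)
 qed
 also have "\<dots> = (\<Sum>\<^sup>+a. \<integral>\<^sup>+q. g a * (g (fst q) * g (snd q)) \<partial>count_space UNIV)"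
  by (subst nn_integral_fst_count_space[symmetric]) simp
 also have "\<dots> = (\<Sum>\<^sup>+a. g a * (\<Sum>\<^sup>+q. (g (fst q) * g (snd q))))" by (simp add: nn_integral_cmult)
 also have "(\<Sum>\<^sup>+q. (g (fst q) * g (snd q)))
   = (\<Sum>\<^sup>+a. \<integral>\<^sup>+b. g a * g b \<partial>count_space UNIV)" by (subst nn_integral_fst_count_space[symmetric]) simp
 also have "\<dots> = (\<Sum>\<^sup>+n. g n) * (\<Sum>\<^sup>+n. g n)" by (simp add: nn_integral_cmult nn_integral_multc)
 also have "(\<Sum>\<^sup>+a. g a * ((\<Sum>\<^sup>+n. g n) * (\<Sum>\<^sup>+n. g n)))
   = (\<Sum>\<^sup>+n. g n) * ((\<Sum>\<^sup>+n. g n) * (\<Sum>\<^sup>+n. g n))" by (rule nn_integral_multc) simp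
 finally show ?thesis by (simp only: power3_eq_cube mult.assoc)
qed

section \<open>Fourier weights and energies\<close>

locale torus =
 fixes L \<alpha> :: real
 assumes L_pos: "L > 0" and alpha: "\<alpha> > 1 / 2"
begin

definition lam :: "int ^ 3 \<Rightarrow> real" where
 "lam k = (norm (wavevector L k))\<^sup>2"

definition lam1 :: real where
 "lam1 = (2 * pi / L)\<^sup>2"

text \<open>
 The squared norm of \<open>V\<^sup>s\<close> divided by the volume \<open>L\<^sup>3\<close>. Values in \<open>[0, \<infinity>]\<close>
 make sums and limits unconditional; membership in \<open>V\<^sup>s\<close> is finiteness.
\<close>

definition E :: "real \<Rightarrow> field \<Rightarrow> ennreal" where
 "E s u = (\<Sum>\<^sup>+k. ennreal (lam k powr s * (norm (u k))\<^sup>2))"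

definition solenoidal :: "field \<Rightarrow> bool" where
 "solenoidal u \<longleftrightarrow> u 0 = 0 \<and> (\<forall>k. (\<Sum>i\<in>UNIV. of_int (k $ i) * u k $ i) = 0) \<and>
          (\<forall>k i. u (- k) $ i = cnj (u k $ i))"

text \<open>
 The regularity of solutions at almost every time, one derivative above the phase space.
\<close>

abbreviation \<beta> :: real where
 "\<beta> \<equiv> 1 + \<alpha>"

lemma lam1_pos: "lam1 > 0"
 using L_pos by (simp add: lam1_def)

lemma lam_eq: "lam k = lam1 * (\<Sum>i\<in>UNIV. (real_of_int (k $ i))\<^sup>2)"
 unfolding lam_def lam1_def power2_norm_eq_inner inner_vec_def wavevector_def
 unfolding sum_distrib_left by (intro sum.cong) (simp_all add: power2_eq_square)

lemma lam_0 [simp]: "lam 0 = 0"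
 by (simp add: lam_eq)

lemma lam_nonneg [simp]: "0 \<le> lam k"
 by (simp add: lam_def)

lemma lam_minus [simp]: "lam (- k) = lam k"
 by (simp add: lam_eq)

lemma int_sum_squares_ge_1:
 assumes "k \<noteq> (0 :: int^3)"
 shows "1 \<le> (\<Sum>i\<in>UNIV. (real_of_int (k $ i))\<^sup>2)"
proof -
 obtain j where "k $ j \<noteq> 0" using assms by (auto simp: vec_eq_iff)
 then have "1 \<le> \<bar>k $ j\<bar>" by simp
 then have "1 \<le> (k $ j)\<^sup>2" using abs_le_square_iff[of 1 "k $ j"] by simp
 then have "1 \<le> (real_of_int (k $ j))\<^sup>2" by (metis of_int_1 of_int_le_iff of_int_power)
 also have "\<dots> \<le> (\<Sum>i\<in>UNIV. (real_of_int (k $ i))\<^sup>2)" by (rule member_le_sum) auto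
 finally show ?thesis .
qed

lemma lam_ge: "k \<noteq> 0 \<Longrightarrow> lam1 \<le> lam k"
 using mult_left_mono[OF int_sum_squares_ge_1[of k], of lam1] lam1_pos unfolding lam_eq by simp

lemma lam_pos: "k \<noteq> 0 \<Longrightarrow> 0 < lam k"
 using lam_ge[of k] lam1_pos by linarith

lemma lam_eq_0_iff [simp]: "lam k = 0 \<longleftrightarrow> k = 0"
 using lam_pos[of k] lam_0 by fastforce

lemma wavevector_add: "wavevector L (k + l) = wavevector L k + wavevector L l"
 by (simp add: wavevector_def vec_eq_iff algebra_simps)

lemma lam_add_le: "lam (k + l) \<le> 2 * lam k + 2 * lam l"
proof -
 have "lam (k + l) \<le> (norm (wavevector L k) + norm (wavevector L l))\<^sup>2"
  unfolding lam_def wavevector_add by (intro power_mono norm_triangle_ineq) auto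
 also have "\<dots> \<le> 2 * lam k + 2 * lam l"
  unfolding lam_def using sum_squares_bound[of "norm (wavevector L k)" "norm (wavevector L l)"] by (simp add: power2_sum)
 finally show ?thesis .
qed

definition Z :: ennreal where
 "Z = (\<Sum>\<^sup>+k. ennreal (lam k powr - \<beta>))"

text \<open>
 The squared length of \<open>k\<close> dominates every coordinate, so the summand is at most a product of three functions of one
 coordinate each, with decay exponent \<open>2 (1 + \<alpha>) / 3 > 1\<close>.
\<close>

lemma Z_finite: "Z < top"
proof -
 define p where "p = 2 / 3 * \<beta>"
 have p: "p > 1" using alpha by (simp add: p_def)
 define g where "g = (\<lambda>n::int. (1 + \<bar>real_of_int n\<bar>) powr - p)"
 have le: "lam k powr - \<beta> \<le> (4 / lam1) powr \<beta> * (\<Prod>i\<in>UNIV. g (k $ i))" for k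
 proof (cases "k = 0")
  case True
  then show ?thesis by (auto simp: g_def intro!: mult_nonneg_nonneg prod_nonneg)
 next
  case False
  define N where "N = (\<Sum>i\<in>UNIV. (real_of_int (k $ i))\<^sup>2)"
  have N: "1 \<le> N" using int_sum_squares_ge_1[OF False] by (simp add: N_def)
  have gi: "(4 * N) powr - (p / 2) \<le> g (k $ i)" for i
  proof -
   have "(1 + \<bar>real_of_int (k $ i)\<bar>)\<^sup>2 \<le> 2 * (1 + (real_of_int (k $ i))\<^sup>2)"
    using sum_squares_bound[of 1 "\<bar>real_of_int (k $ i)\<bar>"] by (simp add: power2_sum)
   also have "(real_of_int (k $ i))\<^sup>2 \<le> N" unfolding N_def by (rule member_le_sum) auto
   finally have "(1 + \<bar>real_of_int (k $ i)\<bar>)\<^sup>2 \<le> 4 * N" using N by simp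
   then have "(4 * N) powr - (p/2) \<le> ((1 + \<bar>real_of_int (k $ i)\<bar>)\<^sup>2) powr - (p/2)"
    using p by (intro powr_mono2') (auto intro!: zero_less_power add_pos_nonneg)
   also have "\<dots> = ((1 + \<bar>real_of_int (k $ i)\<bar>) powr 2) powr - (p/2)"
   proof -
    have "0 \<le> 1 + \<bar>real_of_int (k $ i)\<bar>" by simp
    then show ?thesis by (simp only: powr_numeral)
   qed
   also have "\<dots> = g (k $ i)" unfolding g_def powr_powr by simp
   finally show ?thesis .
  qed
  have "((4 * N) powr - (p / 2)) ^ 3 = (\<Prod>i\<in>(UNIV :: 3 set). (4 * N) powr - (p / 2))" by simp
  also have "\<dots> \<le> (\<Prod>i\<in>UNIV. g (k $ i))" using gi by (intro prod_mono) auto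
  finally have 1: "((4 * N) powr - (p / 2)) ^ 3 \<le> (\<Prod>i\<in>UNIV. g (k $ i))" .
  have "((4 * N) powr - (p / 2)) ^ 3 = (4 * N) powr (- (p / 2) * 3)"
   using N powr_realpow[of "(4 * N) powr - (p / 2)" 3] powr_powr[of "4 * N" "- (p / 2)" 3] by simp
  also have "- (p / 2) * 3 = - \<beta>" by (simp add: p_def field_simps)
  also have "(4 * N) powr - \<beta> = 4 powr - \<beta> * N powr - \<beta>" using N by (simp only: powr_mult)
  finally have 2: "((4 * N) powr - (p / 2)) ^ 3 = 4 powr - \<beta> * N powr - \<beta>" .
  have "lam k powr - \<beta> = lam1 powr - \<beta> * N powr - \<beta>" unfolding lam_eq N_def[symmetric] using lam1_pos N by (simp only: powr_mult)
  also have "\<dots> = (4 / lam1) powr \<beta> * (4 powr - \<beta> * N powr - \<beta>)"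
  proof -
   have "lam1 powr - q = (4 / lam1) powr q * 4 powr - q" for q
    using lam1_pos by (simp add: powr_mult powr_minus divide_inverse inverse_powr)
   from this[of \<beta>] show ?thesis by simp
  qed
  also have "\<dots> \<le> (4 / lam1) powr \<beta> * (\<Prod>i\<in>UNIV. g (k $ i))" using 1 2 by (intro mult_left_mono) auto
  finally show ?thesis .
 qed
 have "Z \<le> (\<Sum>\<^sup>+k. ennreal ((4 / lam1) powr \<beta>) * (\<Prod>i\<in>UNIV. ennreal (g ((k::int^3) $ i))))" unfolding Z_def
 proof (intro nn_integral_mono)
  fix k :: "int^3"
  show "ennreal (lam k powr - \<beta>) \<le> ennreal ((4 / lam1) powr \<beta>) * (\<Prod>i\<in>UNIV. ennreal (g (k $ i)))"
   using le[of k] by (simp add: g_def prod_ennreal ennreal_mult[symmetric] prod_nonneg ennreal_leI)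
 qed
 also have "\<dots> = ennreal ((4 / lam1) powr \<beta>) * (\<Sum>\<^sup>+n. ennreal (g n)) ^ 3"
  by (subst nn_integral_cmult, simp) (simp add: nn_integral_count_space_prod3[of "\<lambda>n. ennreal (g n)"])
 also have "\<dots> < top" using summable_int_powr[OF p] by (auto simp: g_def ennreal_mult_less_top power_less_top_ennreal)
 finally show ?thesis .
qed

lemma norm_stokes_power: "(norm (stokes_power L (s / 2) u k))\<^sup>2 = lam k powr s * (norm (u k))\<^sup>2"
proof -
 have "(lam k powr (s / 2))\<^sup>2 = lam k powr s" by (cases "k = 0") (auto simp: power2_eq_square powr_add[symmetric])
 then show ?thesis by (simp add: stokes_power_def lam_def power_mult_distrib)
qed

lemma V_iff: "u \<in> V L s \<longleftrightarrow> solenoidal u \<and> E s u < top"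
 unfolding V_def solenoidal_def E_def norm_stokes_power by (subst summable_on_iff_nn_integral) auto

lemma V_norm_eq: "V_norm L s u = sqrt (L ^ 3 * enn2real (E s u))"
proof (cases "E s u < top")
 case True
 then have int: "integrable (count_space UNIV) (\<lambda>k. lam k powr s * (norm (u k))\<^sup>2)"
  unfolding E_def by (simp add: integrable_iff_bounded)
 have "(\<Sum>\<^sub>\<infinity>k. lam k powr s * (norm (u k))\<^sup>2) = enn2real (E s u)" unfolding E_def infsum_eq_integral_count_space[OF int]
  by (rule integral_eq_nn_integral) auto
 then show ?thesis by (simp add: V_norm_def L2_field_norm_def norm_stokes_power)
next
 case False
 then have "\<not> (\<lambda>k. lam k powr s * (norm (u k))\<^sup>2) summable_on UNIV" unfolding E_def by (subst summable_on_iff_nn_integral) auto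
 then show ?thesis using False by (simp add: V_norm_def L2_field_norm_def norm_stokes_power infsum_not_exists not_less top_unique)
qed

lemma V_norm_nonneg: "0 \<le> V_norm L s u"
 using L_pos by (simp add: V_norm_eq)

lemma V_norm_sq: "E s u < top \<Longrightarrow> ennreal ((V_norm L s u)\<^sup>2) = ennreal (L ^ 3) * E s u"
 using L_pos by (simp add: V_norm_eq ennreal_mult)

lemma V_norm_le_iff:
 assumes "E s u < top" "0 \<le> r"
 shows "V_norm L s u \<le> r \<longleftrightarrow> ennreal (L ^ 3) * E s u \<le> ennreal (r\<^sup>2)"
 unfolding V_norm_sq[OF assms(1), symmetric] using assms(2) V_norm_nonneg by (simp add: power_mono_iff)

lemma E_coeff: "ennreal (lam k powr s * (norm (u k))\<^sup>2) \<le> E s u"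
proof -
 have "ennreal (lam k powr s * (norm (u k))\<^sup>2)
   = (\<Sum>\<^sup>+j. ennreal (lam j powr s * (norm (u j))\<^sup>2) * indicator {k} j)" by (subst nn_integral_indicator_singleton) auto
 also have "\<dots> \<le> E s u" unfolding E_def by (intro nn_integral_mono) (auto split: split_indicator)
 finally show ?thesis .
qed


lemma E_mono:
 assumes "\<And>k. k \<noteq> 0 \<Longrightarrow> norm (u k) \<le> norm (v k)"
 shows "E s u \<le> E s v"
 unfolding E_def
proof (intro nn_integral_mono ennreal_leI)
 fix k
 show "lam k powr s * (norm (u k))\<^sup>2 \<le> lam k powr s * (norm (v k))\<^sup>2"
  using assms[of k] by (cases "k = 0") (auto intro!: mult_left_mono power_mono)
qed

lemma E_scaleR: "E s (\<lambda>k. c *\<^sub>R u k) = ennreal (c\<^sup>2) * E s u"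
 unfolding E_def by (subst nn_integral_cmult[symmetric])
   (auto intro!: nn_integral_cong simp: ennreal_mult[symmetric] power_mult_distrib mult_ac)

lemma E_minus: "E s (\<lambda>k. - u k) = E s u"
 by (simp add: E_def)

lemma E_zero [simp]: "E s (\<lambda>k. 0) = 0"
 by (simp add: E_def)

lemma norm_add_sq_weighted_le:
 assumes c: "0 < (c :: real)"
 shows "(norm (x + y))\<^sup>2 \<le> (1 + c) * (norm x)\<^sup>2 + (1 + 1 / c) * (norm (y :: 'a :: real_normed_vector))\<^sup>2"
proof -
 have "(norm (x + y))\<^sup>2 \<le> (norm x + norm y)\<^sup>2" by (intro power_mono norm_triangle_ineq) simp
 moreover have "2 * norm x * norm y \<le> c * (norm x)\<^sup>2 + 1 / c * (norm y)\<^sup>2"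
  using zero_le_power2[of "c * norm x - norm y"] c by (simp add: field_simps power2_eq_square)
 ultimately show ?thesis by (simp add: power2_sum algebra_simps)
qed

lemma E_add_weighted_le:
 assumes c: "0 < (c :: real)"
 shows "E s (\<lambda>k. u k + v k) \<le> ennreal (1 + c) * E s u + ennreal (1 + 1 / c) * E s v"
proof -
 have "E s (\<lambda>k. u k + v k) \<le> (\<Sum>\<^sup>+k. ennreal (1 + c) * ennreal (lam k powr s * (norm (u k))\<^sup>2) + ennreal (1 + 1 / c) * ennreal (lam k powr s * (norm (v k))\<^sup>2))"
  unfolding E_def
 proof (rule nn_integral_mono)
  fix k
  have "lam k powr s * (norm (u k + v k))\<^sup>2 \<le> lam k powr s * ((1 + c) * (norm (u k))\<^sup>2 + (1 + 1 / c) * (norm (v k))\<^sup>2)"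
   by (intro mult_left_mono norm_add_sq_weighted_le c) simp
  also have "\<dots> = (1 + c) * (lam k powr s * (norm (u k))\<^sup>2) + (1 + 1 / c) * (lam k powr s * (norm (v k))\<^sup>2)"
   by (simp add: algebra_simps)
  finally have "ennreal (lam k powr s * (norm (u k + v k))\<^sup>2) \<le> ennreal ((1 + c) * (lam k powr s * (norm (u k))\<^sup>2) + (1 + 1 / c) * (lam k powr s * (norm (v k))\<^sup>2))"
   by (rule ennreal_leI)
  also have "\<dots> = ennreal (1 + c) * ennreal (lam k powr s * (norm (u k))\<^sup>2) + ennreal (1 + 1 / c) * ennreal (lam k powr s * (norm (v k))\<^sup>2)"
   using c by (subst ennreal_plus) (auto simp: ennreal_mult)
  finally show "ennreal (lam k powr s * (norm (u k + v k))\<^sup>2) \<le> ennreal (1 + c) * ennreal (lam k powr s * (norm (u k))\<^sup>2) + ennreal (1 + 1 / c) * ennreal (lam k powr s * (norm (v k))\<^sup>2)" .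
 qed
 also have "\<dots> = ennreal (1 + c) * E s u + ennreal (1 + 1 / c) * E s v"
  unfolding E_def by (subst nn_integral_add) (auto simp: nn_integral_cmult)
 finally show ?thesis .
qed

lemma E_add_le: "E s (\<lambda>k. u k + v k) \<le> 2 * E s u + 2 * E s v"
 using E_add_weighted_le[of 1 s u v] by simp

lemma E_sum3_le: "E s (\<lambda>k. u k + v k + w k) \<le> 4 * (E s u + E s v + E s w)"
proof -
 have "E s (\<lambda>k. u k + v k + w k) \<le> 2 * E s (\<lambda>k. u k + v k) + 2 * E s w" by (rule E_add_le)
 also have "\<dots> \<le> 2 * (2 * E s u + 2 * E s v) + 4 * E s w" by (intro add_mono mult_left_mono mult_right_mono E_add_le) auto
 also have "\<dots> = 4 * (E s u + E s v + E s w)" by (simp add: distrib_left mult.assoc[symmetric])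
 finally show ?thesis .
qed

lemma E_sum4_le: "E s (\<lambda>k. u k + v k + w k + x k) \<le> 8 * (E s u + E s v + E s w + E s x)"
proof -
 have "E s (\<lambda>k. u k + v k + w k + x k) \<le> 2 * E s (\<lambda>k. u k + v k + w k) + 2 * E s x" by (rule E_add_le)
 also have "\<dots> \<le> 2 * (4 * (E s u + E s v + E s w)) + 8 * E s x" by (intro add_mono mult_left_mono mult_right_mono E_sum3_le) auto
 also have "\<dots> = 8 * (E s u + E s v + E s w + E s x)" by (simp add: distrib_left mult.assoc[symmetric])
 finally show ?thesis .
qed

lemma E_diff_le: "E s (\<lambda>k. u k - v k) \<le> 2 * E s u + 2 * E s v"
 using E_add_le[of s u "\<lambda>k. - v k"] by (simp add: E_minus)

lemma E_add_finite: "E s u < top \<Longrightarrow> E s v < top \<Longrightarrow> E s (\<lambda>k. u k + v k) < top"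
 by (rule le_less_trans[OF E_add_le]) (auto simp: ennreal_mult_less_top)

lemma E_diff_finite: "E s u < top \<Longrightarrow> E s v < top \<Longrightarrow> E s (\<lambda>k. u k - v k) < top"
 by (rule le_less_trans[OF E_diff_le]) (auto simp: ennreal_mult_less_top)

lemma E_embedding:
 assumes "s \<le> s'"
 shows "E s u \<le> ennreal (lam1 powr (s - s')) * E s' u"
 unfolding E_def
proof (subst nn_integral_cmult[symmetric], simp, intro nn_integral_mono)
 fix k
 have "lam k powr s \<le> lam1 powr (s - s') * lam k powr s'"
 proof (cases "k = 0")
  case False
  have "lam k powr s = lam k powr (s - s') * lam k powr s'" by (simp add: powr_add[symmetric])
  also have "\<dots> \<le> lam1 powr (s - s') * lam k powr s'"
   using assms lam_ge[OF False] lam1_pos by (intro mult_right_mono powr_mono2') auto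
  finally show ?thesis .
 qed simp
 then have "lam k powr s * (norm (u k))\<^sup>2 \<le> lam1 powr (s - s') * (lam k powr s' * (norm (u k))\<^sup>2)"
  by (metis mult.assoc mult_right_mono zero_le_power2)
 then show "ennreal (lam k powr s * (norm (u k))\<^sup>2)
   \<le> ennreal (lam1 powr (s - s')) * ennreal (lam k powr s' * (norm (u k))\<^sup>2)" by (simp add: ennreal_mult[symmetric] ennreal_leI)
qed

lemma E_embedding_finite: "s \<le> s' \<Longrightarrow> E s' u < top \<Longrightarrow> E s u < top"
 by (rule le_less_trans[OF E_embedding]) (auto simp: ennreal_mult_less_top)

lemma V_mono: "s \<le> s' \<Longrightarrow> u \<in> V L s' \<Longrightarrow> u \<in> V L s"
 by (auto simp: V_iff intro: E_embedding_finite)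

lemma E_eq_0: "E s u = 0 \<Longrightarrow> k \<noteq> 0 \<Longrightarrow> u k = 0"
 using E_coeff[of k s u] lam_pos[of k] by (auto simp: ennreal_eq_0_iff mult_le_0_iff)

lemma solenoidal_add: "solenoidal u \<Longrightarrow> solenoidal v \<Longrightarrow> solenoidal (\<lambda>k. u k + v k)"
 by (simp add: solenoidal_def distrib_left sum.distrib)

lemma solenoidal_diff: "solenoidal u \<Longrightarrow> solenoidal v \<Longrightarrow> solenoidal (\<lambda>k. u k - v k)"
 by (simp add: solenoidal_def right_diff_distrib sum_subtractf)

lemma solenoidal_scaleR: "solenoidal u \<Longrightarrow> (\<And>k. c (- k) = c k) \<Longrightarrow> solenoidal (\<lambda>k. (c k :: real) *\<^sub>R u k)"
 by (simp add: solenoidal_def scaleR_conv_of_real[where 'a = complex] mult.left_commute[of "of_int x" for x] sum_distrib_left[symmetric])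

lemma solenoidal_zero [simp]: "solenoidal (\<lambda>k. 0)"
 by (simp add: solenoidal_def)

lemma solenoidal_at_0: "solenoidal u \<Longrightarrow> u 0 = 0"
 by (simp add: solenoidal_def)

lemma solenoidal_LIMSEQ:
 assumes "\<And>n. solenoidal (X n)" "\<And>k. (\<lambda>n. X n k) \<longlonglongrightarrow> u k"
 shows "solenoidal u"
proof -
 have comp: "(\<lambda>n. X n k $ i) \<longlonglongrightarrow> u k $ i" for k i by (intro tendsto_vec_nth assms)
 have "u 0 = 0" using assms(2)[of 0] by (simp add: solenoidal_at_0[OF assms(1)] LIMSEQ_const_iff)
 moreover have "(\<Sum>i\<in>UNIV. of_int (k $ i) * u k $ i) = 0" for k
 proof -
  have "(\<lambda>n. \<Sum>i\<in>UNIV. of_int (k $ i) * X n k $ i) \<longlonglongrightarrow> (\<Sum>i\<in>UNIV. of_int (k $ i) * u k $ i)"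
   by (intro tendsto_sum tendsto_mult tendsto_const comp)
  then show ?thesis using assms(1) by (simp add: solenoidal_def LIMSEQ_const_iff)
 qed
 moreover have "u (- k) $ i = cnj (u k $ i)" for k i
 proof (rule LIMSEQ_unique[OF comp])
  have "(\<lambda>n. cnj (X n k $ i)) \<longlonglongrightarrow> cnj (u k $ i)" by (intro tendsto_cnj comp)
  then show "(\<lambda>n. X n (- k) $ i) \<longlonglongrightarrow> cnj (u k $ i)" using assms(1) by (simp add: solenoidal_def)
 qed
 ultimately show ?thesis by (simp add: solenoidal_def)
qed

lemma V_diff: "u \<in> V L s \<Longrightarrow> v \<in> V L s \<Longrightarrow> (\<lambda>k. u k - v k) \<in> V L s"
 by (simp add: V_iff solenoidal_diff E_diff_finite)

text \<open>
 The bound is sharpest at \<open>c = B / A\<close>, where its right-hand side is \<open>(A + B)\<^sup>2\<close>. In this form the triangle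
 inequality of any norm given by a quadratic integral follows from a pointwise inequality, without cross terms.
\<close>

lemma Minkowski_criterion:
 fixes A B D :: real
 assumes nn: "0 \<le> A" "0 \<le> B" and D: "\<And>c. 0 < c \<Longrightarrow> D\<^sup>2 \<le> (1 + c) * A\<^sup>2 + (1 + 1 / c) * B\<^sup>2"
 shows "D \<le> A + B"
proof (rule field_le_epsilon)
 fix e :: real assume e: "0 < e"
 \<comment> \<open>The shift by \<open>e / 2\<close> makes the optimal ratio meaningful when \<open>A\<close> or \<open>B\<close> vanishes.\<close>
 define a b where "a = A + e / 2" and "b = B + e / 2"
 have ab: "0 < a" "0 < b" "A \<le> a" "B \<le> b" using nn e by (auto simp: a_def b_def)
 have "D\<^sup>2 \<le> (1 + b / a) * A\<^sup>2 + (1 + 1 / (b / a)) * B\<^sup>2" using ab by (intro D) auto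
 also have "\<dots> \<le> (1 + b / a) * a\<^sup>2 + (1 + 1 / (b / a)) * b\<^sup>2" using ab nn by (intro add_mono mult_left_mono power_mono) auto
 also have "\<dots> = (a + b)\<^sup>2" using ab by (simp add: field_simps power2_eq_square)
 finally have "D \<le> a + b" using ab by (intro power2_le_imp_le[of D "a + b"]) auto
 then show "D \<le> A + B + e" by (simp add: a_def b_def)
qed

lemma V_norm_triangle:
 assumes u: "E s u < top" and v: "E s v < top"
 shows "V_norm L s (\<lambda>k. u k + v k) \<le> V_norm L s u + V_norm L s v"
proof (rule Minkowski_criterion)
 fix c :: real assume c: "0 < c"
 have "ennreal ((V_norm L s (\<lambda>k. u k + v k))\<^sup>2) \<le> ennreal (L ^ 3) * (ennreal (1 + c) * E s u + ennreal (1 + 1 / c) * E s v)"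
  unfolding V_norm_sq[OF E_add_finite[OF u v]] by (intro mult_left_mono E_add_weighted_le c) simp
 also have "\<dots> = ennreal (1 + c) * ennreal ((V_norm L s u)\<^sup>2) + ennreal (1 + 1 / c) * ennreal ((V_norm L s v)\<^sup>2)"
  unfolding V_norm_sq[OF u] V_norm_sq[OF v] by (simp add: distrib_left mult_ac)
 also have "\<dots> = ennreal ((1 + c) * (V_norm L s u)\<^sup>2 + (1 + 1 / c) * (V_norm L s v)\<^sup>2)"
  using c by (subst ennreal_plus) (auto simp: ennreal_mult)
 finally show "(V_norm L s (\<lambda>k. u k + v k))\<^sup>2 \<le> (1 + c) * (V_norm L s u)\<^sup>2 + (1 + 1 / c) * (V_norm L s v)\<^sup>2"
  using c by (subst (asm) ennreal_le_iff) auto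
qed (simp_all add: V_norm_nonneg)

lemma V_norm_minus: "V_norm L s (\<lambda>k. - u k) = V_norm L s u"
 by (simp add: V_norm_eq E_minus)

lemma V_dist_eq_0_iff:
 assumes "u \<in> V L s" "v \<in> V L s"
 shows "V_dist L s u v = 0 \<longleftrightarrow> u = v"
proof
 assume "V_dist L s u v = 0"
 moreover have "E s (\<lambda>k. u k - v k) < top" using assms by (simp add: V_iff E_diff_finite)
 ultimately have 0: "E s (\<lambda>k. u k - v k) = 0" using L_pos by (auto simp: V_dist_def V_norm_eq enn2real_eq_0_iff)
 show "u = v"
 proof
  fix k
  show "u k = v k" using E_eq_0[OF 0, of k] assms by (cases "k = 0") (auto simp: V_iff solenoidal_def)
 qed
qed (simp add: V_dist_def V_norm_eq)

lemma V_dist_commute: "V_dist L s u v = V_dist L s v u"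
 using V_norm_minus[of s "\<lambda>k. u k - v k"] by (simp add: V_dist_def)

lemma V_dist_triangle:
 assumes "E s (\<lambda>k. u k - v k) < top" "E s (\<lambda>k. v k - w k) < top"
 shows "V_dist L s u w \<le> V_dist L s u v + V_dist L s v w"
 using V_norm_triangle[OF assms] by (simp add: V_dist_def)

lemma Metric_space_V: "Metric_space (V L s) (V_dist L s)"
proof
 fix u v w
 show "0 \<le> V_dist L s u v" by (simp add: V_dist_def V_norm_nonneg)
 show "V_dist L s u v = V_dist L s v u" by (rule V_dist_commute)
 assume "u \<in> V L s" "v \<in> V L s"
 then show "V_dist L s u v = 0 \<longleftrightarrow> u = v" by (rule V_dist_eq_0_iff)
 assume "w \<in> V L s"
 then show "V_dist L s u w \<le> V_dist L s u v + V_dist L s v w"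
  using \<open>u \<in> V L s\<close> \<open>v \<in> V L s\<close> by (intro V_dist_triangle) (auto simp: V_iff E_diff_finite)
qed

section \<open>Truncation\<close>

text \<open>
 Frequencies are kept or dropped in pairs \<open>k\<close>, \<open>- k\<close>, so that truncated fields stay real.
\<close>

definition trunc :: "nat \<Rightarrow> field \<Rightarrow> field" where
 "trunc n u k = (if to_nat k < n \<or> to_nat (- k) < n then u k else 0)"

lemma trunc_finite: "finite {k. trunc n u k \<noteq> 0}"
proof (rule finite_subset)
 show "{k. trunc n u k \<noteq> 0} \<subseteq> (to_nat -` {..<n}) \<union> uminus -` (to_nat -` {..<n})" by (auto simp: trunc_def)
 show "finite ((to_nat -` {..<n} :: (int^3) set) \<union> uminus -` (to_nat -` {..<n}))"
  by (intro finite_UnI finite_vimageI) (auto simp: inj_on_def)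
qed

lemma solenoidal_trunc: "solenoidal u \<Longrightarrow> solenoidal (trunc n u)"
 by (auto simp: solenoidal_def trunc_def)

lemma E_trunc_le: "E s (trunc n u) \<le> E s u"
 by (rule E_mono) (auto simp: trunc_def)

lemma trunc_in_V: "u \<in> V L s \<Longrightarrow> trunc n u \<in> V L s"
 by (auto simp: V_iff solenoidal_trunc intro: le_less_trans[OF E_trunc_le])

lemma finite_support_E_finite:
 assumes "finite {k. u k \<noteq> 0}"
 shows "E s u < top"
proof -
 have "E s u = (\<integral>\<^sup>+k. ennreal (lam k powr s * (norm (u k))\<^sup>2) \<partial>count_space {k. u k \<noteq> 0})"
  unfolding E_def by (rule nn_integral_count_space_eq) auto
 also have "\<dots> < top" using assms by (simp add: nn_integral_count_space_finite)
 finally show ?thesis .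
qed

lemma trig_fields_iff: "u \<in> trig_fields L \<longleftrightarrow> solenoidal u \<and> finite {k. u k \<noteq> 0}"
 using finite_support_E_finite[of u 0] by (auto simp: trig_fields_def V_iff)

lemma trunc_trig: "solenoidal u \<Longrightarrow> trunc n u \<in> trig_fields L"
 by (simp add: trig_fields_iff solenoidal_trunc trunc_finite)

lemma eventually_trunc: "eventually (\<lambda>n. trunc n u k = u k) sequentially"
 by (rule eventually_sequentiallyI[of "Suc (to_nat k)"]) (auto simp: trunc_def)

lemma E_trunc_tendsto:
 assumes "E s u < top"
 shows "(\<lambda>n. E s (\<lambda>k. trunc n u k - u k)) \<longlonglongrightarrow> 0"
proof -
 have "(\<lambda>n. E s (\<lambda>k. trunc n u k - u k)) \<longlonglongrightarrow> (\<integral>\<^sup>+k. 0 \<partial>count_space (UNIV :: (int^3) set))" unfolding E_def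
 proof (rule nn_integral_dominated_convergence)
  show "(\<Sum>\<^sup>+k. ennreal (lam k powr s * (norm (u k))\<^sup>2)) < \<infinity>" using assms by (simp add: E_def)
  show "AE k in count_space UNIV. ennreal (lam k powr s * (norm (trunc n u k - u k))\<^sup>2)
    \<le> ennreal (lam k powr s * (norm (u k))\<^sup>2)" for n by (auto simp: trunc_def)
  show "AE k in count_space UNIV. (\<lambda>n. ennreal (lam k powr s * (norm (trunc n u k - u k))\<^sup>2)) \<longlonglongrightarrow> 0"
  proof (intro AE_I2 tendsto_eventually)
   fix k
   show "\<forall>\<^sub>F n in sequentially. ennreal (lam k powr s * (norm (trunc n u k - u k))\<^sup>2) = 0"
    using eventually_trunc[of u k] by eventually_elim simp
  qed
 qed auto
 then show ?thesis by simp
qed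

lemma V_dist_tendsto_0_iff:
 assumes "\<And>n. E s (\<lambda>k. X n k - u k) < top"
 shows "(\<lambda>n. V_dist L s (X n) u) \<longlonglongrightarrow> 0 \<longleftrightarrow> (\<lambda>n. E s (\<lambda>k. X n k - u k)) \<longlonglongrightarrow> 0"
proof
 assume "(\<lambda>n. V_dist L s (X n) u) \<longlonglongrightarrow> 0"
 then have "(\<lambda>n. ennreal ((V_dist L s (X n) u)\<^sup>2 / L ^ 3)) \<longlonglongrightarrow> ennreal (0\<^sup>2 / L ^ 3)"
  using L_pos by (intro tendsto_intros tendsto_ennrealI) auto
 moreover have "ennreal ((V_dist L s (X n) u)\<^sup>2 / L ^ 3) = E s (\<lambda>k. X n k - u k)" for n
  using assms[of n] L_pos by (simp add: V_dist_def V_norm_eq)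
 ultimately show "(\<lambda>n. E s (\<lambda>k. X n k - u k)) \<longlonglongrightarrow> 0" by simp
next
 assume "(\<lambda>n. E s (\<lambda>k. X n k - u k)) \<longlonglongrightarrow> 0"
 then have "(\<lambda>n. enn2real (E s (\<lambda>k. X n k - u k))) \<longlonglongrightarrow> 0" by (intro tendsto_enn2real) auto
 then have "(\<lambda>n. sqrt (L ^ 3 * enn2real (E s (\<lambda>k. X n k - u k)))) \<longlonglongrightarrow> sqrt (L ^ 3 * 0)"
  by (intro tendsto_real_sqrt tendsto_mult tendsto_const)
 then show "(\<lambda>n. V_dist L s (X n) u) \<longlonglongrightarrow> 0" by (simp add: V_dist_def V_norm_eq)
qed

end

section \<open>The projected convective term\<close>

lemma norm_vector_scalar_mult: "norm (c *s v) = norm c * norm (v :: complex ^ 'n)"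
 by (simp add: norm_vec_def norm_mult L2_set_right_distrib)

context torus
begin

definition kdot :: "int ^ 3 \<Rightarrow> complex ^ 3 \<Rightarrow> complex" where
 "kdot k z = (\<Sum>i\<in>UNIV. of_real (wavevector L k $ i) * z $ i)"

definition leray :: "int ^ 3 \<Rightarrow> complex ^ 3 \<Rightarrow> complex ^ 3" where
 "leray k z = z - (\<chi> i. kdot k z / of_real (lam k) * of_real (wavevector L k $ i))"

definition adv_term :: "field \<Rightarrow> field \<Rightarrow> int ^ 3 \<Rightarrow> int ^ 3 \<Rightarrow> complex ^ 3" where
 "adv_term u v k l = (\<i> * kdot k (u l)) *s v (k - l)"

definition adv :: "field \<Rightarrow> field \<Rightarrow> field" where
 "adv u v k = (\<integral>l. adv_term u v k l \<partial>count_space UNIV)"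

text \<open>
 The coefficients of the Leray projection of \<open>(u \<sqdot> \<nabla>) v\<close>. The frequency \<open>k - l\<close> of the derivative
 is replaced by \<open>k\<close> in \<open>adv_term\<close>, which makes no difference for divergence free \<open>u\<close> and exposes the
 factor \<open>sqrt \<lambda>\<^sub>k\<close>.
\<close>

definition PB :: "field \<Rightarrow> field \<Rightarrow> field" where
 "PB u v k = (if k = 0 then 0 else leray k (adv u v k))"

lemma norm_wavevector: "norm (wavevector L k) = sqrt (lam k)"
 by (simp add: lam_def)

lemma norm_kdot_le: "norm (kdot k z) \<le> sqrt (lam k) * norm z"
proof -
 have "norm (kdot k z) \<le> (\<Sum>i\<in>UNIV. \<bar>wavevector L k $ i\<bar> * \<bar>norm (z $ i)\<bar>)"
  unfolding kdot_def by (rule order_trans[OF norm_sum]) (simp add: norm_mult)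
 also have "\<dots> \<le> L2_set (\<lambda>i. wavevector L k $ i) UNIV * L2_set (\<lambda>i. norm (z $ i)) UNIV" by (rule L2_set_mult_ineq)
 also have "\<dots> = norm (wavevector L k) * norm z" by (simp add: norm_vec_def L2_set_def)
 finally show ?thesis by (simp add: norm_wavevector)
qed

lemma kdot_add: "kdot k (y + z) = kdot k y + kdot k z"
 by (simp add: kdot_def distrib_left sum.distrib)

lemma kdot_diff: "kdot k (y - z) = kdot k y - kdot k z"
 by (simp add: kdot_def right_diff_distrib sum_subtractf)

lemma kdot_scaleR: "kdot k (c *\<^sub>R z) = c *\<^sub>R kdot k z"
 unfolding kdot_def scaleR_sum_right by (intro sum.cong) auto

lemma kdot_eq_0_iff: "kdot k z = 0 \<longleftrightarrow> (\<Sum>i\<in>UNIV. of_int (k $ i) * z $ i) = 0"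
proof -
 have "kdot k z = of_real (2 * pi / L) * (\<Sum>i\<in>UNIV. of_int (k $ i) * z $ i)"
  unfolding kdot_def sum_distrib_left by (intro sum.cong) (auto simp: wavevector_def)
 then show ?thesis using L_pos by auto
qed

lemma kdot_wavevector: "kdot k (\<chi> i. c * of_real (wavevector L k $ i)) = c * of_real (lam k)"
proof -
 have "lam k = (\<Sum>i\<in>UNIV. (wavevector L k $ i)\<^sup>2)"
  unfolding lam_def power2_norm_eq_inner inner_vec_def by (simp add: power2_eq_square)
 then show ?thesis unfolding kdot_def by (simp add: sum_distrib_left power2_eq_square mult_ac)
qed

lemma kdot_leray: "k \<noteq> 0 \<Longrightarrow> kdot k (leray k z) = 0"
 unfolding leray_def kdot_diff kdot_wavevector by simp

lemma leray_add: "leray k (y + z) = leray k y + leray k z"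
 by (simp add: leray_def vec_eq_iff kdot_add algebra_simps add_divide_distrib)

lemma leray_diff: "leray k (y - z) = leray k y - leray k z"
 by (simp add: leray_def vec_eq_iff kdot_diff algebra_simps diff_divide_distrib)

lemma leray_scaleR: "leray k (c *\<^sub>R z) = c *\<^sub>R leray k z"
 unfolding leray_def vec_eq_iff kdot_scaleR by (auto simp: scaleR_conv_of_real[where 'a = complex] algebra_simps)

lemma norm_leray_le:
 assumes "k \<noteq> 0"
 shows "norm (leray k z) \<le> 2 * norm z"
proof -
 let ?w = "(\<chi> i. kdot k z / of_real (lam k) * of_real (wavevector L k $ i)) :: complex ^ 3"
 have "?w = (kdot k z / of_real (lam k)) *s (\<chi> i. of_real (wavevector L k $ i))" by (simp add: vec_eq_iff)
 moreover have "norm (\<chi> i. complex_of_real (wavevector L k $ i)) = sqrt (lam k)"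
  unfolding norm_wavevector[symmetric] by (simp add: norm_vec_def L2_set_def)
 ultimately have "norm ?w = norm (kdot k z) / lam k * sqrt (lam k)" by (simp add: norm_vector_scalar_mult norm_divide)
 also have "\<dots> \<le> sqrt (lam k) * norm z / lam k * sqrt (lam k)" by (intro mult_right_mono divide_right_mono norm_kdot_le) auto
 also have "\<dots> = norm z" using lam_pos[OF assms] assms by (simp add: field_simps)
 finally show ?thesis unfolding leray_def using norm_triangle_ineq4[of z ?w] by linarith
qed

definition conv_abs :: "field \<Rightarrow> field \<Rightarrow> int ^ 3 \<Rightarrow> ennreal" where
 "conv_abs u v k = (\<Sum>\<^sup>+l. ennreal (norm (u l) * norm (v (k - l))))"

lemma norm_adv_term_le: "norm (adv_term u v k l) \<le> sqrt (lam k) * (norm (u l) * norm (v (k - l)))"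
 unfolding adv_term_def norm_vector_scalar_mult using mult_right_mono[OF norm_kdot_le[of k "u l"], of "norm (v (k - l))"]
 by (simp add: norm_mult mult.assoc)

lemma nn_integral_adv_term_le:
 "(\<Sum>\<^sup>+l. ennreal (norm (adv_term u v k l))) \<le> ennreal (sqrt (lam k)) * conv_abs u v k" unfolding conv_abs_def
 by (subst nn_integral_cmult[symmetric])
   (auto intro!: nn_integral_mono ennreal_leI norm_adv_term_le simp: ennreal_mult[symmetric])

lemma integrable_adv_term:
 assumes "conv_abs u v k < top"
 shows "integrable (count_space UNIV) (adv_term u v k)"
 using le_less_trans[OF nn_integral_adv_term_le[of u v k]] assms by (auto simp: integrable_iff_bounded ennreal_mult_less_top)

lemma norm_PB_le: "ennreal (norm (PB u v k)) \<le> ennreal (2 * sqrt (lam k)) * conv_abs u v k"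
proof (cases "k = 0")
 case False
 have adv: "ennreal (norm (adv u v k)) \<le> ennreal (sqrt (lam k)) * conv_abs u v k"
 proof (cases "integrable (count_space UNIV) (adv_term u v k)")
  case True
  then show ?thesis unfolding adv_def by (rule order_trans[OF integral_norm_bound_ennreal nn_integral_adv_term_le])
 next
  case False
  then show ?thesis by (simp add: adv_def not_integrable_integral_eq)
 qed
 have "ennreal (norm (PB u v k)) \<le> ennreal (2 * norm (adv u v k))"
  using norm_leray_le[OF False] False by (simp add: PB_def ennreal_leI)
 also have "\<dots> = 2 * ennreal (norm (adv u v k))" by (simp add: ennreal_mult)
 also have "\<dots> \<le> 2 * (ennreal (sqrt (lam k)) * conv_abs u v k)" by (intro mult_left_mono adv) auto
 finally show ?thesis by (simp add: ennreal_mult mult.assoc)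
qed (simp add: PB_def)

definition K :: real where
 "K = 12 * 4 powr \<alpha> * enn2real Z + 1"

lemma K_pos: "0 < K"
 by (simp add: K_def add_nonneg_pos)

text \<open>
 Because of \<open>k = l + m\<close>, the larger of \<open>\<lambda>\<^sub>l\<close> and \<open>\<lambda>\<^sub>m\<close> is at least
 \<open>\<lambda>\<^sub>k / 4\<close>; it absorbs the weight \<open>\<lambda>\<^sub>k\<^sup>\<alpha>\<close>.
\<close>

lemma weight_split:
 assumes k: "k = l + m" and l: "l \<noteq> 0" and m: "m \<noteq> 0"
 shows "lam k powr \<alpha> * (lam l powr - \<beta> * lam m powr - \<alpha>)
   \<le> 4 powr \<alpha> * (2 * lam l powr - \<beta> + lam m powr - \<beta>)"
proof -
 define x where "x = lam l"
 define y where "y = lam m"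
 have pos: "0 < x" "0 < y" using lam_pos l m by (auto simp: x_def y_def)
 have a0: "0 \<le> \<alpha>" using alpha by simp
 have "lam k \<le> 4 * max x y" using lam_add_le[of l m] by (auto simp: k x_def y_def)
 then have "lam k powr \<alpha> \<le> (4 * max x y) powr \<alpha>" using a0 by (intro powr_mono2) auto
 also have "\<dots> = 4 powr \<alpha> * (max x y) powr \<alpha>" using pos by (simp add: powr_mult)
 also have "(max x y) powr \<alpha> \<le> x powr \<alpha> + y powr \<alpha>" by (simp add: max_def)
 finally have 1: "lam k powr \<alpha> \<le> 4 powr \<alpha> * (x powr \<alpha> + y powr \<alpha>)" by simp
 have xx: "x powr \<alpha> * x powr - \<beta> = x powr - 1" by (simp add: powr_add[symmetric])
 have yy: "y powr \<alpha> * y powr - \<alpha> = 1" using pos by (simp add: powr_add[symmetric])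
 have 2: "x powr - 1 * y powr - \<alpha> \<le> x powr - \<beta> + y powr - \<beta>"
 proof (cases "x \<le> y")
  case True
  then have "y powr - \<alpha> \<le> x powr - \<alpha>" using a0 pos by (intro powr_mono2') auto
  then have "x powr - 1 * y powr - \<alpha> \<le> x powr - 1 * x powr - \<alpha>" by (intro mult_left_mono) auto
  also have "\<dots> = x powr - \<beta>" unfolding powr_add[symmetric] by simp
  finally show ?thesis by (simp add: add_increasing2)
 next
  case False
  then have "x powr - 1 \<le> y powr - 1" using pos by (intro powr_mono2') auto
  then have "x powr - 1 * y powr - \<alpha> \<le> y powr - 1 * y powr - \<alpha>" by (intro mult_right_mono) auto
  also have "\<dots> = y powr - \<beta>" unfolding powr_add[symmetric] by simp
  finally show ?thesis by (simp add: add_increasing)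
 qed
 have "lam k powr \<alpha> * (x powr - \<beta> * y powr - \<alpha>)
   \<le> 4 powr \<alpha> * (x powr \<alpha> + y powr \<alpha>) * (x powr - \<beta> * y powr - \<alpha>)" by (intro mult_right_mono 1) auto
 also have "\<dots> = 4 powr \<alpha> * ((x powr \<alpha> * x powr - \<beta>) * y powr - \<alpha>
          + (y powr \<alpha> * y powr - \<alpha>) * x powr - \<beta>)" by (simp add: algebra_simps)
 also have "\<dots> = 4 powr \<alpha> * (x powr - 1 * y powr - \<alpha> + x powr - \<beta>)" unfolding xx yy by simp
 also have "\<dots> \<le> 4 powr \<alpha> * (2 * x powr - \<beta> + y powr - \<beta>)" using 2 by (intro mult_left_mono) auto
 finally show ?thesis by (simp add: x_def y_def)
qed

lemma nn_integral_shift: "(\<Sum>\<^sup>+l. f (k - l)) = (\<integral>\<^sup>+l. f l \<partial>count_space (UNIV :: (int^3) set))"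
 by (rule nn_integral_bij_count_space) (rule bij_betwI[where g = "\<lambda>l. k - l"], auto)

lemma nn_integral_weights_le:
 "(\<Sum>\<^sup>+l. ennreal (lam k powr \<alpha> * (lam l powr - \<beta> * lam (k - l) powr - \<alpha>)))
  \<le> ennreal (4 powr \<alpha>) * (3 * Z)"
proof -
 have "(\<Sum>\<^sup>+l. ennreal (lam k powr \<alpha> * (lam l powr - \<beta> * lam (k - l) powr - \<alpha>)))
  \<le> (\<Sum>\<^sup>+l. ennreal (4 powr \<alpha>) * (2 * ennreal (lam l powr - \<beta>) + ennreal (lam (k - l) powr - \<beta>)))"
 proof (intro nn_integral_mono)
  fix l
  have "lam k powr \<alpha> * (lam l powr - \<beta> * lam (k - l) powr - \<alpha>)
    \<le> 4 powr \<alpha> * (2 * lam l powr - \<beta> + lam (k - l) powr - \<beta>)"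
  proof (cases "l = 0 \<or> k - l = 0")
   case True
   then show ?thesis by auto
  next
   case False
   then show ?thesis by (intro weight_split) auto
  qed
  then show "ennreal (lam k powr \<alpha> * (lam l powr - \<beta> * lam (k - l) powr - \<alpha>))
    \<le> ennreal (4 powr \<alpha>) * (2 * ennreal (lam l powr - \<beta>) + ennreal (lam (k - l) powr - \<beta>))"
   by (subst (asm) ennreal_le_iff[symmetric]) (auto simp: ennreal_mult ennreal_plus)
 qed
 also have "\<dots> = ennreal (4 powr \<alpha>) * (2 * Z + (\<Sum>\<^sup>+l. ennreal (lam (k - l) powr - \<beta>)))"
  unfolding Z_def by (simp add: nn_integral_cmult nn_integral_add)
 also have "(\<Sum>\<^sup>+l. ennreal (lam (k - l) powr - \<beta>)) = Z" unfolding Z_def by (rule nn_integral_shift)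
 also have "2 * Z + Z = 3 * Z" by (metis distrib_right mult_1 numeral_Bit1 numeral_One one_add_one)
 finally show ?thesis .
qed

text \<open>
 Cauchy-Schwarz for the convolution, after inserting the weights of the two norms and their inverses.
\<close>

lemma conv_abs_bound:
 assumes u0: "u 0 = 0" and v0: "v 0 = 0"
 shows "ennreal (lam k powr \<alpha>) * (conv_abs u v k)\<^sup>2 \<le> ennreal (4 powr \<alpha>) * (3 * Z) *
   (\<Sum>\<^sup>+l. ennreal (lam l powr \<beta> * (norm (u l))\<^sup>2) * ennreal (lam (k - l) powr \<alpha> * (norm (v (k - l)))\<^sup>2))"
proof -
 define f where "f = (\<lambda>l. lam l powr (- \<beta> / 2) * lam (k - l) powr (- \<alpha> / 2))"
 define g where "g = (\<lambda>l. (lam l powr (\<beta> / 2) * norm (u l)) * (lam (k - l) powr (\<alpha> / 2) * norm (v (k - l))))"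
 have f0: "0 \<le> f l" and g0: "0 \<le> g l" for l by (auto simp: f_def g_def)
 have sq: "(x powr (s / 2))\<^sup>2 = x powr s" for x s :: real by (cases "x = 0") (auto simp: power2_eq_square powr_add[symmetric])
 have sqm: "(x powr - (s / 2))\<^sup>2 = x powr - s" for x s :: real using sq[of x "- s"] by simp
 have fg: "norm (u l) * norm (v (k - l)) = f l * g l" for l
 proof (cases "l = 0 \<or> k - l = 0")
  case True
  then show ?thesis using u0 v0 by (auto simp: g_def)
 next
  case False
  then have "lam l > 0" "lam (k - l) > 0" using lam_pos by auto
  then have "lam l powr (- \<beta> / 2) * lam l powr (\<beta> / 2) = 1"
   "lam (k - l) powr (- \<alpha> / 2) * lam (k - l) powr (\<alpha> / 2) = 1" by (auto simp: powr_add[symmetric] add_divide_distrib[symmetric])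
  moreover have "f l * g l = (lam l powr (- \<beta> / 2) * lam l powr (\<beta> / 2)) *
    (lam (k - l) powr (- \<alpha> / 2) * lam (k - l) powr (\<alpha> / 2)) * (norm (u l) * norm (v (k - l)))" by (simp add: f_def g_def mult_ac)
  ultimately show ?thesis by simp
 qed
 have "(conv_abs u v k)\<^sup>2 = (\<Sum>\<^sup>+l. ennreal (f l) * ennreal (g l))\<^sup>2"
  unfolding conv_abs_def fg using f0 g0 by (simp add: ennreal_mult)
 also have "\<dots> \<le> (\<Sum>\<^sup>+l. (ennreal (f l))\<^sup>2) * (\<Sum>\<^sup>+l. (ennreal (g l))\<^sup>2)" by (rule Cauchy_Schwarz_nn_integral) auto
 finally have "ennreal (lam k powr \<alpha>) * (conv_abs u v k)\<^sup>2
   \<le> ennreal (lam k powr \<alpha>) * (\<Sum>\<^sup>+l. (ennreal (f l))\<^sup>2) * (\<Sum>\<^sup>+l. (ennreal (g l))\<^sup>2)" by (simp add: mult.assoc mult_left_mono)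
 also have "ennreal (lam k powr \<alpha>) * (\<Sum>\<^sup>+l. (ennreal (f l))\<^sup>2)
   = (\<Sum>\<^sup>+l. ennreal (lam k powr \<alpha> * (lam l powr - \<beta> * lam (k - l) powr - \<alpha>)))" by (subst nn_integral_cmult[symmetric])
    (auto intro!: nn_integral_cong simp: f_def ennreal_power ennreal_mult power_mult_distrib sq sqm)
 also have "\<dots> \<le> ennreal (4 powr \<alpha>) * (3 * Z)" by (rule nn_integral_weights_le)
 also have "(\<lambda>l. (ennreal (g l))\<^sup>2) = (\<lambda>l. ennreal (lam l powr \<beta> * (norm (u l))\<^sup>2) * ennreal (lam (k - l) powr \<alpha> * (norm (v (k - l)))\<^sup>2))"
  by (auto simp: g_def ennreal_power ennreal_mult[symmetric] power_mult_distrib sq)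
 finally show ?thesis by (simp add: mult_right_mono)
qed

lemma conv_abs_finite:
 assumes "u 0 = 0" "v 0 = 0" "E \<beta> u < top" "E \<alpha> v < top" "k \<noteq> 0"
 shows "conv_abs u v k < top"
proof -
 have "(\<Sum>\<^sup>+l. ennreal (lam l powr \<beta> * (norm (u l))\<^sup>2) * ennreal (lam (k - l) powr \<alpha> * (norm (v (k - l)))\<^sup>2))
   \<le> (\<Sum>\<^sup>+l. ennreal (lam l powr \<beta> * (norm (u l))\<^sup>2) * E \<alpha> v)" by (intro nn_integral_mono mult_left_mono E_coeff) auto
 also have "\<dots> = E \<beta> u * E \<alpha> v" unfolding E_def[of \<beta>] by (simp add: nn_integral_multc)
 also have "\<dots> < top" using assms by (simp add: ennreal_mult_less_top)
 finally have "ennreal (lam k powr \<alpha>) * (conv_abs u v k)\<^sup>2 < top"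
  using Z_finite by (intro le_less_trans[OF conv_abs_bound]) (auto simp: assms ennreal_mult_less_top)
 then show ?thesis using lam_pos[OF assms(5)] by (auto simp: ennreal_mult_less_top power_less_top_ennreal)
qed

text \<open>
 The nonlinear estimate. The derivative in the convective term contributes \<open>sqrt \<lambda>\<^sub>k\<close>, which accounts for the
 exponent \<open>\<alpha> - 1\<close> on the left; what remains is the convolution bound, summed over \<open>k\<close>.
\<close>

lemma E_PB_le:
 assumes u0: "u 0 = 0" and v0: "v 0 = 0"
 shows "E (\<alpha> - 1) (PB u v) \<le> ennreal K * (E \<beta> u * E \<alpha> v)"
proof -
 define F where "F = (\<lambda>k l. ennreal (lam l powr \<beta> * (norm (u l))\<^sup>2) * ennreal (lam (k - l) powr \<alpha> * (norm (v (k - l)))\<^sup>2))"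
 define c where "c = ennreal (4 powr \<alpha>) * (3 * Z)"
 have "ennreal (lam k powr (\<alpha> - 1) * (norm (PB u v k))\<^sup>2) \<le> 4 * (c * (\<Sum>\<^sup>+l. F k l))" for k
 proof (cases "k = 0")
  case False
  have "ennreal (lam k powr (\<alpha> - 1) * (norm (PB u v k))\<^sup>2)
    = ennreal (lam k powr (\<alpha> - 1)) * (ennreal (norm (PB u v k)))\<^sup>2" by (simp add: ennreal_mult ennreal_power)
  also have "\<dots> \<le> ennreal (lam k powr (\<alpha> - 1)) * (ennreal (2 * sqrt (lam k)) * conv_abs u v k)\<^sup>2"
   by (intro mult_left_mono power_mono norm_PB_le) auto
  also have "\<dots> = (ennreal (lam k powr (\<alpha> - 1)) * (ennreal (2 * sqrt (lam k)))\<^sup>2) * (conv_abs u v k)\<^sup>2"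
   by (simp add: power_mult_distrib mult.assoc)
  also have "ennreal (lam k powr (\<alpha> - 1)) * (ennreal (2 * sqrt (lam k)))\<^sup>2 = ennreal (4 * lam k powr \<alpha>)"
  proof -
   have "lam k powr (\<alpha> - 1) * lam k = lam k powr \<alpha>" using lam_pos[OF False] by (simp add: powr_diff)
   then show ?thesis by (simp add: ennreal_power ennreal_mult[symmetric] power_mult_distrib mult.left_commute)
  qed
  also have "\<dots> * (conv_abs u v k)\<^sup>2 = 4 * (ennreal (lam k powr \<alpha>) * (conv_abs u v k)\<^sup>2)" by (simp add: ennreal_mult mult.assoc)
  also have "\<dots> \<le> 4 * (c * (\<Sum>\<^sup>+l. F k l))" unfolding c_def F_def by (intro mult_left_mono conv_abs_bound u0 v0) auto
  finally show ?thesis .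
 qed simp
 then have "E (\<alpha> - 1) (PB u v) \<le> (\<Sum>\<^sup>+k. 4 * (c * (\<Sum>\<^sup>+l. F k l)))" unfolding E_def by (intro nn_integral_mono)
 also have "\<dots> = 4 * c * (\<Sum>\<^sup>+k. \<integral>\<^sup>+l. F k l \<partial>count_space UNIV)" by (simp add: nn_integral_cmult mult.assoc)
 also have "(\<Sum>\<^sup>+k. \<integral>\<^sup>+l. F k l \<partial>count_space UNIV)
   = (\<Sum>\<^sup>+l. \<integral>\<^sup>+k. F k l \<partial>count_space UNIV)" by (rule nn_integral_count_space_nn_integral) auto
 also have "\<dots> = (\<Sum>\<^sup>+l. ennreal (lam l powr \<beta> * (norm (u l))\<^sup>2) * E \<alpha> v)"
 proof (intro nn_integral_cong)
  fix l
  have "(\<Sum>\<^sup>+k. ennreal (lam (k - l) powr \<alpha> * (norm (v (k - l)))\<^sup>2)) = E \<alpha> v"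
   unfolding E_def by (rule nn_integral_bij_count_space) (rule bij_betwI[where g = "\<lambda>k. k + l"], auto)
  then show "(\<Sum>\<^sup>+k. F k l) = ennreal (lam l powr \<beta> * (norm (u l))\<^sup>2) * E \<alpha> v" unfolding F_def by (simp add: nn_integral_cmult)
 qed
 also have "\<dots> = E \<beta> u * E \<alpha> v" unfolding E_def[of \<beta>] by (simp add: nn_integral_multc)
 also have "4 * c * (E \<beta> u * E \<alpha> v) \<le> ennreal K * (E \<beta> u * E \<alpha> v)"
 proof (intro mult_right_mono)
  obtain z where z: "Z = ennreal z" "0 \<le> z" using Z_finite by (cases Z) auto
  show "4 * c \<le> ennreal K"
  proof -
   have "4 * c = ennreal (12 * 4 powr \<alpha> * z)"
   proof -
    have "12 * 4 powr \<alpha> * z = 4 * (4 powr \<alpha> * (3 * z))" by simp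
    then show ?thesis unfolding c_def z(1) using z(2) by (simp only:) (simp add: ennreal_mult mult.left_commute)
   qed
   then show ?thesis using z by (simp add: K_def ennreal_leI del: ennreal_plus)
  qed
 qed auto
 finally show ?thesis .
qed

lemma PB_0 [simp]: "PB u v 0 = 0"
 by (simp add: PB_def)

lemma PB_diff_left:
 assumes "u 0 = 0" "u' 0 = 0" "v 0 = 0" "E \<beta> u < top" "E \<beta> u' < top" "E \<alpha> v < top"
 shows "PB (\<lambda>k. u k - u' k) v k = PB u v k - PB u' v k"
proof (cases "k = 0")
 case False
 have eq: "adv_term (\<lambda>k. u k - u' k) v k = (\<lambda>l. adv_term u v k l - adv_term u' v k l)"
  by (auto simp: fun_eq_iff adv_term_def kdot_diff vec_eq_iff algebra_simps)
 have "adv (\<lambda>k. u k - u' k) v k = adv u v k - adv u' v k" unfolding adv_def eq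
  by (intro Bochner_Integration.integral_diff integrable_adv_term conv_abs_finite assms False)
 then show ?thesis using False by (simp add: PB_def leray_diff)
qed simp

lemma PB_add_left:
 assumes "u 0 = 0" "u' 0 = 0" "v 0 = 0" "E \<beta> u < top" "E \<beta> u' < top" "E \<alpha> v < top"
 shows "PB (\<lambda>k. u k + u' k) v k = PB u v k + PB u' v k"
proof (cases "k = 0")
 case False
 have eq: "adv_term (\<lambda>k. u k + u' k) v k = (\<lambda>l. adv_term u v k l + adv_term u' v k l)"
  by (auto simp: fun_eq_iff adv_term_def kdot_add vec_eq_iff algebra_simps)
 have "adv (\<lambda>k. u k + u' k) v k = adv u v k + adv u' v k" unfolding adv_def eq
  by (intro Bochner_Integration.integral_add integrable_adv_term conv_abs_finite assms False)
 then show ?thesis using False by (simp add: PB_def leray_add)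
qed simp

lemma PB_diff_right:
 assumes "u 0 = 0" "v 0 = 0" "v' 0 = 0" "E \<beta> u < top" "E \<alpha> v < top" "E \<alpha> v' < top"
 shows "PB u (\<lambda>k. v k - v' k) k = PB u v k - PB u v' k"
proof (cases "k = 0")
 case False
 have eq: "adv_term u (\<lambda>k. v k - v' k) k = (\<lambda>l. adv_term u v k l - adv_term u v' k l)"
  by (auto simp: fun_eq_iff adv_term_def kdot_diff vec_eq_iff algebra_simps)
 have "adv u (\<lambda>k. v k - v' k) k = adv u v k - adv u v' k" unfolding adv_def eq
  by (intro Bochner_Integration.integral_diff integrable_adv_term conv_abs_finite assms False)
 then show ?thesis using False by (simp add: PB_def leray_diff)
qed simp

lemma PB_add_right:
 assumes "u 0 = 0" "v 0 = 0" "v' 0 = 0" "E \<beta> u < top" "E \<alpha> v < top" "E \<alpha> v' < top"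
 shows "PB u (\<lambda>k. v k + v' k) k = PB u v k + PB u v' k"
proof (cases "k = 0")
 case False
 have eq: "adv_term u (\<lambda>k. v k + v' k) k = (\<lambda>l. adv_term u v k l + adv_term u v' k l)"
  by (auto simp: fun_eq_iff adv_term_def kdot_add vec_eq_iff algebra_simps)
 have "adv u (\<lambda>k. v k + v' k) k = adv u v k + adv u v' k" unfolding adv_def eq
  by (intro Bochner_Integration.integral_add integrable_adv_term conv_abs_finite assms False)
 then show ?thesis using False by (simp add: PB_def leray_add)
qed simp

lemma PB_scaleR: "PB (\<lambda>k. c *\<^sub>R u k) (\<lambda>k. d *\<^sub>R v k) k = (c * d) *\<^sub>R PB u v k"
proof -
 have "adv_term (\<lambda>k. c *\<^sub>R u k) (\<lambda>k. d *\<^sub>R v k) k = (\<lambda>l. (c * d) *\<^sub>R adv_term u v k l)"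
  by (auto simp: adv_term_def kdot_scaleR vec_eq_iff scaleR_conv_of_real[where 'a = complex] mult_ac)
 then have "adv (\<lambda>k. c *\<^sub>R u k) (\<lambda>k. d *\<^sub>R v k) k = (c * d) *\<^sub>R adv u v k" unfolding adv_def by simp
 then show ?thesis by (simp add: PB_def leray_scaleR)
qed

lemma solenoidal_PB:
 assumes u: "solenoidal u" and v: "solenoidal v"
 shows "solenoidal (PB u v)"
proof -
 define cv where "cv = (\<lambda>z :: complex ^ 3. \<chi> i. cnj (z $ i))"
 have cv: "bounded_linear cv"
 proof (rule bounded_linear_intro[where K = 1])
  show "norm (cv x) \<le> norm x * 1" for x by (simp add: cv_def norm_vec_def)
 qed (auto simp: cv_def vec_eq_iff)
 have cvcv: "cv (cv z) = z" for z by (simp add: cv_def vec_eq_iff)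
 have wm: "wavevector L (- k) $ i = - wavevector L k $ i" for k i by (simp add: wavevector_def)
 have un: "u (- k) = cv (u k)" "v (- k) = cv (v k)" for k using u v by (auto simp: solenoidal_def cv_def vec_eq_iff)
 have km: "kdot (- k) (cv z) = - cnj (kdot k z)" for k z by (simp add: kdot_def cv_def wm sum_negf)
 have "adv u v (- k) = cv (adv u v k)" for k
 proof -
  have "adv_term u v (- k) (- l) = cv (adv_term u v k l)" for l
  proof -
   have "- k - - l = - (k - l)" by simp
   then show ?thesis unfolding adv_term_def un km by (simp only: un) (simp add: cv_def vec_eq_iff)
  qed
  then have "adv u v (- k) = (\<integral>l. cv (adv_term u v k l) \<partial>count_space UNIV)" unfolding adv_def
   using integral_bij_count_space[of uminus UNIV UNIV "adv_term u v (- k)"] by (simp add: bij_uminus)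
  also have "\<dots> = cv (adv u v k)" unfolding adv_def by (rule integral_bounded_linear'[OF cv cv]) (auto simp: cvcv)
  finally show ?thesis .
 qed
 then have "PB u v (- k) = cv (PB u v k)" for k using km[of k "adv u v k"]
  by (auto simp: PB_def leray_def) (auto simp: cv_def vec_eq_iff wm)
 moreover have "(\<Sum>i\<in>UNIV. of_int (k $ i) * PB u v k $ i) = 0" for k unfolding kdot_eq_0_iff[symmetric]
  by (cases "k = 0") (simp add: kdot_def, simp add: PB_def kdot_leray)
 ultimately show ?thesis by (simp add: solenoidal_def cv_def)
qed

lemma measurable_PB:
 assumes [measurable]: "\<And>k. (\<lambda>t. a t k) \<in> borel_measurable M" "\<And>k. (\<lambda>t. u t k) \<in> borel_measurable M"
 shows "(\<lambda>t. PB (a t) (u t) k) \<in> borel_measurable M"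
proof -
 have kd: "continuous_on UNIV (kdot k)" unfolding kdot_def[abs_def] by (intro continuous_intros)
 then have [measurable]: "kdot k \<in> borel_measurable borel" by (rule borel_measurable_continuous_onI)
 have "continuous_on UNIV (leray k)"
  unfolding leray_def[abs_def] divide_inverse by (intro continuous_intros continuous_on_vec_lambda kd)
 then have [measurable]: "leray k \<in> borel_measurable borel" by (rule borel_measurable_continuous_onI)
 have "continuous_on UNIV (\<lambda>p :: complex \<times> (complex ^ 3). fst p *s snd p)"
  unfolding vector_scalar_mult_def by (intro continuous_intros continuous_on_vec_lambda)
 then have sm: "(\<lambda>p :: complex \<times> (complex ^ 3). fst p *s snd p) \<in> borel_measurable borel"
  by (rule borel_measurable_continuous_onI)
 have tm: "(\<lambda>t. adv_term (a t) (u t) k l) \<in> borel_measurable M" for l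
 proof -
  have "(\<lambda>t. (\<i> * kdot k (a t l), u t (k - l))) \<in> borel_measurable M" by measurable
  from measurable_compose[OF this sm] show ?thesis by (simp add: adv_term_def)
 qed
 have "(\<lambda>p. (\<lambda>l t. adv_term (a t) (u t) k l) (snd p) (fst p)) \<in> borel_measurable (M \<Otimes>\<^sub>M count_space UNIV)"
  by (rule measurable_compose_countable'[where I = UNIV and g = snd])
    (auto intro: measurable_compose[OF measurable_fst tm])
 then have "(\<lambda>t. adv (a t) (u t) k) \<in> borel_measurable M" unfolding adv_def
  by (intro sigma_finite_measure.borel_measurable_lebesgue_integral sigma_finite_measure_count_space)
    (simp add: split_beta')
 then show ?thesis unfolding PB_def by (cases "k = 0") auto
qed

end

section \<open>Orthogonality of the characters\<close>

lemma integral_lborel_prod: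
 fixes f :: "'a::euclidean_space \<Rightarrow> real \<Rightarrow> complex"
 assumes "\<And>b. b \<in> Basis \<Longrightarrow> integrable lborel (f b)"
 shows "(\<integral>x. (\<Prod>b\<in>Basis. f b (x \<bullet> b)) \<partial>lborel) = (\<Prod>b\<in>Basis. (\<integral>x. f b x \<partial>lborel))"
proof -
 interpret product_sigma_finite "\<lambda>_::'a. lborel :: real measure" ..
 have [measurable]: "f b \<in> borel_measurable borel" if "b \<in> Basis" for b
  using borel_measurable_integrable[OF assms[OF that]] by simp
 have "(\<integral>x. (\<Prod>b\<in>Basis. f b (x \<bullet> b)) \<partial>lborel)
   = (\<integral>g. (\<Prod>b\<in>Basis. f b ((\<Sum>b\<in>Basis. g b *\<^sub>R b) \<bullet> b)) \<partial>(\<Pi>\<^sub>M b\<in>Basis. lborel))"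
  by (subst lborel_eq) (rule integral_distr, measurable)
 also have "\<dots> = (\<integral>g. (\<Prod>b\<in>Basis. f b (g b)) \<partial>(\<Pi>\<^sub>M b\<in>Basis. lborel))"
  by (intro Bochner_Integration.integral_cong prod.cong) (auto simp: inner_sum_left inner_Basis if_distrib cong: if_cong)
 also have "\<dots> = (\<Prod>b\<in>Basis. (\<integral>x. f b x \<partial>lborel))" by (rule product_integral_prod) (auto intro: assms)
 finally show ?thesis .
qed

lemma integral_cis_period:
 fixes L :: real and n :: int
 assumes "L > 0"
 shows "(\<integral>t. indicator {0..L} t *\<^sub>R cis (2 * pi / L * of_int n * t) \<partial>lborel) = (if n = 0 then of_real L else 0)"
proof (cases "n = 0")
 case True
 then show ?thesis using assms by (simp add: scaleR_conv_of_real)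
next
 case False
 define a where "a = 2 * pi / L * of_int n"
 have a: "a \<noteq> 0" using False assms by (simp add: a_def)
 define F where "F = (\<lambda>t. cis (a * t) / (\<i> * of_real a))"
 have der: "(F has_vector_derivative cis (a * t)) (at t within {0..L})" for t
 proof -
  have "((\<lambda>t. exp (\<i> * of_real a * of_real t)) has_vector_derivative (\<i> * of_real a * exp (\<i> * of_real a * of_real t))) (at t within {0..L})"
   by (auto intro!: derivative_eq_intros has_vector_derivative_real_field simp: mult_ac)
  then have "((\<lambda>t. cis (a * t)) has_vector_derivative (\<i> * of_real a * cis (a * t))) (at t within {0..L})"
   by (simp add: cis_conv_exp mult_ac)
  from has_vector_derivative_divide[OF this, of "\<i> * of_real a"] show ?thesis using a by (simp add: F_def)
 qed
 have "(\<integral>t. indicator {0..L} t *\<^sub>R cis (a * t) \<partial>lborel) = F L - F 0"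
  using assms by (intro integral_FTC_atLeastAtMost der continuous_intros) auto
 also have "cis (a * L) = 1" using assms cis_multiple_2pi[of "of_int n"] by (simp add: a_def mult_ac)
 then have "F L - F 0 = 0" by (simp add: F_def)
 finally show ?thesis using False by (simp add: a_def)
qed

context torus
begin

definition box :: "(real ^ 3) set" where
 "box = cbox 0 (\<chi> _. L)"

definition ch :: "int ^ 3 \<Rightarrow> real ^ 3 \<Rightarrow> complex" where
 "ch k x = cis (wavevector L k \<bullet> x)"

lemma ch_add: "ch (k + l) x = ch k x * ch l x"
 by (simp add: ch_def wavevector_add inner_add_left cis_mult)

lemma ch_minus: "ch (- k) x = cnj (ch k x)"
proof -
 have "wavevector L (- k) = - wavevector L k" by (simp add: wavevector_def vec_eq_iff)
 then show ?thesis by (simp add: ch_def cis_cnj)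
qed

lemma integrable_ch: "integrable lborel (\<lambda>x. indicator box x *\<^sub>R ch k x)"
 unfolding box_def ch_def by (intro borel_integrable_compact compact_cbox continuous_intros)

lemma integral_ch: "(\<integral>x. indicator box x *\<^sub>R ch k x \<partial>lborel) = (if k = 0 then of_real (L ^ 3) else 0)"
proof -
 define n where "n = (\<lambda>b::real^3. (THE i. b = axis i 1))"
 have n: "n (axis i 1) = i" for i by (simp add: n_def axis_eq_axis)
 define f where "f = (\<lambda>b t. indicator {0..L} t *\<^sub>R cis (2 * pi / L * of_int (k $ n b) * t))"
 have B: "(\<Prod>b\<in>(Basis :: (real^3) set). h b) = (\<Prod>i\<in>UNIV. h (axis i 1))" for h :: "real^3 \<Rightarrow> complex"
 proof -
  have Beq: "(Basis :: (real^3) set) = range (\<lambda>i. axis i 1)" by (auto simp: Basis_vec_def)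
  have inj: "inj (\<lambda>i::3. axis i 1 :: real^3)" by (auto simp: inj_def axis_eq_axis)
  show ?thesis unfolding Beq using prod.reindex[OF inj, of h] by (simp add: o_def)
 qed
 have "indicator box x *\<^sub>R ch k x = (\<Prod>b\<in>Basis. f b (x \<bullet> b))" for x
 proof -
  have "indicator box x = (\<Prod>i\<in>UNIV. indicator {0..L} (x $ i) :: real)"
   by (auto simp: indicator_def box_def mem_box_cart prod_zero_iff)
  moreover have "ch k x = (\<Prod>i\<in>UNIV. cis (2 * pi / L * of_int (k $ i) * x $ i))" unfolding ch_def cis_conv_exp
   by (subst exp_sum[symmetric]) (auto simp: inner_vec_def wavevector_def sum_distrib_left)
  ultimately show ?thesis unfolding B by (simp add: f_def n inner_axis scaleR_conv_of_real prod.distrib)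
 qed
 then have "(\<integral>x. indicator box x *\<^sub>R ch k x \<partial>lborel) = (\<integral>x. (\<Prod>b\<in>Basis. f b (x \<bullet> b)) \<partial>lborel)" by simp
 also have "\<dots> = (\<Prod>b\<in>Basis. (\<integral>x. f b x \<partial>lborel))" unfolding f_def
  by (intro integral_lborel_prod borel_integrable_compact compact_Icc continuous_intros)
 also have "\<dots> = (\<Prod>i\<in>(UNIV :: 3 set). if k $ i = 0 then of_real L else 0)" unfolding B f_def n integral_cis_period[OF L_pos] ..
 also have "\<dots> = (if k = 0 then of_real (L ^ 3) else 0)" by (auto simp: vec_eq_iff)
 finally show ?thesis .
qed

section \<open>The trilinear form on trigonometric polynomials\<close>

lemma real_trig_sum:
 assumes fin: "finite {k. c k \<noteq> 0}" and sym: "\<And>k. c (- k) = cnj (c k)"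
 shows "of_real (Re (\<Sum>k | c k \<noteq> 0. c k * ch k x)) = (\<Sum>k | c k \<noteq> 0. c k * ch k x)"
proof -
 have "cnj (\<Sum>k | c k \<noteq> 0. c k * ch k x) = (\<Sum>k | c k \<noteq> 0. c (- k) * ch (- k) x)" by (simp add: sym ch_minus)
 also have "\<dots> = (\<Sum>k | c k \<noteq> 0. c k * ch k x)" by (rule sum.reindex_bij_witness[of _ uminus uminus]) (auto simp: sym)
 finally show ?thesis by (intro of_real_Re) (simp add: Reals_cnj_iff)
qed

lemma field_value_trig:
 assumes "u \<in> trig_fields L" "finite F" "{k. u k \<noteq> 0} \<subseteq> F"
 shows "of_real (field_value L u x $ i) = (\<Sum>k\<in>F. u k $ i * ch k x)"
proof -
 have sub: "{k. u k $ i \<noteq> 0} \<subseteq> F" using assms(3) by auto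
 have fin: "finite {k. u k $ i \<noteq> 0}" using sub assms(2) by (rule finite_subset)
 have "(\<Sum>\<^sub>\<infinity>k. u k $ i * ch k x) = (\<Sum>\<^sub>\<infinity>k\<in>{k. u k $ i \<noteq> 0}. u k $ i * ch k x)" by (rule infsum_cong_neutral) auto
 then have "field_value L u x $ i = Re (\<Sum>k | u k $ i \<noteq> 0. u k $ i * ch k x)" using fin by (simp add: field_value_def ch_def)
 then have "of_real (field_value L u x $ i) = (\<Sum>k | u k $ i \<noteq> 0. u k $ i * ch k x)"
  using assms(1) real_trig_sum[OF fin] by (simp add: trig_fields_iff solenoidal_def)
 also have "\<dots> = (\<Sum>k\<in>F. u k $ i * ch k x)" using sub assms(2) by (intro sum.mono_neutral_left) auto
 finally show ?thesis .
qed

lemma partial_field_value_trig: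
 assumes v: "v \<in> trig_fields L" and F: "finite F" "{k. v k \<noteq> 0} \<subseteq> F"
 shows "of_real (partial j (\<lambda>y. field_value L v y $ i) x) = (\<Sum>k\<in>F. \<i> * of_real (wavevector L k $ j) * v k $ i * ch k x)"
proof -
 define c where "c = (\<lambda>k. \<i> * of_real (wavevector L k $ j) * v k $ i)"
 have sub: "{k. c k \<noteq> 0} \<subseteq> F" using F(2) by (auto simp: c_def)
 have fin: "finite {k. c k \<noteq> 0}" using sub F(1) by (rule finite_subset)
 have sym: "c (- k) = cnj (c k)" for k using v by (simp add: c_def trig_fields_iff solenoidal_def wavevector_def)
 have val: "field_value L v y $ i = Re (\<Sum>k\<in>F. v k $ i * ch k y)" for y
  using field_value_trig[OF assms, of y i] by (metis Re_complex_of_real)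
 have chd: "(ch k has_derivative (\<lambda>h. \<i> * of_real (wavevector L k \<bullet> h) * ch k x)) (at x)" for k
 proof -
  have "((\<lambda>y. \<i> * complex_of_real (wavevector L k \<bullet> y)) has_derivative (\<lambda>h. \<i> * of_real (wavevector L k \<bullet> h))) (at x)"
   by (auto intro!: derivative_eq_intros)
  from has_derivative_compose[OF this DERIV_exp[unfolded has_field_derivative_def]]
  have "((\<lambda>y. exp (\<i> * complex_of_real (wavevector L k \<bullet> y))) has_derivative
    (\<lambda>h. \<i> * of_real (wavevector L k \<bullet> h) * exp (\<i> * of_real (wavevector L k \<bullet> x)))) (at x)" by (simp add: mult_ac)
  then show ?thesis by (simp add: ch_def[abs_def] cis_conv_exp)
 qed
 have "((\<lambda>y. Re (\<Sum>k\<in>F. v k $ i * ch k y)) has_derivative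
   (\<lambda>h. Re (\<Sum>k\<in>F. v k $ i * (\<i> * of_real (wavevector L k \<bullet> h) * ch k x)))) (at x)"
  by (intro bounded_linear.has_derivative[OF bounded_linear_Re] has_derivative_sum has_derivative_mult_right chd)
 then have "partial j (\<lambda>y. field_value L v y $ i) x = Re (\<Sum>k\<in>F. v k $ i * (\<i> * of_real (wavevector L k \<bullet> axis j 1) * ch k x))"
  unfolding partial_def val by (simp add: frechet_derivative_at[symmetric])
 also have "(\<Sum>k\<in>F. v k $ i * (\<i> * of_real (wavevector L k \<bullet> axis j 1) * ch k x)) = (\<Sum>k\<in>F. c k * ch k x)"
  by (intro sum.cong) (auto simp: c_def inner_axis mult_ac)
 also have "\<dots> = (\<Sum>k | c k \<noteq> 0. c k * ch k x)" using sub F(1) by (intro sum.mono_neutral_right) auto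
 finally have "of_real (partial j (\<lambda>y. field_value L v y $ i) x) = (\<Sum>k | c k \<noteq> 0. c k * ch k x)"
  using real_trig_sum[OF fin sym] by simp
 also have "\<dots> = (\<Sum>k\<in>F. c k * ch k x)" using sub F(1) by (intro sum.mono_neutral_left) auto
 finally show ?thesis by (simp add: c_def)
qed

lemma integral_triple:
 assumes "finite A" "finite B" "finite C"
 shows "(\<integral>x. indicator box x *\<^sub>R ((\<Sum>l\<in>A. a l * ch l x) * (\<Sum>m\<in>B. b m * ch m x) * (\<Sum>n\<in>C. c n * ch n x)) \<partial>lborel)
   = of_real (L ^ 3) * (\<Sum>l\<in>A. \<Sum>m\<in>B. \<Sum>n\<in>C. if l + m + n = 0 then a l * b m * c n else 0)"
proof -
 have "indicator box x *\<^sub>R ((\<Sum>l\<in>A. a l * ch l x) * (\<Sum>m\<in>B. b m * ch m x) * (\<Sum>n\<in>C. c n * ch n x))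
   = (\<Sum>l\<in>A. \<Sum>m\<in>B. \<Sum>n\<in>C. a l * b m * c n * (indicator box x *\<^sub>R ch (l + m + n) x))" for x
  by (simp add: sum_product sum_distrib_left sum_distrib_right ch_add scaleR_sum_right mult_ac)
    (subst sum.swap, simp add: mult_ac)
 then have "(\<integral>x. indicator box x *\<^sub>R ((\<Sum>l\<in>A. a l * ch l x) * (\<Sum>m\<in>B. b m * ch m x) * (\<Sum>n\<in>C. c n * ch n x)) \<partial>lborel)
   = (\<Sum>l\<in>A. \<Sum>m\<in>B. \<Sum>n\<in>C. a l * b m * c n * (\<integral>x. indicator box x *\<^sub>R ch (l + m + n) x \<partial>lborel))"
  by (simp add: Bochner_Integration.integral_sum integrable_ch del: mult_scaleR_right)
 also have "\<dots> = of_real (L ^ 3) * (\<Sum>l\<in>A. \<Sum>m\<in>B. \<Sum>n\<in>C. if l + m + n = 0 then a l * b m * c n else 0)"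
  unfolding sum_distrib_left integral_ch by (intro sum.cong) auto
 finally show ?thesis .
qed

lemma inner_complex3: "(z :: complex ^ 3) \<bullet> w = Re (\<Sum>i\<in>UNIV. z $ i * cnj (w $ i))"
 by (simp add: inner_vec_def inner_complex_def)

lemma inner_leray:
 assumes "kdot k w = 0"
 shows "leray k z \<bullet> w = z \<bullet> w"
proof -
 have "(\<chi> i. kdot k z / of_real (lam k) * of_real (wavevector L k $ i)) \<bullet> w
   = Re (kdot k z / of_real (lam k) * cnj (kdot k w))" unfolding inner_complex3 kdot_def[of k w]
  by (simp add: sum_distrib_left mult_ac)
 then show ?thesis using assms by (simp add: leray_def inner_diff_left)
qed

lemma kdot_solenoidal: "solenoidal u \<Longrightarrow> kdot k (u k) = 0"
 by (simp add: kdot_eq_0_iff solenoidal_def)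

definition bt :: "field \<Rightarrow> field \<Rightarrow> field \<Rightarrow> real" where
 "bt u v w = L ^ 3 * (\<integral>k. PB u v k \<bullet> w k \<partial>count_space UNIV)"

lemma inner_PB:
 assumes "solenoidal w"
 shows "PB u v k \<bullet> w k = adv u v k \<bullet> w k"
 using assms by (auto simp: PB_def inner_leray kdot_solenoidal solenoidal_at_0)

text \<open>
 Multiplying out three trigonometric polynomials and integrating over a period leaves the triples of frequencies with sum zero. The Leray
 projection may be inserted since \<open>w\<close> is divergence free.
\<close>

lemma b_trig_eq:
 assumes u: "u \<in> trig_fields L" and v: "v \<in> trig_fields L" and w: "w \<in> trig_fields L"
 shows "b_trig L u v w = bt u v w"
proof -
 define A where "A = {k. u k \<noteq> 0}"
 define B where "B = {k. v k \<noteq> 0}"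
 define C where "C = {k. w k \<noteq> 0}"
 have fin: "finite A" "finite B" "finite C" using u v w by (auto simp: trig_fields_iff A_def B_def C_def)
 have sol: "solenoidal u" "solenoidal v" "solenoidal w" using u v w by (auto simp: trig_fields_iff)
 have wm: "w (- k) $ i = cnj (w k $ i)" for k i using sol by (simp add: solenoidal_def)
 let ?b = "\<lambda>i j m. \<i> * of_real (wavevector L m $ j) * v m $ i"
 have 1: "complex_of_real (LINT x:cbox 0 (\<chi> _. L)|lborel.
     field_value L u x $ j * partial j (\<lambda>y. field_value L v y $ i) x * field_value L w x $ i)
   = of_real (L ^ 3) * (\<Sum>l\<in>A. \<Sum>m\<in>B. u l $ j * ?b i j m * cnj (w (l + m) $ i))" (is "?lhs = _") for i j
 proof -
  have "?lhs = (\<integral>x. indicator box x *\<^sub>R (of_real (field_value L u x $ j) *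
    of_real (partial j (\<lambda>y. field_value L v y $ i) x) * of_real (field_value L w x $ i)) \<partial>lborel)"
   unfolding set_lebesgue_integral_def integral_complex_of_real[symmetric] box_def
   by (intro Bochner_Integration.integral_cong) (auto simp: scaleR_conv_of_real)
  also have "\<dots> = (\<integral>x. indicator box x *\<^sub>R ((\<Sum>l\<in>A. u l $ j * ch l x) * (\<Sum>m\<in>B. ?b i j m * ch m x) *
    (\<Sum>n\<in>C. w n $ i * ch n x)) \<partial>lborel)" unfolding field_value_trig[OF u fin(1), folded A_def, OF order_refl]
    field_value_trig[OF w fin(3), folded C_def, OF order_refl]
    partial_field_value_trig[OF v fin(2), folded B_def, OF order_refl] ..
  also have "\<dots> = of_real (L ^ 3) * (\<Sum>l\<in>A. \<Sum>m\<in>B. \<Sum>n\<in>C. if l + m + n = 0 then u l $ j * ?b i j m * w n $ i else 0)"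
   by (rule integral_triple[OF fin])
  finally have "?lhs = of_real (L ^ 3) * (\<Sum>l\<in>A. \<Sum>m\<in>B. \<Sum>n\<in>C. if l + m + n = 0 then u l $ j * ?b i j m * w n $ i else 0)" .
  moreover have "(\<Sum>n\<in>C. if l + m + n = 0 then u l $ j * ?b i j m * w n $ i else 0)
    = u l $ j * ?b i j m * cnj (w (l + m) $ i)" for l m
  proof -
   have "(\<Sum>n\<in>C. if l + m + n = 0 then u l $ j * ?b i j m * w n $ i else 0)
    = (\<Sum>n\<in>C. if n = - (l + m) then u l $ j * ?b i j m * w (- (l + m)) $ i else 0)"
   proof (intro sum.cong refl)
    fix n
    have "l + m + n = 0 \<longleftrightarrow> n = - (l + m)" by (metis eq_neg_iff_add_eq_0 add.commute)
    then show "(if l + m + n = 0 then u l $ j * ?b i j m * w n $ i else 0)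
     = (if n = - (l + m) then u l $ j * ?b i j m * w (- (l + m)) $ i else 0)" by simp
   qed
   also have "\<dots> = u l $ j * ?b i j m * w (- (l + m)) $ i" using fin(3) by (auto simp: C_def)
   finally show ?thesis by (simp only: wm)
  qed
  ultimately show ?thesis by simp
 qed
 have shift: "(\<Sum>m\<in>B. adv_term u v (l + m) l \<bullet> w (l + m)) = (\<Sum>k\<in>C. adv_term u v k l \<bullet> w k)" for l
 proof -
  have "(\<Sum>m\<in>B. adv_term u v (l + m) l \<bullet> w (l + m)) = (\<Sum>k\<in>(\<lambda>m. l + m) ` B. adv_term u v k l \<bullet> w k)" by (subst sum.reindex) auto
  also have "\<dots> = (\<Sum>k\<in>(\<lambda>m. l + m) ` B \<union> C. adv_term u v k l \<bullet> w k)"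
  proof (intro sum.mono_neutral_left ballI)
   fix k assume k: "k \<in> ((\<lambda>m. l + m) ` B \<union> C) - (\<lambda>m. l + m) ` B"
   have "k - l \<notin> B"
   proof
    assume "k - l \<in> B"
    then have "l + (k - l) \<in> (\<lambda>m. l + m) ` B" by (rule imageI)
    then show False using k by simp
   qed
   then show "adv_term u v k l \<bullet> w k = 0" by (simp add: B_def adv_term_def vector_scalar_mult_def inner_vec_def)
  qed (use fin in auto)
  also have "\<dots> = (\<Sum>k\<in>C. adv_term u v k l \<bullet> w k)"
  proof (intro sum.mono_neutral_right ballI)
   fix k assume "k \<in> ((\<lambda>m. l + m) ` B \<union> C) - C"
   then show "adv_term u v k l \<bullet> w k = 0" by (simp add: C_def)
  qed (use fin in auto)
  finally show ?thesis .
 qed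
 have "complex_of_real (b_trig L u v w) = of_real (L ^ 3) * (\<Sum>i\<in>UNIV. \<Sum>j\<in>UNIV. \<Sum>l\<in>A. \<Sum>m\<in>B. u l $ j * ?b i j m * cnj (w (l + m) $ i))"
  unfolding b_trig_def of_real_sum 1 sum_distrib_left ..
 also have "(\<Sum>i\<in>UNIV. \<Sum>j\<in>UNIV. \<Sum>l\<in>A. \<Sum>m\<in>B. u l $ j * ?b i j m * cnj (w (l + m) $ i))
   = (\<Sum>l\<in>A. \<Sum>m\<in>B. \<Sum>i\<in>UNIV. \<Sum>j\<in>UNIV. u l $ j * ?b i j m * cnj (w (l + m) $ i))"
  unfolding sum.swap[of _ A "UNIV :: 3 set"] sum.swap[of _ B "UNIV :: 3 set"] ..
 also have "\<dots> = (\<Sum>l\<in>A. \<Sum>m\<in>B. \<Sum>i\<in>UNIV. adv_term u v (l + m) l $ i * cnj (w (l + m) $ i))"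
 proof (intro sum.cong refl)
  fix l m i
  have "kdot (l + m) (u l) = kdot l (u l) + kdot m (u l)" by (simp add: kdot_def wavevector_add distrib_right sum.distrib)
  then have k: "kdot (l + m) (u l) = (\<Sum>j\<in>UNIV. of_real (wavevector L m $ j) * u l $ j)"
   by (simp add: kdot_solenoidal[OF sol(1)] kdot_def[of m])
  show "(\<Sum>j\<in>UNIV. u l $ j * ?b i j m * cnj (w (l + m) $ i)) = adv_term u v (l + m) l $ i * cnj (w (l + m) $ i)"
   unfolding adv_term_def k by (simp add: sum_distrib_left sum_distrib_right mult_ac)
 qed
 finally have "b_trig L u v w = Re (of_real (L ^ 3) * (\<Sum>l\<in>A. \<Sum>m\<in>B. \<Sum>i\<in>UNIV. adv_term u v (l + m) l $ i * cnj (w (l + m) $ i)))"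
  by (metis Re_complex_of_real)
 also have "\<dots> = L ^ 3 * (\<Sum>l\<in>A. \<Sum>m\<in>B. adv_term u v (l + m) l \<bullet> w (l + m))" by (simp add: inner_complex3 flip: of_real_power)
 also have "(\<Sum>l\<in>A. \<Sum>m\<in>B. adv_term u v (l + m) l \<bullet> w (l + m)) = (\<Sum>l\<in>A. \<Sum>k\<in>C. adv_term u v k l \<bullet> w k)"
  by (intro sum.cong refl shift)
 also have "(\<Sum>l\<in>A. \<Sum>k\<in>C. adv_term u v k l \<bullet> w k) = (\<Sum>k\<in>C. adv u v k \<bullet> w k)"
 proof (subst sum.swap, intro sum.cong refl)
  fix k
  have sub: "{l. adv_term u v k l \<noteq> 0} \<subseteq> A" by (auto simp: adv_term_def A_def kdot_def)
  have "adv u v k = (\<Sum>l | adv_term u v k l \<noteq> 0. adv_term u v k l)" unfolding adv_def using finite_subset[OF sub fin(1)]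
   by (subst lebesgue_integral_count_space_finite_support) auto
  also have "\<dots> = (\<Sum>l\<in>A. adv_term u v k l)" using sub fin(1) by (intro sum.mono_neutral_left) auto
  finally show "(\<Sum>l\<in>A. adv_term u v k l \<bullet> w k) = adv u v k \<bullet> w k" by (simp add: inner_sum_left)
 qed
 also have "\<dots> = (\<Sum>k\<in>C. PB u v k \<bullet> w k)" using inner_PB[OF sol(3)] by simp
 also have "\<dots> = (\<integral>k. PB u v k \<bullet> w k \<partial>count_space UNIV)"
 proof -
  have sub: "{k. PB u v k \<bullet> w k \<noteq> 0} \<subseteq> C" by (auto simp: C_def)
  have "(\<integral>k. PB u v k \<bullet> w k \<partial>count_space UNIV) = (\<Sum>k | PB u v k \<bullet> w k \<noteq> 0. PB u v k \<bullet> w k)"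
   using finite_subset[OF sub fin(3)] by (subst lebesgue_integral_count_space_finite_support) auto
  also have "\<dots> = (\<Sum>k\<in>C. PB u v k \<bullet> w k)" using sub fin(3) by (intro sum.mono_neutral_left) auto
  finally show ?thesis by simp
 qed
 finally show ?thesis by (simp add: bt_def)
qed

section \<open>Extension of the trilinear form by continuity\<close>

lemma duality_bound:
 assumes "g 0 = 0 \<or> w 0 = 0"
 shows "(\<Sum>\<^sup>+k. ennreal (norm (g k) * norm (w k)))\<^sup>2 \<le> E (- s) g * E s w"
proof -
 have sq: "(x powr (r / 2))\<^sup>2 = x powr r" for x r :: real by (cases "x = 0") (auto simp: power2_eq_square powr_add[symmetric])
 define p where "p = (\<lambda>k. lam k powr (- s / 2) * norm (g k))"
 define q where "q = (\<lambda>k. lam k powr (s / 2) * norm (w k))"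
 have pq0: "0 \<le> p k" "0 \<le> q k" for k by (auto simp: p_def q_def)
 have "norm (g k) * norm (w k) = p k * q k" for k
 proof (cases "k = 0")
  case False
  then have "lam k powr (- s / 2) * lam k powr (s / 2) = 1" using lam_pos[of k] by (simp add: powr_add[symmetric])
  moreover have "p k * q k = (lam k powr (- s / 2) * lam k powr (s / 2)) * (norm (g k) * norm (w k))"
   by (simp add: p_def q_def mult_ac)
  ultimately show ?thesis by simp
 qed (use assms in \<open>auto simp: p_def q_def\<close>)
 then have "(\<Sum>\<^sup>+k. ennreal (norm (g k) * norm (w k))) = (\<Sum>\<^sup>+k. ennreal (p k) * ennreal (q k))"
  using pq0 by (simp add: ennreal_mult)
 moreover have "(\<Sum>\<^sup>+k. ennreal (p k) * ennreal (q k))\<^sup>2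
   \<le> (\<Sum>\<^sup>+k. (ennreal (p k))\<^sup>2) * (\<Sum>\<^sup>+k. (ennreal (q k))\<^sup>2)" by (rule Cauchy_Schwarz_nn_integral) auto
 moreover have "(\<lambda>k. (ennreal (p k))\<^sup>2) = (\<lambda>k. ennreal (lam k powr - s * (norm (g k))\<^sup>2))"
  using sq[of _ "- s"] by (simp add: p_def ennreal_power power_mult_distrib)
 moreover have "(\<lambda>k. (ennreal (q k))\<^sup>2) = (\<lambda>k. ennreal (lam k powr s * (norm (w k))\<^sup>2))"
  using sq[of _ s] by (simp add: q_def ennreal_power power_mult_distrib)
 ultimately show ?thesis by (simp add: E_def)
qed

lemma duality_integrable:
 assumes "g 0 = 0 \<or> w 0 = 0" "E (- s) g < top" "E s w < top"
 shows "integrable (count_space UNIV) (\<lambda>k. g k \<bullet> w k)"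
  and "(\<Sum>\<^sup>+k. ennreal (norm (g k) * norm (w k))) < top"
proof -
 have "(\<Sum>\<^sup>+k. ennreal (norm (g k) * norm (w k)))\<^sup>2 < top"
  using assms by (intro le_less_trans[OF duality_bound[where g = g and w = w and s = s, OF assms(1)]]) (simp add: ennreal_mult_less_top)
 then show *: "(\<Sum>\<^sup>+k. ennreal (norm (g k) * norm (w k))) < top" by (simp add: power_less_top_ennreal)
 have "(\<Sum>\<^sup>+k. ennreal (norm (g k \<bullet> w k))) \<le> (\<Sum>\<^sup>+k. ennreal (norm (g k) * norm (w k)))"
  by (intro nn_integral_mono ennreal_leI) (simp add: Cauchy_Schwarz_ineq2)
 then show "integrable (count_space UNIV) (\<lambda>k. g k \<bullet> w k)" using * by (auto simp: integrable_iff_bounded)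
qed

lemma pairing_eq:
 assumes "g 0 = 0 \<or> w 0 = 0" "E (- s) g < top" "E s w < top"
 shows "pairing L g w = L ^ 3 * (\<integral>k. g k \<bullet> w k \<partial>count_space UNIV)"
 unfolding pairing_def by (subst infsum_eq_integral_count_space[OF duality_integrable(1)[where g = g and w = w and s = s, OF assms]]) simp

lemma E_PB_finite:
 assumes "u \<in> V L \<beta>" "v \<in> V L \<alpha>"
 shows "E (\<alpha> - 1) (PB u v) < top"
 using assms by (intro le_less_trans[OF E_PB_le]) (auto simp: V_iff solenoidal_at_0 ennreal_mult_less_top)

lemma V_alpha: "v \<in> V L \<beta> \<Longrightarrow> v \<in> V L \<alpha>"
 by (rule V_mono) auto

lemma bt_integrable:
 assumes "u \<in> V L \<beta>" "v \<in> V L \<beta>" "w \<in> V L \<beta>"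
 shows "integrable (count_space UNIV) (\<lambda>k. PB u v k \<bullet> w k)"
proof (rule duality_integrable[where s = "1 - \<alpha>"])
 show "E (- (1 - \<alpha>)) (PB u v) < top" using E_PB_finite[OF assms(1) V_alpha[OF assms(2)]] by simp
 show "E (1 - \<alpha>) w < top" using assms alpha by (intro E_embedding_finite[of "1 - \<alpha>" \<beta>]) (auto simp: V_iff)
qed auto

lemma bt_bound:
 "\<exists>C\<ge>0. \<forall>u\<in>V L \<beta>. \<forall>v\<in>V L \<beta>. \<forall>w\<in>V L \<beta>.
   \<bar>bt u v w\<bar> \<le> C * (V_norm L \<beta> u * V_norm L \<beta> v * V_norm L \<beta> w)"
proof -
 define c1 where "c1 = lam1 powr (\<alpha> - \<beta>)"
 define c2 where "c2 = lam1 powr ((1 - \<alpha>) - \<beta>)"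
 define D where "D = sqrt (K * c1 * c2)"
 have nn: "0 \<le> c1" "0 \<le> c2" "0 \<le> K" using K_pos by (auto simp: c1_def c2_def)
 have D0: "0 \<le> D" using nn by (simp add: D_def)
 have "\<bar>bt u v w\<bar> \<le> (L ^ 3 * D / (sqrt (L ^ 3)) ^ 3) * (V_norm L \<beta> u * V_norm L \<beta> v * V_norm L \<beta> w)"
  if u: "u \<in> V L \<beta>" and v: "v \<in> V L \<beta>" and w: "w \<in> V L \<beta>" for u v w
 proof -
  define a where "a = enn2real (E \<beta> u)"
  define b where "b = enn2real (E \<beta> v)"
  define c where "c = enn2real (E \<beta> w)"
  have abc: "E \<beta> u = ennreal a" "E \<beta> v = ennreal b" "E \<beta> w = ennreal c" "0 \<le> a" "0 \<le> b" "0 \<le> c"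
   using u v w by (auto simp: a_def b_def c_def V_iff)
  define I where "I = (\<Sum>\<^sup>+k. ennreal (norm (PB u v k) * norm (w k)))"
  have Ev: "E \<alpha> v \<le> ennreal c1 * E \<beta> v" unfolding c1_def by (rule E_embedding) simp
  have Ew: "E (1 - \<alpha>) w \<le> ennreal c2 * E \<beta> w" unfolding c2_def using alpha by (intro E_embedding) simp
  have "I\<^sup>2 \<le> E (\<alpha> - 1) (PB u v) * E (1 - \<alpha>) w" unfolding I_def using duality_bound[of "PB u v" w "1 - \<alpha>"] by simp
  also have "\<dots> \<le> (ennreal K * (E \<beta> u * (ennreal c1 * E \<beta> v))) * (ennreal c2 * E \<beta> w)"
   using u v by (intro mult_mono order_trans[OF E_PB_le] Ev Ew) (auto simp: V_iff solenoidal_at_0)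
  also have "\<dots> = ennreal (K * c1 * c2 * (a * b * c))" using nn abc by (simp add: ennreal_mult[symmetric] mult_ac)
  also have "\<dots> = (ennreal (D * (sqrt a * sqrt b * sqrt c)))\<^sup>2" using nn abc by (simp add: D_def ennreal_power power_mult_distrib)
  finally have "I \<le> ennreal (D * (sqrt a * sqrt b * sqrt c))"
   using D0 abc by (cases I) (auto simp: ennreal_power top_power_ennreal top_unique power2_le_iff_abs_le)
  moreover have "ennreal \<bar>\<integral>k. PB u v k \<bullet> w k \<partial>count_space UNIV\<bar> \<le> I" unfolding I_def real_norm_def[symmetric]
   by (rule order_trans[OF integral_norm_bound_ennreal[OF bt_integrable[OF u v w]]])
     (auto intro!: nn_integral_mono ennreal_leI simp: Cauchy_Schwarz_ineq2)
  ultimately have "ennreal \<bar>\<integral>k. PB u v k \<bullet> w k \<partial>count_space UNIV\<bar> \<le> ennreal (D * (sqrt a * sqrt b * sqrt c))"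
   by (rule order_trans[rotated])
  then have "\<bar>\<integral>k. PB u v k \<bullet> w k \<partial>count_space UNIV\<bar> \<le> D * (sqrt a * sqrt b * sqrt c)"
   using D0 abc by (subst (asm) ennreal_le_iff) auto
  then have "\<bar>bt u v w\<bar> \<le> L ^ 3 * (D * (sqrt a * sqrt b * sqrt c))" using L_pos by (simp add: bt_def abs_mult)
  also have "\<dots> = (L ^ 3 * D / (sqrt (L ^ 3)) ^ 3) * (V_norm L \<beta> u * V_norm L \<beta> v * V_norm L \<beta> w)"
   unfolding V_norm_eq real_sqrt_mult a_def b_def c_def using L_pos by (simp add: power3_eq_cube[of "sqrt _"])
  finally show ?thesis .
 qed
 moreover have "0 \<le> L ^ 3 * D / (sqrt (L ^ 3)) ^ 3" using L_pos D0 by simp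
 ultimately show ?thesis by blast
qed

lemma bt_diff:
 assumes V: "u \<in> V L \<beta>" "v \<in> V L \<beta>" "w \<in> V L \<beta>" "u' \<in> V L \<beta>"  "v' \<in> V L \<beta>" "w' \<in> V L \<beta>"
 shows "bt u v w - bt u' v' w' = bt (\<lambda>k. u k - u' k) v w + bt u' (\<lambda>k. v k - v' k) w + bt u' v' (\<lambda>k. w k - w' k)"
proof -
 have f: "E \<beta> x < top" "E \<alpha> x < top" "x 0 = 0" if "x \<in> V L \<beta>" for x
  using that V_alpha[OF that] by (auto simp: V_iff solenoidal_at_0)
 have "bt u v w - bt u' v w = bt (\<lambda>k. u k - u' k) v w" unfolding bt_def right_diff_distrib[symmetric]
  by (subst Bochner_Integration.integral_diff[symmetric])
    (auto intro!: bt_integrable V simp: PB_diff_left f V inner_diff_left)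
 moreover have "bt u' v w - bt u' v' w = bt u' (\<lambda>k. v k - v' k) w" unfolding bt_def right_diff_distrib[symmetric]
  by (subst Bochner_Integration.integral_diff[symmetric])
    (auto intro!: bt_integrable V simp: PB_diff_right f V inner_diff_left)
 moreover have "bt u' v' w - bt u' v' w' = bt u' v' (\<lambda>k. w k - w' k)" unfolding bt_def right_diff_distrib[symmetric]
  by (subst Bochner_Integration.integral_diff[symmetric])
    (auto intro!: bt_integrable V simp: f V inner_diff_right)
 ultimately show ?thesis by linarith
qed

lemma trilinear_limit:
 fixes a b c :: "nat \<Rightarrow> real"
 assumes a: "a \<longlonglongrightarrow> 0" and b: "b \<longlonglongrightarrow> 0" and c: "c \<longlonglongrightarrow> 0"
 shows "(\<lambda>n. C * (a n * (b n + y) * (c n + z)) + C * (x * b n * (c n + z)) + C * (x * y * c n)) \<longlonglongrightarrow> 0"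
proof -
 have b': "(\<lambda>n. b n + y) \<longlonglongrightarrow> 0 + y" by (rule tendsto_add[OF b tendsto_const])
 have c': "(\<lambda>n. c n + z) \<longlonglongrightarrow> 0 + z" by (rule tendsto_add[OF c tendsto_const])
 have 1: "(\<lambda>n. C * (a n * (b n + y) * (c n + z))) \<longlonglongrightarrow> C * (0 * (0 + y) * (0 + z))"
  by (rule tendsto_mult_left[OF tendsto_mult[OF tendsto_mult[OF a b'] c']])
 have 2: "(\<lambda>n. C * (x * b n * (c n + z))) \<longlonglongrightarrow> C * (x * 0 * (0 + z))"
  by (rule tendsto_mult_left[OF tendsto_mult[OF tendsto_mult_left[OF b] c']])
 have 3: "(\<lambda>n. C * (x * y * c n)) \<longlonglongrightarrow> C * (x * y * 0)" by (rule tendsto_mult_left[OF tendsto_mult_left[OF c]])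
 show ?thesis using tendsto_add[OF tendsto_add[OF 1 2] 3] by simp
qed

lemma trig_in_V: "u \<in> trig_fields L \<Longrightarrow> u \<in> V L s"
 by (auto simp: trig_fields_iff V_iff intro: finite_support_E_finite)

text \<open>
 Both sides agree on trigonometric polynomials, these are dense, and \<open>bt\<close> is bounded, hence continuous, on
 \<open>V\<^sup>\<beta>\<close>.
\<close>

lemma b_form_eq:
 assumes u: "u \<in> V L \<beta>" and v: "v \<in> V L \<beta>" and w: "w \<in> V L \<beta>"
 shows "b_form L \<beta> u v w = bt u v w"
proof -
 let ?d = "V_dist L \<beta>" and ?n = "V_norm L \<beta>"
 have conv: "(\<lambda>n. b_trig L (un n) (vn n) (wn n)) \<longlonglongrightarrow> bt u v w"
  if r: "range un \<subseteq> trig_fields L" "range vn \<subseteq> trig_fields L" "range wn \<subseteq> trig_fields L"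
  and lim: "(\<lambda>n. ?d (un n) u) \<longlonglongrightarrow> 0" "(\<lambda>n. ?d (vn n) v) \<longlonglongrightarrow> 0" "(\<lambda>n. ?d (wn n) w) \<longlonglongrightarrow> 0"
  for un vn wn :: "nat \<Rightarrow> field"
 proof -
  obtain C where C: "0 \<le> C" "\<And>u v w. u \<in> V L \<beta> \<Longrightarrow> v \<in> V L \<beta> \<Longrightarrow> w \<in> V L \<beta> \<Longrightarrow>
    \<bar>bt u v w\<bar> \<le> C * (?n u * ?n v * ?n w)" using bt_bound by blast
  have inV: "un n \<in> V L \<beta>" "vn n \<in> V L \<beta>" "wn n \<in> V L \<beta>" for n using r by (auto intro!: trig_in_V simp: image_subset_iff)
  have nle: "?n x \<le> ?d x y + ?n y" if "x \<in> V L \<beta>" "y \<in> V L \<beta>" for x y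
   using V_norm_triangle[of \<beta> "\<lambda>k. x k - y k" y] that by (simp add: V_dist_def V_iff E_diff_finite)
  have bound: "norm (b_trig L (un n) (vn n) (wn n) - bt u v w)
    \<le> C * (?d (un n) u * (?d (vn n) v + ?n v) * (?d (wn n) w + ?n w)) + C * (?n u * ?d (vn n) v * (?d (wn n) w + ?n w))
     + C * (?n u * ?n v * ?d (wn n) w)" for n
  proof -
   have "b_trig L (un n) (vn n) (wn n) = bt (un n) (vn n) (wn n)" using r by (intro b_trig_eq) auto
   then have "norm (b_trig L (un n) (vn n) (wn n) - bt u v w)
     \<le> \<bar>bt (\<lambda>k. un n k - u k) (vn n) (wn n)\<bar> + \<bar>bt u (\<lambda>k. vn n k - v k) (wn n)\<bar> + \<bar>bt u v (\<lambda>k. wn n k - w k)\<bar>"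
    using bt_diff[OF inV u v w, of n n n] by simp
   also have "\<dots> \<le> C * (?d (un n) u * ?n (vn n) * ?n (wn n)) + C * (?n u * ?d (vn n) v * ?n (wn n)) + C * (?n u * ?n v * ?d (wn n) w)"
    unfolding V_dist_def by (intro add_mono C V_diff inV u v w)
   also have "\<dots> \<le> C * (?d (un n) u * (?d (vn n) v + ?n v) * (?d (wn n) w + ?n w)) + C * (?n u * ?d (vn n) v * (?d (wn n) w + ?n w))
     + C * (?n u * ?n v * ?d (wn n) w)"
    by (intro add_mono mult_left_mono mult_mono nle inV u v w mult_nonneg_nonneg add_nonneg_nonneg C order_refl)
      (auto simp: V_dist_def V_norm_nonneg C)
   finally show ?thesis .
  qed
  have "(\<lambda>n. b_trig L (un n) (vn n) (wn n) - bt u v w) \<longlonglongrightarrow> 0"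
   by (rule Lim_null_comparison[OF always_eventually[OF allI[OF bound]] trilinear_limit[OF lim]])
  then show ?thesis by (rule LIM_zero_cancel)
 qed
 have trunc: "range (\<lambda>n. trunc n x) \<subseteq> trig_fields L" "(\<lambda>n. ?d (trunc n x) x) \<longlonglongrightarrow> 0" if "x \<in> V L \<beta>" for x
 proof -
  show "range (\<lambda>n. trunc n x) \<subseteq> trig_fields L" using that by (auto simp: V_iff intro: trunc_trig)
  have "E \<beta> (\<lambda>k. trunc n x k - x k) < top" for n using V_diff[OF trunc_in_V that, OF that] by (simp add: V_iff)
  then show "(\<lambda>n. ?d (trunc n x) x) \<longlonglongrightarrow> 0" using that by (subst V_dist_tendsto_0_iff) (auto intro: E_trunc_tendsto simp: V_iff)
 qed
 show ?thesis unfolding b_form_def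
 proof (rule the_equality)
  show "\<forall>un vn wn :: nat \<Rightarrow> field. range un \<subseteq> trig_fields L \<longrightarrow> range vn \<subseteq> trig_fields L \<longrightarrow> range wn \<subseteq> trig_fields L \<longrightarrow>
    (\<lambda>n. ?d (un n) u) \<longlonglongrightarrow> 0 \<longrightarrow> (\<lambda>n. ?d (vn n) v) \<longlonglongrightarrow> 0 \<longrightarrow> (\<lambda>n. ?d (wn n) w) \<longlonglongrightarrow> 0 \<longrightarrow>
    (\<lambda>n. b_trig L (un n) (vn n) (wn n)) \<longlonglongrightarrow> bt u v w" using conv by blast
  fix c
  assume *: "\<forall>un vn wn :: nat \<Rightarrow> field. range un \<subseteq> trig_fields L \<longrightarrow> range vn \<subseteq> trig_fields L \<longrightarrow> range wn \<subseteq> trig_fields L \<longrightarrow>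
    (\<lambda>n. ?d (un n) u) \<longlonglongrightarrow> 0 \<longrightarrow> (\<lambda>n. ?d (vn n) v) \<longlonglongrightarrow> 0 \<longrightarrow> (\<lambda>n. ?d (wn n) w) \<longlonglongrightarrow> 0 \<longrightarrow>
    (\<lambda>n. b_trig L (un n) (vn n) (wn n)) \<longlonglongrightarrow> c"
  show "c = bt u v w"
   using *[rule_format, OF trunc(1)[OF u] trunc(1)[OF v] trunc(1)[OF w] trunc(2)[OF u] trunc(2)[OF v] trunc(2)[OF w]]
    conv[OF trunc(1)[OF u] trunc(1)[OF v] trunc(1)[OF w] trunc(2)[OF u] trunc(2)[OF v] trunc(2)[OF w]] by (rule LIMSEQ_unique)
 qed
qed

end

section \<open>Lebesgue and Borel measurability\<close>

lemma AE_lebesgue_on_iff: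
 assumes "I \<in> sets borel"
 shows "(AE t in lebesgue_on I. P t) \<longleftrightarrow> (AE t in lborel. t \<in> I \<longrightarrow> P t)"
 using assms by (subst AE_restrict_space_iff) (auto simp: AE_completion_iff)

lemma measurable_lebesgue_AE_eq:
 assumes g: "g \<in> borel_measurable borel" and ae: "AE t in lborel. f t = g t"
 shows "f \<in> borel_measurable lebesgue"
proof (rule measurableI)
 fix S :: "'b set" assume S: "S \<in> sets borel"
 have gS: "g -` S \<inter> space lebesgue \<in> sets lebesgue" using measurable_sets[OF measurable_completion[of g lborel borel] S] g by simp
 have "AE t in lebesgue. t \<in> g -` S \<inter> space lebesgue \<longleftrightarrow> t \<in> f -` S \<inter> space lebesgue"
  using ae unfolding AE_completion_iff by eventually_elim auto
 then show "f -` S \<inter> space lebesgue \<in> sets lebesgue" using gS by (rule completion.in_sets_AE) auto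
qed simp

lemma lebesgue_on_AE_eq:
 fixes f g :: "real \<Rightarrow> 'b :: {banach, second_countable_topology}"
 assumes I: "I \<in> sets borel" and g: "g \<in> borel_measurable borel"
  and ae: "AE t in lborel. t \<in> I \<longrightarrow> f t = g t"
 shows "integrable (lebesgue_on I) f \<longleftrightarrow> integrable lborel (\<lambda>t. indicator I t *\<^sub>R g t)"
  and "(LINT t|lebesgue_on I. f t) = (\<integral>t. indicator I t *\<^sub>R g t \<partial>lborel)"
proof -
 let ?f = "\<lambda>t. indicator I t *\<^sub>R f t" and ?g = "\<lambda>t. indicator I t *\<^sub>R g t"
 have [measurable]: "?g \<in> borel_measurable borel" using g I by measurable
 have ae': "AE t in lborel. ?f t = ?g t" using ae by eventually_elim (auto split: split_indicator)
 have f: "?f \<in> borel_measurable lebesgue" by (rule measurable_lebesgue_AE_eq[OF _ ae']) simp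
 have g': "?g \<in> borel_measurable lebesgue" by (rule measurable_completion) simp
 have IL: "I \<inter> space lebesgue \<in> sets lebesgue" using I by simp
 have "integrable lebesgue ?f \<longleftrightarrow> integrable lebesgue ?g" using ae' by (intro integrable_cong_AE f g') (simp add: AE_completion_iff)
 then show "integrable (lebesgue_on I) f \<longleftrightarrow> integrable lborel ?g"
  unfolding integrable_restrict_space[OF IL] by (simp add: integrable_completion)
 have "(\<integral>t. ?f t \<partial>lebesgue) = (\<integral>t. ?g t \<partial>lebesgue)" using ae' by (intro integral_cong_AE f g') (simp add: AE_completion_iff)
 then show "(LINT t|lebesgue_on I. f t) = (\<integral>t. ?g t \<partial>lborel)"
  unfolding integral_restrict_space[OF IL] by (simp add: integral_completion)
qed

lemma lebesgue_ex_borel: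
 fixes f :: "real \<Rightarrow> 'b :: euclidean_space"
 assumes f: "f \<in> borel_measurable lebesgue"
 shows "\<exists>g\<in>borel_measurable borel. AE t in lborel. f t = g t"
proof -
 have "\<exists>h\<in>borel_measurable lborel. AE t in lborel. f t \<bullet> b = h t" for b
  by (intro completion_ex_borel_measurable_real borel_measurable_inner f borel_measurable_const)
 then obtain h where h: "\<And>b. h b \<in> borel_measurable lborel" "\<And>b. AE t in lborel. f t \<bullet> b = h b t" by metis
 have [measurable]: "h b \<in> borel_measurable borel" for b using h(1)[of b] by simp
 have "AE t in lborel. \<forall>b\<in>Basis. f t \<bullet> b = h b t" using h(2) by (intro AE_finite_allI) auto
 then have "AE t in lborel. f t = (\<Sum>b\<in>Basis. h b t *\<^sub>R b)"
 proof eventually_elim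
  case (elim t)
  have "f t = (\<Sum>b\<in>Basis. (f t \<bullet> b) *\<^sub>R b)" by (simp add: euclidean_representation)
  also have "\<dots> = (\<Sum>b\<in>Basis. h b t *\<^sub>R b)" using elim by (intro sum.cong) auto
  finally show ?case .
 qed
 moreover have "(\<lambda>t. \<Sum>b\<in>Basis. h b t *\<^sub>R b) \<in> borel_measurable borel"
  by (intro borel_measurable_sum borel_measurable_scaleR borel_measurable_const) simp
 ultimately show ?thesis by (intro bexI)
qed

context torus
begin

section \<open>Measurability of functions with values in the Sobolev spaces\<close>

lemma measurable_E:
 assumes "\<And>k. (\<lambda>t. u t k) \<in> borel_measurable M"
 shows "(\<lambda>t. E s (u t)) \<in> borel_measurable M"
proof -
 have [measurable]: "(\<lambda>t. u t k) \<in> borel_measurable M" for k by (rule assms)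
 have "(\<lambda>p. (\<lambda>k t. ennreal (lam k powr s * (norm (u t k))\<^sup>2)) (snd p) (fst p)) \<in> borel_measurable (M \<Otimes>\<^sub>M count_space UNIV)"
  by (rule measurable_compose_countable'[where I = UNIV and g = snd])
    (auto intro!: measurable_compose[OF measurable_fst])
 then show ?thesis unfolding E_def by (intro sigma_finite_measure.borel_measurable_nn_integral sigma_finite_measure_count_space)
    (simp add: split_beta')
qed

abbreviation V_sigma :: "real \<Rightarrow> field measure" where
 "V_sigma s \<equiv> sigma (V L s) {W. openin (V_topology L s) W}"

lemma topspace_V: "topspace (V_topology L s) = V L s"
 by (rule Metric_space.topspace_mtopology[OF Metric_space_V])

lemma openin_V_iff:
 "openin (V_topology L s) W \<longleftrightarrow> W \<subseteq> V L s \<and> (\<forall>v\<in>W. \<exists>r>0. \<forall>v'\<in>V L s. V_dist L s v v' < r \<longrightarrow> v' \<in> W)"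
proof -
 interpret Metric_space "V L s" "V_dist L s" by (rule Metric_space_V)
 show ?thesis unfolding openin_mtopology
 proof (rule conj_cong[OF refl])
  assume W: "W \<subseteq> V L s"
  have "mball v r \<subseteq> W \<longleftrightarrow> (\<forall>v'\<in>V L s. V_dist L s v v' < r \<longrightarrow> v' \<in> W)" if "v \<in> W" for v r using that W unfolding mball_def by blast
  then show "(\<forall>x. x \<in> W \<longrightarrow> (\<exists>r>0. mball x r \<subseteq> W)) \<longleftrightarrow>
    (\<forall>v\<in>W. \<exists>r>0. \<forall>v'\<in>V L s. V_dist L s v v' < r \<longrightarrow> v' \<in> W)" by (simp add: Ball_def)
 qed
qed

lemma open_subset_Pow: "{W. openin (V_topology L s) W} \<subseteq> Pow (V L s)"
 using openin_subset[of "V_topology L s"] by (auto simp: topspace_V)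

lemma space_V_sigma: "space (V_sigma s) = V L s"
 by (rule space_measure_of[OF open_subset_Pow])

lemma coeff_le_V_dist:
 assumes "u \<in> V L s" "v \<in> V L s"
 shows "norm (u k - v k) \<le> V_dist L s u v / (sqrt (L ^ 3) * (lam k powr (s / 2)))"
proof (cases "k = 0")
 case True
 then show ?thesis using assms by (simp add: V_iff solenoidal_at_0)
next
 case False
 define e where "e = enn2real (E s (\<lambda>k. u k - v k))"
 have e: "E s (\<lambda>k. u k - v k) = ennreal e" "0 \<le> e" using V_diff[OF assms] by (auto simp: e_def V_iff)
 have "lam k powr s * (norm (u k - v k))\<^sup>2 \<le> e" using E_coeff[of k s "\<lambda>k. u k - v k"] e by simp
 moreover have "lam k powr s = (lam k powr (s / 2))\<^sup>2" using lam_pos[OF False] by (simp add: power2_eq_square powr_add[symmetric])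
 ultimately have "(lam k powr (s / 2) * norm (u k - v k))\<^sup>2 \<le> e" by (simp add: power_mult_distrib)
 then have "lam k powr (s / 2) * norm (u k - v k) \<le> sqrt e" by (rule real_le_rsqrt)
 moreover have "V_dist L s u v = sqrt (L ^ 3) * sqrt e" by (simp add: V_dist_def V_norm_eq e_def real_sqrt_mult)
 moreover have "0 < lam k powr (s / 2)" using lam_pos[OF False] False by simp
 ultimately show ?thesis using L_pos by (simp add: field_simps)
qed

lemma openin_coeff:
 assumes "open S"
 shows "openin (V_topology L s) {v \<in> V L s. v k \<in> S}"
 unfolding openin_V_iff
proof (intro conjI ballI)
 fix v assume v: "v \<in> {v \<in> V L s. v k \<in> S}"
 then obtain e where e: "0 < e" "\<And>z. dist z (v k) < e \<Longrightarrow> z \<in> S" using assms by (auto simp: open_dist)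
 define c where "c = sqrt (L ^ 3) * (lam k powr (s / 2))"
 show "\<exists>r>0. \<forall>v'\<in>V L s. V_dist L s v v' < r \<longrightarrow> v' \<in> {v \<in> V L s. v k \<in> S}"
 proof (cases "k = 0")
  case True
  then show ?thesis using v by (intro exI[of _ 1]) (auto simp: V_iff solenoidal_at_0)
 next
  case False
  then have c: "0 < c" using L_pos lam_pos[OF False] by (simp add: c_def)
  show ?thesis
  proof (intro exI[of _ "e * c"] conjI ballI impI)
   show "0 < e * c" using e c by simp
   fix v' assume v': "v' \<in> V L s" "V_dist L s v v' < e * c"
   have "norm (v k - v' k) \<le> V_dist L s v v' / c" unfolding c_def using v v' by (intro coeff_le_V_dist) auto
   also have "\<dots> < e" using v' c by (simp add: field_simps)
   finally have "dist (v' k) (v k) < e" by (simp add: dist_norm norm_minus_commute)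
   then show "v' \<in> {v \<in> V L s. v k \<in> S}" using e v' by auto
  qed
 qed
qed auto

lemma measurable_coeff:
 assumes w: "w \<in> measurable M (V_sigma s)"
 shows "(\<lambda>t. w t k) \<in> borel_measurable M"
proof -
 have "(\<lambda>v. v k) \<in> borel_measurable (V_sigma s)"
 proof (rule borel_measurableI)
  fix S :: "(complex ^ 3) set" assume "open S"
  have "(\<lambda>v. v k) -` S \<inter> space (V_sigma s) = {v \<in> V L s. v k \<in> S}" by (auto simp: space_V_sigma)
  moreover have "\<dots> \<in> sets (V_sigma s)" using openin_coeff[OF \<open>open S\<close>] by (subst sets_measure_of[OF open_subset_Pow]) auto
  ultimately show "(\<lambda>v. v k) -` S \<inter> space (V_sigma s) \<in> sets (V_sigma s)" by simp
 qed
 from measurable_compose[OF w this] show ?thesis .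
qed

text \<open>
 Separability: finitely supported fields with coordinates from a countable dense set.
\<close>

lemma countable_dense_fields:
 obtains D :: "field set" where "countable D" "\<And>v e. E s v < top \<Longrightarrow> 0 < (e::real) \<Longrightarrow> \<exists>c\<in>D. E s (\<lambda>k. v k - c k) < ennreal e"
proof -
 obtain Q :: "(complex ^ 3) set" where Q: "countable Q" "\<And>X. open X \<Longrightarrow> X \<noteq> {} \<Longrightarrow> \<exists>d\<in>Q. d \<in> X" using countable_dense_setE by blast
 define D where "D = (\<lambda>xs :: ((int^3) \<times> (complex^3)) list. \<lambda>k. case map_of xs k of None \<Rightarrow> 0 | Some z \<Rightarrow> z) ` lists (UNIV \<times> Q)"
 have "countable D" unfolding D_def using Q(1) by (intro countable_image countable_lists countable_SIGMA) auto
 moreover have "\<exists>c\<in>D. E s (\<lambda>k. v k - c k) < ennreal e" if v: "E s v < top" and e: "0 < e" for v and e :: real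
 proof -
  have "eventually (\<lambda>n. E s (\<lambda>k. trunc n v k - v k) < ennreal (e / 8)) sequentially"
   using order_tendstoD(2)[OF E_trunc_tendsto[OF v], of "ennreal (e / 8)"] e by simp
  then obtain n where n: "E s (\<lambda>k. trunc n v k - v k) < ennreal (e / 8)" by (auto simp: eventually_sequentially)
  define F where "F = {k. trunc n v k \<noteq> 0}"
  have F: "finite F" unfolding F_def by (rule trunc_finite)
  define d where "d = e / (8 * (real (card F) + 1))"
  have d: "0 < d" using e by (simp add: d_def)
  have "\<exists>z\<in>Q. lam k powr s * (norm (v k - z))\<^sup>2 \<le> d" for k
  proof -
   define r where "r = sqrt (d / (lam k powr s + 1))"
   have p: "0 < lam k powr s + 1" by (simp add: add_nonneg_pos)
   have r: "0 < r" using d p by (simp add: r_def)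
   obtain z where z: "z \<in> Q" "dist (v k) z < r" using Q(2)[of "ball (v k) r"] r by auto
   have "(norm (v k - z))\<^sup>2 \<le> r\<^sup>2" using z by (intro power_mono) (auto simp: dist_norm)
   also have "r\<^sup>2 = d / (lam k powr s + 1)" using d p by (simp add: r_def)
   finally have "(lam k powr s + 1) * (norm (v k - z))\<^sup>2 \<le> d" using p by (simp add: field_simps)
   then have "lam k powr s * (norm (v k - z))\<^sup>2 + (norm (v k - z))\<^sup>2 \<le> d" by (simp add: distrib_right)
   with zero_le_power2[of "norm (v k - z)"] have "lam k powr s * (norm (v k - z))\<^sup>2 \<le> d" by linarith
   then show ?thesis using z by blast
  qed
  then obtain z where z: "\<And>k. z k \<in> Q" "\<And>k. lam k powr s * (norm (v k - z k))\<^sup>2 \<le> d" by metis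
  obtain xs where xs: "set xs = F" using finite_list[OF F] by blast
  define c where "c = (\<lambda>k. if k \<in> F then z k else 0)"
  have "map_of (map (\<lambda>k. (k, z k)) xs) k = (if k \<in> F then Some (z k) else None)" for k
   by (simp add: map_of_map_restrict xs restrict_map_def)
  then have "c = (\<lambda>k. case map_of (map (\<lambda>k. (k, z k)) xs) k of None \<Rightarrow> 0 | Some z \<Rightarrow> z)" by (auto simp: c_def)
  then have cD: "c \<in> D" unfolding D_def using z(1) by (intro image_eqI) auto
  have "E s (\<lambda>k. trunc n v k - c k) = (\<integral>\<^sup>+k. ennreal (lam k powr s * (norm (v k - z k))\<^sup>2) \<partial>count_space F)"
  proof -
   have "E s (\<lambda>k. trunc n v k - c k) = (\<integral>\<^sup>+k. ennreal (lam k powr s * (norm (trunc n v k - c k))\<^sup>2) \<partial>count_space F)"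
    unfolding E_def by (rule nn_integral_count_space_eq) (auto simp: c_def F_def)
   also have "\<dots> = (\<integral>\<^sup>+k. ennreal (lam k powr s * (norm (v k - z k))\<^sup>2) \<partial>count_space F)"
    by (intro nn_integral_cong) (auto simp: c_def F_def trunc_def split: if_splits)
   finally show ?thesis .
  qed
  also have "\<dots> \<le> (\<integral>\<^sup>+k. ennreal d \<partial>count_space F)" by (intro nn_integral_mono ennreal_leI z)
  also have "\<dots> = ennreal (real (card F) * d)"
   using F d by (simp add: emeasure_count_space_finite ennreal_mult mult.commute ennreal_of_nat_eq_real_of_nat)
  also have "\<dots> \<le> ennreal (e / 8)"
  proof (rule ennreal_leI)
   have "real (card F) * d \<le> (real (card F) + 1) * d" using d by (intro mult_right_mono) auto
   also have "\<dots> = e / 8" by (simp add: d_def field_simps)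
   finally show "real (card F) * d \<le> e / 8" .
  qed
  finally have c: "E s (\<lambda>k. trunc n v k - c k) \<le> ennreal (e / 8)" .
  have "E s (\<lambda>k. v k - c k) = E s (\<lambda>k. - (trunc n v k - v k) + (trunc n v k - c k))" by simp
  also have "\<dots> \<le> 2 * E s (\<lambda>k. trunc n v k - v k) + 2 * E s (\<lambda>k. trunc n v k - c k)"
   using E_add_le[of s "\<lambda>k. - (trunc n v k - v k)" "\<lambda>k. trunc n v k - c k"] unfolding E_minus .
  also have "\<dots> \<le> 2 * ennreal (e / 8) + 2 * ennreal (e / 8)" using n c by (intro add_mono mult_left_mono) auto
  also have "\<dots> = ennreal (e / 2)"
   using e by (simp add: ennreal_mult[symmetric] ennreal_plus[symmetric] ennreal_numeral[symmetric] del: ennreal_plus ennreal_numeral)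
  also have "\<dots> < ennreal e" using e by (simp add: ennreal_less_iff)
  finally show ?thesis using cD by blast
 qed
 ultimately show ?thesis using that by blast
qed

text \<open>
 By separability every open set is a countable union of balls, and membership in a ball is a measurable condition on the coefficients. So
 measurability with values in \<open>V\<^sup>s\<close> can be checked coefficient by coefficient.
\<close>

lemma measurable_V_sigmaI:
 assumes V: "\<And>t. t \<in> space M \<Longrightarrow> w t \<in> V L s"
  and meas: "\<And>k. (\<lambda>t. w t k) \<in> borel_measurable M"
 shows "w \<in> measurable M (V_sigma s)"
proof (rule measurable_measure_of[OF open_subset_Pow])
 show "w \<in> space M \<rightarrow> V L s" using V by auto
 fix W assume "W \<in> {W. openin (V_topology L s) W}"
 then have W: "W \<subseteq> V L s" "\<And>v. v \<in> W \<Longrightarrow> \<exists>r>0. \<forall>v'\<in>V L s. V_dist L s v v' < r \<longrightarrow> v' \<in> W" by (auto simp: openin_V_iff)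
 obtain D :: "field set" where D: "countable D" "\<And>v e. E s v < top \<Longrightarrow> 0 < (e::real) \<Longrightarrow> \<exists>c\<in>D. E s (\<lambda>k. v k - c k) < ennreal e"
  using countable_dense_fields by blast
 define P where "P = {(c, n). c \<in> D \<and> {v \<in> V L s. E s (\<lambda>k. v k - c k) < ennreal (1 / real (Suc n))} \<subseteq> W}"
 have cP: "countable P" by (rule countable_subset[of _ "D \<times> UNIV"]) (use D(1) in \<open>auto simp: P_def\<close>)
 have "w -` W \<inter> space M = (\<Union>(c, n)\<in>P. {t \<in> space M. E s (\<lambda>k. w t k - c k) < ennreal (1 / real (Suc n))})"
 proof (intro equalityI subsetI)
  fix t assume t: "t \<in> w -` W \<inter> space M"
  obtain r where r: "r > 0" "\<And>v'. v' \<in> V L s \<Longrightarrow> V_dist L s (w t) v' < r \<Longrightarrow> v' \<in> W" using W(2)[of "w t"] t by auto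
  have Ew: "E s (w t) < top" using V[of t] t by (auto simp: V_iff)
  obtain n where n: "4 * L ^ 3 / r\<^sup>2 < real n" using reals_Archimedean2 by blast
  have r2: "0 < r\<^sup>2" using r(1) by simp
  with n have "4 * L ^ 3 < real n * r\<^sup>2" by (simp add: field_simps)
  also have "\<dots> < real (Suc n) * r\<^sup>2" using r2 by simp
  finally have n': "L ^ 3 * (4 / real (Suc n)) < r\<^sup>2" by (simp add: field_simps)
  obtain c where c: "c \<in> D" "E s (\<lambda>k. w t k - c k) < ennreal (1 / real (Suc n))" using D(2)[OF Ew, of "1 / real (Suc n)"] by auto
  have "v \<in> W" if v: "v \<in> V L s" "E s (\<lambda>k. v k - c k) < ennreal (1 / real (Suc n))" for v
  proof (rule r(2)[OF v(1)])
   have "E s (\<lambda>k. w t k - v k) = E s (\<lambda>k. (w t k - c k) - (v k - c k))" by simp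
   also have "\<dots> \<le> 2 * E s (\<lambda>k. w t k - c k) + 2 * E s (\<lambda>k. v k - c k)" by (rule E_diff_le)
   also have "\<dots> \<le> 2 * ennreal (1 / real (Suc n)) + 2 * ennreal (1 / real (Suc n))"
    using c(2) v(2) by (intro add_mono mult_left_mono) auto
   also have "\<dots> = ennreal (4 / real (Suc n))"
    by (simp add: ennreal_mult[symmetric] ennreal_plus[symmetric] ennreal_numeral[symmetric] del: ennreal_plus ennreal_numeral)
   finally have "enn2real (E s (\<lambda>k. w t k - v k)) \<le> 4 / real (Suc n)" by (intro enn2real_leI) auto
   then have "L ^ 3 * enn2real (E s (\<lambda>k. w t k - v k)) \<le> L ^ 3 * (4 / real (Suc n))" using L_pos by (intro mult_left_mono) auto
   also have "\<dots> < r\<^sup>2" by (rule n')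
   finally show "V_dist L s (w t) v < r"
    unfolding V_dist_def V_norm_eq using r(1) by (intro real_less_lsqrt) (auto simp: L_pos less_imp_le)
  qed
  then have "(c, n) \<in> P" using c(1) by (auto simp: P_def)
  then show "t \<in> (\<Union>(c, n)\<in>P. {t \<in> space M. E s (\<lambda>k. w t k - c k) < ennreal (1 / real (Suc n))})" using c(2) t by auto
 qed (use V in \<open>auto simp: P_def\<close>)
 also have "\<dots> \<in> sets M"
 proof (rule sets.countable_UN''[OF cP])
  fix p assume "p \<in> P"
  have "(\<lambda>t. E s (\<lambda>k. w t k - fst p k)) \<in> borel_measurable M"
   by (intro measurable_E borel_measurable_diff meas borel_measurable_const)
  then have "{t \<in> space M. E s (\<lambda>k. w t k - fst p k) < ennreal (1 / real (Suc (snd p)))} \<in> sets M" by measurable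
  then show "(case p of (c, n) \<Rightarrow> {t \<in> space M. E s (\<lambda>k. w t k - c k) < ennreal (1 / real (Suc n))}) \<in> sets M"
   by (simp add: split_beta)
 qed
 finally show "w -` W \<inter> space M \<in> sets M" .
qed

section \<open>Borel representatives\<close>

definition borel_field :: "(real \<Rightarrow> field) \<Rightarrow> bool" where
 "borel_field w \<longleftrightarrow> (\<forall>k. (\<lambda>t. w t k) \<in> borel_measurable borel)"

definition Eint :: "real \<Rightarrow> real set \<Rightarrow> (real \<Rightarrow> field) \<Rightarrow> ennreal" where
 "Eint s I w = (\<integral>\<^sup>+t. E s (w t) * indicator I t \<partial>lborel)"

lemma borel_field_E [measurable]: "borel_field w \<Longrightarrow> (\<lambda>t. E s (w t)) \<in> borel_measurable borel"
 by (intro measurable_E) (simp add: borel_field_def)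

lemma L2_funsI:
 assumes I: "I \<in> sets borel" and w: "borel_field w" and sol: "\<And>t. t \<in> I \<Longrightarrow> solenoidal (w t)"
  and fin: "Eint s I w < top" and ae: "AE t in lborel. t \<in> I \<longrightarrow> u t = w t"
 shows "u \<in> L2_funs L s I"
proof -
 define w' where "w' = (\<lambda>t. if E s (w t) < top then w t else (\<lambda>k. 0))"
 have [measurable]: "(\<lambda>t. w t k) \<in> borel_measurable borel" for k using w by (simp add: borel_field_def)
 have [measurable]: "(\<lambda>t. E s (w t)) \<in> borel_measurable borel" by (rule borel_field_E[OF w])
 have "(\<lambda>t. w' t k) = (\<lambda>t. if E s (w t) < top then w t k else 0)" for k by (auto simp: w'_def)
 then have w'm: "(\<lambda>t. w' t k) \<in> borel_measurable borel" for k by simp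
 then have w'b: "borel_field w'" by (simp add: borel_field_def)
 have w'V: "w' t \<in> V L s" if "t \<in> I" for t using sol[OF that] by (simp add: w'_def V_iff)
 have aew: "AE t in lborel. t \<in> I \<longrightarrow> w t = w' t"
 proof -
  have "AE t in lborel. E s (w t) * indicator I t \<noteq> \<infinity>" using fin I by (intro nn_integral_PInf_AE) (auto simp: Eint_def)
  then show ?thesis by eventually_elim (auto simp: w'_def top.not_eq_extremum)
 qed
 have "AE t in lborel. E s (w' t) * indicator I t = E s (w t) * indicator I t"
  using aew by eventually_elim (auto split: split_indicator)
 then have fin': "(\<integral>\<^sup>+t. E s (w' t) * indicator I t \<partial>lborel) < top"
  using fin unfolding Eint_def by (subst nn_integral_cong_AE) auto
 have m1: "w' \<in> measurable (lebesgue_on I) (V_sigma s)"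
 proof (rule measurable_V_sigmaI)
  show "w' t \<in> V L s" if "t \<in> space (lebesgue_on I)" for t using that I by (intro w'V) simp
  show "(\<lambda>t. w' t k) \<in> borel_measurable (lebesgue_on I)" for k
   using w'm[of k] by (intro measurable_restrict_space1 measurable_completion) simp
 qed
 have [measurable]: "(\<lambda>t. (V_norm L s (w' t))\<^sup>2) \<in> borel_measurable borel"
  unfolding V_norm_eq using borel_field_E[OF w'b] by measurable
 have "integrable lborel (\<lambda>t. indicator I t *\<^sub>R (V_norm L s (w' t))\<^sup>2)"
 proof (rule integrableI_nonneg)
  have "(\<integral>\<^sup>+t. ennreal (indicator I t *\<^sub>R (V_norm L s (w' t))\<^sup>2) \<partial>lborel)
    = (\<integral>\<^sup>+t. ennreal (L ^ 3) * (E s (w' t) * indicator I t) \<partial>lborel)"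
   using w'V by (intro nn_integral_cong) (auto split: split_indicator simp: V_norm_sq V_iff)
  also have "\<dots> < \<infinity>" using fin' borel_field_E[OF w'b] I by (subst nn_integral_cmult) (auto simp: ennreal_mult_less_top)
  finally show "(\<integral>\<^sup>+t. ennreal (indicator I t *\<^sub>R (V_norm L s (w' t))\<^sup>2) \<partial>lborel) < \<infinity>" .
 qed (use I in auto)
 then have m2: "integrable (lebesgue_on I) (\<lambda>t. (V_norm L s (w' t))\<^sup>2)"
  using I by (subst lebesgue_on_AE_eq(1)[where g = "\<lambda>t. (V_norm L s (w' t))\<^sup>2"]) auto
 have m3: "AE t in lebesgue_on I. u t = w' t" unfolding AE_lebesgue_on_iff[OF I] using ae aew by eventually_elim auto
 show ?thesis unfolding L2_funs_def using m1 m2 m3 by blast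
qed

text \<open>
 The representative has Borel coefficients and values in \<open>V\<^sup>s\<close> at every time, not only almost everywhere; this is what
 the coefficientwise calculus below works with.
\<close>

lemma L2_funs_borel_rep:
 assumes u: "u \<in> L2_funs L s I" and I: "I \<in> sets borel"
 obtains w where "borel_field w" "\<And>t. w t \<in> V L s" "\<And>t. t \<notin> I \<Longrightarrow> w t = (\<lambda>k. 0)"
  "AE t in lborel. t \<in> I \<longrightarrow> u t = w t" "Eint s I w < top"
proof -
 obtain w0 where w0: "w0 \<in> measurable (lebesgue_on I) (V_sigma s)"
  "integrable (lebesgue_on I) (\<lambda>t. (V_norm L s (w0 t))\<^sup>2)" "AE t in lebesgue_on I. u t = w0 t"
  using u unfolding L2_funs_def by blast
 have IL: "I \<inter> space lebesgue \<in> sets lebesgue" using I by simp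
 have w0V: "w0 t \<in> V L s" if "t \<in> I" for t using measurable_space[OF w0(1)] that I by (simp add: space_V_sigma)
 have "(\<lambda>t. indicator I t *\<^sub>R w0 t k) \<in> borel_measurable lebesgue" for k
  using measurable_coeff[OF w0(1), of k] borel_measurable_restrict_space_iff[OF IL, of "\<lambda>t. w0 t k"] by simp
 then have "\<exists>g\<in>borel_measurable borel. AE t in lborel. indicator I t *\<^sub>R w0 t k = g t" for k by (rule lebesgue_ex_borel)
 then have "\<forall>k. \<exists>g. g \<in> borel_measurable borel \<and> (AE t in lborel. indicator I t *\<^sub>R w0 t k = g t)"
  by (simp only: Bex_def simp_thms)
 from choice[OF this] obtain g where
  "\<forall>k. g k \<in> borel_measurable borel \<and> (AE t in lborel. indicator I t *\<^sub>R w0 t k = g k t)" ..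
 then have g: "\<And>k. g k \<in> borel_measurable borel" "\<And>k. AE t in lborel. indicator I t *\<^sub>R w0 t k = g k t" by simp_all
 have "AE t in lborel. \<forall>k. indicator I t *\<^sub>R w0 t k = g k t" using g(2) by (simp add: AE_all_countable)
 then obtain N where N: "{t \<in> space lborel. \<not> (\<forall>k. indicator I t *\<^sub>R w0 t k = g k t)} \<subseteq> N" "emeasure lborel N = 0" "N \<in> sets lborel"
  by (rule AE_E)
 define w where "w = (\<lambda>t. if t \<in> I - N then (\<lambda>k. g k t) else (\<lambda>k. 0))"
 have weq: "w t = w0 t" if "t \<in> I - N" for t
 proof -
  have "t \<notin> {t \<in> space lborel. \<not> (\<forall>k. indicator I t *\<^sub>R w0 t k = g k t)}" using N(1) that by blast
  then have "\<forall>k. indicator I t *\<^sub>R w0 t k = g k t" by simp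
  then show ?thesis using that by (auto simp: w_def)
 qed
 show ?thesis
 proof
  have [measurable]: "N \<in> sets borel" using N(3) by simp
  note [measurable] = I g(1)
  have "(\<lambda>t. w t k) = (\<lambda>t. if t \<in> I - N then g k t else 0)" for k by (auto simp: w_def)
  then show b: "borel_field w" unfolding borel_field_def by simp
  show "w t \<in> V L s" for t
  proof (cases "t \<in> I - N")
   case True
   then show ?thesis using weq w0V by simp
  qed (auto simp: w_def V_iff)
  show "t \<notin> I \<Longrightarrow> w t = (\<lambda>k. 0)" for t by (simp add: w_def)
  have aeN: "AE t in lborel. t \<notin> N" using N by (intro AE_not_in) auto
  then have ae0: "AE t in lborel. t \<in> I \<longrightarrow> w0 t = w t" by eventually_elim (simp add: weq)
  show "AE t in lborel. t \<in> I \<longrightarrow> u t = w t" using w0(3)[unfolded AE_lebesgue_on_iff[OF I]] ae0 by eventually_elim auto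
  have [measurable]: "(\<lambda>t. (V_norm L s (w t))\<^sup>2) \<in> borel_measurable borel"
   unfolding V_norm_eq using borel_field_E[OF b] by measurable
  have "integrable lborel (\<lambda>t. indicator I t *\<^sub>R (V_norm L s (w t))\<^sup>2)"
   using w0(2) ae0 I by (subst (asm) lebesgue_on_AE_eq(1)[where g = "\<lambda>t. (V_norm L s (w t))\<^sup>2"]) (auto elim: eventually_mono)
  then have "(\<integral>\<^sup>+t. ennreal (norm (indicator I t *\<^sub>R (V_norm L s (w t))\<^sup>2)) \<partial>lborel) < \<infinity>" by (simp add: integrable_iff_bounded)
  also have "(\<integral>\<^sup>+t. ennreal (norm (indicator I t *\<^sub>R (V_norm L s (w t))\<^sup>2)) \<partial>lborel)
    = (\<integral>\<^sup>+t. ennreal (L ^ 3) * (E s (w t) * indicator I t) \<partial>lborel)"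
   using \<open>\<And>t. w t \<in> V L s\<close> by (intro nn_integral_cong) (auto split: split_indicator simp: V_norm_sq V_iff)
  also have "\<dots> = ennreal (L ^ 3) * Eint s I w" unfolding Eint_def using borel_field_E[OF b] by (subst nn_integral_cmult) auto
  finally show "Eint s I w < top" using L_pos by (auto simp: ennreal_mult_less_top)
 qed
qed

lemma L2_norm_integral:
 assumes I: "I \<in> sets borel" and b: "borel_field w" and ae: "AE t in lborel. t \<in> I \<longrightarrow> f t = w t"
  and fin: "Eint s I w < top"
 shows "ennreal ((sqrt (LINT t|lebesgue_on I. (V_norm L s (f t))\<^sup>2))\<^sup>2) = ennreal (L ^ 3) * Eint s I w"
proof -
 note [measurable] = I borel_field_E[OF b]
 have [measurable]: "(\<lambda>t. (V_norm L s (w t))\<^sup>2) \<in> borel_measurable borel" unfolding V_norm_eq by measurable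
 have aef: "AE t in lborel. E s (w t) * indicator I t \<noteq> \<infinity>" using fin by (intro nn_integral_PInf_AE) (auto simp: Eint_def)
 have eq: "(\<integral>\<^sup>+t. ennreal (indicator I t *\<^sub>R (V_norm L s (w t))\<^sup>2) \<partial>lborel) = ennreal (L ^ 3) * Eint s I w"
 proof -
  have "(\<integral>\<^sup>+t. ennreal (indicator I t *\<^sub>R (V_norm L s (w t))\<^sup>2) \<partial>lborel)
    = (\<integral>\<^sup>+t. ennreal (L ^ 3) * (E s (w t) * indicator I t) \<partial>lborel)" using aef by (intro nn_integral_cong_AE, eventually_elim)
     (auto split: split_indicator simp: V_norm_sq top.not_eq_extremum)
  then show ?thesis unfolding Eint_def by (subst (asm) nn_integral_cmult) auto
 qed
 have "(LINT t|lebesgue_on I. (V_norm L s (f t))\<^sup>2) = (\<integral>t. indicator I t *\<^sub>R (V_norm L s (w t))\<^sup>2 \<partial>lborel)"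
  using ae I by (intro lebesgue_on_AE_eq(2)) (auto elim: eventually_mono)
 also have "\<dots> = enn2real (ennreal (L ^ 3) * Eint s I w)" unfolding eq[symmetric] by (rule integral_eq_nn_integral) auto
 finally show ?thesis using fin by (simp add: ennreal_mult_less_top)
qed

end

section \<open>Weak derivatives on the line\<close>

lemma deriv_test_function_0:
 assumes "compact K" "\<And>t. t \<notin> K \<Longrightarrow> \<eta> t = 0" "t \<notin> K"
 shows "deriv \<eta> t = (0::real)"
proof -
 have "((\<lambda>x. 0) has_real_derivative 0) (at t)" by simp
 then have "(\<eta> has_real_derivative 0) (at t)" by (rule has_field_derivative_transform_within_open[of _ _ _ "- K"])
    (use assms compact_imp_closed in \<open>auto simp: open_Compl\<close>)
 then show ?thesis by (rule DERIV_imp_deriv)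
qed

lemma C1_has_deriv:
 assumes "\<eta> C1_differentiable_on UNIV"
 shows "((\<eta> :: real \<Rightarrow> real) has_real_derivative deriv \<eta> t) (at t)" "continuous_on UNIV (deriv \<eta>)"
proof -
 obtain D where D: "\<And>x. (\<eta> has_vector_derivative D x) (at x)" "continuous_on UNIV D"
  using assms by (auto simp: C1_differentiable_on_def)
 have D': "(\<eta> has_real_derivative D x) (at x)" for x using D(1) by (simp add: has_real_derivative_iff_has_vector_derivative)
 then have "deriv \<eta> = D" by (auto intro: DERIV_imp_deriv)
 then show "(\<eta> has_real_derivative deriv \<eta> t) (at t)" "continuous_on UNIV (deriv \<eta>)" using D' D(2) by auto
qed

lemma C1_differentiableI:
 assumes "\<And>x. (\<eta> has_real_derivative D x) (at x)" "continuous_on UNIV D"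
 shows "\<eta> C1_differentiable_on UNIV"
 using assms by (auto simp: C1_differentiable_on_def has_real_derivative_iff_has_vector_derivative)

text \<open>
 Fubini on the triangle \<open>s \<le> t\<close>, applied to the product of \<open>h s\<close> and the derivative at \<open>t\<close>.
\<close>

lemma integral_by_parts_absolutely_continuous:
 fixes h z :: "real \<Rightarrow> real"
 assumes \<zeta>: "\<zeta> C1_differentiable_on UNIV" and ends: "\<zeta> c = 0" "\<zeta> T = 0" and cT: "c \<le> T"
  and h: "integrable lborel (\<lambda>s. indicator {c..T} s * h s)"
  and z: "\<And>t. t \<in> {c..T} \<Longrightarrow> z t = z0 + (\<integral>s. indicator {c..t} s * h s \<partial>lborel)"
 shows "(\<integral>t. indicator {c..T} t * (deriv \<zeta> t * z t) \<partial>lborel) = - (\<integral>t. indicator {c..T} t * (\<zeta> t * h t) \<partial>lborel)"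
proof -
 note D = C1_has_deriv[OF \<zeta>]
 define F where "F = (\<lambda>t s. (indicator {c..T} t * deriv \<zeta> t) * (indicator {..t} s * (indicator {c..T} s * h s)))"
 have [measurable]: "deriv \<zeta> \<in> borel_measurable borel" by (rule borel_measurable_continuous_onI[OF D(2)])
 have hm [measurable]: "(\<lambda>s. indicator {c..T} s * h s) \<in> borel_measurable borel" using borel_measurable_integrable[OF h] by simp
 have dI: "integrable lborel (\<lambda>t. indicator {c..T} t * deriv \<zeta> t)"
  using borel_integrable_compact[OF compact_Icc continuous_on_subset[OF D(2)], of c T] by simp
 have meas: "case_prod F \<in> borel_measurable (lborel \<Otimes>\<^sub>M lborel)"
 proof -
  have "Measurable.pred (lborel \<Otimes>\<^sub>M lborel) (\<lambda>p :: real \<times> real. snd p \<le> fst p)" by measurable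
  moreover have "case_prod F = (\<lambda>p. (indicator {c..T} (fst p) * deriv \<zeta> (fst p)) * ((if snd p \<le> fst p then 1 else 0) * (indicator {c..T} (snd p) * h (snd p))))"
   by (auto simp: F_def fun_eq_iff indicator_def)
  moreover have "(\<lambda>p. indicator {c..T} (snd p) * h (snd p)) \<in> borel_measurable (lborel \<Otimes>\<^sub>M lborel)"
   by (rule measurable_compose[OF measurable_snd, of "\<lambda>s. indicator {c..T} s * h s"]) simp
  ultimately show ?thesis by simp
 qed
 have int: "integrable (lborel \<Otimes>\<^sub>M lborel) (case_prod F)"
 proof (rule lborel_pair.Fubini_integrable[OF meas])
  have Fs: "integrable lborel (F t)" for t
  proof (unfold F_def, intro integrable_mult_right)
   show "integrable lborel (\<lambda>s. indicator {..t} s * (indicator {c..T} s * h s))"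
    by (rule Bochner_Integration.integrable_bound[OF h]) (auto split: split_indicator)
  qed
  show "AE t in lborel. integrable lborel (\<lambda>s. case_prod F (t, s))" using Fs by simp
  have "(\<integral>s. norm (F t s) \<partial>lborel) \<le> norm ((indicator {c..T} t * deriv \<zeta> t) * (\<integral>s. \<bar>indicator {c..T} s * h s\<bar> \<partial>lborel))" for t
  proof -
   have "(\<integral>s. norm (F t s) \<partial>lborel) \<le> (\<integral>s. \<bar>indicator {c..T} t * deriv \<zeta> t\<bar> * \<bar>indicator {c..T} s * h s\<bar> \<partial>lborel)"
   proof (rule integral_mono)
    show "integrable lborel (\<lambda>s. norm (F t s))" by (rule integrable_norm[OF Fs])
    show "integrable lborel (\<lambda>s. \<bar>indicator {c..T} t * deriv \<zeta> t\<bar> * \<bar>indicator {c..T} s * h s\<bar>)"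
     using integrable_norm[OF h] by (intro integrable_mult_right) simp
   qed (auto simp: F_def abs_mult split: split_indicator)
   then show ?thesis by (simp add: abs_mult)
  qed
  moreover have "(\<lambda>t. \<integral>s. norm (F t s) \<partial>lborel) \<in> borel_measurable lborel"
   using meas by (intro lborel.borel_measurable_lebesgue_integral) (simp add: split_beta')
  ultimately show "integrable lborel (\<lambda>t. \<integral>s. norm (case_prod F (t, s)) \<partial>lborel)"
   by (intro Bochner_Integration.integrable_bound[OF integrable_mult_left[OF dI, of "\<integral>s. \<bar>indicator {c..T} s * h s\<bar> \<partial>lborel"]])
     (auto intro: abs_ge_self order_trans)
 qed
 have "(\<integral>t. indicator {c..T} t * (deriv \<zeta> t * z t) \<partial>lborel)
   = (\<integral>t. (indicator {c..T} t * deriv \<zeta> t) * z0 + (\<integral>s. F t s \<partial>lborel) \<partial>lborel)"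
 proof (intro Bochner_Integration.integral_cong refl)
  fix t
  show "indicator {c..T} t * (deriv \<zeta> t * z t) = (indicator {c..T} t * deriv \<zeta> t) * z0 + (\<integral>s. F t s \<partial>lborel)"
  proof (cases "t \<in> {c..T}")
   case True
   have "(\<integral>s. F t s \<partial>lborel) = deriv \<zeta> t * (\<integral>s. indicator {..t} s * (indicator {c..T} s * h s) \<partial>lborel)"
    using True by (simp add: F_def)
   also have "(\<integral>s. indicator {..t} s * (indicator {c..T} s * h s) \<partial>lborel) = (\<integral>s. indicator {c..t} s * h s \<partial>lborel)"
    using True by (intro Bochner_Integration.integral_cong) (auto split: split_indicator)
   finally show ?thesis using True z[OF True] by (simp add: distrib_left)
  qed (simp add: F_def)
 qed
 also have "\<dots> = (\<integral>t. indicator {c..T} t * deriv \<zeta> t \<partial>lborel) * z0 + (\<integral>t. \<integral>s. F t s \<partial>lborel \<partial>lborel)"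
  using dI lborel_pair.integrable_fst'[OF int] by (subst Bochner_Integration.integral_add) auto
 also have "(\<integral>t. indicator {c..T} t * deriv \<zeta> t \<partial>lborel) = \<zeta> T - \<zeta> c"
  using integral_FTC_atLeastAtMost[OF cT, of \<zeta> "deriv \<zeta>"] D continuous_on_subset[OF D(2)]
  by (auto simp: has_real_derivative_iff_has_vector_derivative intro: has_vector_derivative_at_within)
 also have "(\<integral>t. \<integral>s. F t s \<partial>lborel \<partial>lborel) = (\<integral>s. \<integral>t. F t s \<partial>lborel \<partial>lborel)"
  by (rule lborel_pair.Fubini_integral[OF int, symmetric])
 also have "\<dots> = (\<integral>s. - (indicator {c..T} s * (\<zeta> s * h s)) \<partial>lborel)"
 proof (intro Bochner_Integration.integral_cong refl)
  fix s
  show "(\<integral>t. F t s \<partial>lborel) = - (indicator {c..T} s * (\<zeta> s * h s))"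
  proof (cases "s \<in> {c..T}")
   case True
   have "(\<integral>t. F t s \<partial>lborel) = (\<integral>t. (indicator {s..T} t *\<^sub>R deriv \<zeta> t) * h s \<partial>lborel)"
    using True by (intro Bochner_Integration.integral_cong) (auto simp: F_def split: split_indicator)
   also have "\<dots> = (\<zeta> T - \<zeta> s) * h s" using integral_FTC_atLeastAtMost[of s T \<zeta> "deriv \<zeta>"] D continuous_on_subset[OF D(2)] True
    by (auto simp: has_real_derivative_iff_has_vector_derivative intro: has_vector_derivative_at_within)
   finally show ?thesis using True ends by simp
  qed (simp add: F_def)
 qed
 finally show ?thesis using ends by simp
qed

lemma continuous_on_indefinite_integral:
 fixes F :: "real \<Rightarrow> 'b :: euclidean_space"
 assumes "\<And>t. integrable lborel (\<lambda>s. indicator {c..t} s *\<^sub>R F s)"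
 shows "continuous_on {c..d} (\<lambda>t. \<integral>s. indicator {c..t} s *\<^sub>R F s \<partial>lborel)"
proof -
 have si: "set_integrable lborel {c..t} F" for t using assms by (simp add: set_integrable_def)
 have "(\<integral>s. indicator {c..t} s *\<^sub>R F s \<partial>lborel) = integral {c..t} F" for t
  using set_borel_integral_eq_integral(2)[OF si] by (simp add: set_lebesgue_integral_def)
 then show ?thesis using indefinite_integral_continuous_1[OF set_borel_integral_eq_integral(1)[OF si]] by simp
qed

lemma integral_continuous_Icc:
 assumes "continuous_on {a..b} (f :: real \<Rightarrow> real)"
 shows "integrable lborel (\<lambda>r. indicator {a..b} r * f r)" "(\<integral>r. indicator {a..b} r * f r \<partial>lborel) = integral {a..b} f"
 using borel_integrable_compact[OF compact_Icc assms] set_borel_integral_eq_integral(2)[of "{a..b}" f]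
 by (simp_all add: set_integrable_def set_lebesgue_integral_def)

text \<open>
 Subtracting an antiderivative \<open>G\<close> of \<open>g\<close> leaves a continuous \<open>h\<close> that is orthogonal to all
 derivatives of test functions, that is, to all continuous functions of compact support and mean zero. Testing with \<open>h - m\<close>
 times a cut-off \<open>\<xi>\<close>, where \<open>m\<close> is the \<open>\<xi>\<close>-weighted mean of \<open>h\<close>, shows that
 \<open>h\<close> is constant.
\<close>

lemma du_bois_reymond:
 fixes y g :: "real \<Rightarrow> real"
 assumes y: "continuous_on {c..d} y" and g: "integrable lborel (\<lambda>t. indicator {c<..<d} t * g t)"
  and weak: "\<And>\<eta>. \<eta> \<in> test_functions {c<..<d} \<Longrightarrow>
    (\<integral>t. indicator {c<..<d} t * (deriv \<eta> t * y t) \<partial>lborel) = - (\<integral>t. indicator {c<..<d} t * (\<eta> t * g t) \<partial>lborel)"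
  and t: "t \<in> {c..d}"
 shows "y t - y c = (\<integral>r. indicator {c..t} r * g r \<partial>lborel)"
proof -
 define gg where "gg r = indicator {c<..<d} r * g r" for r
 define G where "G r = (\<integral>s. indicator {c..r} s * gg s \<partial>lborel)" for r
 define h where "h r = y r - G r" for r
 have gi: "integrable lborel gg" using g by (simp add: gg_def[abs_def])
 have gi': "integrable lborel (\<lambda>s. indicator {c..r} s * gg s)" for r using integrable_mult_indicator[OF _ gi, of "{c..r}"] by simp
 have hc: "continuous_on {c..d} h"
  unfolding h_def G_def using continuous_on_indefinite_integral[of c gg d] gi' y by (intro continuous_on_diff) auto
 have Gt: "G t = (\<integral>r. indicator {c..t} r * g r \<partial>lborel)"
 proof -
  have "(\<lambda>r. indicator {c..t} r * g r) = (\<lambda>r. indicator {c..t} r * gg r + indicator {c} r * (indicator {c..t} c * g c) + indicator ({d} - {c}) r * (indicator {c..t} d * g d))"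
   using t by (auto simp: fun_eq_iff gg_def split: split_indicator)
  then have [measurable]: "(\<lambda>r. indicator {c..t} r * g r) \<in> borel_measurable lborel"
   using borel_measurable_integrable[OF gi'[of t]] by simp
  show ?thesis unfolding G_def
  proof (rule integral_cong_AE)
   show "(\<lambda>r. indicator {c..t} r * gg r) \<in> borel_measurable lborel" by (rule borel_measurable_integrable[OF gi'])
   show "AE r in lborel. indicator {c..t} r * gg r = indicator {c..t} r * g r"
    using AE_lborel_singleton[of c] AE_lborel_singleton[of d]
    by eventually_elim (use t in \<open>auto simp: gg_def split: split_indicator\<close>)
  qed measurable
 qed
 have "h s = h r" if sr: "c < s" "s < r" "r < d" for s r
 proof -
  define a b where "a = (c + s) / 2" and "b = (r + d) / 2"
  have ab: "c < a" "a < s" "r < b" "b < d" using sr by (auto simp: a_def b_def)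
  define \<xi> where "\<xi> x = max 0 (x - a) * max 0 (b - x)" for x
  have \<xi>c: "continuous_on S \<xi>" for S unfolding \<xi>_def by (intro continuous_intros)
  have hab: "continuous_on {a..b} h" by (rule continuous_on_subset[OF hc]) (use ab in auto)
  \<comment> \<open>With this \<open>m\<close> the function \<open>\<phi>\<close> below has mean zero, so its antiderivative is a test function.\<close>
  define m where "m = integral {a..b} (\<lambda>x. \<xi> x * h x) / integral {a..b} \<xi>"
  have "integral {a..b} \<xi> \<noteq> 0"
  proof
   assume "integral {a..b} \<xi> = 0"
   then have "\<xi> s = 0" using integral_eq_0_iff[OF \<xi>c, of a b] ab sr by (auto simp: \<xi>_def)
   then show False using ab sr by (simp add: \<xi>_def)
  qed
  then have mean: "integral {a..b} (\<lambda>x. \<xi> x * (h x - m)) = 0"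
   using integral_diff[of "\<lambda>x. \<xi> x * h x" "{a..b}" "\<lambda>x. \<xi> x * m"] \<xi>c hab
   by (simp add: right_diff_distrib m_def integrable_continuous_interval continuous_on_mult)
  define \<phi> where "\<phi> x = \<xi> x * (h (max a (min b x)) - m)" for x
  have \<phi>c: "continuous_on UNIV \<phi>"
   unfolding \<phi>_def by (intro continuous_intros \<xi>c continuous_on_compose2[OF hab]) (use ab sr in auto)
  have \<phi>0: "\<phi> x = 0" if "x \<notin> {a<..<b}" for x using that by (auto simp: \<phi>_def \<xi>_def)
  have \<phi>h: "\<phi> x = \<xi> x * (h x - m)" if "x \<in> {a..b}" for x using that by (simp add: \<phi>_def min_absorb2 max_absorb2)
  obtain F where F: "\<And>x. (F has_vector_derivative \<phi> x) (at x)"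
   using einterval_antiderivative[of "-\<infinity>" "\<infinity>" \<phi>] \<phi>c by (auto simp: continuous_on_eq_continuous_at)
  define \<eta> where "\<eta> x = F x - F a" for x
  have \<eta>d: "(\<eta> has_real_derivative \<phi> x) (at x)" for x using F[of x] unfolding \<eta>_def has_real_derivative_iff_has_vector_derivative
   by (auto intro!: derivative_eq_intros)
  have \<eta>b: "\<eta> b = 0"
  proof -
   have "(\<phi> has_integral F b - F a) {a..b}"
    by (rule fundamental_theorem_of_calculus) (use ab sr F in \<open>auto intro: has_vector_derivative_at_within\<close>)
   moreover have "integral {a..b} \<phi> = 0" unfolding mean[symmetric] by (rule integral_cong) (rule \<phi>h)
   ultimately show ?thesis by (simp add: \<eta>_def has_integral_iff)
  qed
  have flat: "\<eta> x = \<eta> z" if xz: "x \<le> z" "z \<le> a \<or> b \<le> x" for x z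
  proof (cases "x = z")
   case False
   have "(\<eta> has_real_derivative 0) (at w)" if "x < w" "w < z" for w using \<eta>d[of w] \<phi>0[of w] that xz by auto
   then have "\<eta> z = \<eta> x"
    using xz False \<eta>d by (intro DERIV_isconst2[of x z]) (auto intro!: DERIV_continuous_on intro: has_field_derivative_at_within)
   then show ?thesis by simp
  qed simp
  have \<eta>0: "\<eta> x = 0" if "x \<notin> {a..b}" for x using flat[of x a] flat[of b x] that \<eta>b by (cases "x < a") (auto simp: \<eta>_def)
  have C1: "\<eta> C1_differentiable_on UNIV" by (rule C1_differentiableI[OF \<eta>d \<phi>c])
  have \<eta>': "deriv \<eta> x = \<phi> x" for x by (rule DERIV_imp_deriv[OF \<eta>d])
  have "\<eta> \<in> test_functions {c<..<d}" unfolding test_functions_def mem_Collect_eq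
   by (intro conjI C1 exI[of _ "{a..b}"] allI impI \<eta>0) (use ab in auto)
  then have 1: "(\<integral>x. indicator {c<..<d} x * (\<phi> x * y x) \<partial>lborel) = - (\<integral>x. indicator {c<..<d} x * (\<eta> x * g x) \<partial>lborel)"
   using weak[of \<eta>] by (simp add: \<eta>')
  have 2: "(\<integral>x. indicator {c..d} x * (\<phi> x * G x) \<partial>lborel) = - (\<integral>x. indicator {c..d} x * (\<eta> x * gg x) \<partial>lborel)"
   using integral_by_parts_absolutely_continuous[OF C1 \<eta>0[of c] \<eta>0[of d] _ gi', where z = G and ?z0.0 = 0] ab sr by (simp add: G_def \<eta>')
  have e1: "indicator {c<..<d} x * (\<phi> x * y x) = indicator {a..b} x * (\<phi> x * y x)" "indicator {c..d} x * (\<phi> x * G x) = indicator {a..b} x * (\<phi> x * G x)"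
   "indicator {c..d} x * (\<eta> x * gg x) = indicator {c<..<d} x * (\<eta> x * g x)" for x
   using ab \<phi>0[of x] by (auto simp: gg_def split: split_indicator)
  have c: "continuous_on {a..b} (\<lambda>x. \<phi> x * y x)" "continuous_on {a..b} (\<lambda>x. \<phi> x * h x)"
   using ab sr by (auto intro!: continuous_on_mult continuous_on_subset[OF \<phi>c] hab continuous_on_subset[OF y])
  have "integral {a..b} (\<lambda>x. \<phi> x * h x) = 0"
  proof -
   have "(\<integral>x. indicator {a..b} x * (\<phi> x * G x) \<partial>lborel) = (\<integral>x. indicator {a..b} x * (\<phi> x * y x) - indicator {a..b} x * (\<phi> x * h x) \<partial>lborel)"
    by (simp add: h_def algebra_simps)
   also have "\<dots> = (\<integral>x. indicator {a..b} x * (\<phi> x * y x) \<partial>lborel) - (\<integral>x. indicator {a..b} x * (\<phi> x * h x) \<partial>lborel)"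
    by (intro Bochner_Integration.integral_diff integral_continuous_Icc(1) c)
   finally show ?thesis using 1 2 unfolding e1 integral_continuous_Icc(2)[OF c(2)] by simp
  qed
  moreover have "integral {a..b} (\<lambda>x. \<xi> x * (h x - m)\<^sup>2) = integral {a..b} (\<lambda>x. \<phi> x * h x) - m * integral {a..b} (\<lambda>x. \<xi> x * (h x - m))"
  proof -
   have "integral {a..b} (\<lambda>x. \<xi> x * (h x - m)\<^sup>2) = integral {a..b} (\<lambda>x. \<phi> x * h x - m * (\<xi> x * (h x - m)))"
    by (rule integral_cong) (simp add: \<phi>h power2_eq_square algebra_simps)
   also have "\<dots> = integral {a..b} (\<lambda>x. \<phi> x * h x) - integral {a..b} (\<lambda>x. m * (\<xi> x * (h x - m)))"
    by (intro integral_diff integrable_continuous_interval c continuous_intros \<xi>c hab)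
   finally show ?thesis by simp
  qed
  ultimately have "integral {a..b} (\<lambda>x. \<xi> x * (h x - m)\<^sup>2) = 0" using mean by simp
  moreover have "continuous_on {a..b} (\<lambda>x. \<xi> x * (h x - m)\<^sup>2)" by (intro continuous_intros \<xi>c hab)
  ultimately have z: "\<xi> x * (h x - m)\<^sup>2 = 0" if "x \<in> {a..b}" for x
   using integral_eq_0_iff[of a b "\<lambda>x. \<xi> x * (h x - m)\<^sup>2"] ab sr that by (auto simp: \<xi>_def)
  then show ?thesis using z[of s] z[of r] ab sr by (auto simp: \<xi>_def)
 qed
 note interior = this
 have "h t = h c"
 proof (cases "c < d")
  case True
  then obtain q where q: "c < q" "q < d" using dense by blast
  have const: "h s = h q" if "s \<in> {c<..<d}" for s
   using interior[of s q] interior[of q s, symmetric] that q by (cases s q rule: linorder_cases) auto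
  have cl: "closure {c<..<d} = {c..d}" using True by simp
  have "h s = h q" if "s \<in> {c..d}" for s by (rule continuous_constant_on_closure[of "{c<..<d}", unfolded cl, OF hc const that])
  from this[OF t] this[of c] True show ?thesis by simp
 next
  case False
  then have "t = c" using t by simp
  then show ?thesis by simp
 qed
 moreover have "G c = 0"
  unfolding G_def by (rule integral_eq_zero_AE) (use AE_lborel_singleton[of c] in \<open>eventually_elim, auto split: split_indicator\<close>)
 ultimately show ?thesis unfolding Gt[symmetric] by (simp add: h_def)
qed

section \<open>Weak solutions and the variation of constants formula\<close>

context torus
begin

text \<open>
 The variation of constants formula in each mode, multiplied by the integrating factor. The forcing \<open>G\<close> is a separate argument
 because it is built from Borel representatives, whereas the formula holds for \<open>u\<close> at every time.
\<close>

definition mild :: "real \<Rightarrow> (real \<Rightarrow> field) \<Rightarrow> (real \<Rightarrow> field) \<Rightarrow> real \<Rightarrow> real \<Rightarrow> bool" where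
 "mild \<nu> G u c d \<longleftrightarrow> (\<forall>k. \<forall>t\<in>{c..d}. exp (\<nu> * lam k * t) *\<^sub>R u t k - exp (\<nu> * lam k * c) *\<^sub>R u c k
   = (\<integral>s. indicator {c..t} s *\<^sub>R (exp (\<nu> * lam k * s) *\<^sub>R G s k) \<partial>lborel))"

definition forcing :: "field \<Rightarrow> (real \<Rightarrow> field) \<Rightarrow> (real \<Rightarrow> field) \<Rightarrow> real \<Rightarrow> field" where
 "forcing f a u s = (\<lambda>k. f k - PB (a s) (u s) k)"

lemma ennreal_sq_le_imp:
 assumes x: "0 \<le> x" and c: "0 < c" and C: "0 \<le> C" and le: "ennreal (c * x\<^sup>2) \<le> ennreal C * (A * B)"
 shows "ennreal x \<le> ennreal (sqrt (C / c)) * (A + B)"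
proof (cases "C = 0")
 case True
 then have "c * x\<^sup>2 \<le> 0" using le by (simp add: ennreal_eq_0_iff)
 then have "x = 0" using c by (simp add: mult_le_0_iff)
 then show ?thesis by simp
next
 case False
 then have Cp: "0 < C" using C by simp
 show ?thesis
 proof (cases "A = top \<or> B = top")
  case True
  then have "ennreal (sqrt (C / c)) * (A + B) = top" using Cp c by (auto simp: ennreal_mult_top)
  then show ?thesis by simp
 next
  case False
  then obtain a b where ab: "A = ennreal a" "B = ennreal b" "0 \<le> a" "0 \<le> b" by (cases A; cases B) auto
  have "c * x\<^sup>2 \<le> C * (a * b)" using le ab C by (simp add: ennreal_mult[symmetric])
  also have "\<dots> \<le> C * (a + b)\<^sup>2" using ab C by (intro mult_left_mono) (auto simp: power2_sum)
  finally have le2: "c * x\<^sup>2 \<le> C * (a + b)\<^sup>2" .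
  define q where "q = sqrt (C / c)"
  have q: "0 \<le> q" "C = c * q\<^sup>2" using C c by (auto simp: q_def)
  have "c * x\<^sup>2 \<le> c * (q * (a + b))\<^sup>2" using le2 unfolding q(2) by (simp only: power_mult_distrib mult.assoc)
  then have "x\<^sup>2 \<le> (q * (a + b))\<^sup>2" using c by (simp only: mult_le_cancel_left_pos)
  then have "x \<le> q * (a + b)" by (rule power2_le_imp_le) (use ab q in simp)
  then have "ennreal x \<le> ennreal (q * (a + b))" by (rule ennreal_leI)
  also have "\<dots> = ennreal q * (A + B)" using ab q by (simp add: ennreal_mult)
  finally show ?thesis by (simp add: q_def)
 qed
qed

lemma norm_PB_sum_le:
 assumes "a 0 = 0" "u 0 = 0" "k \<noteq> 0"
 shows "ennreal (norm (PB a u k)) \<le> ennreal (sqrt (K / lam k powr (\<alpha> - 1))) * (E \<beta> a + E \<alpha> u)"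
proof (rule ennreal_sq_le_imp)
 show "ennreal (lam k powr (\<alpha> - 1) * (norm (PB a u k))\<^sup>2) \<le> ennreal K * (E \<beta> a * E \<alpha> u)"
  using order_trans[OF E_coeff[of k "\<alpha> - 1" "PB a u"] E_PB_le[of a u]] assms by simp
 show "0 < lam k powr (\<alpha> - 1)" using lam_pos[OF assms(3)] assms(3) by simp
qed (use K_pos in auto)

lemma borel_PB:
 assumes "borel_field a" "borel_field u"
 shows "borel_field (\<lambda>t. PB (a t) (u t))"
 using assms unfolding borel_field_def by (auto intro: measurable_PB)

lemma Eint_embedding:
 assumes "s \<le> s'" "borel_field u" "I \<in> sets borel"
 shows "Eint s I u \<le> ennreal (lam1 powr (s - s')) * Eint s' I u"
proof -
 note [measurable] = borel_field_E[OF assms(2)] assms(3)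
 have "Eint s I u \<le> (\<integral>\<^sup>+t. ennreal (lam1 powr (s - s')) * (E s' (u t) * indicator I t) \<partial>lborel)"
  unfolding Eint_def using E_embedding[OF assms(1)] by (intro nn_integral_mono) (auto split: split_indicator)
 also have "\<dots> = ennreal (lam1 powr (s - s')) * Eint s' I u" unfolding Eint_def by (rule nn_integral_cmult) measurable
 finally show ?thesis .
qed

lemma Eint_embedding_finite:
 "s \<le> s' \<Longrightarrow> borel_field u \<Longrightarrow> I \<in> sets borel \<Longrightarrow> Eint s' I u < top \<Longrightarrow> Eint s I u < top"
 by (rule le_less_trans[OF Eint_embedding]) (auto simp: ennreal_mult_less_top)

lemma integrable_PB:
 assumes a: "borel_field a" "\<And>t. a t 0 = 0" "Eint \<beta> I a < top"
  and u: "borel_field u" "\<And>t. u t 0 = 0" "Eint \<alpha> I u < top" and I [measurable]: "I \<in> sets borel"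
 shows "integrable lborel (\<lambda>t. indicator I t *\<^sub>R PB (a t) (u t) k)"
proof (cases "k = 0")
 case False
 note [measurable] = borel_field_E[OF a(1)] borel_field_E[OF u(1)]
 have [measurable]: "(\<lambda>t. PB (a t) (u t) k) \<in> borel_measurable borel" using borel_PB[OF a(1) u(1)] by (simp add: borel_field_def)
 let ?C = "ennreal (sqrt (K / lam k powr (\<alpha> - 1)))"
 have "(\<integral>\<^sup>+t. ennreal (norm (indicator I t *\<^sub>R PB (a t) (u t) k)) \<partial>lborel)
   \<le> (\<integral>\<^sup>+t. ?C * (E \<beta> (a t) * indicator I t + E \<alpha> (u t) * indicator I t) \<partial>lborel)"
 proof (rule nn_integral_mono)
  fix t
  have "ennreal (norm (PB (a t) (u t) k)) \<le> ?C * (E \<beta> (a t) + E \<alpha> (u t))" by (rule norm_PB_sum_le) (use a u False in auto)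
  then show "ennreal (norm (indicator I t *\<^sub>R PB (a t) (u t) k)) \<le> ?C * (E \<beta> (a t) * indicator I t + E \<alpha> (u t) * indicator I t)"
   by (auto split: split_indicator)
 qed
 also have "\<dots> = ?C * (Eint \<beta> I a + Eint \<alpha> I u)"
  unfolding Eint_def by (subst nn_integral_cmult, measurable, subst nn_integral_add) auto
 also have "\<dots> < \<infinity>" using a u by (auto simp: ennreal_mult_less_top)
 finally show ?thesis by (auto simp: integrable_iff_bounded)
qed simp

lemma integrable_bounded_mult:
 fixes g :: "real \<Rightarrow> 'b :: {banach, second_countable_topology}" and \<phi> :: "real \<Rightarrow> real"
 assumes g: "integrable lborel (\<lambda>t. indicator I t *\<^sub>R g t)" and phi: "continuous_on UNIV \<phi>"
  and I: "I \<subseteq> {c..d}"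
 shows "integrable lborel (\<lambda>t. indicator I t *\<^sub>R (\<phi> t *\<^sub>R g t))"
proof -
 obtain M where M: "\<forall>t\<in>{c..d}. \<bar>\<phi> t\<bar> \<le> M"
  using compact_imp_bounded[OF compact_continuous_image[OF continuous_on_subset[OF phi] compact_Icc[of c d]]]
  by (auto simp: bounded_iff)
 have [measurable]: "(\<lambda>t. indicator I t *\<^sub>R g t) \<in> borel_measurable borel" using borel_measurable_integrable[OF g] by simp
 have [measurable]: "\<phi> \<in> borel_measurable borel" by (rule borel_measurable_continuous_onI[OF phi])
 have eq: "(\<lambda>t. indicator I t *\<^sub>R (\<phi> t *\<^sub>R g t)) = (\<lambda>t. \<phi> t *\<^sub>R (indicator I t *\<^sub>R g t))" by (auto simp: fun_eq_iff)
 show ?thesis unfolding eq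
 proof (rule Bochner_Integration.integrable_bound[OF integrable_scaleR_right[OF g, of M]])
  show "AE t in lborel. norm (\<phi> t *\<^sub>R (indicator I t *\<^sub>R g t)) \<le> norm (M *\<^sub>R (indicator I t *\<^sub>R g t))"
  proof (intro AE_I2)
   fix t
   show "norm (\<phi> t *\<^sub>R (indicator I t *\<^sub>R g t)) \<le> norm (M *\<^sub>R (indicator I t *\<^sub>R g t))"
   proof (cases "t \<in> I")
    case True
    then have "\<bar>\<phi> t\<bar> \<le> \<bar>M\<bar>" using M I by fastforce
    then show ?thesis using True by (simp add: mult_right_mono)
   qed simp
  qed
 qed (rule borel_measurable_scaleR, simp_all)
qed

lemma Eint_integrable:
 assumes u: "borel_field u" "\<And>t. u t 0 = 0" and fin: "Eint s I u < top" and I [measurable]: "I \<in> sets borel" "I \<subseteq> {c..d}"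
 shows "integrable lborel (\<lambda>t. indicator I t *\<^sub>R u t k)"
proof (cases "k = 0")
 case False
 have [measurable]: "(\<lambda>t. u t k) \<in> borel_measurable borel" using u(1) by (simp add: borel_field_def)
 note [measurable] = borel_field_E[OF u(1), of s]
 have lp: "0 < lam k powr s" using lam_pos[OF False] False by simp
 have "(\<integral>\<^sup>+t. ennreal (norm (indicator I t *\<^sub>R u t k)) \<partial>lborel)
   \<le> (\<integral>\<^sup>+t. indicator {c..d} t + ennreal (inverse (lam k powr s)) * (E s (u t) * indicator I t) \<partial>lborel)"
 proof (rule nn_integral_mono)
  fix t
  have "norm (u t k) \<le> 1 + (norm (u t k))\<^sup>2"
   using sum_squares_bound[of "norm (u t k)" 1] zero_le_power2[of "norm (u t k)"] by (simp; linarith)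
  also have "\<dots> = 1 + inverse (lam k powr s) * (lam k powr s * (norm (u t k))\<^sup>2)" using lp by simp
  finally have "ennreal (norm (u t k)) \<le> ennreal (1 + inverse (lam k powr s) * (lam k powr s * (norm (u t k))\<^sup>2))"
   by (rule ennreal_leI)
  also have "\<dots> = 1 + ennreal (inverse (lam k powr s)) * ennreal (lam k powr s * (norm (u t k))\<^sup>2)"
   using lp by (subst ennreal_plus) (auto simp: ennreal_mult)
  also have "\<dots> \<le> 1 + ennreal (inverse (lam k powr s)) * E s (u t)" by (intro add_mono mult_left_mono E_coeff) auto
  finally show "ennreal (norm (indicator I t *\<^sub>R u t k)) \<le> indicator {c..d} t + ennreal (inverse (lam k powr s)) * (E s (u t) * indicator I t)"
   using I(2) by (auto split: split_indicator)
 qed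
 also have "\<dots> = emeasure lborel {c..d} + ennreal (inverse (lam k powr s)) * Eint s I u"
  unfolding Eint_def by (subst nn_integral_add) (auto simp: nn_integral_cmult)
 also have "\<dots> < \<infinity>" using fin by (simp add: ennreal_mult_less_top emeasure_lborel_Icc_eq)
 finally show ?thesis by (auto simp: integrable_iff_bounded)
qed (simp add: u(2))

lemma integrable_forcing:
 assumes a: "borel_field a" "\<And>t. a t 0 = 0" "Eint \<beta> I a < top"
  and u: "borel_field u" "\<And>t. u t 0 = 0" "Eint \<alpha> I u < top" and I [measurable]: "I \<in> sets borel" "I \<subseteq> {c..d}"
 shows "integrable lborel (\<lambda>t. indicator I t *\<^sub>R forcing f a u t k)"
proof -
 have "integrable lborel (\<lambda>t. indicator I t *\<^sub>R f k)"
 proof (rule Bochner_Integration.integrable_bound)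
  show "integrable lborel (\<lambda>t. indicator {c..d} t *\<^sub>R f k)" by (intro borel_integrable_compact) auto
  show "AE t in lborel. norm (indicator I t *\<^sub>R f k) \<le> norm (indicator {c..d} t *\<^sub>R f k)"
   using I by (intro AE_I2) (auto split: split_indicator)
 qed simp
 from Bochner_Integration.integrable_diff[OF this integrable_PB[OF a u I(1), of k]]
 show ?thesis by (simp add: forcing_def scaleR_diff_right)
qed

lemma bounded_linear_kdot: "bounded_linear (kdot k)"
 by (rule bounded_linear_intro[where K = "sqrt (lam k)"])
   (simp_all add: kdot_add kdot_scaleR, subst mult.commute, rule norm_kdot_le)

subsection \<open>Testing with a single Fourier mode\<close>

definition mode :: "int ^ 3 \<Rightarrow> complex ^ 3 \<Rightarrow> field" where
 "mode k e j = (if j = k then e else if j = - k then (\<chi> i. cnj (e $ i)) else 0)"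

lemma mode_trig:
 assumes "k \<noteq> 0" "kdot k e = 0"
 shows "mode k e \<in> trig_fields L"
 unfolding trig_fields_iff
proof
 have kk: "k \<noteq> - k" using assms(1) by (simp add: vec_eq_iff)
 have e: "(\<Sum>i\<in>UNIV. of_int (k $ i) * e $ i) = 0" using assms(2) by (simp add: kdot_eq_0_iff)
 then have "cnj (\<Sum>i\<in>UNIV. of_int (k $ i) * e $ i) = 0" by simp
 then have e': "(\<Sum>i\<in>UNIV. of_int (k $ i) * cnj (e $ i)) = 0" by simp
 show "solenoidal (mode k e)" unfolding solenoidal_def
 proof (intro conjI allI)
  show "mode k e 0 = 0" using assms(1) by (auto simp: mode_def)
  show "(\<Sum>i\<in>UNIV. of_int (j $ i) * mode k e j $ i) = 0" for j using e e' by (auto simp: mode_def sum_negf)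
  show "mode k e (- j) $ i = cnj (mode k e j $ i)" for j i using kk by (auto simp: mode_def)
 qed
 show "finite {j. mode k e j \<noteq> 0}" by (rule finite_subset[of _ "{k, - k}"]) (auto simp: mode_def)
qed

lemma sum_mode:
 assumes "k \<noteq> 0" "solenoidal g"
 shows "(\<Sum>j\<in>{k, - k}. g j \<bullet> mode k e j) = 2 * (g k \<bullet> e)"
proof -
 have kk: "k \<noteq> - k" using assms(1) by (simp add: vec_eq_iff)
 have "g (- k) \<bullet> (\<chi> i. cnj (e $ i)) = g k \<bullet> e" using assms(2) by (simp add: inner_vec_def solenoidal_def inner_complex_def)
 then show ?thesis using kk by (simp add: mode_def)
qed

lemma pairing_mode:
 assumes "k \<noteq> 0" "solenoidal g"
 shows "pairing L g (mode k e) = 2 * L ^ 3 * (g k \<bullet> e)"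
proof -
 have "(\<Sum>\<^sub>\<infinity>j. g j \<bullet> mode k e j) = (\<Sum>\<^sub>\<infinity>j\<in>{k, - k}. g j \<bullet> mode k e j)" by (rule infsum_cong_neutral) (auto simp: mode_def)
 then show ?thesis using sum_mode[OF assms, of e] by (simp add: pairing_def)
qed

lemma bt_mode:
 assumes "k \<noteq> 0" "solenoidal u" "solenoidal v"
 shows "bt u v (mode k e) = 2 * L ^ 3 * (PB u v k \<bullet> e)"
proof -
 let ?g = "\<lambda>j. PB u v j \<bullet> mode k e j"
 have sub: "{j. ?g j \<noteq> 0} \<subseteq> {k, - k}" by (auto simp: mode_def)
 have "(\<integral>j. ?g j \<partial>count_space UNIV) = (\<Sum>j | ?g j \<noteq> 0. ?g j)"
  using finite_subset[OF sub] by (subst lebesgue_integral_count_space_finite_support) auto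
 also have "\<dots> = (\<Sum>j\<in>{k, - k}. ?g j)" using sub by (intro sum.mono_neutral_left) auto
 also have "\<dots> = 2 * (PB u v k \<bullet> e)" by (rule sum_mode[OF assms(1) solenoidal_PB[OF assms(2,3)]])
 finally show ?thesis by (simp add: bt_def)
qed

lemma solenoidal_stokes: "solenoidal u \<Longrightarrow> solenoidal (stokes L u)"
 unfolding stokes_def by (rule solenoidal_scaleR) (simp_all add: lam_minus flip: lam_def)

lemma stokes_eq: "stokes L u k = lam k *\<^sub>R u k"
 by (simp add: stokes_def lam_def)

text \<open>
 Testing the weak equation with a real field supported on the frequencies \<open>k\<close> and \<open>- k\<close> gives a scalar weak
 equation for each component of the coefficient \<open>u\<^sub>k\<close>, to which the lemma of du Bois-Reymond applies after
 multiplication with the integrating factor.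
\<close>

lemma weak_imp_mild:
 assumes J: "J \<in> sets borel" "{c<..<d} \<subseteq> J" and cd: "c < d"
  and weak: "weak_equation L \<alpha> \<nu> f J a u" and f: "f \<in> V L \<alpha>"
  and aB: "borel_field aB" "\<And>t. aB t \<in> V L \<beta>" "AE t in lborel. t \<in> {c<..<d} \<longrightarrow> a t = aB t" "Eint \<beta> {c<..<d} aB < top"
  and uB: "borel_field uB" "\<And>t. uB t \<in> V L \<beta>" "AE t in lborel. t \<in> {c<..<d} \<longrightarrow> u t = uB t" "Eint \<beta> {c<..<d} uB < top"
  and cont: "\<And>k. continuous_on {c..d} (\<lambda>t. u t k)" and sol: "\<And>t. t \<in> {c..d} \<Longrightarrow> solenoidal (u t)"
 shows "mild \<nu> (forcing f aB uB) u c d"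
 unfolding mild_def
proof (intro allI ballI)
 fix k t assume t: "t \<in> {c..d}"
 define e0 where "e0 = (\<lambda>s. exp (\<nu> * lam k * s))"
 have e0c: "continuous_on S e0" for S unfolding e0_def by (intro continuous_intros)
 have [measurable]: "e0 \<in> borel_measurable borel" by (rule borel_measurable_continuous_onI[OF e0c])
 have e0d: "(e0 has_real_derivative \<nu> * lam k * e0 s) (at s)" for s unfolding e0_def by (auto intro!: derivative_eq_intros)
 define G where "G = forcing f aB uB"
 have aB0: "aB s 0 = 0" and uB0: "uB s 0 = 0" for s using aB(2)[of s] uB(2)[of s] by (auto simp: V_iff solenoidal_at_0)
 have uBa: "Eint \<alpha> {c<..<d} uB < top" using uB by (intro Eint_embedding_finite[of \<alpha> \<beta>]) auto
 have PBint: "integrable lborel (\<lambda>s. indicator {c<..<d} s *\<^sub>R PB (aB s) (uB s) k)"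
  by (rule integrable_PB[OF aB(1) aB0 aB(4) uB(1) uB0 uBa]) simp
 have Gint: "integrable lborel (\<lambda>s. indicator {c<..<d} s *\<^sub>R G s k)" unfolding G_def
  by (rule integrable_forcing[OF aB(1) aB0 aB(4) uB(1) uB0 uBa, where c = c and d = d]) auto
 have eGint: "integrable lborel (\<lambda>s. indicator {c<..<d} s *\<^sub>R (e0 s *\<^sub>R G s k))"
  by (rule integrable_bounded_mult[OF Gint e0c, where c = c and d = d]) auto
 have eGt: "integrable lborel (\<lambda>s. indicator {c..t} s *\<^sub>R (e0 s *\<^sub>R G s k))"
 proof -
  have "(\<lambda>s. PB (aB s) (uB s) k) \<in> borel_measurable borel" using borel_PB[OF aB(1) uB(1)] by (simp add: borel_field_def)
  then have [measurable]: "(\<lambda>s. G s k) \<in> borel_measurable borel"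
   unfolding G_def forcing_def by (intro borel_measurable_diff borel_measurable_const)
  have int: "integrable lborel (\<lambda>s. indicator {c..t} s *\<^sub>R (indicator {c<..<d} s *\<^sub>R (e0 s *\<^sub>R G s k)))"
   using integrable_mult_indicator[OF _ eGint, of "{c..t}"] by simp
  have "AE s in lborel. s \<noteq> c \<and> s \<noteq> d" using AE_lborel_singleton[of c] AE_lborel_singleton[of d] by eventually_elim simp
  then have ae: "AE s in lborel. indicator {c..t} s *\<^sub>R (indicator {c<..<d} s *\<^sub>R (e0 s *\<^sub>R G s k)) = indicator {c..t} s *\<^sub>R (e0 s *\<^sub>R G s k)"
   by eventually_elim (use t in \<open>auto split: split_indicator\<close>)
  show ?thesis by (rule integrable_cong_AE_imp[OF int _ ae]) measurable
 qed
 define X where "X = e0 t *\<^sub>R u t k - e0 c *\<^sub>R u c k - (\<integral>s. indicator {c..t} s *\<^sub>R (e0 s *\<^sub>R G s k) \<partial>lborel)"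
 have "X = 0"
 proof (cases "k = 0")
  case True
  then show ?thesis using f sol t cd by (simp add: X_def G_def forcing_def V_iff solenoidal_at_0)
 next
  case False
  have main: "X \<bullet> e = 0" if e: "kdot k e = 0" for e
  proof -
   define y where "y = (\<lambda>s. e0 s * (u s k \<bullet> e))"
   define g where "g = (\<lambda>s. e0 s * (G s k \<bullet> e))"
   have yc: "continuous_on {c..d} y" unfolding y_def by (intro continuous_intros e0c cont)
   have gint: "integrable lborel (\<lambda>s. indicator {c<..<d} s * g s)"
    using integrable_inner_left[OF eGint, of e] by (auto simp: g_def mult_ac)
   have "y t - y c = (\<integral>r. indicator {c..t} r * g r \<partial>lborel)"
   proof (rule du_bois_reymond[OF yc gint _ t])
    fix \<zeta> assume \<zeta>: "\<zeta> \<in> test_functions {c<..<d}"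
    then obtain Kc where Kc: "compact Kc" "Kc \<subseteq> {c<..<d}" "\<And>t. t \<notin> Kc \<Longrightarrow> \<zeta> t = 0" and C1: "\<zeta> C1_differentiable_on UNIV"
     by (auto simp: test_functions_def)
    note D = C1_has_deriv[OF C1]
    have \<zeta>c: "continuous_on UNIV \<zeta>" using D(1) by (intro continuous_at_imp_continuous_on) (blast intro: DERIV_isCont)
    have [measurable]: "deriv \<zeta> \<in> borel_measurable borel" "\<zeta> \<in> borel_measurable borel"
     by (rule borel_measurable_continuous_onI, rule D(2), rule borel_measurable_continuous_onI, rule \<zeta>c)
    define \<eta> where "\<eta> = (\<lambda>s. e0 s * \<zeta> s)"
    have \<eta>d: "(\<eta> has_real_derivative \<nu> * lam k * e0 s * \<zeta> s + e0 s * deriv \<zeta> s) (at s)" for s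
     unfolding \<eta>_def using DERIV_mult[OF e0d D(1), of s] by (simp add: mult_ac add_ac)
    have \<eta>': "deriv \<eta> s = \<nu> * lam k * e0 s * \<zeta> s + e0 s * deriv \<zeta> s" for s by (rule DERIV_imp_deriv[OF \<eta>d])
    have \<eta>test: "\<eta> \<in> test_functions J" unfolding test_functions_def mem_Collect_eq
    proof (intro conjI exI[of _ Kc])
     show "\<eta> C1_differentiable_on UNIV" by (rule C1_differentiableI[OF \<eta>d]) (intro continuous_intros e0c \<zeta>c D(2))
    qed (use Kc J in \<open>auto simp: \<eta>_def\<close>)
    have out: "\<zeta> s = 0" "deriv \<zeta> s = 0" if "s \<notin> {c<..<d}" for s
    proof -
     have "s \<notin> Kc" using that Kc(2) by auto
     then show "\<zeta> s = 0" "deriv \<zeta> s = 0" by (rule Kc(3), intro deriv_test_function_0[OF Kc(1) Kc(3)])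
    qed
    have cut: "{c..d} \<in> sets borel" by simp
    have mu: "(\<lambda>s. indicator {c..d} s *\<^sub>R u s k) \<in> borel_measurable borel"
     by (intro borel_measurable_continuous_on_indicator cont) simp
    have [measurable]: "(\<lambda>s. PB (aB s) (uB s) k) \<in> borel_measurable borel"
     using borel_PB[OF aB(1) uB(1)] by (simp add: borel_field_def)
    have mode: "mode k e \<in> V L \<beta>" by (rule trig_in_V[OF mode_trig[OF False e]])
    define A where "A = (\<lambda>s. deriv \<zeta> s * (e0 s * ((indicator {c..d} s *\<^sub>R u s k) \<bullet> e)))"
    define P where "P = (\<lambda>s. \<zeta> s * (e0 s * (PB (aB s) (uB s) k \<bullet> e)))"
    define F where "F = (\<lambda>s. \<zeta> s * (e0 s * (f k \<bullet> e)))"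
    have [measurable]: "A \<in> borel_measurable borel"
     unfolding A_def by (intro borel_measurable_times borel_measurable_inner mu borel_measurable_const) simp_all
    have [measurable]: "P \<in> borel_measurable borel" "F \<in> borel_measurable borel" unfolding P_def F_def by simp_all
    have lhs: "(LINT s|lebesgue_on J. - deriv \<eta> s * pairing L (u s) (mode k e)
       + \<eta> s * (\<nu> * pairing L (stokes L (u s)) (mode k e) + b_form L \<beta> (a s) (u s) (mode k e)))
      = (\<integral>s. indicator J s *\<^sub>R (2 * L ^ 3 * (P s - A s)) \<partial>lborel)"
    proof (rule lebesgue_on_AE_eq(2)[OF J(1)])
     show "AE s in lborel. s \<in> J \<longrightarrow> - deriv \<eta> s * pairing L (u s) (mode k e)
       + \<eta> s * (\<nu> * pairing L (stokes L (u s)) (mode k e) + b_form L \<beta> (a s) (u s) (mode k e)) = 2 * L ^ 3 * (P s - A s)"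
      using aB(3) uB(3)
     proof eventually_elim
      case (elim s)
      show ?case
      proof (cases "s \<in> {c<..<d}")
       case True
       have su: "solenoidal (u s)" using True by (intro sol) auto
       have uV: "u s = uB s" "a s = aB s" using elim True by auto
       have sb: "solenoidal (aB s)" using aB(2)[of s] by (simp add: V_iff)
       have bf: "b_form L \<beta> (a s) (u s) (mode k e) = 2 * L ^ 3 * (PB (aB s) (uB s) k \<bullet> e)"
        unfolding uV by (subst b_form_eq[OF aB(2) uB(2) mode]) (rule bt_mode[OF False sb], use su uV in simp)
       have p1: "pairing L (u s) (mode k e) = 2 * L ^ 3 * (u s k \<bullet> e)" by (rule pairing_mode[OF False su])
       have p2: "pairing L (stokes L (u s)) (mode k e) = 2 * L ^ 3 * (lam k * (u s k \<bullet> e))"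
        by (subst pairing_mode[OF False solenoidal_stokes[OF su]]) (simp add: stokes_eq)
       show ?thesis unfolding bf p1 p2 \<eta>' using True by (simp add: \<eta>_def A_def P_def algebra_simps)
      next
       case False
       have "deriv \<eta> s = 0" "\<eta> s = 0" using out[OF False] by (simp add: \<eta>', simp add: \<eta>_def)
       then show ?thesis using out[OF False] by (simp add: A_def P_def)
      qed
     qed
    qed measurable
    have rhs: "(LINT s|lebesgue_on J. \<eta> s * pairing L f (mode k e)) = (\<integral>s. indicator J s *\<^sub>R (2 * L ^ 3 * F s) \<partial>lborel)"
     using f False by (intro lebesgue_on_AE_eq(2)[OF J(1)]) (auto simp: pairing_mode V_iff \<eta>_def F_def)
    have eq: "(\<integral>s. indicator J s *\<^sub>R (2 * L ^ 3 * (P s - A s)) \<partial>lborel) = (\<integral>s. indicator J s *\<^sub>R (2 * L ^ 3 * F s) \<partial>lborel)"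
     using weak[unfolded weak_equation_def, rule_format, OF mode \<eta>test] unfolding lhs rhs .
    have J0: "indicator J s *\<^sub>R (2 * L ^ 3 * (P s - A s)) = 2 * L ^ 3 * (P s - A s)" "indicator J s *\<^sub>R (2 * L ^ 3 * F s) = 2 * L ^ 3 * F s" for s
    proof -
     have "P s = 0 \<and> A s = 0 \<and> F s = 0" if "s \<notin> J"
     proof -
      have "s \<notin> {c<..<d}" using that J(2) by blast
      from out[OF this] show ?thesis by (simp add: P_def A_def F_def)
     qed
     then show "indicator J s *\<^sub>R (2 * L ^ 3 * (P s - A s)) = 2 * L ^ 3 * (P s - A s)" "indicator J s *\<^sub>R (2 * L ^ 3 * F s) = 2 * L ^ 3 * F s"
      by (cases "s \<in> J"; simp)+
    qed
    have "(2 * L ^ 3) * (\<integral>s. P s - A s \<partial>lborel) = (2 * L ^ 3) * (\<integral>s. F s \<partial>lborel)" using eq unfolding J0 by simp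
    then have eq2: "(\<integral>s. P s - A s \<partial>lborel) = (\<integral>s. F s \<partial>lborel)" using L_pos by simp
    have Aint: "integrable lborel A"
    proof -
     have "integrable lborel (\<lambda>s. indicator {c..d} s *\<^sub>R (deriv \<zeta> s * (e0 s * (u s k \<bullet> e))))"
      by (intro borel_integrable_compact compact_Icc continuous_intros continuous_on_subset[OF D(2)] e0c cont) auto
     moreover have "A = (\<lambda>s. indicator {c..d} s *\<^sub>R (deriv \<zeta> s * (e0 s * (u s k \<bullet> e))))" by (auto simp: A_def fun_eq_iff)
     ultimately show ?thesis by simp
    qed
    have Pint: "integrable lborel P"
    proof -
     have "integrable lborel (\<lambda>s. indicator {c<..<d} s *\<^sub>R ((\<zeta> s * e0 s) *\<^sub>R PB (aB s) (uB s) k))"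
      by (rule integrable_bounded_mult[OF PBint, where c = c and d = d]) (auto intro!: continuous_intros e0c \<zeta>c)
     from integrable_inner_left[OF this, of e]
     have "integrable lborel (\<lambda>s. (indicator {c<..<d} s *\<^sub>R ((\<zeta> s * e0 s) *\<^sub>R PB (aB s) (uB s) k)) \<bullet> e)" by simp
     moreover have "P = (\<lambda>s. (indicator {c<..<d} s *\<^sub>R ((\<zeta> s * e0 s) *\<^sub>R PB (aB s) (uB s) k)) \<bullet> e)"
     proof
      fix s show "P s = (indicator {c<..<d} s *\<^sub>R ((\<zeta> s * e0 s) *\<^sub>R PB (aB s) (uB s) k)) \<bullet> e"
       using out[of s] by (cases "s \<in> {c<..<d}") (simp_all add: P_def)
     qed
     ultimately show ?thesis by simp
    qed
    have Fint: "integrable lborel F"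
    proof -
     have "integrable lborel (\<lambda>s. indicator {c..d} s *\<^sub>R F s)"
      unfolding F_def by (intro borel_integrable_compact compact_Icc continuous_intros e0c continuous_on_subset[OF \<zeta>c]) auto
     moreover have "(\<lambda>s. indicator {c..d} s *\<^sub>R F s) = F"
     proof
      fix s show "indicator {c..d} s *\<^sub>R F s = F s" using out[of s] by (cases "s \<in> {c..d}") (auto simp: F_def)
     qed
     ultimately show ?thesis by simp
    qed
    have "(\<integral>s. indicator {c<..<d} s * (deriv \<zeta> s * y s) \<partial>lborel) = (\<integral>s. A s \<partial>lborel)"
    proof (intro Bochner_Integration.integral_cong refl)
     fix s show "indicator {c<..<d} s * (deriv \<zeta> s * y s) = A s"
      using out[of s] by (cases "s \<in> {c<..<d}") (auto simp: A_def y_def)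
    qed
    also have "\<dots> = (\<integral>s. P s \<partial>lborel) - (\<integral>s. F s \<partial>lborel)" using eq2 Bochner_Integration.integral_diff[OF Pint Aint] by simp
    also have "\<dots> = - (\<integral>s. F s - P s \<partial>lborel)" using Bochner_Integration.integral_diff[OF Fint Pint] by simp
    also have "(\<integral>s. F s - P s \<partial>lborel) = (\<integral>s. indicator {c<..<d} s * (\<zeta> s * g s) \<partial>lborel)"
    proof (intro Bochner_Integration.integral_cong refl)
     fix s show "F s - P s = indicator {c<..<d} s * (\<zeta> s * g s)"
      using out[of s] by (cases "s \<in> {c<..<d}") (auto simp: F_def P_def g_def G_def forcing_def inner_diff_left algebra_simps)
    qed
    finally show "(\<integral>s. indicator {c<..<d} s * (deriv \<zeta> s * y s) \<partial>lborel) = - (\<integral>s. indicator {c<..<d} s * (\<zeta> s * g s) \<partial>lborel)" .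
   qed
   moreover have "(\<integral>r. indicator {c..t} r * g r \<partial>lborel) = (\<integral>s. indicator {c..t} s *\<^sub>R (e0 s *\<^sub>R G s k) \<partial>lborel) \<bullet> e"
    by (subst integral_inner_left[OF eGt, symmetric]) (simp add: g_def mult.assoc)
   ultimately show ?thesis by (simp add: X_def y_def inner_diff_left)
  qed
  have "kdot k (\<integral>s. indicator {c..t} s *\<^sub>R (e0 s *\<^sub>R G s k) \<partial>lborel) = 0"
  proof -
   have "kdot k (\<integral>s. indicator {c..t} s *\<^sub>R (e0 s *\<^sub>R G s k) \<partial>lborel)
     = (\<integral>s. kdot k (indicator {c..t} s *\<^sub>R (e0 s *\<^sub>R G s k)) \<partial>lborel)"
    by (rule integral_bounded_linear[OF bounded_linear_kdot eGt, symmetric])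
   also have "kdot k (G s k) = 0" for s using f aB(2)[of s] uB(2)[of s]
    by (simp add: G_def forcing_def kdot_diff kdot_solenoidal solenoidal_PB V_iff)
   then have "(\<integral>s. kdot k (indicator {c..t} s *\<^sub>R (e0 s *\<^sub>R G s k)) \<partial>lborel) = 0" by (simp add: kdot_scaleR)
   finally show ?thesis .
  qed
  then have "kdot k X = 0" using sol[OF t] sol[of c] cd by (simp add: X_def kdot_diff kdot_scaleR kdot_solenoidal)
  from main[OF this] show ?thesis by simp
 qed
 then show "exp (\<nu> * lam k * t) *\<^sub>R u t k - exp (\<nu> * lam k * c) *\<^sub>R u c k
   = (\<integral>s. indicator {c..t} s *\<^sub>R (exp (\<nu> * lam k * s) *\<^sub>R forcing f aB uB s k) \<partial>lborel)" by (simp add: X_def e0_def G_def)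
qed


lemma duality_sum_le:
 assumes "g 0 = 0 \<or> w 0 = 0"
 shows "(\<Sum>\<^sup>+k. ennreal (norm (g k) * norm (w k))) \<le> E (- s) g + E s w"
proof -
 have "norm (g k) * norm (w k) \<le> lam k powr (- s) * (norm (g k))\<^sup>2 + lam k powr s * (norm (w k))\<^sup>2" for k
 proof (cases "k = 0")
  case False
  define p where "p = lam k powr (- s / 2) * norm (g k)"
  define q where "q = lam k powr (s / 2) * norm (w k)"
  have "lam k powr (- s / 2) * lam k powr (s / 2) = 1" using lam_pos[OF False] False by (simp add: powr_add[symmetric])
  then have pq: "norm (g k) * norm (w k) = p * q" by (simp add: p_def q_def mult_ac)
  have "p\<^sup>2 = lam k powr (- s) * (norm (g k))\<^sup>2" "q\<^sup>2 = lam k powr s * (norm (w k))\<^sup>2"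
   by (simp_all add: p_def q_def power_mult_distrib power2_eq_square powr_add[symmetric])
  moreover have "p * q \<le> p\<^sup>2 + q\<^sup>2" using sum_squares_bound[of p q] zero_le_power2[of p] zero_le_power2[of q] by linarith
  ultimately show ?thesis using pq by simp
 qed (use assms in auto)
 then have "(\<Sum>\<^sup>+k. ennreal (norm (g k) * norm (w k)))
   \<le> (\<Sum>\<^sup>+k. ennreal (lam k powr (- s) * (norm (g k))\<^sup>2) + ennreal (lam k powr s * (norm (w k))\<^sup>2))"
  by (intro nn_integral_mono) (simp add: ennreal_plus[symmetric] ennreal_leI del: ennreal_plus)
 also have "\<dots> = E (- s) g + E s w" unfolding E_def by (rule nn_integral_add) auto
 finally show ?thesis .
qed

lemma E_stokes: "E s (stokes L u) = E (s + 2) u"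
proof -
 have "lam k powr s * (lam k)\<^sup>2 = lam k powr (s + 2)" for k using lam_pos[of k] by (cases "k = 0") (simp_all add: powr_add)
 then have "lam k powr s * (norm (stokes L u k))\<^sup>2 = lam k powr (s + 2) * (norm (u k))\<^sup>2" for k
  by (simp add: stokes_eq power_mult_distrib mult.assoc[symmetric])
 then show ?thesis by (simp add: E_def)
qed

text \<open>
 Each Fourier mode satisfies the weak equation by integration by parts, and the modes are then summed. The sum over modes and the integral
 over time may be exchanged because the tested expression lies in \<open>V\<^sup>\<alpha>\<^sup>-\<^sup>1\<close> with an integrable
 squared norm, while the test field lies in \<open>V\<^sup>1\<^sup>-\<^sup>\<alpha>\<close>.
\<close>

lemma mild_imp_weak:
 assumes J [measurable]: "J \<in> sets borel" and Jc: "J \<subseteq> {c<..}"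
  and f: "f \<in> V L \<alpha>"
  and a: "borel_field a" "\<And>t. a t 0 = 0" "AE t in lborel. t \<in> J \<longrightarrow> a t \<in> V L \<beta>"
  and u: "borel_field u" "\<And>t. t \<in> J \<Longrightarrow> solenoidal (u t)" "\<And>t. u t 0 = 0"
  and aE: "\<And>T. T \<in> J \<Longrightarrow> Eint \<beta> {c..T} a < top"
  and uE: "\<And>T. T \<in> J \<Longrightarrow> Eint \<beta> {c..T} u < top"
  and PBE: "\<And>T. T \<in> J \<Longrightarrow> Eint (\<alpha> - 1) {c..T} (\<lambda>t. PB (a t) (u t)) < top"
  and mild: "\<And>T. T \<in> J \<Longrightarrow> mild \<nu> (forcing f a u) u c T"
 shows "weak_equation L \<alpha> \<nu> f J a u"
 unfolding weak_equation_def
proof (intro ballI)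
 fix v \<eta> assume v: "v \<in> V L \<beta>" and \<eta>: "\<eta> \<in> test_functions J"
 obtain Kc where Kc: "compact Kc" "Kc \<subseteq> J" "\<And>t. t \<notin> Kc \<Longrightarrow> \<eta> t = 0" and C1: "\<eta> C1_differentiable_on UNIV"
  using \<eta> by (auto simp: test_functions_def)
 note D = C1_has_deriv[OF C1]
 have out: "deriv \<eta> t = 0" if "t \<notin> Kc" for t by (rule deriv_test_function_0[OF Kc(1) Kc(3) that])
 show "(LINT t|lebesgue_on J. - deriv \<eta> t * pairing L (u t) v
   + \<eta> t * (\<nu> * pairing L (stokes L (u t)) v + b_form L \<beta> (a t) (u t) v))
   = (LINT t|lebesgue_on J. \<eta> t * pairing L f v)"
 proof (cases "Kc = {}")
  case True
  then have "\<eta> t = 0" "deriv \<eta> t = 0" for t using Kc(3) out by auto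
  then show ?thesis by simp
 next
  case False
  define T where "T = Sup Kc"
  have TK: "T \<in> Kc" and leT: "\<And>t. t \<in> Kc \<Longrightarrow> t \<le> T" unfolding T_def using Kc(1) False
   by (auto intro!: closed_contains_Sup compact_imp_closed cSup_upper bounded_imp_bdd_above compact_imp_bounded)
  have TJ: "T \<in> J" using TK Kc(2) by auto
  have cT: "c < T" using TJ Jc by auto
  have KI: "Kc \<subseteq> {c<..T}" using leT Kc(2) Jc by auto
  have \<eta>c: "continuous_on UNIV \<eta>" using D(1) by (intro continuous_at_imp_continuous_on) (blast intro: DERIV_isCont)
  have [measurable]: "deriv \<eta> \<in> borel_measurable borel" "\<eta> \<in> borel_measurable borel"
   by (rule borel_measurable_continuous_onI, rule D(2), rule borel_measurable_continuous_onI, rule \<eta>c)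
  have "c \<notin> Kc" using KI by auto
  then have c0: "\<eta> c = 0" "deriv \<eta> c = 0" by (rule Kc(3), rule out)
  have T0: "\<eta> T = 0"
  proof -
   have "((\<lambda>n. \<eta> (T + 1 / real (Suc n))) \<longlongrightarrow> \<eta> T) sequentially"
   proof (rule continuous_on_tendsto_compose[OF \<eta>c])
    show "(\<lambda>n. T + 1 / real (Suc n)) \<longlonglongrightarrow> T"
     using tendsto_add[OF tendsto_const LIMSEQ_inverse_real_of_nat, of T] by (simp add: divide_inverse)
   qed auto
   moreover have "\<eta> (T + 1 / real (Suc n)) = 0" for n
   proof (rule Kc(3))
    have "T < T + 1 / real (Suc n)" by simp
    then show "T + 1 / real (Suc n) \<notin> Kc" using leT by fastforce
   qed
   ultimately show ?thesis by (simp add: LIMSEQ_const_iff)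
  qed
  \<comment> \<open>The integrand of the weak equation, as a field that is paired with \<open>v\<close>.\<close>
  define x where "x = (\<lambda>t k. - deriv \<eta> t *\<^sub>R u t k + (\<eta> t * \<nu>) *\<^sub>R stokes L (u t) k + \<eta> t *\<^sub>R PB (a t) (u t) k + (- \<eta> t) *\<^sub>R f k)"
  define w where "w = (\<lambda>k t. x t k \<bullet> v k)"
  have w0: "w k t = 0" if "t \<notin> Kc" for k t using Kc(3)[OF that] out[OF that] by (simp add: w_def x_def)
  have um [measurable]: "(\<lambda>t. u t k) \<in> borel_measurable borel" for k using u(1) by (simp add: borel_field_def)
  have PBm [measurable]: "(\<lambda>t. PB (a t) (u t) k) \<in> borel_measurable borel" for k
   using borel_PB[OF a(1) u(1)] by (simp add: borel_field_def)
  have wm [measurable]: "w k \<in> borel_measurable borel" for k unfolding w_def x_def stokes_eq by measurable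
  have uEa: "Eint \<alpha> {c..T} u < top" by (rule Eint_embedding_finite[OF _ u(1) _ uE[OF TJ]]) auto
  have uint: "integrable lborel (\<lambda>t. indicator {c..T} t *\<^sub>R u t k)" for k
   by (rule Eint_integrable[OF u(1,3) uEa, where c = c and d = T]) auto
  have Gint: "integrable lborel (\<lambda>t. indicator {c..T} t *\<^sub>R forcing f a u t k)" for k
   by (rule integrable_forcing[OF a(1) a(2) aE[OF TJ] u(1) u(3) uEa, where c = c and d = T]) auto
  have zero: "(\<integral>t. w k t \<partial>lborel) = 0" for k
  proof -
   define \<kappa> where "\<kappa> = \<nu> * lam k"
   define \<zeta> where "\<zeta> = (\<lambda>t. exp (- \<kappa> * t) * \<eta> t)"
   define z where "z = (\<lambda>t. exp (\<kappa> * t) * (u t k \<bullet> v k))"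
   define h where "h = (\<lambda>s. exp (\<kappa> * s) * (forcing f a u s k \<bullet> v k))"
   have \<zeta>d: "(\<zeta> has_real_derivative exp (- \<kappa> * t) * (deriv \<eta> t - \<kappa> * \<eta> t)) (at t)" for t
    unfolding \<zeta>_def by (auto intro!: derivative_eq_intros D(1) simp: algebra_simps)
   have \<zeta>': "deriv \<zeta> t = exp (- \<kappa> * t) * (deriv \<eta> t - \<kappa> * \<eta> t)" for t by (rule DERIV_imp_deriv[OF \<zeta>d])
   have C1\<zeta>: "\<zeta> C1_differentiable_on UNIV" by (rule C1_differentiableI[OF \<zeta>d]) (intro continuous_intros D(2) \<eta>c)
   have eG: "integrable lborel (\<lambda>s. indicator {c..T} s *\<^sub>R (exp (\<kappa> * s) *\<^sub>R forcing f a u s k))"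
    by (rule integrable_bounded_mult[OF Gint, where c = c and d = T]) (auto intro!: continuous_intros)
   have hint: "integrable lborel (\<lambda>s. indicator {c..T} s * h s)"
    using integrable_inner_left[OF eG, of "v k"] by (auto simp: h_def mult_ac)
   have zz: "z t = exp (\<kappa> * c) * (u c k \<bullet> v k) + (\<integral>s. indicator {c..t} s * h s \<partial>lborel)" if t: "t \<in> {c..T}" for t
   proof -
    have "exp (\<kappa> * t) *\<^sub>R u t k - exp (\<kappa> * c) *\<^sub>R u c k = (\<integral>s. indicator {c..t} s *\<^sub>R (exp (\<kappa> * s) *\<^sub>R forcing f a u s k) \<partial>lborel)"
     using mild[OF TJ] t by (simp add: mild_def \<kappa>_def)
    then have "(exp (\<kappa> * t) *\<^sub>R u t k - exp (\<kappa> * c) *\<^sub>R u c k) \<bullet> v k = (\<integral>s. indicator {c..t} s *\<^sub>R (exp (\<kappa> * s) *\<^sub>R forcing f a u s k) \<partial>lborel) \<bullet> v k"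
     by simp
    also have "\<dots> = (\<integral>s. (indicator {c..t} s *\<^sub>R (exp (\<kappa> * s) *\<^sub>R forcing f a u s k)) \<bullet> v k \<partial>lborel)"
    proof (rule integral_inner_left[symmetric])
     have "integrable lborel (\<lambda>s. indicator {c..t} s *\<^sub>R (indicator {c..T} s *\<^sub>R (exp (\<kappa> * s) *\<^sub>R forcing f a u s k)))"
      using integrable_mult_indicator[OF _ eG, of "{c..t}"] by simp
     moreover have "(\<lambda>s. indicator {c..t} s *\<^sub>R (indicator {c..T} s *\<^sub>R (exp (\<kappa> * s) *\<^sub>R forcing f a u s k)))
       = (\<lambda>s. indicator {c..t} s *\<^sub>R (exp (\<kappa> * s) *\<^sub>R forcing f a u s k))"
      using t by (auto simp: fun_eq_iff split: split_indicator)
     ultimately show "integrable lborel (\<lambda>s. indicator {c..t} s *\<^sub>R (exp (\<kappa> * s) *\<^sub>R forcing f a u s k))" by simp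
    qed
    finally show ?thesis by (simp add: z_def h_def inner_diff_left mult.assoc)
   qed
   have ibp: "(\<integral>t. indicator {c..T} t * (deriv \<zeta> t * z t) \<partial>lborel) = - (\<integral>t. indicator {c..T} t * (\<zeta> t * h t) \<partial>lborel)"
    by (rule integral_by_parts_absolutely_continuous[OF C1\<zeta> _ _ _ hint zz]) (use c0 T0 cT in \<open>auto simp: \<zeta>_def\<close>)
   have ee: "exp (- \<kappa> * t) * exp (\<kappa> * t) = 1" for t by (simp add: exp_add[symmetric])
   have A: "deriv \<zeta> t * z t = (deriv \<eta> t - \<kappa> * \<eta> t) * (u t k \<bullet> v k)" for t
   proof -
    have "deriv \<zeta> t * z t = (exp (- \<kappa> * t) * exp (\<kappa> * t)) * ((deriv \<eta> t - \<kappa> * \<eta> t) * (u t k \<bullet> v k))"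
     unfolding \<zeta>' z_def by (simp only: mult_ac)
    then show ?thesis unfolding ee by simp
   qed
   have B: "\<zeta> t * h t = \<eta> t * (forcing f a u t k \<bullet> v k)" for t
   proof -
    have "\<zeta> t * h t = (exp (- \<kappa> * t) * exp (\<kappa> * t)) * (\<eta> t * (forcing f a u t k \<bullet> v k))"
     unfolding \<zeta>_def h_def by (simp only: mult_ac)
    then show ?thesis unfolding ee by simp
   qed
   have Aint: "integrable lborel (\<lambda>t. indicator {c..T} t * (deriv \<zeta> t * z t))"
   proof -
    have "integrable lborel (\<lambda>t. indicator {c..T} t *\<^sub>R ((deriv \<eta> t - \<kappa> * \<eta> t) *\<^sub>R u t k))"
     by (rule integrable_bounded_mult[OF uint, where c = c and d = T]) (auto intro!: continuous_intros D(2) \<eta>c)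
    from integrable_inner_left[OF this, of "v k"] show ?thesis unfolding A by (simp add: mult.assoc)
   qed
   have Bint: "integrable lborel (\<lambda>t. indicator {c..T} t * (\<zeta> t * h t))"
   proof -
    have "integrable lborel (\<lambda>t. indicator {c..T} t *\<^sub>R (\<eta> t *\<^sub>R forcing f a u t k))"
     by (rule integrable_bounded_mult[OF Gint \<eta>c, where c = c and d = T]) auto
    from integrable_inner_left[OF this, of "v k"] show ?thesis unfolding B by (simp add: mult.assoc)
   qed
   have "(\<integral>t. w k t \<partial>lborel) = (\<integral>t. - (indicator {c..T} t * (deriv \<zeta> t * z t)) - indicator {c..T} t * (\<zeta> t * h t) \<partial>lborel)"
   proof (intro Bochner_Integration.integral_cong refl)
    fix t
    show "w k t = - (indicator {c..T} t * (deriv \<zeta> t * z t)) - indicator {c..T} t * (\<zeta> t * h t)"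
    proof (cases "t \<in> {c..T}")
     case True
     then show ?thesis
      unfolding A B by (simp add: w_def x_def stokes_eq \<kappa>_def forcing_def inner_diff_left inner_add_left algebra_simps)
    next
     case False
     then have "t \<notin> Kc" using KI by auto
     then show ?thesis using w0[of t k] False by simp
    qed
   qed
   also have "\<dots> = - (\<integral>t. indicator {c..T} t * (deriv \<zeta> t * z t) \<partial>lborel) - (\<integral>t. indicator {c..T} t * (\<zeta> t * h t) \<partial>lborel)"
    by (subst Bochner_Integration.integral_diff) (use Aint Bint in auto)
   finally show ?thesis using ibp by simp
  qed
  obtain M where M: "\<forall>t\<in>{c..T}. \<bar>deriv \<eta> t\<bar> \<le> M" "\<forall>t\<in>{c..T}. \<bar>\<eta> t\<bar> \<le> M"
  proof -
   have "bounded (deriv \<eta> ` {c..T})" "bounded (\<eta> ` {c..T})"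
    by (intro compact_imp_bounded compact_continuous_image compact_Icc continuous_on_subset[OF D(2)] continuous_on_subset[OF \<eta>c], simp)+
   then obtain M1 M2 where "\<forall>t\<in>{c..T}. \<bar>deriv \<eta> t\<bar> \<le> M1" "\<forall>t\<in>{c..T}. \<bar>\<eta> t\<bar> \<le> M2" by (auto simp: bounded_iff)
   then show ?thesis by (intro that[of "max M1 M2"]) (auto simp: le_max_iff_disj)
  qed
  have M0: "0 \<le> M" using M cT by (meson abs_ge_zero atLeastAtMost_iff less_imp_le order_refl order_trans)
  have v0: "v 0 = 0" using v by (auto simp: V_iff solenoidal_at_0)
  have Ev: "E s v < top" if "s \<le> \<beta>" for s using v that by (auto simp: V_iff intro: E_embedding_finite)
  define W where "W = (\<lambda>p. w (snd p) (fst p))"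
  have Wm [measurable]: "W \<in> borel_measurable (lborel \<Otimes>\<^sub>M count_space UNIV)" unfolding W_def
   by (rule measurable_compose_countable'[where I = UNIV and g = snd and f = "\<lambda>k p. w k (fst p)"])
     (auto intro!: measurable_compose[OF measurable_fst])
  interpret P: pair_sigma_finite "lborel :: real measure" "count_space UNIV :: (int ^ 3) measure"
   by (intro pair_sigma_finite.intro sigma_finite_measure_count_space sigma_finite_lborel)
  have E1: "E (\<alpha> - 1) g < top" if "E s g < top" "\<alpha> - 1 \<le> s" for g s using that by (rule E_embedding_finite[rotated])
  have wle: "(\<Sum>\<^sup>+k. ennreal (norm (w k t)))
    \<le> (8 * (ennreal (M\<^sup>2) * E (\<alpha> - 1) (u t) + ennreal ((M * \<nu>)\<^sup>2) * E \<beta> (u t) + ennreal (M\<^sup>2) * E (\<alpha> - 1) (PB (a t) (u t))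
      + ennreal (M\<^sup>2) * E (\<alpha> - 1) f) + E (1 - \<alpha>) v) * indicator {c..T} t" for t
  proof (cases "t \<in> {c..T}")
   case False
   then have "t \<notin> Kc" using KI by auto
   then show ?thesis using w0 by simp
  next
   case True
   have sq: "y\<^sup>2 \<le> M\<^sup>2" if "\<bar>y\<bar> \<le> M" for y using that by (simp add: abs_le_square_iff[symmetric])
   have d: "(- deriv \<eta> t)\<^sup>2 \<le> M\<^sup>2" "(\<eta> t)\<^sup>2 \<le> M\<^sup>2" "(- \<eta> t)\<^sup>2 \<le> M\<^sup>2" "(\<eta> t * \<nu>)\<^sup>2 \<le> (M * \<nu>)\<^sup>2"
    using M True by (auto simp: power_mult_distrib intro!: mult_right_mono sq)
   have "(\<Sum>\<^sup>+k. ennreal (norm (w k t))) \<le> (\<Sum>\<^sup>+k. ennreal (norm (x t k) * norm (v k)))"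
    unfolding w_def real_norm_def by (intro nn_integral_mono ennreal_leI Cauchy_Schwarz_ineq2)
   also have "\<dots> \<le> E (- (1 - \<alpha>)) (x t) + E (1 - \<alpha>) v" by (rule duality_sum_le) (simp add: v0)
   also have "E (- (1 - \<alpha>)) (x t) \<le> 8 * (ennreal (M\<^sup>2) * E (\<alpha> - 1) (u t) + ennreal ((M * \<nu>)\<^sup>2) * E \<beta> (u t)
     + ennreal (M\<^sup>2) * E (\<alpha> - 1) (PB (a t) (u t)) + ennreal (M\<^sup>2) * E (\<alpha> - 1) f)"
   proof -
    have "E (\<alpha> - 1) (stokes L (u t)) = E \<beta> (u t)" by (simp add: E_stokes add.commute)
    then show ?thesis
     unfolding x_def by (intro order_trans[OF E_sum4_le]) (simp only: E_scaleR minus_diff_eq, intro mult_left_mono add_mono mult_right_mono ennreal_leI d, auto)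
   qed
   finally show ?thesis using True by simp
  qed
  have fin: "(\<integral>\<^sup>+t. \<integral>\<^sup>+k. ennreal (norm (w k t)) \<partial>count_space UNIV \<partial>lborel) < top"
  proof -
   note [measurable] = borel_field_E[OF u(1)] borel_field_E[OF borel_PB[OF a(1) u(1)]]
   have fv: "E (\<alpha> - 1) f < top" "E (1 - \<alpha>) v < top" using E1[of \<alpha> f] Ev[of "1 - \<alpha>"] f alpha by (auto simp: V_iff)
   have "(\<integral>\<^sup>+t. \<integral>\<^sup>+k. ennreal (norm (w k t)) \<partial>count_space UNIV \<partial>lborel)
     \<le> (\<integral>\<^sup>+t. 8 * (ennreal (M\<^sup>2) * (E (\<alpha> - 1) (u t) * indicator {c..T} t) + ennreal ((M * \<nu>)\<^sup>2) * (E \<beta> (u t) * indicator {c..T} t)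
      + ennreal (M\<^sup>2) * (E (\<alpha> - 1) (PB (a t) (u t)) * indicator {c..T} t)) + (8 * (ennreal (M\<^sup>2) * E (\<alpha> - 1) f) + E (1 - \<alpha>) v) * indicator {c..T} t \<partial>lborel)"
    by (intro nn_integral_mono order_trans[OF wle]) (auto simp: distrib_left add_ac split: split_indicator)
   also have "\<dots> = 8 * (ennreal (M\<^sup>2) * Eint (\<alpha> - 1) {c..T} u + ennreal ((M * \<nu>)\<^sup>2) * Eint \<beta> {c..T} u
     + ennreal (M\<^sup>2) * Eint (\<alpha> - 1) {c..T} (\<lambda>t. PB (a t) (u t))) + (8 * (ennreal (M\<^sup>2) * E (\<alpha> - 1) f) + E (1 - \<alpha>) v) * emeasure lborel {c..T}"
    unfolding Eint_def by (simp add: nn_integral_cmult nn_integral_add)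
   also have "\<dots> < top"
    using Eint_embedding_finite[OF _ u(1) _ uE[OF TJ], of "\<alpha> - 1"] uE[OF TJ] PBE[OF TJ] fv cT by (auto simp: ennreal_mult_less_top)
   finally show ?thesis .
  qed
  have Wint: "integrable (lborel \<Otimes>\<^sub>M count_space UNIV) W"
  proof -
   have "(\<integral>\<^sup>+p. ennreal (norm (W p)) \<partial>(lborel \<Otimes>\<^sub>M count_space UNIV)) = (\<integral>\<^sup>+t. \<integral>\<^sup>+k. ennreal (norm (W (t, k))) \<partial>count_space UNIV \<partial>lborel)"
    by (rule P.M2.nn_integral_fst[symmetric]) measurable
   then show ?thesis using fin Wm by (auto simp: integrable_iff_bounded W_def)
  qed
  have sum0: "(\<integral>t. \<integral>k. w k t \<partial>count_space UNIV \<partial>lborel) = 0"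
  proof -
   have "(\<integral>t. \<integral>k. w k t \<partial>count_space UNIV \<partial>lborel) = (\<integral>k. \<integral>t. w k t \<partial>lborel \<partial>count_space UNIV)"
    using P.Fubini_integral[of "\<lambda>t k. w k t"] Wint by (simp add: W_def split_beta')
   then show ?thesis by (simp add: zero)
  qed
  have sint: "integrable lborel (\<lambda>t. \<integral>k. w k t \<partial>count_space UNIV)" using P.integrable_fst'[OF Wint] by (simp add: W_def)
  have [measurable]: "(\<lambda>t. \<integral>k. w k t \<partial>count_space UNIV) \<in> borel_measurable borel"
   using borel_measurable_integrable[OF sint] by simp
  define g where "g = (\<lambda>t. L ^ 3 * (\<integral>k. w k t \<partial>count_space UNIV) + \<eta> t * pairing L f v)"
  have gm: "g \<in> borel_measurable borel" unfolding g_def by measurable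
  have g0: "g t = 0" if "t \<notin> J" for t
  proof -
   have "t \<notin> Kc" using that Kc(2) by auto
   then show ?thesis using w0 Kc(3) by (simp add: g_def)
  qed
  have dual: "integrable (count_space UNIV) (\<lambda>k. g k \<bullet> v k)" "pairing L g v = L ^ 3 * (\<integral>k. g k \<bullet> v k \<partial>count_space UNIV)"
   if "E (\<alpha> - 1) g < top" for g
   using duality_integrable(1)[where g = g and w = v and s = "1 - \<alpha>"] pairing_eq[where g = g and w = v and s = "1 - \<alpha>"]
    that v0 Ev[of "1 - \<alpha>"] alpha by simp_all
  have Ef: "E (\<alpha> - 1) f < top" using E1[of \<alpha> f] f by (simp add: V_iff)
  have ae: "AE t in lborel. t \<in> J \<longrightarrow> - deriv \<eta> t * pairing L (u t) v
   + \<eta> t * (\<nu> * pairing L (stokes L (u t)) v + b_form L \<beta> (a t) (u t) v) = g t"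
  proof -
   have "AE t in lborel. E \<beta> (u t) * indicator {c..T} t \<noteq> \<infinity>"
    using uE[OF TJ] borel_field_E[OF u(1)] by (intro nn_integral_PInf_AE) (auto simp: Eint_def)
   then show ?thesis using a(3)
   proof eventually_elim
    case (elim t)
    show ?case
    proof (cases "t \<in> Kc")
     case False
     then show ?thesis using w0 Kc(3) out by (simp add: g_def)
    next
     case True
     have tI: "t \<in> {c..T}" and tJ: "t \<in> J" using True KI Kc(2) by auto
     have uV: "u t \<in> V L \<beta>" using elim tI u(2)[OF tJ] by (auto simp: V_iff top.not_eq_extremum)
     have aV: "a t \<in> V L \<beta>" using elim tJ by auto
     have Eu: "E (\<alpha> - 1) (u t) < top" "E (\<alpha> - 1) (stokes L (u t)) < top"
      using uV E1[of \<beta> "u t"] by (simp_all add: V_iff E_stokes add.commute)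
     have EP: "E (\<alpha> - 1) (PB (a t) (u t)) < top" by (rule E_PB_finite[OF aV V_alpha[OF uV]])
     have b: "b_form L \<beta> (a t) (u t) v = L ^ 3 * (\<integral>k. PB (a t) (u t) k \<bullet> v k \<partial>count_space UNIV)"
      using b_form_eq[OF aV uV v] by (simp add: bt_def)
     have eq: "(\<integral>k. w k t \<partial>count_space UNIV) = - deriv \<eta> t * (\<integral>k. u t k \<bullet> v k \<partial>count_space UNIV) + (\<eta> t * \<nu>) * (\<integral>k. stokes L (u t) k \<bullet> v k \<partial>count_space UNIV)
       + \<eta> t * (\<integral>k. PB (a t) (u t) k \<bullet> v k \<partial>count_space UNIV) + (- \<eta> t) * (\<integral>k. f k \<bullet> v k \<partial>count_space UNIV)"
      unfolding w_def x_def inner_add_left inner_scaleR_left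
      using dual(1)[OF Eu(1)] dual(1)[OF Eu(2)] dual(1)[OF EP] dual(1)[OF Ef] by simp
     show ?thesis unfolding g_def dual(2)[OF Eu(1)] dual(2)[OF Eu(2)] b dual(2)[OF Ef] eq by (simp add: algebra_simps)
    qed
   qed
  qed
  have "(LINT t|lebesgue_on J. - deriv \<eta> t * pairing L (u t) v
   + \<eta> t * (\<nu> * pairing L (stokes L (u t)) v + b_form L \<beta> (a t) (u t) v)) = (\<integral>t. indicator J t *\<^sub>R g t \<partial>lborel)"
   by (rule lebesgue_on_AE_eq(2)[OF J gm ae])
  also have "\<dots> = (\<integral>t. g t \<partial>lborel)" by (intro Bochner_Integration.integral_cong) (auto simp: g0 split: split_indicator)
  also have "\<dots> = L ^ 3 * (\<integral>t. \<integral>k. w k t \<partial>count_space UNIV \<partial>lborel) + (\<integral>t. \<eta> t * pairing L f v \<partial>lborel)"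
  proof -
   have "integrable lborel (\<lambda>t. indicator {c..T} t *\<^sub>R \<eta> t)"
    by (intro borel_integrable_compact compact_Icc continuous_on_subset[OF \<eta>c]) auto
   moreover have "(\<lambda>t. indicator {c..T} t *\<^sub>R \<eta> t) = \<eta>"
   proof
    fix t
    have "\<eta> t = 0" if "t \<notin> {c..T}"
    proof (rule Kc(3))
     show "t \<notin> Kc" using that KI by auto
    qed
    then show "indicator {c..T} t *\<^sub>R \<eta> t = \<eta> t" by (cases "t \<in> {c..T}") auto
   qed
   ultimately have "integrable lborel \<eta>" by simp
   then show ?thesis unfolding g_def using sint by (subst Bochner_Integration.integral_add) auto
  qed
  also have "\<dots> = (\<integral>t. indicator J t *\<^sub>R (\<eta> t * pairing L f v) \<partial>lborel)"
  proof -
   have "indicator J t *\<^sub>R (\<eta> t * pairing L f v) = \<eta> t * pairing L f v" for t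
   proof (cases "t \<in> J")
    case False
    then have "\<eta> t = 0" using Kc(2) by (intro Kc(3)) auto
    then show ?thesis by simp
   qed simp
   then show ?thesis by (simp only: sum0 mult_zero_right add_0_left)
  qed
  also have "\<dots> = (LINT t|lebesgue_on J. \<eta> t * pairing L f v)" by (intro lebesgue_on_AE_eq(2)[symmetric]) auto
  finally show ?thesis .
 qed
qed

end

section \<open>A contraction principle for quasi-norms\<close>

text \<open>
 \<open>Q\<close> plays the role of the square of a norm: it satisfies the triangle inequality up to the factor 2, controls all
 coordinates, and is lower semicontinuous under coordinatewise limits. A contraction factor below \<open>1 / 2\<close> for
 \<open>Q\<close>, here \<open>1 / 8\<close>, outweighs the factor 2 and makes the iterates from 0 converge.
\<close>

lemma contraction_fixed_point:
 fixes P :: "('i \<Rightarrow> 'b::banach) \<Rightarrow> bool" and Q :: "('i \<Rightarrow> 'b) \<Rightarrow> ennreal" and r :: real and c :: "'i \<Rightarrow> real"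
 assumes P0: "P (\<lambda>i. 0)" and Q0: "Q (\<lambda>i. 0) = 0" and r: "0 \<le> r" and c: "\<And>i. 0 \<le> c i"
  and Pdiff: "\<And>x y. P x \<Longrightarrow> P y \<Longrightarrow> P (\<lambda>i. x i - y i)"
  and Plim: "\<And>X x. (\<And>n. P (X n)) \<Longrightarrow> (\<And>i. (\<lambda>n. X n i) \<longlonglongrightarrow> x i) \<Longrightarrow> P x"
  and Qdiff: "\<And>x y. P x \<Longrightarrow> P y \<Longrightarrow> Q (\<lambda>i. x i - y i) \<le> 2 * (Q x + Q y)"
  and coord: "\<And>x i. P x \<Longrightarrow> ennreal ((norm (x i))\<^sup>2) \<le> ennreal (c i) * Q x"
  and Fatou: "\<And>X x b. (\<And>n. P (X n)) \<Longrightarrow> P x \<Longrightarrow> (\<And>i. (\<lambda>n. X n i) \<longlonglongrightarrow> x i) \<Longrightarrow> (\<And>n. Q (X n) \<le> b) \<Longrightarrow> Q x \<le> b"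
  and maps: "\<And>x. P x \<Longrightarrow> Q x \<le> ennreal r \<Longrightarrow> P (T x) \<and> Q (T x) \<le> ennreal r"
  and contr: "\<And>x y. P x \<Longrightarrow> P y \<Longrightarrow> Q x \<le> ennreal r \<Longrightarrow> Q y \<le> ennreal r \<Longrightarrow>
    Q (\<lambda>i. T x i - T y i) \<le> ennreal (1 / 8) * Q (\<lambda>i. x i - y i)"
 shows "\<exists>x. P x \<and> Q x \<le> ennreal r \<and> T x = x"
proof -
 define X where "X = (\<lambda>n. (T ^^ n) (\<lambda>i. 0))"
 have XS: "X (Suc n) = T (X n)" for n by (simp add: X_def)
 have X0: "X 0 = (\<lambda>i. 0)" by (simp add: X_def)
 have X: "P (X n)" "Q (X n) \<le> ennreal r" for n
 proof (induction n)
  case 0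
  { case 1 show ?case by (simp add: X0 P0) }
  { case 2 show ?case by (simp add: X0 Q0) }
 next
  case (Suc n)
  { case 1 show ?case using maps[OF Suc] by (simp add: XS) }
  { case 2 show ?case using maps[OF Suc] by (simp add: XS) }
 qed
 have step: "Q (\<lambda>i. X n i - X (Suc n) i) \<le> ennreal (2 * r * (1 / 8) ^ n)" for n
 proof (induction n)
  case 0
  have "Q (\<lambda>i. X 0 i - X (Suc 0) i) \<le> 2 * (Q (X 0) + Q (X (Suc 0)))" by (intro Qdiff X)
  also have "\<dots> \<le> 2 * ennreal r" using X(2)[of "Suc 0"] by (simp add: X0 Q0 mult_left_mono)
  finally show ?case using r by (simp add: ennreal_mult)
 next
  case (Suc n)
  have "Q (\<lambda>i. X (Suc n) i - X (Suc (Suc n)) i) \<le> ennreal (1 / 8) * Q (\<lambda>i. X n i - X (Suc n) i)"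
   unfolding XS[of n] XS[of "Suc n"] by (intro contr) (use X[of "Suc n"] X[of n] in \<open>auto simp: XS\<close>)
  also have "\<dots> \<le> ennreal (1 / 8) * ennreal (2 * r * (1 / 8) ^ n)" by (intro mult_left_mono Suc) auto
  also have "\<dots> = ennreal (2 * r * (1 / 8) ^ Suc n)" using r by (simp add: ennreal_mult[symmetric] mult_ac)
  finally show ?case .
 qed
 have two_add: "2 * (ennreal a + ennreal b) = ennreal (2 * (a + b))" if "0 \<le> a" "0 \<le> b" for a b
  using that by (simp add: ennreal_mult ennreal_plus)
 have far: "Q (\<lambda>i. X (n + j) i - X n i) \<le> ennreal (6 * r * (1 / 8) ^ n)" for n j
 proof (induction j arbitrary: n)
  case 0
  then show ?case by (simp add: Q0)
 next
  case (Suc j)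
  have "Q (\<lambda>i. X (n + Suc j) i - X n i) = Q (\<lambda>i. (X (Suc n + j) i - X (Suc n) i) - (X n i - X (Suc n) i))" by simp
  also have "\<dots> \<le> 2 * (Q (\<lambda>i. X (Suc n + j) i - X (Suc n) i) + Q (\<lambda>i. X n i - X (Suc n) i))" by (intro Qdiff Pdiff X)
  also have "\<dots> \<le> 2 * (ennreal (6 * r * (1 / 8) ^ Suc n) + ennreal (2 * r * (1 / 8) ^ n))"
   by (intro mult_left_mono add_mono Suc step) auto
  also have "\<dots> = ennreal (2 * (6 * r * (1 / 8) ^ Suc n + 2 * r * (1 / 8) ^ n))" using r by (intro two_add) auto
  also have "\<dots> \<le> ennreal (6 * r * (1 / 8) ^ n)"
  proof (rule ennreal_leI)
   have "0 \<le> r * (1 / 8) ^ n" using r by simp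
   then show "2 * (6 * r * (1 / 8) ^ Suc n + 2 * r * (1 / 8) ^ n) \<le> 6 * r * (1 / 8) ^ n" by simp
  qed
  finally show ?case .
 qed
 have pow0: "(\<lambda>n. C * (1 / 8 :: real) ^ n) \<longlonglongrightarrow> 0" for C
  using tendsto_mult_left[OF LIMSEQ_realpow_zero[of "1 / 8 :: real"], of C] by simp
 have "Cauchy (\<lambda>n. X n i)" for i
 proof (rule CauchyI)
  fix e :: real assume e: "0 < e"
  have "\<forall>\<^sub>F n in sequentially. (c i * 6 * r) * (1 / 8) ^ n < e\<^sup>2" using e by (intro order_tendstoD(2)[OF pow0]) simp
  then obtain N where N: "\<And>n. n \<ge> N \<Longrightarrow> (c i * 6 * r) * (1 / 8) ^ n < e\<^sup>2" by (auto simp: eventually_sequentially)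
  have key: "norm (X (m + j) i - X m i) < e" if m: "N \<le> m" for m j
  proof -
   have "ennreal ((norm (X (m + j) i - X m i))\<^sup>2) \<le> ennreal (c i) * Q (\<lambda>i. X (m + j) i - X m i)" by (rule coord) (intro Pdiff X)
   also have "\<dots> \<le> ennreal (c i) * ennreal (6 * r * (1 / 8) ^ m)" by (intro mult_left_mono far) auto
   also have "\<dots> = ennreal ((c i * 6 * r) * (1 / 8) ^ m)" using c[of i] r by (simp add: ennreal_mult[symmetric] mult_ac)
   finally have "(norm (X (m + j) i - X m i))\<^sup>2 \<le> (c i * 6 * r) * (1 / 8) ^ m"
    by (rule ennreal_le_iff[THEN iffD1, rotated]) (use c[of i] r in simp)
   also have "\<dots> < e\<^sup>2" by (rule N[OF m])
   finally show "norm (X (m + j) i - X m i) < e" by (rule power2_less_imp_less) (use e in simp)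
  qed
  show "\<exists>M. \<forall>m\<ge>M. \<forall>n\<ge>M. norm (X m i - X n i) < e"
  proof (intro exI[of _ N] allI impI)
   fix m n assume mn: "N \<le> m" "N \<le> n"
   show "norm (X m i - X n i) < e" using key[OF mn(1), of "n - m"] key[OF mn(2), of "m - n"]
    by (cases "m \<le> n") (simp_all add: norm_minus_commute)
  qed
 qed
 then have "convergent (\<lambda>n. X n i)" for i by (rule Cauchy_convergent)
 then have x: "(\<lambda>n. X n i) \<longlonglongrightarrow> lim (\<lambda>n. X n i)" for i by (simp add: convergent_LIMSEQ_iff)
 define x where "x = (\<lambda>i. lim (\<lambda>n. X n i))"
 have x: "(\<lambda>n. X n i) \<longlonglongrightarrow> x i" for i using x by (simp add: x_def)
 have Px: "P x" by (rule Plim[OF X(1) x])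
 have Qx: "Q x \<le> ennreal r" by (rule Fatou[OF X(1) Px x X(2)])
 have near: "Q (\<lambda>i. x i - X n i) \<le> ennreal (6 * r * (1 / 8) ^ n)" for n
 proof (rule Fatou[where X = "\<lambda>j i. X (n + j) i - X n i"])
  show "P (\<lambda>i. X (n + j) i - X n i)" for j by (intro Pdiff X)
  show "P (\<lambda>i. x i - X n i)" by (intro Pdiff X Px)
  show "(\<lambda>j. X (n + j) i - X n i) \<longlonglongrightarrow> x i - X n i" for i
  proof (intro tendsto_diff tendsto_const)
   show "(\<lambda>j. X (n + j) i) \<longlonglongrightarrow> x i" using LIMSEQ_ignore_initial_segment[OF x[of i], of n] by (simp add: add.commute)
  qed
 qed (rule far)
 have PT: "P (T x)" using maps[OF Px Qx] by simp
 have "Q (\<lambda>i. T x i - x i) \<le> ennreal ((24 * r) * (1 / 8) ^ n)" for n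
 proof -
  have "Q (\<lambda>i. T x i - X (Suc n) i) \<le> ennreal (1 / 8) * Q (\<lambda>i. x i - X n i)" unfolding XS by (intro contr Px Qx X)
  also have "\<dots> \<le> ennreal (1 / 8) * ennreal (6 * r * (1 / 8) ^ n)" by (intro mult_left_mono near) auto
  also have "\<dots> \<le> ennreal (6 * r * (1 / 8) ^ n)" using r by (simp add: ennreal_mult[symmetric] ennreal_leI)
  finally have 1: "Q (\<lambda>i. T x i - X (Suc n) i) \<le> ennreal (6 * r * (1 / 8) ^ n)" .
  have 2: "Q (\<lambda>i. x i - X (Suc n) i) \<le> ennreal (6 * r * (1 / 8) ^ n)"
   by (rule order_trans[OF near]) (use r in \<open>auto intro!: ennreal_leI mult_left_mono\<close>)
  have "Q (\<lambda>i. T x i - x i) = Q (\<lambda>i. (T x i - X (Suc n) i) - (x i - X (Suc n) i))" by simp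
  also have "\<dots> \<le> 2 * (Q (\<lambda>i. T x i - X (Suc n) i) + Q (\<lambda>i. x i - X (Suc n) i))" by (intro Qdiff Pdiff X Px PT)
  also have "\<dots> \<le> 2 * (ennreal (6 * r * (1 / 8) ^ n) + ennreal (6 * r * (1 / 8) ^ n))" by (intro mult_left_mono add_mono 1 2) auto
  also have "\<dots> = ennreal (2 * (6 * r * (1 / 8) ^ n + 6 * r * (1 / 8) ^ n))" using r by (intro two_add) auto
  finally show ?thesis by (simp add: algebra_simps)
 qed
 moreover have "(\<lambda>n. ennreal ((24 * r) * (1 / 8) ^ n)) \<longlonglongrightarrow> ennreal 0" by (intro tendsto_ennrealI pow0)
 ultimately have "Q (\<lambda>i. T x i - x i) \<le> ennreal 0" by (intro LIMSEQ_le_const) auto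
 then have Q00: "Q (\<lambda>i. T x i - x i) = 0" by simp
 have "T x i = x i" for i using coord[OF Pdiff[OF PT Px], of i] Q00 by simp
 then have "T x = x" by auto
 then show ?thesis using Px Qx by blast
qed

section \<open>Stationary solutions at large viscosity\<close>

context torus
begin

lemma E_liminf:
 assumes lim: "\<And>k. (\<lambda>n. X n k) \<longlonglongrightarrow> u k" and b: "\<And>n. E s (X n) \<le> b"
 shows "E s u \<le> b"
proof -
 have "E s u = (\<Sum>\<^sup>+k. liminf (\<lambda>n. ennreal (lam k powr s * (norm (X n k))\<^sup>2)))" unfolding E_def
 proof (intro nn_integral_cong)
  fix k
  have "(\<lambda>n. ennreal (lam k powr s * (norm (X n k))\<^sup>2)) \<longlonglongrightarrow> ennreal (lam k powr s * (norm (u k))\<^sup>2)"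
   by (intro tendsto_ennrealI tendsto_mult tendsto_const tendsto_power tendsto_norm lim)
  then show "ennreal (lam k powr s * (norm (u k))\<^sup>2) = liminf (\<lambda>n. ennreal (lam k powr s * (norm (X n k))\<^sup>2))"
   by (intro lim_imp_Liminf[symmetric]) auto
 qed
 also have "\<dots> \<le> liminf (\<lambda>n. E s (X n))" unfolding E_def by (rule nn_integral_liminf) auto
 also have "\<dots> \<le> b" by (rule order_trans[OF Liminf_mono[where g = "\<lambda>n. b"]]) (auto simp: b Liminf_const)
 finally show ?thesis .
qed

lemma E_resolvent:
 assumes "\<nu> > 0"
 shows "E (s + 2) (\<lambda>k. (1 / (\<nu> * lam k)) *\<^sub>R g k) \<le> ennreal (1 / \<nu>\<^sup>2) * E s g"
proof -
 have "lam k powr (s + 2) * (norm ((1 / (\<nu> * lam k)) *\<^sub>R g k))\<^sup>2 \<le> 1 / \<nu>\<^sup>2 * (lam k powr s * (norm (g k))\<^sup>2)" for k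
 proof (cases "k = 0")
  case False
  have l: "0 < lam k" by (rule lam_pos[OF False])
  have "lam k powr (s + 2) = lam k powr s * (lam k)\<^sup>2" using l by (simp add: powr_add)
  then show ?thesis using l assms by (simp add: power_mult_distrib power_divide)
 qed simp
 then show ?thesis unfolding E_def
  by (subst nn_integral_cmult[symmetric]) (auto intro!: nn_integral_mono ennreal_leI simp: ennreal_mult[symmetric])
qed

lemma E_diff_le': "E s (\<lambda>k. u k - v k) \<le> 2 * (E s u + E s v)"
 using E_diff_le[of s u v] by (simp add: distrib_left)

lemma E_coeff_bound:
 assumes "u 0 = 0"
 shows "ennreal ((norm (u k))\<^sup>2) \<le> ennreal (if k = 0 then 0 else lam k powr (- s)) * E s u"
proof (cases "k = 0")
 case False
 have "(norm (u k))\<^sup>2 = lam k powr (- s) * (lam k powr s * (norm (u k))\<^sup>2)"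
  using lam_pos[OF False] False by (simp add: powr_minus)
 then have "ennreal ((norm (u k))\<^sup>2) = ennreal (lam k powr (- s)) * ennreal (lam k powr s * (norm (u k))\<^sup>2)"
  by (simp add: ennreal_mult[symmetric])
 also have "\<dots> \<le> ennreal (lam k powr (- s)) * E s u" by (intro mult_left_mono E_coeff) auto
 finally show ?thesis using False by simp
qed (use assms in simp)

lemma PB_quadratic_diff:
 assumes "u 0 = 0" "v 0 = 0" "E \<beta> u < top" "E \<beta> v < top"
 shows "PB u u k - PB v v k = PB (\<lambda>k. u k - v k) u k + PB v (\<lambda>k. u k - v k) k"
proof -
 have a: "E \<alpha> u < top" "E \<alpha> v < top" using assms by (auto intro: E_embedding_finite[of \<alpha> \<beta>])
 show ?thesis using PB_diff_left[of u v u k] PB_diff_right[of v u v k] assms a by simp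
qed

definition stationary :: "real \<Rightarrow> field \<Rightarrow> field \<Rightarrow> bool" where
 "stationary \<nu> f p \<longleftrightarrow> (\<forall>k. (\<nu> * lam k) *\<^sub>R p k = f k - PB p p k)"

text \<open>
 \<open>p\<close> is the fixed point of \<open>u \<mapsto> (\<nu> A)\<^sup>-\<^sup>1 (f - B(u, u))\<close>. The resolvent gains two
 derivatives and the factor \<open>1 / \<nu>\<close>, so for large \<open>\<nu>\<close> the map is a contraction of any prescribed ball.
\<close>

lemma exists_stationary:
 assumes f: "f \<in> V L \<alpha>" and \<delta>: "0 < \<delta>"
 shows "\<exists>\<nu>\<^sub>0\<ge>1. \<forall>\<nu>\<ge>\<nu>\<^sub>0. \<exists>p. solenoidal p \<and> E \<beta> p \<le> ennreal \<delta> \<and> stationary \<nu> f p"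
proof -
 have Ef: "E (\<alpha> - 1) f < top" using f by (auto simp: V_iff intro: E_embedding_finite[of "\<alpha> - 1" \<alpha>])
 define F where "F = enn2real (E (\<alpha> - 1) f)"
 have F: "E (\<alpha> - 1) f = ennreal F" "0 \<le> F" using Ef by (auto simp: F_def)
 define c1 where "c1 = lam1 powr (\<alpha> - \<beta>)"
 have c1: "0 \<le> c1" by (simp add: c1_def)
 have Ea: "E \<alpha> u \<le> ennreal c1 * E \<beta> u" for u unfolding c1_def by (rule E_embedding) simp
 have K0: "0 \<le> K" using K_pos by simp
 define A where "A = 2 * (F + K * c1 * \<delta>\<^sup>2) / \<delta>"
 define B where "B = 32 * K * c1 * \<delta>"
 define \<nu>0 where "\<nu>0 = 1 + A + B"
 have nn: "0 \<le> A" "0 \<le> B" using F c1 K0 \<delta> by (auto simp: A_def B_def)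
 have "\<exists>p. solenoidal p \<and> E \<beta> p \<le> ennreal \<delta> \<and> stationary \<nu> f p" if \<nu>: "\<nu> \<ge> \<nu>0" for \<nu>
 proof -
  have \<nu>1: "1 \<le> \<nu>" using \<nu> nn by (simp add: \<nu>0_def)
  have \<nu>sq: "\<nu> \<le> \<nu>\<^sup>2" using \<nu>1 by (simp add: power2_eq_square)
  have b1: "2 * (F + K * c1 * \<delta>\<^sup>2) / \<nu>\<^sup>2 \<le> \<delta>"
  proof -
   have "A \<le> \<nu>\<^sup>2" using \<nu> nn \<nu>sq by (simp add: \<nu>0_def)
   then show ?thesis using \<delta> \<nu>1 by (simp add: A_def field_simps)
  qed
  have b2: "4 * K * c1 * \<delta> / \<nu>\<^sup>2 \<le> 1 / 8"
  proof -
   have "B \<le> \<nu>\<^sup>2" using \<nu> nn \<nu>sq by (simp add: \<nu>0_def)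
   then show ?thesis using \<nu>1 by (simp add: B_def field_simps)
  qed
  define T where "T = (\<lambda>u k. (1 / (\<nu> * lam k)) *\<^sub>R (f k - PB u u k))"
  have "\<exists>p. solenoidal p \<and> E \<beta> p \<le> ennreal \<delta> \<and> T p = p"
  proof (rule contraction_fixed_point[where c = "\<lambda>k. if k = 0 then 0 else lam k powr - \<beta>"])
   show "0 \<le> \<delta>" using \<delta> by simp
   show "solenoidal (\<lambda>k. x k - y k)" if "solenoidal x" "solenoidal y" for x y using that by (rule solenoidal_diff)
   show "solenoidal x" if "\<And>n. solenoidal (X n)" "\<And>k. (\<lambda>n. X n k) \<longlonglongrightarrow> x k" for X x using that by (rule solenoidal_LIMSEQ)
   show "E \<beta> x \<le> b" if "\<And>k. (\<lambda>n. X n k) \<longlonglongrightarrow> x k" "\<And>n. E \<beta> (X n) \<le> b" for X x b using that by (rule E_liminf)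
   show "ennreal ((norm (x k))\<^sup>2) \<le> ennreal (if k = 0 then 0 else lam k powr - \<beta>) * E \<beta> x" if "solenoidal x" for x k
    using that by (intro E_coeff_bound) (rule solenoidal_at_0)
   show "solenoidal (T x) \<and> E \<beta> (T x) \<le> ennreal \<delta>" if x: "solenoidal x" "E \<beta> x \<le> ennreal \<delta>" for x
   proof
    show "solenoidal (T x)"
     unfolding T_def using f x by (intro solenoidal_scaleR solenoidal_diff solenoidal_PB) (auto simp: V_iff)
    have "E \<beta> (T x) \<le> ennreal (1 / \<nu>\<^sup>2) * E (\<alpha> - 1) (\<lambda>k. f k - PB x x k)"
     using E_resolvent[of \<nu> "\<alpha> - 1" "\<lambda>k. f k - PB x x k"] \<nu>1 by (simp add: T_def add.commute)
    also have "\<dots> \<le> ennreal (1 / \<nu>\<^sup>2) * (2 * (ennreal F + ennreal K * (ennreal \<delta> * (ennreal c1 * ennreal \<delta>))))"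
    proof (intro mult_left_mono order_trans[OF E_diff_le'] add_mono)
     show "E (\<alpha> - 1) f \<le> ennreal F" by (simp add: F)
     show "E (\<alpha> - 1) (PB x x) \<le> ennreal K * (ennreal \<delta> * (ennreal c1 * ennreal \<delta>))"
      using x by (intro order_trans[OF E_PB_le] mult_left_mono mult_mono order_trans[OF Ea]) (auto simp: solenoidal_at_0)
    qed auto
    also have "\<dots> = ennreal (2 * (F + K * c1 * \<delta>\<^sup>2) / \<nu>\<^sup>2)"
     using F c1 K0 \<delta> by (simp add: ennreal_mult[symmetric] ennreal_plus[symmetric] ennreal_numeral[symmetric] power2_eq_square mult_ac del: ennreal_plus ennreal_numeral)
    also have "\<dots> \<le> ennreal \<delta>" using b1 by (rule ennreal_leI)
    finally show "E \<beta> (T x) \<le> ennreal \<delta>" .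
   qed
   show "E \<beta> (\<lambda>k. T x k - T y k) \<le> ennreal (1 / 8) * E \<beta> (\<lambda>k. x k - y k)"
    if xy: "solenoidal x" "solenoidal y" "E \<beta> x \<le> ennreal \<delta>" "E \<beta> y \<le> ennreal \<delta>" for x y
   proof -
    define d where "d = (\<lambda>k. x k - y k)"
    have d0: "d 0 = 0" "x 0 = 0" "y 0 = 0" using xy by (auto simp: d_def solenoidal_at_0)
    have fin: "E \<beta> x < top" "E \<beta> y < top" using xy by (auto intro: le_less_trans)
    have eq: "T x k - T y k = (1 / (\<nu> * lam k)) *\<^sub>R (- (PB d x k + PB y d k))" for k
    proof -
     have "T x k - T y k = (1 / (\<nu> * lam k)) *\<^sub>R (- (PB x x k - PB y y k))" by (simp add: T_def scaleR_diff_right)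
     then show ?thesis unfolding d_def using PB_quadratic_diff[of x y k] d0 fin by simp
    qed
    have "E \<beta> (\<lambda>k. T x k - T y k) \<le> ennreal (1 / \<nu>\<^sup>2) * E (\<alpha> - 1) (\<lambda>k. - (PB d x k + PB y d k))"
     unfolding eq using E_resolvent[of \<nu> "\<alpha> - 1" "\<lambda>k. - (PB d x k + PB y d k)"] \<nu>1 by (simp add: add.commute)
    also have "E (\<alpha> - 1) (\<lambda>k. - (PB d x k + PB y d k)) \<le> 2 * E (\<alpha> - 1) (PB d x) + 2 * E (\<alpha> - 1) (PB y d)"
     unfolding E_minus by (rule E_add_le)
    also have "\<dots> \<le> 2 * (ennreal K * (E \<beta> d * (ennreal c1 * ennreal \<delta>))) + 2 * (ennreal K * (ennreal \<delta> * (ennreal c1 * E \<beta> d)))"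
     using d0 xy by (intro add_mono mult_left_mono order_trans[OF E_PB_le] mult_mono order_trans[OF Ea] order_refl) auto
    also have "\<dots> = ennreal (4 * K * c1 * \<delta>) * E \<beta> d"
    proof -
     have "ennreal (4 * K * c1 * \<delta>) = 2 * (ennreal K * (ennreal c1 * ennreal \<delta>)) + 2 * (ennreal K * (ennreal c1 * ennreal \<delta>))"
      using K0 c1 \<delta> by (simp add: ennreal_mult[symmetric] ennreal_plus[symmetric] ennreal_numeral[symmetric] mult_ac del: ennreal_plus ennreal_numeral)
     then show ?thesis by (simp add: distrib_left distrib_right mult_ac)
    qed
    also have "ennreal (1 / \<nu>\<^sup>2) * (ennreal (4 * K * c1 * \<delta>) * E \<beta> d) = ennreal (4 * K * c1 * \<delta> / \<nu>\<^sup>2) * E \<beta> d"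
     using K0 c1 \<delta> by (simp add: mult.assoc[symmetric] ennreal_mult[symmetric])
    also have "\<dots> \<le> ennreal (1 / 8) * E \<beta> d" by (intro mult_right_mono ennreal_leI b2) auto
    finally show ?thesis by (simp add: d_def mult_left_mono)
   qed
   show "E \<beta> (\<lambda>k. x k - y k) \<le> 2 * (E \<beta> x + E \<beta> y)" for x y by (rule E_diff_le')
  qed simp_all
  then obtain p where p: "solenoidal p" "E \<beta> p \<le> ennreal \<delta>" "T p = p" by blast
  have "(\<nu> * lam k) *\<^sub>R p k = f k - PB p p k" for k
  proof (cases "k = 0")
   case True
   then show ?thesis using f by (simp add: V_iff solenoidal_at_0)
  next
   case False
   have "p k = (1 / (\<nu> * lam k)) *\<^sub>R (f k - PB p p k)" using fun_cong[OF p(3), of k] by (simp add: T_def)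
   then have "(\<nu> * lam k) *\<^sub>R p k = (\<nu> * lam k) *\<^sub>R ((1 / (\<nu> * lam k)) *\<^sub>R (f k - PB p p k))" by simp
   also have "\<dots> = f k - PB p p k" using lam_pos[OF False] False \<nu>1 by simp
   finally show ?thesis .
  qed
  then show ?thesis using p by (auto simp: stationary_def)
 qed
 moreover have "\<nu>0 \<ge> 1" using nn by (simp add: \<nu>0_def)
 ultimately show ?thesis by blast
qed

end

section \<open>Duhamel integrals\<close>

definition duhamel :: "real \<Rightarrow> (real \<Rightarrow> 'b :: {banach, second_countable_topology}) \<Rightarrow> real \<Rightarrow> 'b" where
 "duhamel \<kappa> h t = (\<integral>s. indicator {0..t} s *\<^sub>R (exp (- \<kappa> * (t - s)) *\<^sub>R h s) \<partial>lborel)"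

lemma nn_integral_exp_Icc_le:
 assumes "\<kappa> > 0"
 shows "(\<integral>\<^sup>+s. indicator {0..t} s * ennreal (exp (- \<kappa> * (t - s))) \<partial>lborel) \<le> ennreal (1 / \<kappa>)"
proof (cases "0 \<le> t")
 case True
 define F where "F = (\<lambda>s. exp (- \<kappa> * (t - s)) / \<kappa>)"
 have der: "(F has_vector_derivative exp (- \<kappa> * (t - s))) (at s within {0..t})" for s
  unfolding F_def has_real_derivative_iff_has_vector_derivative[symmetric]
  using assms by (auto intro!: derivative_eq_intros simp: field_simps)
 have c: "continuous_on {0..t} (\<lambda>s. exp (- \<kappa> * (t - s)))" by (intro continuous_intros)
 have "(\<integral>\<^sup>+s. indicator {0..t} s * ennreal (exp (- \<kappa> * (t - s))) \<partial>lborel)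
   = (\<integral>\<^sup>+s. ennreal (indicator {0..t} s *\<^sub>R exp (- \<kappa> * (t - s))) \<partial>lborel)"
  by (intro nn_integral_cong) (auto split: split_indicator)
 also have "\<dots> = ennreal (\<integral>s. indicator {0..t} s *\<^sub>R exp (- \<kappa> * (t - s)) \<partial>lborel)"
  by (intro nn_integral_eq_integral borel_integrable_compact compact_Icc c) auto
 also have "(\<integral>s. indicator {0..t} s *\<^sub>R exp (- \<kappa> * (t - s)) \<partial>lborel) = F t - F 0"
  using True by (intro integral_FTC_atLeastAtMost der c)
 also have "F t - F 0 \<le> 1 / \<kappa>" using assms by (simp add: F_def)
 finally show ?thesis by (simp add: ennreal_leI)
qed simp

lemma nn_integral_exp_atLeast:
 assumes "\<kappa> > 0"
 shows "(\<integral>\<^sup>+t. indicator {s..} t * ennreal (exp (- \<kappa> * (t - s))) \<partial>lborel) = ennreal (1 / \<kappa>)"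
proof -
 define F where "F = (\<lambda>t. - exp (- \<kappa> * (t - s)) / \<kappa>)"
 have "(\<integral>\<^sup>+t. ennreal (exp (- \<kappa> * (t - s))) * indicator {s..} t \<partial>lborel) = ennreal (0 - F s)"
 proof (rule nn_integral_FTC_atLeast)
  show "(F has_real_derivative exp (- \<kappa> * (t - s))) (at t)" for t
   unfolding F_def using assms by (auto intro!: derivative_eq_intros simp: field_simps)
  have "((\<lambda>t. exp (- \<kappa> * (t - s))) \<longlongrightarrow> 0) at_top"
  proof (rule filterlim_compose[OF exp_at_bot])
   have "filterlim (\<lambda>t. \<kappa> * (- s + t)) at_top at_top" using assms by (intro filterlim_tendsto_pos_mult_at_top[OF tendsto_const]
      filterlim_tendsto_add_at_top[OF tendsto_const filterlim_ident])
   then show "filterlim (\<lambda>t. - \<kappa> * (t - s)) at_bot at_top" by (simp add: filterlim_uminus_at_bot algebra_simps)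
  qed
  from tendsto_divide[OF tendsto_minus[OF this] tendsto_const, of \<kappa>] assms
  show "(F \<longlongrightarrow> 0) at_top" by (simp add: F_def)
 qed auto
 then show ?thesis by (simp add: F_def mult.commute)
qed

text \<open>
 Cauchy-Schwarz with respect to the kernel, whose total mass is at most \<open>1 / \<kappa>\<close>.
\<close>

lemma duhamel_pointwise:
 fixes h :: "real \<Rightarrow> 'b :: euclidean_space"
 assumes \<kappa>: "\<kappa> > 0" and h [measurable]: "h \<in> borel_measurable borel"
 shows "ennreal ((norm (duhamel \<kappa> h t))\<^sup>2)
  \<le> ennreal (1 / \<kappa>) * (\<integral>\<^sup>+s. indicator {0..t} s * ennreal (exp (- \<kappa> * (t - s))) * ennreal ((norm (h s))\<^sup>2) \<partial>lborel)"
proof -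
 define q where "q = (\<lambda>s. indicator {0..t} s * ennreal (exp (- \<kappa> * (t - s) / 2)))"
 have [measurable]: "q \<in> borel_measurable borel" unfolding q_def by measurable
 have qq: "(q s)\<^sup>2 = indicator {0..t} s * ennreal (exp (- \<kappa> * (t - s)))" for s
  by (auto simp: q_def ennreal_power exp_double[symmetric] split: split_indicator)
 have "ennreal (norm (duhamel \<kappa> h t)) \<le> (\<integral>\<^sup>+s. q s * (q s * ennreal (norm (h s))) \<partial>lborel)"
 proof (cases "integrable lborel (\<lambda>s. indicator {0..t} s *\<^sub>R (exp (- \<kappa> * (t - s)) *\<^sub>R h s))")
  case True
  then have "ennreal (norm (duhamel \<kappa> h t)) \<le> (\<integral>\<^sup>+s. ennreal (norm (indicator {0..t} s *\<^sub>R (exp (- \<kappa> * (t - s)) *\<^sub>R h s))) \<partial>lborel)"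
   unfolding duhamel_def by (rule integral_norm_bound_ennreal)
  also have "\<dots> = (\<integral>\<^sup>+s. q s * (q s * ennreal (norm (h s))) \<partial>lborel)"
  proof (intro nn_integral_cong)
   fix s
   have "q s * (q s * ennreal (norm (h s))) = (q s)\<^sup>2 * ennreal (norm (h s))" by (simp only: power2_eq_square mult.assoc)
   then show "ennreal (norm (indicator {0..t} s *\<^sub>R (exp (- \<kappa> * (t - s)) *\<^sub>R h s))) = q s * (q s * ennreal (norm (h s)))"
    unfolding qq by (auto simp: ennreal_mult split: split_indicator)
  qed
  finally show ?thesis .
 next
  case False
  then show ?thesis by (simp add: duhamel_def not_integrable_integral_eq)
 qed
 then have "(ennreal (norm (duhamel \<kappa> h t)))\<^sup>2 \<le> (\<integral>\<^sup>+s. q s * (q s * ennreal (norm (h s))) \<partial>lborel)\<^sup>2" by (intro power_mono) auto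
 also have "\<dots> \<le> (\<integral>\<^sup>+s. (q s)\<^sup>2 \<partial>lborel) * (\<integral>\<^sup>+s. (q s * ennreal (norm (h s)))\<^sup>2 \<partial>lborel)"
  by (rule Cauchy_Schwarz_nn_integral) auto
 also have "\<dots> \<le> ennreal (1 / \<kappa>) * (\<integral>\<^sup>+s. (q s * ennreal (norm (h s)))\<^sup>2 \<partial>lborel)"
  unfolding qq by (intro mult_right_mono nn_integral_exp_Icc_le \<kappa>) auto
 finally show ?thesis by (simp add: power_mult_distrib qq ennreal_power)
qed

lemma duhamel_sup:
 fixes h :: "real \<Rightarrow> 'b :: euclidean_space"
 assumes \<kappa>: "\<kappa> > 0" and h [measurable]: "h \<in> borel_measurable borel"
 shows "ennreal ((norm (duhamel \<kappa> h t))\<^sup>2) \<le> ennreal (1 / \<kappa>) * (\<integral>\<^sup>+s. ennreal ((norm (h s))\<^sup>2) * indicator {0..} s \<partial>lborel)"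
proof (rule order_trans[OF duhamel_pointwise[OF assms]], intro mult_left_mono nn_integral_mono)
 fix s
 show "indicator {0..t} s * ennreal (exp (- \<kappa> * (t - s))) * ennreal ((norm (h s))\<^sup>2) \<le> ennreal ((norm (h s))\<^sup>2) * indicator {0..} s"
 proof (cases "s \<in> {0..t}")
  case True
  then have "ennreal (exp (- \<kappa> * (t - s))) \<le> 1" using \<kappa> by (simp add: mult_nonneg_nonneg)
  then have "ennreal (exp (- \<kappa> * (t - s))) * ennreal ((norm (h s))\<^sup>2) \<le> 1 * ennreal ((norm (h s))\<^sup>2)"
   by (rule mult_right_mono) simp
  then show ?thesis using True by simp
 qed simp
qed simp

lemma measurable_duhamel:
 fixes h :: "real \<Rightarrow> 'b :: euclidean_space"
 assumes h [measurable]: "h \<in> borel_measurable borel"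
 shows "duhamel \<kappa> h \<in> borel_measurable borel"
proof -
 have m: "(\<lambda>p. (if 0 \<le> snd p \<and> snd p \<le> fst p then 1 else 0) *\<^sub>R (exp (- \<kappa> * (fst p - snd p)) *\<^sub>R h (snd p))) \<in> borel_measurable (lborel \<Otimes>\<^sub>M lborel)"
  by measurable
 have eq: "(\<lambda>p. (if 0 \<le> snd p \<and> snd p \<le> fst p then 1 else 0) *\<^sub>R (exp (- \<kappa> * (fst p - snd p)) *\<^sub>R h (snd p)))
   = (\<lambda>(t, s). indicator {0..t} s *\<^sub>R (exp (- \<kappa> * (t - s)) *\<^sub>R h s))" by (auto simp: fun_eq_iff split: split_indicator)
 have "(\<lambda>t. \<integral>s. indicator {0..t} s *\<^sub>R (exp (- \<kappa> * (t - s)) *\<^sub>R h s) \<partial>lborel) \<in> borel_measurable lborel"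
  using m unfolding eq by (rule lborel.borel_measurable_lebesgue_integral)
 then show ?thesis by (simp add: duhamel_def[abs_def])
qed

text \<open>
 Integrating the pointwise bound over \<open>t\<close> and exchanging the integrals gives the second factor \<open>1 / \<kappa>\<close>.
\<close>

lemma duhamel_L2:
 fixes h :: "real \<Rightarrow> 'b :: euclidean_space"
 assumes \<kappa>: "\<kappa> > 0" and h [measurable]: "h \<in> borel_measurable borel"
 shows "(\<integral>\<^sup>+t. ennreal ((norm (duhamel \<kappa> h t))\<^sup>2) \<partial>lborel) \<le> ennreal (1 / \<kappa>\<^sup>2) * (\<integral>\<^sup>+s. ennreal ((norm (h s))\<^sup>2) * indicator {0..} s \<partial>lborel)"
proof -
 define G where "G = (\<lambda>t s. (if 0 \<le> s \<and> s \<le> t then 1 else 0) * ennreal (exp (- \<kappa> * (t - s))) * ennreal ((norm (h s))\<^sup>2))"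
 have [measurable]: "case_prod G \<in> borel_measurable (lborel \<Otimes>\<^sub>M lborel)" unfolding G_def by measurable
 have "(\<integral>\<^sup>+t. ennreal ((norm (duhamel \<kappa> h t))\<^sup>2) \<partial>lborel) \<le> (\<integral>\<^sup>+t. ennreal (1 / \<kappa>) * (\<integral>\<^sup>+s. G t s \<partial>lborel) \<partial>lborel)"
 proof (rule nn_integral_mono)
  fix t
  have "(\<lambda>s. indicator {0..t} s * ennreal (exp (- \<kappa> * (t - s))) * ennreal ((norm (h s))\<^sup>2)) = G t"
   by (auto simp: G_def fun_eq_iff split: split_indicator)
  then show "ennreal ((norm (duhamel \<kappa> h t))\<^sup>2) \<le> ennreal (1 / \<kappa>) * (\<integral>\<^sup>+s. G t s \<partial>lborel)"
   using duhamel_pointwise[OF assms, of t] by simp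
 qed
 also have "\<dots> = ennreal (1 / \<kappa>) * (\<integral>\<^sup>+t. \<integral>\<^sup>+s. G t s \<partial>lborel \<partial>lborel)" by (rule nn_integral_cmult) measurable
 also have "(\<integral>\<^sup>+t. \<integral>\<^sup>+s. G t s \<partial>lborel \<partial>lborel) = (\<integral>\<^sup>+s. \<integral>\<^sup>+t. G t s \<partial>lborel \<partial>lborel)"
  by (rule lborel_pair.Fubini'[symmetric]) measurable
 also have "\<dots> = (\<integral>\<^sup>+s. ennreal (1 / \<kappa>) * (ennreal ((norm (h s))\<^sup>2) * indicator {0..} s) \<partial>lborel)"
 proof (intro nn_integral_cong)
  fix s
  show "(\<integral>\<^sup>+t. G t s \<partial>lborel) = ennreal (1 / \<kappa>) * (ennreal ((norm (h s))\<^sup>2) * indicator {0..} s)"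
  proof (cases "0 \<le> s")
   case True
   have "(\<integral>\<^sup>+t. G t s \<partial>lborel) = (\<integral>\<^sup>+t. (indicator {s..} t * ennreal (exp (- \<kappa> * (t - s)))) * ennreal ((norm (h s))\<^sup>2) \<partial>lborel)"
    using True by (intro nn_integral_cong) (auto simp: G_def split: split_indicator)
   also have "\<dots> = (\<integral>\<^sup>+t. indicator {s..} t * ennreal (exp (- \<kappa> * (t - s))) \<partial>lborel) * ennreal ((norm (h s))\<^sup>2)"
    by (rule nn_integral_multc) measurable
   finally show ?thesis unfolding nn_integral_exp_atLeast[OF \<kappa>] using True by simp
  qed (simp add: G_def)
 qed
 also have "\<dots> = ennreal (1 / \<kappa>) * (\<integral>\<^sup>+s. ennreal ((norm (h s))\<^sup>2) * indicator {0..} s \<partial>lborel)"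
  by (rule nn_integral_cmult) measurable
 finally show ?thesis using \<kappa> by (simp add: mult.assoc[symmetric] ennreal_mult[symmetric] power2_eq_square)
qed

section \<open>The space of decaying perturbations\<close>

context torus
begin

text \<open>
 The supremum over time is taken inside the sum over modes. This is stronger than a bound on \<open>E \<alpha> (z t)\<close> uniform in
 \<open>t\<close>, yet the Duhamel integral satisfies it, and it yields continuity in time by dominated convergence.
\<close>

definition Qa :: "(real \<Rightarrow> field) \<Rightarrow> ennreal" where
 "Qa z = (\<Sum>\<^sup>+k. (SUP t. ennreal (lam k powr \<alpha> * (norm (z t k))\<^sup>2)))"

definition Qb :: "(real \<Rightarrow> field) \<Rightarrow> ennreal" where
 "Qb z = (\<Sum>\<^sup>+k. \<integral>\<^sup>+t. ennreal (lam k powr \<beta> * (norm (z t k))\<^sup>2) \<partial>lborel)"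

definition Q :: "(real \<Rightarrow> field) \<Rightarrow> ennreal" where
 "Q z = max (Qa z) (Qb z)"

definition perturbation :: "(real \<Rightarrow> field) \<Rightarrow> bool" where
 "perturbation z \<longleftrightarrow> borel_field z \<and> (\<forall>t. solenoidal (z t)) \<and> (\<forall>t<0. z t = (\<lambda>k. 0))"

lemma Eint_Tonelli:
 assumes u: "borel_field u" and I [measurable]: "I \<in> sets borel"
 shows "Eint s I u = (\<Sum>\<^sup>+k. ennreal (lam k powr s) * (\<integral>\<^sup>+t. ennreal ((norm (u t k))\<^sup>2) * indicator I t \<partial>lborel))"
proof -
 interpret P: pair_sigma_finite "lborel :: real measure" "count_space UNIV :: (int ^ 3) measure"
  by (intro pair_sigma_finite.intro sigma_finite_measure_count_space sigma_finite_lborel)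
 have um [measurable]: "(\<lambda>t. u t k) \<in> borel_measurable borel" for k using u by (simp add: borel_field_def)
 let ?g = "\<lambda>t k. ennreal (lam k powr s) * (ennreal ((norm (u t k))\<^sup>2) * indicator I t)"
 have "(\<lambda>p. (\<lambda>k t. ?g t k) (snd p) (fst p)) \<in> borel_measurable (lborel \<Otimes>\<^sub>M count_space UNIV)"
  by (rule measurable_compose_countable'[where I = UNIV and g = snd])
    (auto intro!: measurable_compose[OF measurable_fst])
 then have m: "case_prod ?g \<in> borel_measurable (lborel \<Otimes>\<^sub>M count_space UNIV)" by (simp add: split_beta')
 have "Eint s I u = (\<integral>\<^sup>+t. \<integral>\<^sup>+k. ?g t k \<partial>count_space UNIV \<partial>lborel)" unfolding Eint_def E_def
  by (intro nn_integral_cong) (auto simp: ennreal_mult nn_integral_multc[symmetric] mult.assoc)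
 also have "\<dots> = (\<Sum>\<^sup>+k. \<integral>\<^sup>+t. ?g t k \<partial>lborel)" by (rule P.Fubini'[OF m, symmetric])
 also have "\<dots> = (\<Sum>\<^sup>+k. ennreal (lam k powr s) * (\<integral>\<^sup>+t. ennreal ((norm (u t k))\<^sup>2) * indicator I t \<partial>lborel))"
  by (intro nn_integral_cong nn_integral_cmult) measurable
 finally show ?thesis .
qed

lemma Qb_eq: "borel_field z \<Longrightarrow> Qb z = Eint \<beta> UNIV z"
proof -
 assume z: "borel_field z"
 have [measurable]: "(\<lambda>t. z t k) \<in> borel_measurable borel" for k using z by (simp add: borel_field_def)
 have "(\<integral>\<^sup>+t. ennreal (lam k powr \<beta> * (norm (z t k))\<^sup>2) \<partial>lborel) = ennreal (lam k powr \<beta>) * (\<integral>\<^sup>+t. ennreal ((norm (z t k))\<^sup>2) * indicator UNIV t \<partial>lborel)" for k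
  by (subst nn_integral_cmult[symmetric]) (auto simp: ennreal_mult)
 then show ?thesis unfolding Qb_def by (subst Eint_Tonelli[OF z]) simp_all
qed

lemma E_le_Qa: "E \<alpha> (z t) \<le> Qa z"
 unfolding E_def Qa_def by (intro nn_integral_mono SUP_upper) auto

lemma Qa_le_Q: "Qa z \<le> Q z" and Qb_le_Q: "Qb z \<le> Q z"
 by (auto simp: Q_def)

lemma ennreal_weighted_diff_le:
 assumes "0 \<le> w"
 shows "ennreal (w * (norm (x - y))\<^sup>2) \<le> 2 * (ennreal (w * (norm x)\<^sup>2) + ennreal (w * (norm (y :: 'a :: real_normed_vector))\<^sup>2))"
proof -
 have "w * (norm (x - y))\<^sup>2 \<le> w * (2 * (norm x)\<^sup>2 + 2 * (norm y)\<^sup>2)"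
  using norm_add_sq_weighted_le[of 1 x "- y"] assms by (intro mult_left_mono) auto
 then have "ennreal (w * (norm (x - y))\<^sup>2) \<le> ennreal (2 * (w * (norm x)\<^sup>2 + w * (norm y)\<^sup>2))"
  by (intro ennreal_leI) (simp add: algebra_simps)
 also have "\<dots> = 2 * (ennreal (w * (norm x)\<^sup>2) + ennreal (w * (norm y)\<^sup>2))" using assms by (simp add: ennreal_mult ennreal_plus)
 finally show ?thesis .
qed

lemma Q_diff_le:
 assumes "borel_field x" "borel_field y"
 shows "Q (\<lambda>t k. x t k - y t k) \<le> 2 * (Q x + Q y)"
proof -
 have [measurable]: "(\<lambda>t. x t k) \<in> borel_measurable borel" "(\<lambda>t. y t k) \<in> borel_measurable borel" for k
  using assms by (auto simp: borel_field_def)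
 have "Qa (\<lambda>t k. x t k - y t k) \<le> (\<Sum>\<^sup>+k. 2 * ((SUP t. ennreal (lam k powr \<alpha> * (norm (x t k))\<^sup>2)) + (SUP t. ennreal (lam k powr \<alpha> * (norm (y t k))\<^sup>2))))"
  unfolding Qa_def
  by (intro nn_integral_mono SUP_least order_trans[OF ennreal_weighted_diff_le] mult_left_mono add_mono SUP_upper) auto
 also have "\<dots> = 2 * (Qa x + Qa y)" unfolding Qa_def by (simp add: nn_integral_cmult nn_integral_add)
 also have "\<dots> \<le> 2 * (Q x + Q y)" by (intro mult_left_mono add_mono Qa_le_Q) auto
 finally have a: "Qa (\<lambda>t k. x t k - y t k) \<le> 2 * (Q x + Q y)" .
 have "Qb (\<lambda>t k. x t k - y t k) \<le> (\<Sum>\<^sup>+k. \<integral>\<^sup>+t. 2 * (ennreal (lam k powr \<beta> * (norm (x t k))\<^sup>2) + ennreal (lam k powr \<beta> * (norm (y t k))\<^sup>2)) \<partial>lborel)"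
  unfolding Qb_def by (intro nn_integral_mono ennreal_weighted_diff_le) auto
 also have "\<dots> = 2 * (Qb x + Qb y)" unfolding Qb_def by (simp add: nn_integral_cmult nn_integral_add)
 also have "\<dots> \<le> 2 * (Q x + Q y)" by (intro mult_left_mono add_mono Qb_le_Q) auto
 finally have "Qb (\<lambda>t k. x t k - y t k) \<le> 2 * (Q x + Q y)" .
 with a show ?thesis by (simp add: Q_def)
qed

lemma Q_liminf:
 assumes X: "\<And>n. borel_field (X n)" and lim: "\<And>t k. (\<lambda>n. X n t k) \<longlonglongrightarrow> x t k" and b: "\<And>n. Q (X n) \<le> b"
 shows "Q x \<le> b"
proof -
 have [measurable]: "(\<lambda>t. X n t k) \<in> borel_measurable borel" for n k using X by (auto simp: borel_field_def)
 have li: "ennreal (c * (norm (x t k))\<^sup>2) = liminf (\<lambda>n. ennreal (c * (norm (X n t k))\<^sup>2))" for c t k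
  by (intro lim_imp_Liminf[symmetric] tendsto_ennrealI tendsto_mult tendsto_const tendsto_power tendsto_norm lim) simp
 have lb: "liminf f \<le> b" if "\<And>n. f n \<le> b" for f :: "nat \<Rightarrow> ennreal"
  by (rule order_trans[OF Liminf_mono[where g = "\<lambda>n. b"]]) (auto simp: that Liminf_const)
 have "Qa x \<le> (\<Sum>\<^sup>+k. liminf (\<lambda>n. SUP t. ennreal (lam k powr \<alpha> * (norm (X n t k))\<^sup>2)))" unfolding Qa_def
 proof (intro nn_integral_mono SUP_least)
  fix k t
  show "ennreal (lam k powr \<alpha> * (norm (x t k))\<^sup>2) \<le> liminf (\<lambda>n. SUP t. ennreal (lam k powr \<alpha> * (norm (X n t k))\<^sup>2))"
   unfolding li by (intro Liminf_mono always_eventually allI SUP_upper) auto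
 qed
 also have "\<dots> \<le> liminf (\<lambda>n. Qa (X n))" unfolding Qa_def by (rule nn_integral_liminf) auto
 also have "\<dots> \<le> b" using order_trans[OF Qa_le_Q b] by (rule lb)
 finally have a: "Qa x \<le> b" .
 have "Qb x \<le> (\<Sum>\<^sup>+k. liminf (\<lambda>n. \<integral>\<^sup>+t. ennreal (lam k powr \<beta> * (norm (X n t k))\<^sup>2) \<partial>lborel))"
  unfolding Qb_def li by (intro nn_integral_mono nn_integral_liminf) measurable
 also have "\<dots> \<le> liminf (\<lambda>n. Qb (X n))" unfolding Qb_def by (rule nn_integral_liminf) auto
 also have "\<dots> \<le> b" using order_trans[OF Qb_le_Q b] by (rule lb)
 finally show ?thesis using a by (simp add: Q_def)
qed

lemma borel_field_shift:
 assumes "borel_field u"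
 shows "borel_field (\<lambda>t. u (t + c))"
proof -
 have "(\<lambda>t. u t k) \<in> borel_measurable borel" for k using assms by (simp add: borel_field_def)
 then have "(\<lambda>t. u (t + c) k) \<in> borel_measurable borel" for k
  using measurable_compose[of "\<lambda>t. t + c" borel borel "\<lambda>t. u t k" borel] by simp
 then show ?thesis by (simp add: borel_field_def)
qed

text \<open>
 Parabolic regularity. The linear equation gains one derivative uniformly in time and two in the time integral. Both gains come with a
 negative power of \<open>\<nu>\<close>, the only source of smallness in the contraction below.
\<close>

lemma Q_duhamel:
 assumes H: "borel_field H" and \<nu>: "1 \<le> \<nu>" and \<kappa>: "\<And>k. k \<noteq> 0 \<Longrightarrow> \<nu> * lam k / 2 \<le> \<kappa> k"
 shows "Q (\<lambda>t k. duhamel (\<kappa> k) (\<lambda>s. H s k) t) \<le> ennreal (4 / \<nu>) * Eint (\<alpha> - 1) {0..} H"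
proof -
 have [measurable]: "(\<lambda>t. H t k) \<in> borel_measurable borel" for k using H by (auto simp: borel_field_def)
 define N where "N = (\<lambda>k. \<integral>\<^sup>+s. ennreal ((norm (H s k))\<^sup>2) * indicator {0..} s \<partial>lborel)"
 have EN: "Eint (\<alpha> - 1) {0..} H = (\<Sum>\<^sup>+k. ennreal (lam k powr (\<alpha> - 1)) * N k)" unfolding N_def by (rule Eint_Tonelli[OF H]) simp
 have a: "(SUP t. ennreal (lam k powr \<alpha> * (norm (duhamel (\<kappa> k) (\<lambda>s. H s k) t))\<^sup>2)) \<le> ennreal (4 / \<nu>) * (ennreal (lam k powr (\<alpha> - 1)) * N k)" (is "?A k")
  and b: "(\<integral>\<^sup>+t. ennreal (lam k powr \<beta> * (norm (duhamel (\<kappa> k) (\<lambda>s. H s k) t))\<^sup>2) \<partial>lborel) \<le> ennreal (4 / \<nu>) * (ennreal (lam k powr (\<alpha> - 1)) * N k)" (is "?B k") for k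
 proof -
  have "?A k \<and> ?B k"
  proof (cases "k = 0")
   case False
   have l: "0 < lam k" by (rule lam_pos[OF False])
   have \<nu>l: "0 < \<nu> * lam k / 2" using l \<nu> by simp
   have \<kappa>p: "0 < \<kappa> k" using \<kappa>[OF False] \<nu>l by linarith
   have inv: "1 / \<kappa> k \<le> 2 / (\<nu> * lam k)"
   proof -
    have "1 / \<kappa> k \<le> 1 / (\<nu> * lam k / 2)" by (rule frac_le) (use \<kappa>[OF False] \<nu>l in auto)
    then show ?thesis by simp
   qed
   have em: "ennreal (4 / \<nu> * lam k powr (\<alpha> - 1)) = ennreal (4 / \<nu>) * ennreal (lam k powr (\<alpha> - 1))"
    using \<nu> by (intro ennreal_mult) auto
   have p1: "lam k powr \<alpha> = lam k powr (\<alpha> - 1) * lam k" using l by (simp add: powr_diff)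
   have p2: "lam k powr \<beta> = lam k powr (\<alpha> - 1) * (lam k)\<^sup>2" using l by (simp add: powr_diff powr_add power2_eq_square)
   have c1: "lam k powr \<alpha> * (1 / \<kappa> k) \<le> 4 / \<nu> * lam k powr (\<alpha> - 1)"
   proof -
    have "lam k powr \<alpha> * (1 / \<kappa> k) \<le> lam k powr \<alpha> * (2 / (\<nu> * lam k))" by (intro mult_left_mono inv) auto
    also have "\<dots> = 2 / \<nu> * lam k powr (\<alpha> - 1)" using l \<nu> by (simp add: p1)
    also have "\<dots> \<le> 4 / \<nu> * lam k powr (\<alpha> - 1)" using \<nu> by (intro mult_right_mono divide_right_mono) auto
    finally show ?thesis .
   qed
   have c2: "lam k powr \<beta> * (1 / (\<kappa> k)\<^sup>2) \<le> 4 / \<nu> * lam k powr (\<alpha> - 1)"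
   proof -
    have "1 / (\<kappa> k)\<^sup>2 = (1 / \<kappa> k)\<^sup>2" by (simp add: power_divide)
    also have "\<dots> \<le> (2 / (\<nu> * lam k))\<^sup>2" using \<kappa>p by (intro power_mono inv) auto
    finally have "lam k powr \<beta> * (1 / (\<kappa> k)\<^sup>2) \<le> lam k powr \<beta> * (2 / (\<nu> * lam k))\<^sup>2" by (intro mult_left_mono) auto
    also have "\<dots> = 4 / \<nu>\<^sup>2 * lam k powr (\<alpha> - 1)" using l \<nu> by (simp add: p2 power_divide power_mult_distrib)
    also have "\<dots> \<le> 4 / \<nu> * lam k powr (\<alpha> - 1)" using \<nu> by (intro mult_right_mono divide_left_mono) (auto simp: power2_eq_square)
    finally show ?thesis .
   qed
   have A: "?A k"
   proof (rule SUP_least)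
    fix t
    have "ennreal (lam k powr \<alpha> * (norm (duhamel (\<kappa> k) (\<lambda>s. H s k) t))\<^sup>2)
      = ennreal (lam k powr \<alpha>) * ennreal ((norm (duhamel (\<kappa> k) (\<lambda>s. H s k) t))\<^sup>2)" by (simp add: ennreal_mult)
    also have "\<dots> \<le> ennreal (lam k powr \<alpha>) * (ennreal (1 / \<kappa> k) * N k)"
     unfolding N_def by (intro mult_left_mono duhamel_sup[OF \<kappa>p]) auto
    also have "\<dots> = ennreal (lam k powr \<alpha> * (1 / \<kappa> k)) * N k" using \<kappa>p by (simp add: ennreal_mult[symmetric] mult.assoc[symmetric])
    also have "\<dots> \<le> ennreal (4 / \<nu> * lam k powr (\<alpha> - 1)) * N k" by (intro mult_right_mono ennreal_leI c1) auto
    also have "\<dots> = ennreal (4 / \<nu>) * (ennreal (lam k powr (\<alpha> - 1)) * N k)" by (simp only: em mult.assoc)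
    finally show "ennreal (lam k powr \<alpha> * (norm (duhamel (\<kappa> k) (\<lambda>s. H s k) t))\<^sup>2) \<le> ennreal (4 / \<nu>) * (ennreal (lam k powr (\<alpha> - 1)) * N k)" .
   qed
   have [measurable]: "duhamel (\<kappa> k) (\<lambda>s. H s k) \<in> borel_measurable borel" by (rule measurable_duhamel) measurable
   have "(\<integral>\<^sup>+t. ennreal (lam k powr \<beta> * (norm (duhamel (\<kappa> k) (\<lambda>s. H s k) t))\<^sup>2) \<partial>lborel)
     = ennreal (lam k powr \<beta>) * (\<integral>\<^sup>+t. ennreal ((norm (duhamel (\<kappa> k) (\<lambda>s. H s k) t))\<^sup>2) \<partial>lborel)"
    by (subst nn_integral_cmult[symmetric]) (auto simp: ennreal_mult)
   also have "\<dots> \<le> ennreal (lam k powr \<beta>) * (ennreal (1 / (\<kappa> k)\<^sup>2) * N k)"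
    unfolding N_def by (intro mult_left_mono duhamel_L2[OF \<kappa>p]) auto
   also have "\<dots> = ennreal (lam k powr \<beta> * (1 / (\<kappa> k)\<^sup>2)) * N k" by (simp add: ennreal_mult[symmetric] mult.assoc[symmetric])
   also have "\<dots> \<le> ennreal (4 / \<nu> * lam k powr (\<alpha> - 1)) * N k" by (intro mult_right_mono ennreal_leI c2) auto
   also have "\<dots> = ennreal (4 / \<nu>) * (ennreal (lam k powr (\<alpha> - 1)) * N k)" by (simp only: em mult.assoc)
   finally show ?thesis using A by simp
  qed simp
  then show "?A k" "?B k" by auto
 qed
 have c: "(\<Sum>\<^sup>+k. ennreal (4 / \<nu>) * (ennreal (lam k powr (\<alpha> - 1)) * N k)) = ennreal (4 / \<nu>) * Eint (\<alpha> - 1) {0..} H"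
  unfolding EN by (rule nn_integral_cmult) simp
 have "Qa (\<lambda>t k. duhamel (\<kappa> k) (\<lambda>s. H s k) t) \<le> ennreal (4 / \<nu>) * Eint (\<alpha> - 1) {0..} H"
  unfolding Qa_def c[symmetric] by (intro nn_integral_mono a)
 moreover have "Qb (\<lambda>t k. duhamel (\<kappa> k) (\<lambda>s. H s k) t) \<le> ennreal (4 / \<nu>) * Eint (\<alpha> - 1) {0..} H"
  unfolding Qb_def c[symmetric] by (intro nn_integral_mono b)
 ultimately show ?thesis by (simp add: Q_def)
qed

lemma Q_heat:
 assumes w: "w 0 = 0" and \<nu>: "1 \<le> \<nu>" and \<kappa>: "\<And>k. k \<noteq> 0 \<Longrightarrow> \<nu> * lam k / 2 \<le> \<kappa> k"
 shows "Q (\<lambda>t k. (indicator {0..} t * exp (- \<kappa> k * t)) *\<^sub>R w k) \<le> E \<alpha> w"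
proof -
 let ?y = "\<lambda>t k. (indicator {0..} t * exp (- \<kappa> k * t)) *\<^sub>R w k"
 have AB: "(SUP t. ennreal (lam k powr \<alpha> * (norm (?y t k))\<^sup>2)) \<le> ennreal (lam k powr \<alpha> * (norm (w k))\<^sup>2) \<and>
   (\<integral>\<^sup>+t. ennreal (lam k powr \<beta> * (norm (?y t k))\<^sup>2) \<partial>lborel) \<le> ennreal (lam k powr \<alpha> * (norm (w k))\<^sup>2)" for k
 proof (cases "k = 0")
  case False
  have l: "0 < lam k" by (rule lam_pos[OF False])
  have \<nu>l: "0 < \<nu> * lam k / 2" using l \<nu> by simp
  have \<kappa>p: "0 < \<kappa> k" using \<kappa>[OF False] \<nu>l by linarith
  have "ennreal (lam k powr \<alpha> * (norm (?y t k))\<^sup>2) \<le> ennreal (lam k powr \<alpha> * (norm (w k))\<^sup>2)" for t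
  proof (intro ennreal_leI mult_left_mono power_mono)
   have "\<bar>indicator {0..} t * exp (- \<kappa> k * t)\<bar> \<le> 1" using \<kappa>p by (auto split: split_indicator)
   then show "norm (?y t k) \<le> norm (w k)" by (simp add: mult_left_le_one_le)
  qed auto
  then have 1: "(SUP t. ennreal (lam k powr \<alpha> * (norm (?y t k))\<^sup>2)) \<le> ennreal (lam k powr \<alpha> * (norm (w k))\<^sup>2)"
   by (intro SUP_least)
  have "(\<integral>\<^sup>+t. ennreal (lam k powr \<beta> * (norm (?y t k))\<^sup>2) \<partial>lborel)
    = (\<integral>\<^sup>+t. (indicator {0..} t * ennreal (exp (- (2 * \<kappa> k) * (t - 0)))) * ennreal (lam k powr \<beta> * (norm (w k))\<^sup>2) \<partial>lborel)"
  proof (intro nn_integral_cong)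
   fix t
   have "(exp (- \<kappa> k * t))\<^sup>2 = exp (- (2 * \<kappa> k) * (t - 0))" by (simp add: power2_eq_square exp_add[symmetric])
   then show "ennreal (lam k powr \<beta> * (norm (?y t k))\<^sup>2)
    = (indicator {0..} t * ennreal (exp (- (2 * \<kappa> k) * (t - 0)))) * ennreal (lam k powr \<beta> * (norm (w k))\<^sup>2)"
    by (auto simp: power_mult_distrib ennreal_mult[symmetric] mult_ac split: split_indicator)
  qed
  also have "\<dots> = (\<integral>\<^sup>+t. indicator {0..} t * ennreal (exp (- (2 * \<kappa> k) * (t - 0))) \<partial>lborel) * ennreal (lam k powr \<beta> * (norm (w k))\<^sup>2)"
   by (rule nn_integral_multc) measurable
  also have "\<dots> = ennreal (1 / (2 * \<kappa> k) * (lam k powr \<beta> * (norm (w k))\<^sup>2))"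
   using \<kappa>p by (subst nn_integral_exp_atLeast) (auto simp: ennreal_mult[symmetric] less_imp_le)
  also have "\<dots> \<le> ennreal (lam k powr \<alpha> * (norm (w k))\<^sup>2)"
  proof (rule ennreal_leI)
   have "lam k \<le> \<nu> * lam k" using l \<nu> by simp
   then have "lam k \<le> 2 * \<kappa> k" using \<kappa>[OF False] by linarith
   then have "1 / (2 * \<kappa> k) * lam k \<le> 1" using \<kappa>p by simp
   then have "(1 / (2 * \<kappa> k) * lam k) * (lam k powr \<alpha> * (norm (w k))\<^sup>2) \<le> 1 * (lam k powr \<alpha> * (norm (w k))\<^sup>2)"
    by (rule mult_right_mono) auto
   then show "1 / (2 * \<kappa> k) * (lam k powr \<beta> * (norm (w k))\<^sup>2) \<le> lam k powr \<alpha> * (norm (w k))\<^sup>2"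
    using l by (simp add: powr_add mult.assoc)
  qed
  finally show ?thesis using 1 by simp
 qed (simp add: w)
 have "Qa ?y \<le> E \<alpha> w" unfolding Qa_def E_def using AB by (intro nn_integral_mono) blast
 moreover have "Qb ?y \<le> E \<alpha> w" unfolding Qb_def E_def using AB by (intro nn_integral_mono) blast
 ultimately show ?thesis by (simp add: Q_def)
qed

section \<open>Existence of decaying perturbations of a stationary solution\<close>

text \<open>
 The decay rate of a mode after the factor \<open>exp (- t)\<close> has been split off.
\<close>

definition kap :: "real \<Rightarrow> int ^ 3 \<Rightarrow> real" where
 "kap \<nu> k = \<nu> * lam k - 1"

definition hist :: "real \<Rightarrow> (real \<Rightarrow> field) \<Rightarrow> (real \<Rightarrow> field) \<Rightarrow> real \<Rightarrow> field" where
 "hist \<mu> h z s = (\<lambda>k. h (s - \<mu>) k + z (s - \<mu>) k)"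

text \<open>
 If \<open>u = p + exp (- t) z\<close> with a history of the same form, then \<open>B(u(s - \<mu>), u(s)) - B(p, p)\<close> is \<open>exp
 (- s)\<close> times this field. The delayed factor is \<open>exp (\<mu> - s)\<close> times \<open>hist\<close>, hence the weights.
\<close>

definition nonlin :: "real \<Rightarrow> field \<Rightarrow> (real \<Rightarrow> field) \<Rightarrow> (real \<Rightarrow> field) \<Rightarrow> real \<Rightarrow> field" where
 "nonlin \<mu> p h z s = (\<lambda>k. PB p (z s) k + exp (\<mu> - s) *\<^sub>R PB (hist \<mu> h z s) (z s) k + exp \<mu> *\<^sub>R PB (hist \<mu> h z s) p k)"

definition evolve :: "real \<Rightarrow> real \<Rightarrow> field \<Rightarrow> (real \<Rightarrow> field) \<Rightarrow> field \<Rightarrow> (real \<Rightarrow> field) \<Rightarrow> real \<Rightarrow> field" where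
 "evolve \<nu> \<mu> p h w z t = (\<lambda>k. (indicator {0..} t * exp (- kap \<nu> k * t)) *\<^sub>R w k - duhamel (kap \<nu> k) (\<lambda>s. nonlin \<mu> p h z s k) t)"

lemma kap_ge: "2 \<le> \<nu> * lam1 \<Longrightarrow> 0 < \<nu> \<Longrightarrow> k \<noteq> 0 \<Longrightarrow> \<nu> * lam k / 2 \<le> kap \<nu> k"
proof -
 assume *: "2 \<le> \<nu> * lam1" "0 < \<nu>" "k \<noteq> 0"
 then have "\<nu> * lam1 \<le> \<nu> * lam k" by (intro mult_left_mono lam_ge) auto
 with * show ?thesis unfolding kap_def by linarith
qed

lemma borel_hist:
 assumes "borel_field h" "borel_field z"
 shows "borel_field (hist \<mu> h z)"
proof -
 have "borel_field (\<lambda>s. h (s - \<mu>))" "borel_field (\<lambda>s. z (s - \<mu>))"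
  using borel_field_shift[OF assms(1), of "- \<mu>"] borel_field_shift[OF assms(2), of "- \<mu>"] by simp_all
 then have [measurable]: "(\<lambda>s. h (s - \<mu>) k) \<in> borel_measurable borel" "(\<lambda>s. z (s - \<mu>) k) \<in> borel_measurable borel" for k
  by (auto simp: borel_field_def)
 show ?thesis unfolding borel_field_def hist_def by measurable
qed

lemma borel_nonlin:
 assumes "borel_field h" "borel_field z"
 shows "borel_field (nonlin \<mu> p h z)"
proof -
 have c: "borel_field (\<lambda>s. p)" by (simp add: borel_field_def)
 have "borel_field (\<lambda>s. PB p (z s))" "borel_field (\<lambda>s. PB (hist \<mu> h z s) (z s))" "borel_field (\<lambda>s. PB (hist \<mu> h z s) p)"
  by (intro borel_PB borel_hist assms c)+
 then have [measurable]: "(\<lambda>s. PB p (z s) k) \<in> borel_measurable borel" "(\<lambda>s. PB (hist \<mu> h z s) (z s) k) \<in> borel_measurable borel"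
  "(\<lambda>s. PB (hist \<mu> h z s) p k) \<in> borel_measurable borel" for k by (auto simp: borel_field_def)
 show ?thesis unfolding borel_field_def nonlin_def by measurable
qed

lemma solenoidal_hist: "solenoidal (h (s - \<mu>)) \<Longrightarrow> solenoidal (z (s - \<mu>)) \<Longrightarrow> solenoidal (hist \<mu> h z s)"
 unfolding hist_def by (rule solenoidal_add)

lemma solenoidal_integral:
 assumes g: "\<And>s. solenoidal (g s)" and c: "\<And>k s. c (- k) s = c k s"
 shows "solenoidal (\<lambda>k. \<integral>s. (c k s :: real) *\<^sub>R g s k \<partial>M)"
proof -
 define cv where "cv = (\<lambda>z :: complex ^ 3. \<chi> i. cnj (z $ i))"
 have cv: "bounded_linear cv"
 proof (rule bounded_linear_intro[where K = 1])
  show "norm (cv x) \<le> norm x * 1" for x by (simp add: cv_def norm_vec_def)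
 qed (auto simp: cv_def vec_eq_iff)
 have cvcv: "cv (cv z) = z" for z by (simp add: cv_def vec_eq_iff)
 have gm: "g s (- k) = cv (g s k)" for s k using g[of s] by (simp add: solenoidal_def cv_def vec_eq_iff)
 have "(\<integral>s. c (- k) s *\<^sub>R g s (- k) \<partial>M) = (\<integral>s. cv (c k s *\<^sub>R g s k) \<partial>M)" for k
  unfolding gm c by (simp add: linear_cmul[OF bounded_linear.linear[OF cv]])
 also have "(\<integral>s. cv (c k s *\<^sub>R g s k) \<partial>M) = cv (\<integral>s. c k s *\<^sub>R g s k \<partial>M)" for k
  by (rule integral_bounded_linear'[OF cv cv]) (auto simp: cvcv)
 finally have 1: "(\<integral>s. c (- k) s *\<^sub>R g s (- k) \<partial>M) = cv (\<integral>s. c k s *\<^sub>R g s k \<partial>M)" for k .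
 have 2: "kdot k (\<integral>s. c k s *\<^sub>R g s k \<partial>M) = 0" for k
 proof (cases "integrable M (\<lambda>s. c k s *\<^sub>R g s k)")
  case True
  have "kdot k (\<integral>s. c k s *\<^sub>R g s k \<partial>M) = (\<integral>s. kdot k (c k s *\<^sub>R g s k) \<partial>M)"
   by (rule integral_bounded_linear[OF bounded_linear_kdot True, symmetric])
  also have "\<dots> = 0" by (simp add: kdot_scaleR kdot_solenoidal[OF g])
  finally show ?thesis .
 qed (simp add: not_integrable_integral_eq kdot_def)
 show ?thesis unfolding solenoidal_def
 proof (intro conjI allI)
  show "(\<integral>s. c 0 s *\<^sub>R g s 0 \<partial>M) = 0" by (simp add: solenoidal_at_0[OF g])
  show "(\<Sum>i\<in>UNIV. of_int (k $ i) * (\<integral>s. c k s *\<^sub>R g s k \<partial>M) $ i) = 0" for k using 2[of k] by (simp add: kdot_eq_0_iff)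
  show "(\<integral>s. c (- k) s *\<^sub>R g s (- k) \<partial>M) $ i = cnj ((\<integral>s. c k s *\<^sub>R g s k \<partial>M) $ i)" for k i unfolding 1 by (simp add: cv_def)
 qed
qed

lemma Eint_shift:
 assumes "borel_field u" "I \<in> sets borel"
 shows "Eint s I (\<lambda>t. u (t + c)) = Eint s ((\<lambda>t. t + c) ` I) u"
proof -
 have im: "(\<lambda>t. t + c) ` I \<in> sets borel"
 proof -
  have "(\<lambda>t. t + c) ` I = (\<lambda>t. t - c) -` I \<inter> space borel" by (auto intro: image_eqI[of _ _ "_ - c"])
  then show ?thesis using measurable_sets[of "\<lambda>t. t - c" borel borel I] assms(2) by simp
 qed
 note [measurable] = borel_field_E[OF assms(1)] im
 have "Eint s ((\<lambda>t. t + c) ` I) u = (\<integral>\<^sup>+t. E s (u (c + 1 * t)) * indicator ((\<lambda>t. t + c) ` I) (c + 1 * t) \<partial>lborel)"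
  unfolding Eint_def by (subst nn_integral_real_affine[where c = 1 and t = c]) auto
 also have "\<dots> = Eint s I (\<lambda>t. u (t + c))"
  unfolding Eint_def by (intro nn_integral_cong) (auto simp: add.commute split: split_indicator)
 finally show ?thesis by simp
qed

lemma Eint_hist_le:
 assumes h: "borel_field h" and z: "borel_field z"
 shows "Eint \<beta> {0..} (hist \<mu> h z) \<le> 2 * (Eint \<beta> UNIV h + Q z)"
proof -
 have b: "borel_field (\<lambda>s. h (s - \<mu>))" "borel_field (\<lambda>s. z (s - \<mu>))"
  using borel_field_shift[OF h, of "- \<mu>"] borel_field_shift[OF z, of "- \<mu>"] by simp_all
 note [measurable] = borel_field_E[OF b(1)] borel_field_E[OF b(2)]
 have "Eint \<beta> {0..} (hist \<mu> h z) \<le> (\<integral>\<^sup>+s. 2 * (E \<beta> (h (s - \<mu>)) + E \<beta> (z (s - \<mu>))) \<partial>lborel)" unfolding Eint_def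
 proof (intro nn_integral_mono)
  fix s
  have "E \<beta> (hist \<mu> h z s) \<le> 2 * (E \<beta> (h (s - \<mu>)) + E \<beta> (z (s - \<mu>)))"
   using E_add_le[of \<beta> "h (s - \<mu>)" "z (s - \<mu>)"] by (simp add: hist_def distrib_left)
  then show "E \<beta> (hist \<mu> h z s) * indicator {0..} s \<le> 2 * (E \<beta> (h (s - \<mu>)) + E \<beta> (z (s - \<mu>)))" by (auto split: split_indicator)
 qed
 also have "\<dots> = 2 * (Eint \<beta> UNIV (\<lambda>s. h (s - \<mu>)) + Eint \<beta> UNIV (\<lambda>s. z (s - \<mu>)))"
  unfolding Eint_def by (subst nn_integral_cmult, measurable, subst nn_integral_add) auto
 also have "\<dots> = 2 * (Eint \<beta> UNIV h + Qb z)"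
  using Eint_shift[OF h, of UNIV \<beta> "- \<mu>"] Eint_shift[OF z, of UNIV \<beta> "- \<mu>"] surj_plus_right[of "- \<mu>"] by (simp add: Qb_eq[OF z])
 also have "\<dots> \<le> 2 * (Eint \<beta> UNIV h + Q z)" by (intro mult_left_mono add_mono Qb_le_Q order_refl) auto
 finally show ?thesis .
qed

lemma duhamel_diff:
 assumes "borel_field G" "\<And>t. G t 0 = 0" "Eint r {0..} G < top" "borel_field H" "\<And>t. H t 0 = 0" "Eint r {0..} H < top"
 shows "duhamel \<kappa> (\<lambda>s. G s k) t - duhamel \<kappa> (\<lambda>s. H s k) t = duhamel \<kappa> (\<lambda>s. G s k - H s k) t"
proof -
 have i: "integrable lborel (\<lambda>s. indicator {0..t} s *\<^sub>R (exp (- \<kappa> * (t - s)) *\<^sub>R G s k))"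
  if G: "borel_field G" "\<And>t. G t 0 = 0" "Eint r {0..} G < top" for G
 proof (rule integrable_bounded_mult[where c = 0 and d = t])
  have "Eint r {0..t} G \<le> Eint r {0..} G" unfolding Eint_def by (intro nn_integral_mono) (auto split: split_indicator)
  then show "integrable lborel (\<lambda>s. indicator {0..t} s *\<^sub>R G s k)"
   using G by (intro Eint_integrable[where s = r and c = 0 and d = t]) auto
 qed (auto intro!: continuous_intros)
 show ?thesis unfolding duhamel_def using Bochner_Integration.integral_diff[OF i[OF assms(1-3)] i[OF assms(4-6)]]
  by (simp only: scaleR_diff_right)
qed

lemma borel_field_diff:
 assumes "borel_field u" "borel_field v"
 shows "borel_field (\<lambda>t k. u t k - v t k)"
proof -
 have [measurable]: "(\<lambda>t. u t k) \<in> borel_measurable borel" "(\<lambda>t. v t k) \<in> borel_measurable borel" for k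
  using assms by (simp_all add: borel_field_def)
 show ?thesis unfolding borel_field_def by measurable
qed

lemma Q_minus: "Q (\<lambda>t k. - x t k) = Q x"
 by (simp add: Q_def Qa_def Qb_def)

lemma solenoidal_nonlin:
 assumes "solenoidal p" "\<And>t. solenoidal (h t)" "\<And>t. solenoidal (z t)"
 shows "solenoidal (nonlin \<mu> p h z s)"
 unfolding nonlin_def using assms by (intro solenoidal_add solenoidal_PB solenoidal_scaleR solenoidal_hist) auto

lemma perturbation_evolve:
 assumes p: "solenoidal p" and h: "borel_field h" "\<And>t. solenoidal (h t)" and w: "solenoidal w" and z: "perturbation z"
 shows "perturbation (evolve \<nu> \<mu> p h w z)"
 unfolding perturbation_def
proof (intro conjI allI impI)
 have zb: "borel_field z" "\<And>t. solenoidal (z t)" using z by (auto simp: perturbation_def)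
 have kapm: "kap \<nu> (- k) = kap \<nu> k" for k by (simp add: kap_def)
 have [measurable]: "(\<lambda>t. duhamel (kap \<nu> k) (\<lambda>s. nonlin \<mu> p h z s k) t) \<in> borel_measurable borel" for k
  by (rule measurable_duhamel) (use borel_nonlin[OF h(1) zb(1)] in \<open>simp add: borel_field_def\<close>)
 show "borel_field (evolve \<nu> \<mu> p h w z)" unfolding borel_field_def evolve_def by measurable
 show "solenoidal (evolve \<nu> \<mu> p h w z t)" for t
 proof -
  have "solenoidal (\<lambda>k. (indicator {0..} t * exp (- kap \<nu> k * t)) *\<^sub>R w k)" by (rule solenoidal_scaleR[OF w]) (simp add: kapm)
  moreover have "solenoidal (\<lambda>k. duhamel (kap \<nu> k) (\<lambda>s. nonlin \<mu> p h z s k) t)" unfolding duhamel_def scaleR_scaleR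
   by (rule solenoidal_integral) (auto intro: solenoidal_nonlin p h zb simp: kapm)
  ultimately show ?thesis unfolding evolve_def by (rule solenoidal_diff)
 qed
 show "evolve \<nu> \<mu> p h w z t = (\<lambda>k. 0)" if "t < 0" for t using that by (simp add: evolve_def duhamel_def)
qed

lemma Eint_nonlin_le:
 assumes p: "solenoidal p" "E \<beta> p \<le> 1" and h: "borel_field h" "\<And>t. solenoidal (h t)"
  and z: "perturbation z" and m: "0 \<le> m" and r: "0 \<le> r"
  and hm: "Eint \<beta> UNIV h \<le> ennreal m" and zr: "Q z \<le> ennreal r"
 shows "Eint (\<alpha> - 1) {0..} (nonlin \<mu> p h z)
  \<le> ennreal (4 * K * (lam1 powr (\<alpha> - \<beta>) * r + exp (2 * \<mu>) * (2 * (m + r)) * r + exp (2 * \<mu>) * (2 * (m + r)) * lam1 powr (\<alpha> - \<beta>)))"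
proof -
 define c1 where "c1 = lam1 powr (\<alpha> - \<beta>)"
 have c1: "0 \<le> c1" by (simp add: c1_def)
 have Ea: "E \<alpha> u \<le> ennreal c1 * E \<beta> u" for u unfolding c1_def by (rule E_embedding) simp
 have K0: "0 \<le> K" using K_pos by simp
 have zb: "borel_field z" "\<And>t. solenoidal (z t)" using z by (auto simp: perturbation_def)
 have sol0: "p 0 = 0" "\<And>s. z s 0 = 0" "\<And>s. hist \<mu> h z s 0 = 0" using p h zb by (auto simp: solenoidal_at_0 solenoidal_hist)
 have ab: "borel_field (hist \<mu> h z)" by (rule borel_hist[OF h(1) zb(1)])
 note [measurable] = borel_field_E[OF ab] borel_field_E[OF zb(1)]
 let ?M = "ennreal (exp (2 * \<mu>))"
 have pw: "E (\<alpha> - 1) (nonlin \<mu> p h z s) * indicator {0..} s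
   \<le> 4 * ennreal K * (ennreal c1 * (E \<beta> (z s) * indicator UNIV s)
    + (?M * ennreal r + ?M * ennreal c1) * (E \<beta> (hist \<mu> h z s) * indicator {0..} s))" for s
 proof (cases "0 \<le> s")
  case True
  have ex: "(exp (\<mu> - s))\<^sup>2 \<le> exp (2 * \<mu>)" "(exp \<mu>)\<^sup>2 \<le> exp (2 * \<mu>)"
   using True by (simp_all add: power2_eq_square exp_add[symmetric])
  have t1: "E (\<alpha> - 1) (PB p (z s)) \<le> ennreal K * (1 * (ennreal c1 * E \<beta> (z s)))"
   by (rule order_trans[OF E_PB_le]) (simp_all only: sol0, intro mult_left_mono mult_mono p(2) Ea, auto)
  have t2: "E (\<alpha> - 1) (\<lambda>k. exp (\<mu> - s) *\<^sub>R PB (hist \<mu> h z s) (z s) k) \<le> ?M * (ennreal K * (E \<beta> (hist \<mu> h z s) * ennreal r))"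
  proof -
   have "E (\<alpha> - 1) (PB (hist \<mu> h z s) (z s)) \<le> ennreal K * (E \<beta> (hist \<mu> h z s) * ennreal r)"
    by (rule order_trans[OF E_PB_le]) (auto intro!: mult_left_mono order_trans[OF E_le_Qa] order_trans[OF Qa_le_Q] zr simp: sol0)
   then show ?thesis unfolding E_scaleR by (intro mult_mono ennreal_leI ex) auto
  qed
  have t3: "E (\<alpha> - 1) (\<lambda>k. exp \<mu> *\<^sub>R PB (hist \<mu> h z s) p k) \<le> ?M * (ennreal K * (E \<beta> (hist \<mu> h z s) * ennreal c1))"
  proof -
   have "E \<alpha> p \<le> ennreal c1 * 1" by (rule order_trans[OF Ea]) (intro mult_left_mono p, simp)
   then have "E (\<alpha> - 1) (PB (hist \<mu> h z s) p) \<le> ennreal K * (E \<beta> (hist \<mu> h z s) * ennreal c1)"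
    by (intro order_trans[OF E_PB_le]) (auto intro!: mult_left_mono simp: sol0)
   then show ?thesis unfolding E_scaleR by (intro mult_mono ennreal_leI ex) auto
  qed
  have "E (\<alpha> - 1) (nonlin \<mu> p h z s) \<le> 4 * (ennreal K * (1 * (ennreal c1 * E \<beta> (z s)))
    + ?M * (ennreal K * (E \<beta> (hist \<mu> h z s) * ennreal r)) + ?M * (ennreal K * (E \<beta> (hist \<mu> h z s) * ennreal c1)))"
   unfolding nonlin_def by (rule order_trans[OF E_sum3_le]) (intro mult_left_mono add_mono t1 t2 t3, simp)
  also have "\<dots> = 4 * ennreal K * (ennreal c1 * E \<beta> (z s) + (?M * ennreal r + ?M * ennreal c1) * E \<beta> (hist \<mu> h z s))"
   by (simp add: distrib_left distrib_right mult_ac)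
  finally show ?thesis using True by simp
 qed simp
 have "Eint (\<alpha> - 1) {0..} (nonlin \<mu> p h z) \<le> (\<integral>\<^sup>+s. 4 * ennreal K * (ennreal c1 * (E \<beta> (z s) * indicator UNIV s)
    + (?M * ennreal r + ?M * ennreal c1) * (E \<beta> (hist \<mu> h z s) * indicator {0..} s)) \<partial>lborel)"
  unfolding Eint_def by (intro nn_integral_mono pw)
 also have "\<dots> = 4 * ennreal K * (ennreal c1 * Eint \<beta> UNIV z + (?M * ennreal r + ?M * ennreal c1) * Eint \<beta> {0..} (hist \<mu> h z))"
  unfolding Eint_def by (subst nn_integral_cmult, measurable, subst nn_integral_add) (auto simp: nn_integral_cmult)
 also have "\<dots> \<le> 4 * ennreal K * (ennreal c1 * ennreal r + (?M * ennreal r + ?M * ennreal c1) * (2 * (ennreal m + ennreal r)))"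
 proof (intro mult_left_mono add_mono)
  show "Eint \<beta> UNIV z \<le> ennreal r" unfolding Qb_eq[OF zb(1), symmetric] by (rule order_trans[OF Qb_le_Q zr])
  show "Eint \<beta> {0..} (hist \<mu> h z) \<le> 2 * (ennreal m + ennreal r)"
   by (rule order_trans[OF Eint_hist_le[OF h(1) zb(1)]]) (intro mult_left_mono add_mono hm zr, simp)
 qed auto
 also have "\<dots> = ennreal (4 * K * (c1 * r + (exp (2 * \<mu>) * r + exp (2 * \<mu>) * c1) * (2 * (m + r))))"
  using K0 c1 m r by (simp add: ennreal_mult ennreal_plus)
 also have "4 * K * (c1 * r + (exp (2 * \<mu>) * r + exp (2 * \<mu>) * c1) * (2 * (m + r)))
   = 4 * K * (c1 * r + exp (2 * \<mu>) * (2 * (m + r)) * r + exp (2 * \<mu>) * (2 * (m + r)) * c1)" by (simp add: algebra_simps)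
 finally show ?thesis by (simp add: c1_def)
qed

text \<open>
 By bilinearity the difference of the nonlinear terms splits into four terms, each linear in \<open>z - z'\<close> or in its delayed copy,
 and the other factor is bounded by the data.
\<close>

lemma Eint_nonlin_diff_le:
 assumes p: "solenoidal p" "E \<beta> p \<le> 1" and h: "borel_field h" "\<And>t. solenoidal (h t)"
  and z: "perturbation z" and z': "perturbation z'" and m: "0 \<le> m" and r: "0 \<le> r"
  and hm: "Eint \<beta> UNIV h \<le> ennreal m" and zr: "Q z \<le> ennreal r" and zr': "Q z' \<le> ennreal r"
 shows "Eint (\<alpha> - 1) {0..} (\<lambda>s k. nonlin \<mu> p h z s k - nonlin \<mu> p h z' s k)
  \<le> ennreal (8 * K * (lam1 powr (\<alpha> - \<beta>) + exp (2 * \<mu>) * (2 * (m + r)) + exp (2 * \<mu>) * r + exp (2 * \<mu>) * lam1 powr (\<alpha> - \<beta>)))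
    * Q (\<lambda>t k. z t k - z' t k)"
proof -
 define c1 where "c1 = lam1 powr (\<alpha> - \<beta>)"
 have c1: "0 \<le> c1" by (simp add: c1_def)
 have Ea: "E \<alpha> u \<le> ennreal c1 * E \<beta> u" for u unfolding c1_def by (rule E_embedding) simp
 have K0: "0 \<le> K" using K_pos by simp
 have zb: "borel_field z" "\<And>t. solenoidal (z t)" "borel_field z'" "\<And>t. solenoidal (z' t)"
  using z z' by (auto simp: perturbation_def)
 define d where "d = (\<lambda>t k. z t k - z' t k)"
 define D where "D = Q d"
 have db: "borel_field d" "\<And>t. solenoidal (d t)" unfolding d_def using zb by (auto intro: solenoidal_diff borel_field_diff)
 have sol0: "p 0 = 0" "\<And>s. z s 0 = 0" "\<And>s. z' s 0 = 0" "\<And>s. d s 0 = 0" "\<And>s. hist \<mu> h z s 0 = 0" "\<And>s. hist \<mu> h z' s 0 = 0"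
  using p h zb db by (auto simp: solenoidal_at_0 solenoidal_hist)
 have ab: "borel_field (hist \<mu> h z)" "borel_field (hist \<mu> h z')" by (intro borel_hist h zb)+
 have dsb: "borel_field (\<lambda>s. d (s - \<mu>))" using borel_field_shift[OF db(1), of "- \<mu>"] by simp
 note [measurable] = borel_field_E[OF ab(1)] borel_field_E[OF ab(2)] borel_field_E[OF db(1)] borel_field_E[OF dsb]
 let ?M = "ennreal (exp (2 * \<mu>))"
 have histE: "Eint \<beta> {0..} (hist \<mu> h z) \<le> 2 * (ennreal m + ennreal r)"
  "Eint \<beta> {0..} (hist \<mu> h z') \<le> 2 * (ennreal m + ennreal r)"
  by (rule order_trans[OF Eint_hist_le[OF h(1) zb(1)]], intro mult_left_mono add_mono hm zr, simp)
    (rule order_trans[OF Eint_hist_le[OF h(1) zb(3)]], intro mult_left_mono add_mono hm zr', simp)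
 have hfin: "2 * (ennreal m + ennreal r) < top" by (simp add: ennreal_mult_less_top)
 have pfin: "E \<beta> p < top" "E \<alpha> p < top" using le_less_trans[OF p(2) ennreal_one_less_top] E_embedding_finite[of \<alpha> \<beta> p] by simp_all
 have zfin: "E \<alpha> (z s) < top" "E \<alpha> (z' s) < top" for s
  by (rule le_less_trans[OF order_trans[OF E_le_Qa order_trans[OF Qa_le_Q zr]]], simp)
    (rule le_less_trans[OF order_trans[OF E_le_Qa order_trans[OF Qa_le_Q zr']]], simp)
 have aeh: "AE s in lborel. E \<beta> (hist \<mu> h z s) * indicator {0..} s \<noteq> \<infinity>" "AE s in lborel. E \<beta> (hist \<mu> h z' s) * indicator {0..} s \<noteq> \<infinity>"
  by (rule nn_integral_PInf_AE, measurable, use le_less_trans[OF histE(1) hfin] in \<open>simp add: Eint_def\<close>)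
    (rule nn_integral_PInf_AE, measurable, use le_less_trans[OF histE(2) hfin] in \<open>simp add: Eint_def\<close>)
 have pw: "AE s in lborel. E (\<alpha> - 1) (\<lambda>k. nonlin \<mu> p h z s k - nonlin \<mu> p h z' s k) * indicator {0..} s
   \<le> 8 * ennreal K * (ennreal c1 * (E \<beta> (d s) * indicator UNIV s)
    + ?M * D * (E \<beta> (hist \<mu> h z s) * indicator {0..} s)
    + (?M * ennreal r + ?M * ennreal c1) * (E \<beta> (d (s - \<mu>)) * indicator UNIV s))" using aeh
 proof eventually_elim
  case (elim s)
  show ?case
  proof (cases "0 \<le> s")
   case True
   let ?a = "hist \<mu> h z s" and ?a' = "hist \<mu> h z' s"
   have afin: "E \<beta> ?a < top" "E \<beta> ?a' < top" using elim True by (auto simp: top.not_eq_extremum)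
   have da: "(\<lambda>k. ?a k - ?a' k) = d (s - \<mu>)" by (simp add: hist_def d_def fun_eq_iff)
   have eq: "nonlin \<mu> p h z s k - nonlin \<mu> p h z' s k = PB p (d s) k + exp (\<mu> - s) *\<^sub>R PB ?a (d s) k
     + exp (\<mu> - s) *\<^sub>R PB (d (s - \<mu>)) (z' s) k + exp \<mu> *\<^sub>R PB (d (s - \<mu>)) p k" for k
   proof -
    have e1: "PB p (z s) k - PB p (z' s) k = PB p (d s) k"
     unfolding d_def by (rule PB_diff_right[symmetric]) (auto simp: sol0 pfin zfin)
    have e2: "PB ?a (z s) k - PB ?a (z' s) k = PB ?a (d s) k"
     unfolding d_def by (rule PB_diff_right[symmetric]) (auto simp: sol0 afin zfin)
    have e3: "PB ?a (z' s) k - PB ?a' (z' s) k = PB (d (s - \<mu>)) (z' s) k"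
     unfolding da[symmetric] by (rule PB_diff_left[symmetric]) (auto simp: sol0 afin zfin)
    have e4: "PB ?a p k - PB ?a' p k = PB (d (s - \<mu>)) p k"
     unfolding da[symmetric] by (rule PB_diff_left[symmetric]) (auto simp: sol0 afin pfin)
    show ?thesis unfolding e1[symmetric] e2[symmetric] e3[symmetric] e4[symmetric] by (simp add: nonlin_def scaleR_diff_right)
   qed
   have ex: "(exp (\<mu> - s))\<^sup>2 \<le> exp (2 * \<mu>)" "(exp \<mu>)\<^sup>2 \<le> exp (2 * \<mu>)"
    using True by (simp_all add: power2_eq_square exp_add[symmetric])
   have t1: "E (\<alpha> - 1) (PB p (d s)) \<le> ennreal K * (1 * (ennreal c1 * E \<beta> (d s)))"
    by (rule order_trans[OF E_PB_le]) (simp_all only: sol0, intro mult_left_mono mult_mono p(2) Ea, auto)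
   have t2: "E (\<alpha> - 1) (\<lambda>k. exp (\<mu> - s) *\<^sub>R PB ?a (d s) k) \<le> ?M * (ennreal K * (E \<beta> ?a * D))"
   proof -
    have "E (\<alpha> - 1) (PB ?a (d s)) \<le> ennreal K * (E \<beta> ?a * D)"
     unfolding D_def by (rule order_trans[OF E_PB_le]) (auto intro!: mult_left_mono order_trans[OF E_le_Qa] Qa_le_Q simp: sol0)
    then show ?thesis unfolding E_scaleR by (intro mult_mono ennreal_leI ex) auto
   qed
   have t3: "E (\<alpha> - 1) (\<lambda>k. exp (\<mu> - s) *\<^sub>R PB (d (s - \<mu>)) (z' s) k) \<le> ?M * (ennreal K * (E \<beta> (d (s - \<mu>)) * ennreal r))"
   proof -
    have "E (\<alpha> - 1) (PB (d (s - \<mu>)) (z' s)) \<le> ennreal K * (E \<beta> (d (s - \<mu>)) * ennreal r)"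
     by (rule order_trans[OF E_PB_le]) (auto intro!: mult_left_mono order_trans[OF E_le_Qa] order_trans[OF Qa_le_Q] zr' simp: sol0)
    then show ?thesis unfolding E_scaleR by (intro mult_mono ennreal_leI ex) auto
   qed
   have t4: "E (\<alpha> - 1) (\<lambda>k. exp \<mu> *\<^sub>R PB (d (s - \<mu>)) p k) \<le> ?M * (ennreal K * (E \<beta> (d (s - \<mu>)) * ennreal c1))"
   proof -
    have "E \<alpha> p \<le> ennreal c1 * 1" by (rule order_trans[OF Ea]) (intro mult_left_mono p, simp)
    then have "E (\<alpha> - 1) (PB (d (s - \<mu>)) p) \<le> ennreal K * (E \<beta> (d (s - \<mu>)) * ennreal c1)"
     by (intro order_trans[OF E_PB_le]) (auto intro!: mult_left_mono simp: sol0)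
    then show ?thesis unfolding E_scaleR by (intro mult_mono ennreal_leI ex) auto
   qed
   have "E (\<alpha> - 1) (\<lambda>k. nonlin \<mu> p h z s k - nonlin \<mu> p h z' s k) \<le> 8 * (ennreal K * (1 * (ennreal c1 * E \<beta> (d s)))
     + ?M * (ennreal K * (E \<beta> ?a * D)) + ?M * (ennreal K * (E \<beta> (d (s - \<mu>)) * ennreal r))
     + ?M * (ennreal K * (E \<beta> (d (s - \<mu>)) * ennreal c1)))"
    unfolding eq by (rule order_trans[OF E_sum4_le]) (intro mult_left_mono add_mono t1 t2 t3 t4, simp)
   also have "\<dots> = 8 * ennreal K * (ennreal c1 * E \<beta> (d s) + ?M * D * E \<beta> ?a
     + (?M * ennreal r + ?M * ennreal c1) * E \<beta> (d (s - \<mu>)))" by (simp add: distrib_left distrib_right mult_ac add_ac)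
   finally show ?thesis using True by simp
  qed simp
 qed
 have "Eint (\<alpha> - 1) {0..} (\<lambda>s k. nonlin \<mu> p h z s k - nonlin \<mu> p h z' s k) \<le> (\<integral>\<^sup>+s. 8 * ennreal K * (ennreal c1 * (E \<beta> (d s) * indicator UNIV s)
    + ?M * D * (E \<beta> (hist \<mu> h z s) * indicator {0..} s)
    + (?M * ennreal r + ?M * ennreal c1) * (E \<beta> (d (s - \<mu>)) * indicator UNIV s)) \<partial>lborel)"
  unfolding Eint_def using pw by (rule nn_integral_mono_AE)
 also have "\<dots> = 8 * ennreal K * (ennreal c1 * Eint \<beta> UNIV d + ?M * D * Eint \<beta> {0..} (hist \<mu> h z)
   + (?M * ennreal r + ?M * ennreal c1) * Eint \<beta> UNIV (\<lambda>s. d (s - \<mu>)))"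
  unfolding Eint_def by (subst nn_integral_cmult, measurable, subst nn_integral_add, measurable, subst nn_integral_add) (auto simp: nn_integral_cmult)
 also have "\<dots> \<le> 8 * ennreal K * (ennreal c1 * D + ?M * D * (2 * (ennreal m + ennreal r)) + (?M * ennreal r + ?M * ennreal c1) * D)"
 proof (intro mult_left_mono add_mono histE)
  show 1: "Eint \<beta> UNIV d \<le> D" unfolding Qb_eq[OF db(1), symmetric] D_def by (rule Qb_le_Q)
  show "Eint \<beta> UNIV (\<lambda>s. d (s - \<mu>)) \<le> D" using Eint_shift[OF db(1), of UNIV \<beta> "- \<mu>"] surj_plus_right[of "- \<mu>"] 1 by simp
 qed auto
 also have "\<dots> = ennreal (8 * K * (c1 + exp (2 * \<mu>) * (2 * (m + r)) + exp (2 * \<mu>) * r + exp (2 * \<mu>) * c1)) * D"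
 proof -
  have "ennreal (8 * K * (c1 + exp (2 * \<mu>) * (2 * (m + r)) + exp (2 * \<mu>) * r + exp (2 * \<mu>) * c1))
   = 8 * ennreal K * (ennreal c1 + ?M * (2 * (ennreal m + ennreal r)) + ?M * ennreal r + ?M * ennreal c1)"
   using K0 c1 m r by (simp add: ennreal_mult ennreal_plus)
  then show ?thesis by (simp add: distrib_left distrib_right mult_ac add_ac)
 qed
 finally show ?thesis by (simp add: c1_def D_def d_def)
qed

text \<open>
 The threshold depends on the size \<open>m\<close> of the data only: this uniformity makes the attraction uniform over the ball.
\<close>

lemma exists_perturbation:
 assumes m: "1 \<le> m"
 shows "\<exists>\<nu>\<^sub>0\<ge>1. \<forall>\<nu>\<ge>\<nu>\<^sub>0. \<forall>p h w. solenoidal p \<longrightarrow> E \<beta> p \<le> 1 \<longrightarrow> borel_field h \<longrightarrow> (\<forall>t. solenoidal (h t)) \<longrightarrow>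
   Eint \<beta> UNIV h \<le> ennreal m \<longrightarrow> solenoidal w \<longrightarrow> E \<alpha> w \<le> ennreal m \<longrightarrow>
   (\<exists>z. perturbation z \<and> Q z \<le> ennreal (4 * m) \<and> evolve \<nu> \<mu> p h w z = z)"
proof -
 define c1 where "c1 = lam1 powr (\<alpha> - \<beta>)"
 define r where "r = 4 * m"
 define A where "A = 4 * K * (c1 * r + exp (2 * \<mu>) * (2 * (m + r)) * r + exp (2 * \<mu>) * (2 * (m + r)) * c1)"
 define B where "B = 8 * K * (c1 + exp (2 * \<mu>) * (2 * (m + r)) + exp (2 * \<mu>) * r + exp (2 * \<mu>) * c1)"
 have c1: "0 \<le> c1" and r: "0 \<le> r" and m0: "0 \<le> m" and K0: "0 \<le> K" using m K_pos by (auto simp: c1_def r_def)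
 have AB: "0 \<le> A" "0 \<le> B" unfolding A_def B_def using c1 r m0 K0 by (auto intro!: mult_nonneg_nonneg add_nonneg_nonneg)
 \<comment> \<open>The summands ensure \<open>kap \<nu> k \<ge> \<nu> * lam k / 2\<close>, that the ball is mapped into itself, and the factor \<open>1 / 8\<close>.\<close>
 define \<nu>0 where "\<nu>0 = 1 + 2 / lam1 + 4 * A + 32 * B"
 have \<nu>01: "1 \<le> \<nu>0" using AB lam1_pos by (simp add: \<nu>0_def)
 have "\<exists>z. perturbation z \<and> Q z \<le> ennreal r \<and> evolve \<nu> \<mu> p h w z = z"
  if \<nu>: "\<nu> \<ge> \<nu>0" and p: "solenoidal p" "E \<beta> p \<le> 1" and h: "borel_field h" "\<And>t. solenoidal (h t)" "Eint \<beta> UNIV h \<le> ennreal m"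
  and w: "solenoidal w" "E \<alpha> w \<le> ennreal m" for \<nu> p h w
 proof -
  have \<nu>1: "1 \<le> \<nu>" using \<nu> \<nu>01 by simp
  have "2 / lam1 \<le> \<nu>" "4 * A \<le> \<nu>" "32 * B \<le> \<nu>" using \<nu> AB lam1_pos by (auto simp: \<nu>0_def intro: order_trans[rotated])
  moreover have "\<nu> \<le> \<nu> * m" using mult_left_mono[of 1 m \<nu>] \<nu>1 m by simp
  ultimately have "4 * A \<le> m * \<nu>" "2 \<le> \<nu> * lam1" "32 * B \<le> \<nu>" using lam1_pos by (auto simp: pos_divide_le_eq mult.commute)
  then have \<nu>b: "2 \<le> \<nu> * lam1" "4 / \<nu> * A \<le> m" "4 / \<nu> * B \<le> 1 / 8" using \<nu>1 by (simp_all add: pos_divide_le_eq)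
  have kg: "\<nu> * lam k / 2 \<le> kap \<nu> k" if "k \<noteq> 0" for k using \<nu>b(1) \<nu>1 that by (intro kap_ge) auto
  define cur where "cur = (\<lambda>(x :: real \<times> (int ^ 3) \<Rightarrow> complex ^ 3) t k. x (t, k))"
  define T where "T = (\<lambda>x. \<lambda>(t, k). evolve \<nu> \<mu> p h w (cur x) t k)"
  have curT: "cur (T x) = evolve \<nu> \<mu> p h w (cur x)" for x by (simp add: cur_def T_def)
  have curd: "cur (\<lambda>i. x i - y i) = (\<lambda>t k. cur x t k - cur y t k)" for x y by (simp add: cur_def)
  have "\<exists>x. perturbation (cur x) \<and> Q (cur x) \<le> ennreal r \<and> T x = x"
  proof (rule contraction_fixed_point[where c = "\<lambda>(t, k). if k = 0 then 0 else lam k powr (- \<alpha>)"])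
   show "perturbation (cur (\<lambda>i. 0))" by (simp add: perturbation_def cur_def borel_field_def)
   show "Q (cur (\<lambda>i. 0)) = 0" by (simp add: Q_def Qa_def Qb_def cur_def)
   show "0 \<le> r" by (rule r)
   show "0 \<le> (case i of (t, k) \<Rightarrow> if k = 0 then 0 else lam k powr (- \<alpha>))" for i :: "real \<times> (int ^ 3)" by (simp add: split_beta)
   show "perturbation (cur (\<lambda>i. x i - y i))" if "perturbation (cur x)" "perturbation (cur y)" for x y
    using that unfolding curd perturbation_def by (auto intro: solenoidal_diff borel_field_diff)
   show "perturbation (cur x)" if X: "\<And>n. perturbation (cur (X n))" and lim: "\<And>i. (\<lambda>n. X n i) \<longlonglongrightarrow> x i" for X x
    unfolding perturbation_def
   proof (intro conjI allI impI)
    have l: "(\<lambda>n. cur (X n) t k) \<longlonglongrightarrow> cur x t k" for t k using lim by (simp add: cur_def)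
    show "borel_field (cur x)" unfolding borel_field_def
    proof
     fix k show "(\<lambda>t. cur x t k) \<in> borel_measurable borel"
      by (rule borel_measurable_LIMSEQ_metric[OF _ l]) (use X in \<open>simp add: perturbation_def borel_field_def\<close>)
    qed
    show "solenoidal (cur x t)" for t by (rule solenoidal_LIMSEQ[OF _ l]) (use X in \<open>simp add: perturbation_def\<close>)
    show "cur x t = (\<lambda>k. 0)" if "t < 0" for t
    proof
     fix k show "cur x t k = 0" using l[of t k] X that by (simp add: perturbation_def LIMSEQ_const_iff)
    qed
   qed
   show "Q (cur (\<lambda>i. x i - y i)) \<le> 2 * (Q (cur x) + Q (cur y))" if "perturbation (cur x)" "perturbation (cur y)" for x y
    unfolding curd using that by (intro Q_diff_le) (auto simp: perturbation_def)
   show "ennreal ((norm (x i))\<^sup>2) \<le> ennreal (case i of (t, k) \<Rightarrow> if k = 0 then 0 else lam k powr (- \<alpha>)) * Q (cur x)" if "perturbation (cur x)" for x i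
   proof (cases i)
    case (Pair t k)
    have "ennreal ((norm (cur x t k))\<^sup>2) \<le> ennreal (if k = 0 then 0 else lam k powr (- \<alpha>)) * E \<alpha> (cur x t)"
     using that by (intro E_coeff_bound) (auto simp: perturbation_def solenoidal_at_0)
    also have "\<dots> \<le> ennreal (if k = 0 then 0 else lam k powr (- \<alpha>)) * Q (cur x)"
     by (intro mult_left_mono order_trans[OF E_le_Qa Qa_le_Q]) auto
    finally show ?thesis by (simp add: Pair cur_def)
   qed
   show "Q (cur x) \<le> b" if "\<And>n. perturbation (cur (X n))" "\<And>i. (\<lambda>n. X n i) \<longlonglongrightarrow> x i" "\<And>n. Q (cur (X n)) \<le> b" for X x b
   proof (rule Q_liminf[where X = "\<lambda>n. cur (X n)"])
    show "borel_field (cur (X n))" for n using that(1)[of n] by (simp add: perturbation_def)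
    show "(\<lambda>n. cur (X n) t k) \<longlonglongrightarrow> cur x t k" for t k using that(2) by (simp add: cur_def)
    show "Q (cur (X n)) \<le> b" for n by (rule that(3))
   qed
   show "perturbation (cur (T x)) \<and> Q (cur (T x)) \<le> ennreal r" if x: "perturbation (cur x)" "Q (cur x) \<le> ennreal r" for x
   proof
    show "perturbation (cur (T x))" unfolding curT by (rule perturbation_evolve[OF p(1) h(1,2) w(1) x(1)])
    have xb: "borel_field (cur x)" using x by (simp add: perturbation_def)
    let ?H = "nonlin \<mu> p h (cur x)"
    have Hb: "borel_field ?H" by (rule borel_nonlin[OF h(1) xb])
    have [measurable]: "(\<lambda>t. ?H t k) \<in> borel_measurable borel" for k using Hb by (simp add: borel_field_def)
    have b1: "borel_field (\<lambda>t k. (indicator {0..} t * exp (- kap \<nu> k * t)) *\<^sub>R w k)" unfolding borel_field_def by measurable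
    have b2: "borel_field (\<lambda>t k. duhamel (kap \<nu> k) (\<lambda>s. ?H s k) t)"
     unfolding borel_field_def by (intro allI measurable_duhamel) measurable
    have "Q (cur (T x)) \<le> 2 * (Q (\<lambda>t k. (indicator {0..} t * exp (- kap \<nu> k * t)) *\<^sub>R w k) + Q (\<lambda>t k. duhamel (kap \<nu> k) (\<lambda>s. ?H s k) t))"
     unfolding curT evolve_def by (rule Q_diff_le[OF b1 b2])
    also have "\<dots> \<le> 2 * (ennreal m + ennreal m)"
    proof (intro mult_left_mono add_mono)
     show "Q (\<lambda>t k. (indicator {0..} t * exp (- kap \<nu> k * t)) *\<^sub>R w k) \<le> ennreal m"
      by (rule order_trans[OF _ w(2)], rule Q_heat) (use solenoidal_at_0[OF w(1)] \<nu>1 kg in auto)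
     have "Q (\<lambda>t k. duhamel (kap \<nu> k) (\<lambda>s. ?H s k) t) \<le> ennreal (4 / \<nu>) * Eint (\<alpha> - 1) {0..} ?H" by (rule Q_duhamel[OF Hb \<nu>1 kg])
     also have "\<dots> \<le> ennreal (4 / \<nu>) * ennreal A" unfolding A_def c1_def by (intro mult_left_mono Eint_nonlin_le p h x m0 r) auto
     also have "\<dots> = ennreal (4 / \<nu> * A)" using AB \<nu>1 by (simp add: ennreal_mult[symmetric])
     also have "\<dots> \<le> ennreal m" by (intro ennreal_leI \<nu>b)
     finally show "Q (\<lambda>t k. duhamel (kap \<nu> k) (\<lambda>s. ?H s k) t) \<le> ennreal m" .
    qed auto
    also have "\<dots> = ennreal r" using m0 by (simp add: r_def ennreal_mult mult.assoc[symmetric] mult_2[symmetric])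
    finally show "Q (cur (T x)) \<le> ennreal r" .
   qed
   show "Q (cur (\<lambda>i. T x i - T y i)) \<le> ennreal (1 / 8) * Q (cur (\<lambda>i. x i - y i))"
    if x: "perturbation (cur x)" and y: "perturbation (cur y)" and xr: "Q (cur x) \<le> ennreal r" and yr: "Q (cur y) \<le> ennreal r" for x y
   proof -
    have xyb: "borel_field (cur x)" "borel_field (cur y)" using x y by (auto simp: perturbation_def)
    let ?G = "nonlin \<mu> p h (cur x)" and ?H = "nonlin \<mu> p h (cur y)"
    have Gb: "borel_field ?G" "borel_field ?H" by (intro borel_nonlin h xyb)+
    have G0: "?G t 0 = 0" "?H t 0 = 0" for t
     using x y by (auto intro!: solenoidal_at_0 solenoidal_nonlin p h simp: perturbation_def)
    have Gf: "Eint (\<alpha> - 1) {0..} ?G < top" "Eint (\<alpha> - 1) {0..} ?H < top"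
     using Eint_nonlin_le[OF p h(1,2) x m0 r h(3) xr, of \<mu>] Eint_nonlin_le[OF p h(1,2) y m0 r h(3) yr, of \<mu>]
     by (auto intro: le_less_trans)
    have db: "borel_field (\<lambda>s k. ?G s k - ?H s k)" by (rule borel_field_diff[OF Gb])
    have "evolve \<nu> \<mu> p h w (cur x) t k - evolve \<nu> \<mu> p h w (cur y) t k = - duhamel (kap \<nu> k) (\<lambda>s. ?G s k - ?H s k) t" for t k
     unfolding duhamel_diff[OF Gb(1) G0(1) Gf(1) Gb(2) G0(2) Gf(2), symmetric] by (simp add: evolve_def)
    then have "Q (cur (\<lambda>i. T x i - T y i)) = Q (\<lambda>t k. duhamel (kap \<nu> k) (\<lambda>s. ?G s k - ?H s k) t)"
     unfolding curd curT by (simp add: Q_minus)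
    also have "\<dots> \<le> ennreal (4 / \<nu>) * Eint (\<alpha> - 1) {0..} (\<lambda>s k. ?G s k - ?H s k)" using Q_duhamel[OF db \<nu>1 kg] by simp
    also have "\<dots> \<le> ennreal (4 / \<nu>) * (ennreal B * Q (\<lambda>t k. cur x t k - cur y t k))" unfolding B_def c1_def
     by (intro mult_left_mono Eint_nonlin_diff_le[OF p h(1,2) x y m0 r h(3) xr yr]) auto
    also have "\<dots> = ennreal (4 / \<nu> * B) * Q (\<lambda>t k. cur x t k - cur y t k)"
     using AB \<nu>1 by (simp add: mult.assoc[symmetric] ennreal_mult[symmetric])
    also have "\<dots> \<le> ennreal (1 / 8) * Q (\<lambda>t k. cur x t k - cur y t k)" by (intro mult_right_mono ennreal_leI \<nu>b) auto
    finally show ?thesis unfolding curd .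
   qed
  qed
  then obtain x where "perturbation (cur x)" "Q (cur x) \<le> ennreal r" "T x = x" by blast
  then show ?thesis using curT[of x] by (intro exI[of _ "cur x"]) simp
 qed
 then show ?thesis using \<nu>01 unfolding r_def by (intro exI[of _ \<nu>0]) blast
qed

section \<open>Solutions that converge to the stationary one\<close>

text \<open>
 A solution of the delayed equation, in the sense of the variation of constants formula, together with its decay towards \<open>p\<close>.
 The constant \<open>M\<close> bounds both the history and the perturbation.
\<close>

definition trajectory :: "real \<Rightarrow> real \<Rightarrow> real \<Rightarrow> field \<Rightarrow> field \<Rightarrow> (real \<Rightarrow> field) \<Rightarrow> bool" where
 "trajectory \<mu> \<nu> M f p u \<longleftrightarrow> borel_field u \<and> (\<forall>t. solenoidal (u t)) \<and> Eint \<beta> {-\<mu><..<0} u \<le> ennreal M \<and>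
   (\<exists>z. perturbation z \<and> Q z \<le> ennreal M \<and> (\<forall>t\<ge>0. u t = (\<lambda>k. p k + exp (- t) *\<^sub>R z t k))) \<and>
   (\<forall>T. mild \<nu> (forcing f (\<lambda>t. u (t - \<mu>)) u) u 0 T)"

lemma integral_exp_Icc:
 fixes x :: "'b :: euclidean_space"
 assumes "0 \<le> t"
 shows "has_bochner_integral lborel (\<lambda>s. indicator {0..t} s *\<^sub>R (exp (\<kappa> * s) *\<^sub>R (\<kappa> *\<^sub>R x))) ((exp (\<kappa> * t) - 1) *\<^sub>R x)"
proof -
 have "has_bochner_integral lborel (\<lambda>s. indicator {0..t} s *\<^sub>R (exp (\<kappa> * s) *\<^sub>R (\<kappa> *\<^sub>R x))) (exp (\<kappa> * t) *\<^sub>R x - exp (\<kappa> * 0) *\<^sub>R x)"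
  by (rule has_bochner_integral_FTC_Icc[OF assms])
    (auto intro!: derivative_eq_intros continuous_intros)
 then show ?thesis by (simp add: scaleR_diff_left)
qed

lemma duhamel_at_0: "duhamel \<kappa> h 0 = 0"
proof -
 have "AE s in lborel. indicator {0..0::real} s *\<^sub>R (exp (- \<kappa> * (0 - s)) *\<^sub>R h s) = 0"
  using AE_lborel_singleton[of "0::real"] by eventually_elim (auto split: split_indicator)
 then show ?thesis unfolding duhamel_def by (rule integral_eq_zero_AE)
qed

lemma borel_forcing: "borel_field a \<Longrightarrow> borel_field u \<Longrightarrow> borel_field (forcing f a u)"
 using borel_PB[of a u] unfolding borel_field_def forcing_def by (auto intro: borel_measurable_diff)

text \<open>
 Substituting \<open>u = p + exp (- t) z\<close> into the variation of constants formula; the stationary equation for \<open>p\<close>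
 accounts for the terms without \<open>z\<close>.
\<close>

lemma mild_perturbed:
 assumes N: "borel_field N" "\<And>k t. integrable lborel (\<lambda>s. indicator {0..t} s *\<^sub>R N s k)"
  and G: "borel_field G" "AE s in lborel. 0 < s \<longrightarrow> (\<forall>k. G s k = (\<nu> * lam k) *\<^sub>R p k - exp (- s) *\<^sub>R N s k)"
  and u: "\<And>t k. 0 \<le> t \<Longrightarrow> u t k = p k + exp (- t) *\<^sub>R (exp (- kap \<nu> k * t) *\<^sub>R w k - duhamel (kap \<nu> k) (\<lambda>s. N s k) t)"
 shows "mild \<nu> G u 0 T"
 unfolding mild_def
proof (intro allI ballI)
 fix k t assume "t \<in> {0..T}"
 then have t: "0 \<le> t" by simp
 let ?\<kappa> = "\<nu> * lam k"
 have [measurable]: "(\<lambda>s. N s k) \<in> borel_measurable borel" "(\<lambda>s. G s k) \<in> borel_measurable borel"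
  using N(1) G(1) by (simp_all add: borel_field_def)
 define D where "D = (\<integral>s. indicator {0..t} s *\<^sub>R (exp (kap \<nu> k * s) *\<^sub>R N s k) \<partial>lborel)"
 have iN: "integrable lborel (\<lambda>s. indicator {0..t} s *\<^sub>R (exp (kap \<nu> k * s) *\<^sub>R N s k))"
  by (rule integrable_bounded_mult[where c = 0 and d = t, OF N(2)]) (auto intro!: continuous_intros)
 have "(\<integral>s. indicator {0..t} s *\<^sub>R (exp (?\<kappa> * s) *\<^sub>R G s k) \<partial>lborel)
   = (\<integral>s. indicator {0..t} s *\<^sub>R (exp (?\<kappa> * s) *\<^sub>R (?\<kappa> *\<^sub>R p k)) - indicator {0..t} s *\<^sub>R (exp (kap \<nu> k * s) *\<^sub>R N s k) \<partial>lborel)"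
 proof (rule integral_cong_AE)
  show "AE s in lborel. indicator {0..t} s *\<^sub>R (exp (?\<kappa> * s) *\<^sub>R G s k)
    = indicator {0..t} s *\<^sub>R (exp (?\<kappa> * s) *\<^sub>R (?\<kappa> *\<^sub>R p k)) - indicator {0..t} s *\<^sub>R (exp (kap \<nu> k * s) *\<^sub>R N s k)"
   using G(2) AE_lborel_singleton[of "0::real"]
  proof eventually_elim
   case (elim s)
   have "exp (kap \<nu> k * s) = exp (?\<kappa> * s) * exp (- s)" by (simp add: kap_def algebra_simps exp_add[symmetric])
   then show ?case using elim by (auto simp: scaleR_diff_right split: split_indicator)
  qed
 qed measurable
 also have "\<dots> = (exp (?\<kappa> * t) - 1) *\<^sub>R p k - D" unfolding D_def using integral_exp_Icc[OF t, of ?\<kappa> "p k"] iN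
  by (subst Bochner_Integration.integral_diff) (auto simp: has_bochner_integral_iff)
 finally have R: "(\<integral>s. indicator {0..t} s *\<^sub>R (exp (?\<kappa> * s) *\<^sub>R G s k) \<partial>lborel) = (exp (?\<kappa> * t) - 1) *\<^sub>R p k - D" .
 have "exp (?\<kappa> * t) * (exp (- t) * exp (- (kap \<nu> k * t))) = 1" by (simp add: kap_def algebra_simps exp_add[symmetric])
 moreover have "(exp (?\<kappa> * t) * exp (- t)) *\<^sub>R duhamel (kap \<nu> k) (\<lambda>s. N s k) t = D"
 proof -
  have "exp (?\<kappa> * t) * exp (- t) * exp (- kap \<nu> k * (t - s)) = exp (kap \<nu> k * s)" for s
   by (simp add: kap_def algebra_simps exp_add[symmetric])
  then show ?thesis unfolding duhamel_def D_def Bochner_Integration.integral_scaleR_right[symmetric]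
   by (intro Bochner_Integration.integral_cong) (auto simp: mult_ac)
 qed
 ultimately have "exp (?\<kappa> * t) *\<^sub>R u t k = exp (?\<kappa> * t) *\<^sub>R p k + (w k - D)"
  unfolding u[OF t] by (simp add: scaleR_add_right scaleR_diff_right)
 then show "exp (?\<kappa> * t) *\<^sub>R u t k - exp (?\<kappa> * 0) *\<^sub>R u 0 k = (\<integral>s. indicator {0..t} s *\<^sub>R (exp (?\<kappa> * s) *\<^sub>R G s k) \<partial>lborel)"
  unfolding R by (simp add: u[of 0] duhamel_at_0 scaleR_diff_left)
qed

lemma PB_around_steady:
 assumes "p 0 = 0" "H 0 = 0" "y 0 = 0" "E \<beta> p < top" "E \<beta> H < top" "E \<alpha> y < top"
 shows "PB (\<lambda>k. p k + c *\<^sub>R H k) (\<lambda>k. p k + d *\<^sub>R y k) k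
   = PB p p k + d *\<^sub>R PB p y k + c *\<^sub>R PB H p k + (c * d) *\<^sub>R PB H y k"
proof -
 have pa: "E \<alpha> p < top" using E_embedding_finite[of \<alpha> \<beta> p] assms by simp
 have fin: "E \<beta> (\<lambda>k. c *\<^sub>R H k) < top" "E \<alpha> (\<lambda>k. d *\<^sub>R y k) < top" using assms by (simp_all add: E_scaleR ennreal_mult_less_top)
 have s: "PB p (\<lambda>k. d *\<^sub>R y k) k = d *\<^sub>R PB p y k" "PB (\<lambda>k. c *\<^sub>R H k) p k = c *\<^sub>R PB H p k"
  using PB_scaleR[of 1 p d y k] PB_scaleR[of c H 1 p k] by simp_all
 have "PB (\<lambda>k. p k + c *\<^sub>R H k) (\<lambda>k. p k + d *\<^sub>R y k) k = PB p (\<lambda>k. p k + d *\<^sub>R y k) k + PB (\<lambda>k. c *\<^sub>R H k) (\<lambda>k. p k + d *\<^sub>R y k) k"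
  by (rule PB_add_left) (use assms pa fin E_add_finite in auto)
 also have "PB p (\<lambda>k. p k + d *\<^sub>R y k) k = PB p p k + PB p (\<lambda>k. d *\<^sub>R y k) k" by (rule PB_add_right) (use assms pa fin in auto)
 also have "PB (\<lambda>k. c *\<^sub>R H k) (\<lambda>k. p k + d *\<^sub>R y k) k = PB (\<lambda>k. c *\<^sub>R H k) p k + PB (\<lambda>k. c *\<^sub>R H k) (\<lambda>k. d *\<^sub>R y k) k"
  by (rule PB_add_right) (use assms pa fin in auto)
 finally show ?thesis by (simp add: s PB_scaleR)
qed

text \<open>
 The factor \<open>exp t\<close> in \<open>h\<close> makes the ansatz \<open>p + exp (- t) z(t)\<close> valid for the given history as
 well, with \<open>h\<close> in place of \<open>z\<close> at negative times; so one formula covers the delayed argument.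
\<close>

lemma trajectory_from_perturbation:
 assumes p: "solenoidal p" "E \<beta> p \<le> 1" "stationary \<nu> f p" and \<mu>: "0 < \<mu>"
  and \<phi>: "borel_field \<phi>" "\<And>t. solenoidal (\<phi> t)" "Eint \<beta> {-\<mu><..<0} \<phi> \<le> ennreal M"
  and u0: "solenoidal u0" and M: "0 \<le> M"
  and h_eq: "h = (\<lambda>t k. (indicator {-\<mu><..<0} t * exp t) *\<^sub>R (\<phi> t k - p k))"
  and h: "borel_field h" "\<And>t. solenoidal (h t)" "Eint \<beta> UNIV h \<le> ennreal m" and m: "0 \<le> m"
  and z: "perturbation z" "Q z \<le> ennreal M" "evolve \<nu> \<mu> p h (\<lambda>k. u0 k - p k) z = z"
 shows "\<exists>u. trajectory \<mu> \<nu> M f p u \<and> (\<forall>t<0. u t = \<phi> t) \<and> u 0 = u0"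
proof -
 define u where "u = (\<lambda>t. if t < 0 then \<phi> t else (\<lambda>k. p k + exp (- t) *\<^sub>R z t k))"
 have zb: "borel_field z" "\<And>t. solenoidal (z t)" "\<And>t. t < 0 \<Longrightarrow> z t = (\<lambda>k. 0)" using z by (auto simp: perturbation_def)
 have [measurable]: "(\<lambda>t. \<phi> t k) \<in> borel_measurable borel" "(\<lambda>t. z t k) \<in> borel_measurable borel" for k
  using \<phi> zb by (auto simp: borel_field_def)
 have "(\<lambda>t. u t k) = (\<lambda>t. if t < 0 then \<phi> t k else p k + exp (- t) *\<^sub>R z t k)" for k by (auto simp: u_def)
 then have ub: "borel_field u" unfolding borel_field_def by simp
 have usol: "solenoidal (u t)" for t
  using solenoidal_add[OF p(1) solenoidal_scaleR[OF zb(2), of "\<lambda>k. exp (- t)" t]] \<phi>(2) by (simp add: u_def)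
 let ?H = "hist \<mu> h z" and ?N = "nonlin \<mu> p h z"
 have zeros: "p 0 = 0" "\<And>s. z s 0 = 0" "\<And>s. ?H s 0 = 0" using p h zb by (auto simp: solenoidal_at_0 solenoidal_hist)
 have Hb: "borel_field ?H" by (rule borel_hist[OF h(1) zb(1)])
 note [measurable] = borel_field_E[OF Hb]
 have "Eint \<beta> {0..} ?H \<le> 2 * (ennreal m + ennreal M)"
  by (rule order_trans[OF Eint_hist_le[OF h(1) zb(1)]], intro mult_left_mono add_mono h z, simp)
 then have "Eint \<beta> {0..} ?H < top" by (rule le_less_trans) (simp add: ennreal_mult_less_top)
 then have aeH: "AE s in lborel. E \<beta> (?H s) * indicator {0..} s \<noteq> \<infinity>" by (intro nn_integral_PInf_AE) (simp_all add: Eint_def)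
 have Nb: "borel_field ?N" by (rule borel_nonlin[OF h(1) zb(1)])
 have Ni: "integrable lborel (\<lambda>s. indicator {0..t} s *\<^sub>R ?N s k)" for k t
 proof (rule Eint_integrable[where s = "\<alpha> - 1" and c = 0 and d = t, OF Nb])
  show "?N t 0 = 0" for t by (intro solenoidal_at_0 solenoidal_nonlin p h zb)
  have "Eint (\<alpha> - 1) {0..t} ?N \<le> Eint (\<alpha> - 1) {0..} ?N"
   unfolding Eint_def by (intro nn_integral_mono) (auto split: split_indicator)
  also have "\<dots> < top" by (rule le_less_trans[OF Eint_nonlin_le[OF p(1,2) h(1,2) z(1) m M h(3) z(2)]]) simp
  finally show "Eint (\<alpha> - 1) {0..t} ?N < top" .
 qed auto
 have shift: "u (s - \<mu>) = (\<lambda>k. p k + exp (\<mu> - s) *\<^sub>R ?H s k)" if "0 < s" for s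
 proof (cases "s < \<mu>")
  case True
  have "exp (\<mu> - s) * exp (s - \<mu>) = 1" by (simp add: exp_add[symmetric])
  then show ?thesis using True that zb(3)[of "s - \<mu>"] by (simp add: u_def hist_def h_eq fun_eq_iff)
 qed (simp add: u_def hist_def h_eq fun_eq_iff)
 have ubs: "borel_field (\<lambda>t. u (t - \<mu>))" using borel_field_shift[OF ub, of "- \<mu>"] by simp
 have "mild \<nu> (forcing f (\<lambda>t. u (t - \<mu>)) u) u 0 T" for T
 proof (rule mild_perturbed[where N = ?N and p = p and w = "\<lambda>k. u0 k - p k", OF Nb Ni])
  show "borel_field (forcing f (\<lambda>t. u (t - \<mu>)) u)" by (rule borel_forcing[OF ubs ub])
  show "AE s in lborel. 0 < s \<longrightarrow> (\<forall>k. forcing f (\<lambda>t. u (t - \<mu>)) u s k = (\<nu> * lam k) *\<^sub>R p k - exp (- s) *\<^sub>R ?N s k)" using aeH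
  proof eventually_elim
   case (elim s)
   show ?case
   proof (intro impI allI)
    fix k assume s: "0 < s"
    have fin: "E \<beta> p < top" "E \<beta> (?H s) < top" "E \<alpha> (z s) < top"
     using elim s le_less_trans[OF p(2) ennreal_one_less_top] le_less_trans[OF order_trans[OF E_le_Qa order_trans[OF Qa_le_Q z(2)]], of top]
     by (auto simp: top.not_eq_extremum)
    have us: "u s = (\<lambda>k. p k + exp (- s) *\<^sub>R z s k)" using s by (simp add: u_def)
    have ex: "exp (\<mu> - s) = exp \<mu> * exp (- s)" by (simp add: exp_add[symmetric])
    have st: "(\<nu> * lam k) *\<^sub>R p k = f k - PB p p k" using p(3) by (simp add: stationary_def)
    show "forcing f (\<lambda>t. u (t - \<mu>)) u s k = (\<nu> * lam k) *\<^sub>R p k - exp (- s) *\<^sub>R ?N s k"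
     unfolding forcing_def shift[OF s] us PB_around_steady[where p = p and H = "?H s" and y = "z s", OF zeros(1,3,2) fin] st nonlin_def
     by (simp add: ex scaleR_add_right algebra_simps)
   qed
  qed
  show "u t k = p k + exp (- t) *\<^sub>R (exp (- kap \<nu> k * t) *\<^sub>R (u0 k - p k) - duhamel (kap \<nu> k) (\<lambda>s. ?N s k) t)" if "0 \<le> t" for t k
   using fun_cong[OF fun_cong[OF z(3)], of t k, symmetric] that by (simp add: u_def evolve_def)
 qed
 moreover have "Eint \<beta> {-\<mu><..<0} u = Eint \<beta> {-\<mu><..<0} \<phi>"
  unfolding Eint_def u_def by (intro nn_integral_cong) (auto split: split_indicator)
 moreover have "\<forall>t\<ge>0. u t = (\<lambda>k. p k + exp (- t) *\<^sub>R z t k)" by (simp add: u_def)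
 moreover have "u 0 = u0" using fun_cong[OF z(3), of 0] by (auto simp: u_def evolve_def duhamel_at_0 fun_eq_iff algebra_simps)
 moreover have "u t = \<phi> t" if "t < 0" for t using that by (simp add: u_def)
 ultimately show ?thesis unfolding trajectory_def using ub usol \<phi>(3) z by (intro exI[of _ u]) auto
qed

lemma trajectory_steady:
 assumes p: "solenoidal p" "E \<beta> p \<le> 1" "stationary \<nu> f p"
  and M: "Eint \<beta> {-\<mu><..<0} (\<lambda>t. p) \<le> ennreal M"
 shows "trajectory \<mu> \<nu> M f p (\<lambda>t. p)"
proof -
 have b: "borel_field (\<lambda>t. p)" by (simp add: borel_field_def)
 have "mild \<nu> (forcing f (\<lambda>t. p) (\<lambda>t. p)) (\<lambda>t. p) 0 T" for T
  by (rule mild_perturbed[where N = "\<lambda>t k. 0" and p = p and w = "\<lambda>k. 0"])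
    (use p(3) in \<open>auto simp: stationary_def forcing_def duhamel_def borel_field_def\<close>)
 moreover have "perturbation (\<lambda>t k. 0)" "Q (\<lambda>t k. 0) \<le> ennreal M"
  by (simp_all add: perturbation_def borel_field_def Q_def Qa_def Qb_def)
 ultimately show ?thesis unfolding trajectory_def using b p M by (intro conjI exI[of _ "\<lambda>t k. 0"]) auto
qed

section \<open>Continuity in time and uniqueness on a window\<close>

lemma mild_shift:
 assumes mild: "mild \<nu> G u 0 (T + c)" and c: "0 \<le> c"
  and G: "borel_field G" and i: "\<And>k t. integrable lborel (\<lambda>s. indicator {0..t} s *\<^sub>R G s k)"
 shows "mild \<nu> (\<lambda>t. G (t + c)) (\<lambda>t. u (t + c)) 0 T"
 unfolding mild_def
proof (intro allI ballI)
 fix k t assume t: "t \<in> {0..T}"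
 have [measurable]: "(\<lambda>s. G s k) \<in> borel_measurable borel" using G by (simp add: borel_field_def)
 let ?\<kappa> = "\<nu> * lam k"
 let ?F = "\<lambda>s. exp (?\<kappa> * s) *\<^sub>R G s k"
 have iF: "integrable lborel (\<lambda>s. indicator {0..t} s *\<^sub>R ?F s)" for t
  by (rule integrable_bounded_mult[where c = 0 and d = t, OF i]) (auto intro!: continuous_intros)
 have "exp (?\<kappa> * (t + c)) *\<^sub>R u (t + c) k - exp (?\<kappa> * c) *\<^sub>R u c k
   = (\<integral>s. indicator {0..t + c} s *\<^sub>R ?F s \<partial>lborel) - (\<integral>s. indicator {0..c} s *\<^sub>R ?F s \<partial>lborel)"
  using mild[unfolded mild_def, rule_format, of "t + c" k] mild[unfolded mild_def, rule_format, of c k] t c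
  by (simp add: algebra_simps)
 also have "\<dots> = (\<integral>s. indicator {0..t + c} s *\<^sub>R ?F s - indicator {0..c} s *\<^sub>R ?F s \<partial>lborel)"
  by (rule Bochner_Integration.integral_diff[symmetric]) (rule iF)+
 also have "\<dots> = (\<integral>s. indicator {c<..t + c} s *\<^sub>R ?F s \<partial>lborel)"
  using t c by (intro Bochner_Integration.integral_cong) (auto split: split_indicator)
 also have "\<dots> = (\<integral>s. indicator {c<..t + c} (c + 1 * s) *\<^sub>R ?F (c + 1 * s) \<partial>lborel)"
  by (subst lborel_integral_real_affine[where c = 1 and t = c]) auto
 also have "\<dots> = (\<integral>s. exp (?\<kappa> * c) *\<^sub>R (indicator {0<..t} s *\<^sub>R (exp (?\<kappa> * s) *\<^sub>R G (s + c) k)) \<partial>lborel)"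
  by (intro Bochner_Integration.integral_cong) (auto simp: exp_add distrib_left add.commute split: split_indicator)
 also have "\<dots> = exp (?\<kappa> * c) *\<^sub>R (\<integral>s. indicator {0<..t} s *\<^sub>R (exp (?\<kappa> * s) *\<^sub>R G (s + c) k) \<partial>lborel)"
  by (rule Bochner_Integration.integral_scaleR_right)
 finally have eq: "exp (?\<kappa> * (t + c)) *\<^sub>R u (t + c) k - exp (?\<kappa> * c) *\<^sub>R u c k
   = exp (?\<kappa> * c) *\<^sub>R (\<integral>s. indicator {0<..t} s *\<^sub>R (exp (?\<kappa> * s) *\<^sub>R G (s + c) k) \<partial>lborel)" .
 have "exp (?\<kappa> * c) *\<^sub>R (exp (?\<kappa> * t) *\<^sub>R u (t + c) k - u c k)
   = exp (?\<kappa> * c) *\<^sub>R (\<integral>s. indicator {0<..t} s *\<^sub>R (exp (?\<kappa> * s) *\<^sub>R G (s + c) k) \<partial>lborel)"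
  unfolding eq[symmetric] by (simp add: scaleR_diff_right exp_add[symmetric] distrib_left add.commute)
 moreover have "(\<integral>s. indicator {0<..t} s *\<^sub>R (exp (?\<kappa> * s) *\<^sub>R G (s + c) k) \<partial>lborel)
   = (\<integral>s. indicator {0..t} s *\<^sub>R (exp (?\<kappa> * s) *\<^sub>R G (s + c) k) \<partial>lborel)"
 proof (rule integral_cong_AE)
  show "AE s in lborel. indicator {0<..t} s *\<^sub>R (exp (?\<kappa> * s) *\<^sub>R G (s + c) k) = indicator {0..t} s *\<^sub>R (exp (?\<kappa> * s) *\<^sub>R G (s + c) k)"
   using AE_lborel_singleton[of "0::real"] by eventually_elim (auto split: split_indicator)
 qed measurable
 ultimately show "exp (?\<kappa> * t) *\<^sub>R u (t + c) k - exp (?\<kappa> * 0) *\<^sub>R u (0 + c) k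
   = (\<integral>s. indicator {0..t} s *\<^sub>R (exp (?\<kappa> * s) *\<^sub>R G (s + c) k) \<partial>lborel)" by simp
qed

lemma continuous_map_V_I:
 assumes V: "\<And>t. t \<in> S \<Longrightarrow> u t \<in> V L s"
  and lim: "\<And>X t. (\<And>n. X n \<in> S) \<Longrightarrow> t \<in> S \<Longrightarrow> X \<longlonglongrightarrow> t \<Longrightarrow> (\<lambda>n. E s (\<lambda>k. u (X n) k - u t k)) \<longlonglongrightarrow> 0"
 shows "continuous_map (top_of_set S) (V_topology L s) (u :: real \<Rightarrow> field)"
 unfolding Metric_space.continuous_map_to_metric[OF Metric_space_V]
proof (intro ballI allI impI)
 fix t e :: real assume "t \<in> topspace (top_of_set S)" "0 < e"
 then have t: "t \<in> S" and e: "0 < e" by auto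
 have "((\<lambda>x. V_dist L s (u x) (u t)) \<longlongrightarrow> 0) (at t within S)" unfolding tendsto_at_iff_sequentially comp_def
 proof (intro allI impI)
  fix X assume X: "\<forall>i. X i \<in> S - {t}" "X \<longlonglongrightarrow> t"
  have fin: "E s (\<lambda>k. u (X n) k - u t k) < top" for n using V[of "X n"] V[OF t] X by (intro E_diff_finite) (auto simp: V_iff)
  show "(\<lambda>n. V_dist L s (u (X n)) (u t)) \<longlonglongrightarrow> 0" by (subst V_dist_tendsto_0_iff[OF fin]) (intro lim t; use X in auto)
 qed
 then have "\<forall>\<^sub>F x in at t within S. V_dist L s (u x) (u t) < e" by (rule order_tendstoD(2)) (rule e)
 then obtain d where d: "0 < d" "\<And>x. x \<in> S \<Longrightarrow> x \<noteq> t \<Longrightarrow> dist x t < d \<Longrightarrow> V_dist L s (u x) (u t) < e" unfolding eventually_at by blast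
 have "V_dist L s (u t) (u t) < e" using V_dist_eq_0_iff[OF V[OF t] V[OF t]] e by simp
 then have "V_dist L s (u t) (u x) < e" if "x \<in> S" "dist x t < d" for x
  using d(2)[OF that(1) _ that(2)] V_dist_commute[of s "u t" "u x"] by (cases "x = t") auto
 then show "\<exists>U. openin (top_of_set S) U \<and> t \<in> U \<and> (\<forall>y\<in>U. u y \<in> Metric_space.mball (V L s) (V_dist L s) (u t) e)"
  using t d(1) V by (intro exI[of _ "S \<inter> ball t d"])
   (auto simp: Metric_space.in_mball[OF Metric_space_V] openin_open_Int dist_commute)
qed

lemma continuous_map_V_coeff:
 assumes "continuous_map (top_of_set S) (V_topology L s) u"
 shows "continuous_on S (\<lambda>t. u t k)"
proof (rule continuous_on_open_invariant[THEN iffD2], intro allI impI)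
 fix B :: "(complex ^ 3) set" assume "open B"
 then have "openin (top_of_set S) {t \<in> topspace (top_of_set S). u t \<in> {v \<in> V L s. v k \<in> B}}"
  by (intro openin_continuous_map_preimage[OF assms] openin_coeff)
 moreover have "u t \<in> V L s" if "t \<in> S" for t using continuous_map_image_subset_topspace[OF assms] that by (auto simp: topspace_V)
 then have "{t \<in> topspace (top_of_set S). u t \<in> {v \<in> V L s. v k \<in> B}} = {t \<in> S. u t k \<in> B}" by auto
 ultimately obtain A where "open A" "{t \<in> S. u t k \<in> B} = S \<inter> A" by (auto simp: openin_open)
 then show "\<exists>A. open A \<and> A \<inter> S = (\<lambda>t. u t k) -` B \<inter> S" by (intro exI[of _ A]) auto
qed

lemma continuous_map_V_bounded:
 assumes cont: "continuous_map (top_of_set {c..d :: real}) (V_topology L s) u"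
 obtains M where "\<And>t. t \<in> {c..d} \<Longrightarrow> E s (u t) \<le> ennreal M"
proof -
 interpret Metric_space "V L s" "V_dist L s" by (rule Metric_space_V)
 have V: "u t \<in> V L s" if "t \<in> {c..d}" for t using continuous_map_image_subset_topspace[OF cont] that by (auto simp: topspace_V)
 have "compactin (V_topology L s) (u ` {c..d})" by (rule image_compactin[OF _ cont]) (simp add: compactin_subtopology compact_Icc)
 then obtain v B where vB: "u ` {c..d} \<subseteq> mcball v B" using compactin_imp_mbounded unfolding mbounded_def by blast
 have "E s (u t) \<le> 2 * ennreal (B\<^sup>2 / L ^ 3) + 2 * E s v" if t: "t \<in> {c..d}" for t
 proof -
  have "u t \<in> mcball v B" using vB t by blast
  then have vt: "v \<in> V L s" "V_dist L s v (u t) \<le> B" by (simp_all add: in_mcball)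
  have fin: "E s (\<lambda>k. u t k - v k) < top" using V[OF t] vt by (intro E_diff_finite) (auto simp: V_iff)
  have d: "V_norm L s (\<lambda>k. u t k - v k) \<le> B" using vt(2) V_dist_commute[of s "u t" v] by (simp add: V_dist_def)
  then have "0 \<le> B" using V_norm_nonneg[of s "\<lambda>k. u t k - v k"] by linarith
  then have "ennreal (L ^ 3) * E s (\<lambda>k. u t k - v k) \<le> ennreal (B\<^sup>2)" using V_norm_le_iff[OF fin] d by simp
  then have "ennreal (1 / L ^ 3) * (ennreal (L ^ 3) * E s (\<lambda>k. u t k - v k)) \<le> ennreal (1 / L ^ 3) * ennreal (B\<^sup>2)"
   by (rule mult_left_mono) simp
  then have "E s (\<lambda>k. u t k - v k) \<le> ennreal (B\<^sup>2 / L ^ 3)"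
   using L_pos by (simp add: mult.assoc[symmetric] ennreal_mult[symmetric])
  then have le: "2 * E s (\<lambda>k. u t k - v k) + 2 * E s v \<le> 2 * ennreal (B\<^sup>2 / L ^ 3) + 2 * E s v"
   by (intro add_mono mult_left_mono) auto
  have "E s (u t) \<le> 2 * E s (\<lambda>k. u t k - v k) + 2 * E s v" using E_add_le[of s "\<lambda>k. u t k - v k" v] by simp
  then show ?thesis using le by (rule order_trans)
 qed
 moreover have "v \<in> V L s \<or> {c..d} = {}" using vB by force
 then have "{c..d} = {} \<or> 2 * ennreal (B\<^sup>2 / L ^ 3) + 2 * E s v < top" by (auto simp: V_iff ennreal_mult_less_top)
 ultimately show ?thesis
  by (intro that[of "enn2real (2 * ennreal (B\<^sup>2 / L ^ 3) + 2 * E s v)"]) (auto simp del: atLeastatMost_empty_iff atLeastatMost_empty_iff2)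
qed

text \<open>
 The difference \<open>w\<close> of two solutions solves a linear equation without forcing. If \<open>S\<close> is the supremum of \<open>E
 \<alpha> w\<close> over the window, then \<open>S \<le> (K / \<nu>) A S \<le> S / 2\<close>, and \<open>S\<close> is finite.
\<close>

lemma mild_unique:
 assumes c: "0 \<le> c" and \<nu>: "0 < \<nu>"
  and a: "borel_field a" "\<And>t. a t \<in> V L \<beta>" "Eint \<beta> {c..d} a \<le> ennreal A" and A: "0 \<le> A" "K * A \<le> \<nu> / 2"
  and u: "mild \<nu> (forcing f a uB) u c d" "borel_field uB" "\<And>t. uB t \<in> V L \<beta>" "AE t in lborel. t \<in> {c..d} \<longrightarrow> u t = uB t"
   "Eint \<beta> {c..d} uB < top" "\<And>t. t \<in> {c..d} \<Longrightarrow> solenoidal (u t)" "\<And>t. t \<in> {c..d} \<Longrightarrow> E \<alpha> (u t) \<le> ennreal M"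
  and v: "mild \<nu> (forcing f a vB) v c d" "borel_field vB" "\<And>t. vB t \<in> V L \<beta>" "AE t in lborel. t \<in> {c..d} \<longrightarrow> v t = vB t"
   "Eint \<beta> {c..d} vB < top" "\<And>t. t \<in> {c..d} \<Longrightarrow> solenoidal (v t)" "\<And>t. t \<in> {c..d} \<Longrightarrow> E \<alpha> (v t) \<le> ennreal N"
  and init: "u c = v c" and t: "t \<in> {c..d}"
 shows "u t = v t"
proof -
 define S where "S = (SUP t\<in>{c..d}. E \<alpha> (\<lambda>k. u t k - v t k))"
 have Sub: "E \<alpha> (\<lambda>k. u t k - v t k) \<le> S" if "t \<in> {c..d}" for t unfolding S_def using that by (rule SUP_upper)
 have "S \<le> 2 * ennreal M + 2 * ennreal N"
  unfolding S_def by (intro SUP_least order_trans[OF E_diff_le] add_mono mult_left_mono u v) auto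
 then have Sfin: "S < top" by (rule le_less_trans) (simp add: ennreal_mult_less_top)
 define g where "g = (\<lambda>s k. indicator {c..d} s *\<^sub>R (PB (a s) (uB s) k - PB (a s) (vB s) k))"
 have PBb: "borel_field (\<lambda>t. PB (a t) (uB t))" "borel_field (\<lambda>t. PB (a t) (vB t))" by (intro borel_PB a u v)+
 have [measurable]: "(\<lambda>t. PB (a t) (uB t) k) \<in> borel_measurable borel" "(\<lambda>t. PB (a t) (vB t) k) \<in> borel_measurable borel" for k
  using PBb by (auto simp: borel_field_def)
 have gb: "borel_field g" unfolding borel_field_def g_def by measurable
 have [measurable]: "(\<lambda>s. g s k) \<in> borel_measurable borel" for k using gb by (simp add: borel_field_def)
 note [measurable] = borel_field_E[OF gb] borel_field_E[OF a(1)]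
 have z0: "a s 0 = 0" "uB s 0 = 0" "vB s 0 = 0" for s using a(2) u(3) v(3) by (auto simp: V_iff solenoidal_at_0)
 have "AE s in lborel. E (\<alpha> - 1) (g s) * indicator {0..} s \<le> ennreal K * S * (E \<beta> (a s) * indicator {c..d} s)" using u(4) v(4)
 proof eventually_elim
  case (elim s)
  show ?case
  proof (cases "s \<in> {c..d}")
   case True
   have fin: "E \<beta> (a s) < top" "E \<alpha> (uB s) < top" "E \<alpha> (vB s) < top" using a(2) u(3) v(3) V_mono[of \<alpha> \<beta>] by (auto simp: V_iff)
   have "g s = PB (a s) (\<lambda>k. uB s k - vB s k)" using True by (auto simp: g_def fun_eq_iff intro!: PB_diff_right[symmetric] z0 fin)
   moreover have "E \<alpha> (\<lambda>k. uB s k - vB s k) \<le> S" using Sub[OF True] elim True by simp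
   ultimately have "E (\<alpha> - 1) (g s) \<le> ennreal K * (E \<beta> (a s) * S)"
    by (auto intro!: order_trans[OF E_PB_le] mult_left_mono simp: z0)
   then show ?thesis using True c by (simp add: mult_ac)
  qed (simp add: g_def)
 qed
 then have "Eint (\<alpha> - 1) {0..} g \<le> (\<integral>\<^sup>+s. ennreal K * S * (E \<beta> (a s) * indicator {c..d} s) \<partial>lborel)"
  unfolding Eint_def by (rule nn_integral_mono_AE)
 also have "\<dots> = ennreal K * S * Eint \<beta> {c..d} a" unfolding Eint_def by (rule nn_integral_cmult) measurable
 also have "\<dots> \<le> ennreal K * S * ennreal A" by (intro mult_left_mono a) simp
 finally have gE: "Eint (\<alpha> - 1) {0..} g \<le> ennreal (K * A) * S" using K_pos A by (simp add: ennreal_mult mult_ac)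
 have iG: "integrable lborel (\<lambda>s. indicator {c..t} s *\<^sub>R (exp (\<nu> * lam k * s) *\<^sub>R forcing f a w s k))"
  if "borel_field w" "\<And>t. w t \<in> V L \<beta>" "Eint \<beta> {c..d} w < top" "t \<in> {c..d}" for w t k
 proof (rule integrable_bounded_mult[where c = c and d = t])
  show "integrable lborel (\<lambda>s. indicator {c..t} s *\<^sub>R forcing f a w s k)"
  proof (rule integrable_forcing[where c = c and d = t, OF a(1) _ _ that(1)])
   show "Eint \<beta> {c..t} a < top"
    using a(3) that(4) by (intro le_less_trans[of "Eint \<beta> {c..t} a" "Eint \<beta> {c..d} a"] le_less_trans[OF a(3)])
     (auto simp: Eint_def intro!: nn_integral_mono split: split_indicator)
   have "Eint \<beta> {c..t} w \<le> Eint \<beta> {c..d} w" using that(4) by (auto simp: Eint_def intro!: nn_integral_mono split: split_indicator)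
   then show "Eint \<alpha> {c..t} w < top" using that by (intro Eint_embedding_finite[of \<alpha> \<beta>]) auto
  qed (use z0 that(2) in \<open>auto simp: V_iff solenoidal_at_0\<close>)
 qed (auto intro!: continuous_intros)
 have diff: "u t k - v t k = - duhamel (\<nu> * lam k) (\<lambda>s. g s k) t" if t: "t \<in> {c..d}" for t k
 proof -
  let ?e = "\<lambda>s. exp (\<nu> * lam k * s)"
  have "?e t *\<^sub>R (u t k - v t k) = (\<integral>s. indicator {c..t} s *\<^sub>R (?e s *\<^sub>R forcing f a uB s k) \<partial>lborel) - (\<integral>s. indicator {c..t} s *\<^sub>R (?e s *\<^sub>R forcing f a vB s k) \<partial>lborel)"
   using u(1)[unfolded mild_def, rule_format, OF t, of k] v(1)[unfolded mild_def, rule_format, OF t, of k] init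
   by (simp add: scaleR_diff_right algebra_simps)
  also have "\<dots> = (\<integral>s. indicator {c..t} s *\<^sub>R (?e s *\<^sub>R forcing f a uB s k) - indicator {c..t} s *\<^sub>R (?e s *\<^sub>R forcing f a vB s k) \<partial>lborel)"
   by (rule Bochner_Integration.integral_diff[symmetric]) (intro iG u v t)+
  also have "\<dots> = (\<integral>s. - ?e t *\<^sub>R (indicator {0..t} s *\<^sub>R (exp (- (\<nu> * lam k) * (t - s)) *\<^sub>R g s k)) \<partial>lborel)"
  proof (rule Bochner_Integration.integral_cong)
   fix s :: real
   have "?e t * exp (- (\<nu> * lam k) * (t - s)) = ?e s" by (simp add: exp_add[symmetric] algebra_simps)
   then show "indicator {c..t} s *\<^sub>R (?e s *\<^sub>R forcing f a uB s k) - indicator {c..t} s *\<^sub>R (?e s *\<^sub>R forcing f a vB s k)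
    = - ?e t *\<^sub>R (indicator {0..t} s *\<^sub>R (exp (- (\<nu> * lam k) * (t - s)) *\<^sub>R g s k))"
    using t c by (auto simp: forcing_def g_def scaleR_diff_right split: split_indicator)
  qed simp
  also have "\<dots> = ?e t *\<^sub>R (- duhamel (\<nu> * lam k) (\<lambda>s. g s k) t)" 
   by (simp only: duhamel_def Bochner_Integration.integral_scaleR_right Bochner_Integration.integral_minus scaleR_minus_left scaleR_minus_right)
  finally show ?thesis by (simp only: scaleR_cancel_left exp_not_eq_zero simp_thms)
 qed
 have bnd: "E \<alpha> (\<lambda>k. u t k - v t k) \<le> ennreal (1 / \<nu>) * Eint (\<alpha> - 1) {0..} g" if t: "t \<in> {c..d}" for t
 proof -
  have "ennreal (lam k powr \<alpha> * (norm (u t k - v t k))\<^sup>2)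
    \<le> ennreal (1 / \<nu>) * (ennreal (lam k powr (\<alpha> - 1)) * (\<integral>\<^sup>+s. ennreal ((norm (g s k))\<^sup>2) * indicator {0..} s \<partial>lborel))" for k
  proof (cases "k = 0")
   case False
   have lp: "0 < lam k" by (rule lam_pos[OF False])
   have "ennreal (lam k powr \<alpha> * (norm (u t k - v t k))\<^sup>2) = ennreal (lam k powr \<alpha>) * ennreal ((norm (duhamel (\<nu> * lam k) (\<lambda>s. g s k) t))\<^sup>2)"
    by (simp add: diff[OF t] ennreal_mult)
   also have "\<dots> \<le> ennreal (lam k powr \<alpha>) * (ennreal (1 / (\<nu> * lam k)) * (\<integral>\<^sup>+s. ennreal ((norm (g s k))\<^sup>2) * indicator {0..} s \<partial>lborel))"
    by (intro mult_left_mono duhamel_sup) (use \<nu> lp in auto)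
   also have "ennreal (lam k powr \<alpha>) * (ennreal (1 / (\<nu> * lam k)) * x) = ennreal (1 / \<nu>) * (ennreal (lam k powr (\<alpha> - 1)) * x)" for x
   proof -
    have "lam k powr \<alpha> * (1 / (\<nu> * lam k)) = 1 / \<nu> * lam k powr (\<alpha> - 1)" using lp by (simp add: powr_diff)
    then show ?thesis using \<nu> lp by (simp only: mult.assoc[symmetric] ennreal_mult[symmetric] powr_ge_zero divide_nonneg_pos zero_le_one mult_pos_pos)
   qed
   finally show ?thesis .
  qed (use z0 u(6)[OF t] v(6)[OF t] in \<open>simp add: solenoidal_at_0\<close>)
  then have "E \<alpha> (\<lambda>k. u t k - v t k) \<le> (\<Sum>\<^sup>+k. ennreal (1 / \<nu>) * (ennreal (lam k powr (\<alpha> - 1)) * (\<integral>\<^sup>+s. ennreal ((norm (g s k))\<^sup>2) * indicator {0..} s \<partial>lborel)))"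
   unfolding E_def by (intro nn_integral_mono)
  also have "\<dots> = ennreal (1 / \<nu>) * Eint (\<alpha> - 1) {0..} g" by (subst nn_integral_cmult) (simp_all add: Eint_Tonelli[OF gb])
  finally show ?thesis .
 qed
 have "S \<le> ennreal (1 / \<nu>) * Eint (\<alpha> - 1) {0..} g" unfolding S_def by (rule SUP_least) (rule bnd)
 also have "\<dots> \<le> ennreal (1 / \<nu>) * (ennreal (K * A) * S)" by (rule mult_left_mono[OF gE]) simp
 also have "\<dots> = ennreal (1 / \<nu> * (K * A)) * S" using \<nu> K_pos A by (simp add: mult.assoc[symmetric] ennreal_mult[symmetric])
 also have "\<dots> \<le> ennreal (1 / 2) * S" using \<nu> A by (intro mult_right_mono ennreal_leI) (auto simp: field_simps)
 finally have "S \<le> ennreal (1 / 2) * S" .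
 moreover obtain x where x: "S = ennreal x" "0 \<le> x" using Sfin by (cases S) auto
 ultimately have "x \<le> 1 / 2 * x" by (simp add: ennreal_mult[symmetric] del: ennreal_half)
 then have "S = 0" using x by simp
 then have "E \<alpha> (\<lambda>k. u t k - v t k) = 0" using Sub[OF t] by simp
 then have "u t k = v t k" if "k \<noteq> 0" for k using E_eq_0[of \<alpha> "\<lambda>k. u t k - v t k" k] that by simp
 moreover have "u t 0 = v t 0" using u(6)[OF t] v(6)[OF t] by (simp add: solenoidal_at_0)
 ultimately show ?thesis by (metis ext)
qed

text \<open>
 Two versions of the equation are compared because a delayed solution satisfies it on \<open>(0, \<infinity>)\<close>, a linearized one on
 \<open>(0, \<mu>)\<close>, and because a history is only given up to null sets.
\<close>

lemma weak_window_unique: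
 assumes cd: "0 \<le> c" "c < d" and \<nu>: "0 < \<nu>" and f: "f \<in> V L \<alpha>"
  and a: "borel_field a" "\<And>t. a t \<in> V L \<beta>" "Eint \<beta> {c<..<d} a \<le> ennreal A" and A: "0 \<le> A" "K * A \<le> \<nu> / 2"
  and u: "J \<in> sets borel" "{c<..<d} \<subseteq> J" "weak_equation L \<alpha> \<nu> f J au u" "AE t in lborel. t \<in> {c<..<d} \<longrightarrow> au t = a t"
    "continuous_map (top_of_set {c..d}) (V_topology L \<alpha>) u" "u \<in> L2_funs L \<beta> {c<..<d}"
  and v: "J' \<in> sets borel" "{c<..<d} \<subseteq> J'" "weak_equation L \<alpha> \<nu> f J' av v" "AE t in lborel. t \<in> {c<..<d} \<longrightarrow> av t = a t"
    "continuous_map (top_of_set {c..d}) (V_topology L \<alpha>) v" "v \<in> L2_funs L \<beta> {c<..<d}"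
  and init: "u c = v c" and t: "t \<in> {c..d}"
 shows "u t = v t"
proof -
 have Icc: "Eint s {c..d} w = Eint s {c<..<d} w" for s w unfolding Eint_def
 proof (rule nn_integral_cong_AE)
  show "AE t in lborel. E s (w t) * indicator {c..d} t = E s (w t) * indicator {c<..<d} t"
   using AE_lborel_singleton[of c] AE_lborel_singleton[of d] by eventually_elim (auto split: split_indicator)
 qed
 have key: "\<exists>uB M. mild \<nu> (forcing f a uB) u c d \<and> borel_field uB \<and> (\<forall>t. uB t \<in> V L \<beta>) \<and> (AE t in lborel. t \<in> {c..d} \<longrightarrow> u t = uB t) \<and>
   Eint \<beta> {c..d} uB < top \<and> (\<forall>t\<in>{c..d}. solenoidal (u t)) \<and> (\<forall>t\<in>{c..d}. E \<alpha> (u t) \<le> ennreal M)"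
  if u: "J \<in> sets borel" "{c<..<d} \<subseteq> J" "weak_equation L \<alpha> \<nu> f J au u" "AE t in lborel. t \<in> {c<..<d} \<longrightarrow> au t = a t"
    "continuous_map (top_of_set {c..d}) (V_topology L \<alpha>) u" "u \<in> L2_funs L \<beta> {c<..<d}" for u au J
 proof -
  obtain uB where uB: "borel_field uB" "\<And>t. uB t \<in> V L \<beta>" "AE t in lborel. t \<in> {c<..<d} \<longrightarrow> u t = uB t" "Eint \<beta> {c<..<d} uB < top"
   by (rule L2_funs_borel_rep[OF u(6) borel_open[OF open_greaterThanLessThan]]) blast
  obtain M where M: "\<And>t. t \<in> {c..d} \<Longrightarrow> E \<alpha> (u t) \<le> ennreal M" using continuous_map_V_bounded[OF u(5)] by auto
  have sol: "solenoidal (u t)" if "t \<in> {c..d}" for t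
  proof -
   have "u t \<in> V L \<alpha>" using continuous_map_image_subset_topspace[OF u(5)] that by (auto simp: topspace_V)
   then show ?thesis by (simp add: V_iff)
  qed
  have ae: "AE t in lborel. t \<in> {c..d} \<longrightarrow> u t = uB t"
   using uB(3) AE_lborel_singleton[of c] AE_lborel_singleton[of d] by eventually_elim auto
  have "mild \<nu> (forcing f a uB) u c d"
   by (rule weak_imp_mild[OF u(1,2) cd(2) u(3) f a(1,2) u(4) le_less_trans[OF a(3)] uB continuous_map_V_coeff[OF u(5)] sol]) simp_all
  then show ?thesis using uB M sol ae by (intro exI[of _ uB] exI[of _ M]) (simp add: Icc)
 qed
 obtain uB M where uB: "mild \<nu> (forcing f a uB) u c d" "borel_field uB" "\<And>t. uB t \<in> V L \<beta>" "AE t in lborel. t \<in> {c..d} \<longrightarrow> u t = uB t"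
   "Eint \<beta> {c..d} uB < top" "\<And>t. t \<in> {c..d} \<Longrightarrow> solenoidal (u t)" "\<And>t. t \<in> {c..d} \<Longrightarrow> E \<alpha> (u t) \<le> ennreal M" using key[OF u] by blast
 obtain vB N where vB: "mild \<nu> (forcing f a vB) v c d" "borel_field vB" "\<And>t. vB t \<in> V L \<beta>" "AE t in lborel. t \<in> {c..d} \<longrightarrow> v t = vB t"
   "Eint \<beta> {c..d} vB < top" "\<And>t. t \<in> {c..d} \<Longrightarrow> solenoidal (v t)" "\<And>t. t \<in> {c..d} \<Longrightarrow> E \<alpha> (v t) \<le> ennreal N" using key[OF v] by blast
 show ?thesis by (rule mild_unique[OF cd(1) \<nu> a(1,2) a(3)[folded Icc] A uB vB init t])
qed

end

section \<open>Trajectories around the stationary solution\<close>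

lemma AE_lborel_shift:
 fixes P :: "real \<Rightarrow> bool"
 assumes "AE t in lborel. P t"
 shows "AE t in lborel. P (t + c)"
proof -
 have "AE t in distr lborel borel ((+) c). P t" unfolding lborel_distr_plus by (rule assms)
 then have "AE t in lborel. P (c + t)" by (rule AE_distrD[rotated]) simp
 then show ?thesis by (simp add: add.commute)
qed

text \<open>
 The condition \<open>small\<close> is what uniqueness on a window needs: \<open>2 * \<mu> + 2 * M\<close> bounds the squared
 \<open>L\<^sub>2(V\<^sup>\<beta>)\<close> norm of any trajectory, up to the volume, on the history interval and on every later interval of
 length \<open>\<mu>\<close>.
\<close>

locale steady_regime = torus +
 fixes \<mu> \<nu> M :: real and f p :: field
 assumes mu_pos: "0 < \<mu>" and nu_ge: "1 \<le> \<nu>" and M_nonneg: "0 \<le> M" and f_V: "f \<in> V L \<alpha>"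
  and p_sol: "solenoidal p" and p_E: "E \<beta> p \<le> 1" and p_stat: "stationary \<nu> f p"
  and small: "K * (2 * \<mu> + 2 * M) \<le> \<nu> / 2"
begin

abbreviation traj :: "(real \<Rightarrow> field) \<Rightarrow> bool" where
 "traj \<equiv> trajectory \<mu> \<nu> M f p"

lemma Eint_Icc: "Eint s {c..d} w = Eint s {c<..d} w"
 unfolding Eint_def
proof (rule nn_integral_cong_AE)
 show "AE t in lborel. E s (w t) * indicator {c..d} t = E s (w t) * indicator {c<..d} t"
  using AE_lborel_singleton[of c] by eventually_elim (auto split: split_indicator)
qed

lemma Eint_subset: "I \<subseteq> I' \<Longrightarrow> Eint s I w \<le> Eint s I' w"
 unfolding Eint_def by (intro nn_integral_mono) (auto split: split_indicator)

lemma p_Ea: "E \<alpha> p \<le> ennreal (lam1 powr (\<alpha> - \<beta>))"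
proof -
 have "E \<alpha> p \<le> ennreal (lam1 powr (\<alpha> - \<beta>)) * E \<beta> p" by (rule E_embedding) simp
 also have "\<dots> \<le> ennreal (lam1 powr (\<alpha> - \<beta>)) * 1" by (intro mult_left_mono p_E) simp
 finally show ?thesis by simp
qed

lemma p_in_V: "p \<in> V L \<beta>" "p \<in> V L \<alpha>"
proof -
 show "p \<in> V L \<beta>" using p_sol le_less_trans[OF p_E ennreal_one_less_top] by (simp add: V_iff)
 then show "p \<in> V L \<alpha>" using V_mono[of \<alpha> \<beta>] by simp
qed

lemma traj_borel: "traj u \<Longrightarrow> borel_field u" and traj_sol: "traj u \<Longrightarrow> solenoidal (u t)"
 by (simp_all add: trajectory_def)

lemma traj_at_0: "traj u \<Longrightarrow> u t 0 = 0"
 by (rule solenoidal_at_0) (rule traj_sol)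

lemma traj_remainder:
 assumes "traj u"
 obtains z where "perturbation z" "Q z \<le> ennreal M" "\<And>t. 0 \<le> t \<Longrightarrow> u t = (\<lambda>k. p k + exp (- t) *\<^sub>R z t k)"
 using assms by (auto simp: trajectory_def)

lemma traj_decay:
 assumes "traj u" "0 \<le> t"
 shows "E \<alpha> (\<lambda>k. u t k - p k) \<le> ennreal (M * (exp (- t))\<^sup>2)"
proof -
 obtain z where z: "perturbation z" "Q z \<le> ennreal M" "\<And>t. 0 \<le> t \<Longrightarrow> u t = (\<lambda>k. p k + exp (- t) *\<^sub>R z t k)"
  using traj_remainder[OF assms(1)] by blast
 have "E \<alpha> (\<lambda>k. u t k - p k) = ennreal ((exp (- t))\<^sup>2) * E \<alpha> (z t)" by (simp add: z(3) assms E_scaleR)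
 also have "\<dots> \<le> ennreal ((exp (- t))\<^sup>2) * ennreal M"
  by (intro mult_left_mono order_trans[OF E_le_Qa order_trans[OF Qa_le_Q z(2)]]) simp
 finally show ?thesis using M_nonneg by (simp add: ennreal_mult mult.commute)
qed

lemma traj_decay_Eint:
 assumes u: "traj u" and I: "I \<subseteq> {c..}" "0 \<le> c"
 shows "Eint \<beta> I (\<lambda>t k. u t k - p k) \<le> ennreal (M * (exp (- c))\<^sup>2)"
proof -
 obtain z where z: "perturbation z" "Q z \<le> ennreal M" "\<And>t. 0 \<le> t \<Longrightarrow> u t = (\<lambda>k. p k + exp (- t) *\<^sub>R z t k)"
  using traj_remainder[OF u] by blast
 have zb: "borel_field z" using z(1) by (simp add: perturbation_def)
 note [measurable] = borel_field_E[OF zb]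
 have "Eint \<beta> I (\<lambda>t k. u t k - p k) \<le> (\<integral>\<^sup>+t. ennreal ((exp (- c))\<^sup>2) * (E \<beta> (z t) * indicator UNIV t) \<partial>lborel)" unfolding Eint_def
 proof (rule nn_integral_mono)
  fix t
  show "E \<beta> (\<lambda>k. u t k - p k) * indicator I t \<le> ennreal ((exp (- c))\<^sup>2) * (E \<beta> (z t) * indicator UNIV t)"
  proof (cases "t \<in> I")
   case True
   then have t: "c \<le> t" "0 \<le> t" using I by auto
   then have "E \<beta> (\<lambda>k. u t k - p k) = ennreal ((exp (- t))\<^sup>2) * E \<beta> (z t)" by (simp add: z(3) E_scaleR)
   also have "\<dots> \<le> ennreal ((exp (- c))\<^sup>2) * E \<beta> (z t)" using t by (intro mult_right_mono ennreal_leI power_mono) auto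
   finally show ?thesis by (simp add: True)
  qed simp
 qed
 also have "\<dots> = ennreal ((exp (- c))\<^sup>2) * Qb z" unfolding Qb_eq[OF zb] Eint_def by (rule nn_integral_cmult) measurable
 also have "\<dots> \<le> ennreal ((exp (- c))\<^sup>2) * ennreal M" by (intro mult_left_mono order_trans[OF Qb_le_Q z(2)]) simp
 finally show ?thesis using M_nonneg by (simp add: ennreal_mult mult.commute)
qed

lemma traj_Eint_le:
 assumes u: "traj u" and I: "I \<in> sets borel" "I \<subseteq> {0..}"
 shows "Eint \<beta> I u \<le> 2 * (ennreal M + emeasure lborel I)"
proof -
 let ?d = "\<lambda>t k. u t k - p k"
 have db: "borel_field ?d" by (rule borel_field_diff[OF traj_borel[OF u]]) (simp add: borel_field_def)
 note [measurable] = borel_field_E[OF db] I(1)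
 have "Eint \<beta> I u \<le> (\<integral>\<^sup>+t. 2 * (E \<beta> (?d t) * indicator I t) + 2 * indicator I t \<partial>lborel)" unfolding Eint_def
 proof (rule nn_integral_mono)
  fix t
  have "E \<beta> (u t) \<le> 2 * E \<beta> (?d t) + 2 * E \<beta> p" using E_add_le[of \<beta> "?d t" p] by simp
  also have "\<dots> \<le> 2 * E \<beta> (?d t) + 2 * 1" by (intro add_mono mult_left_mono p_E) auto
  finally show "E \<beta> (u t) * indicator I t \<le> 2 * (E \<beta> (?d t) * indicator I t) + 2 * indicator I t" by (auto split: split_indicator)
 qed
 also have "\<dots> = 2 * Eint \<beta> I ?d + 2 * emeasure lborel I"
  unfolding Eint_def by (subst nn_integral_add) (auto simp: nn_integral_cmult)
 also have "\<dots> \<le> 2 * ennreal M + 2 * emeasure lborel I" using traj_decay_Eint[OF u I(2)] by (intro add_mono mult_left_mono) auto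
 finally show ?thesis by (simp add: distrib_left)
qed

lemma traj_Eint_finite:
 assumes u: "traj u"
 shows "Eint \<beta> {-\<mu><..T} u < top"
proof -
 note [measurable] = borel_field_E[OF traj_borel[OF u]]
 have "Eint \<beta> {-\<mu><..T} u \<le> Eint \<beta> {-\<mu><..<0} u + Eint \<beta> {0..T} u" unfolding Eint_def
  by (subst nn_integral_add[symmetric]) (auto intro!: nn_integral_mono split: split_indicator)
 also have "\<dots> \<le> ennreal M + 2 * (ennreal M + emeasure lborel {0..T})"
  using u by (intro add_mono traj_Eint_le) (auto simp: trajectory_def)
 also have "\<dots> < top" by (simp add: ennreal_mult_less_top emeasure_lborel_Icc_eq)
 finally show ?thesis .
qed

lemma traj_window:
 assumes u: "traj u" and c: "0 \<le> c \<or> c = - \<mu>"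
 shows "Eint \<beta> {c<..<c + \<mu>} u \<le> ennreal (2 * \<mu> + 2 * M)"
proof (cases "0 \<le> c")
 case True
 then have "Eint \<beta> {c<..<c + \<mu>} u \<le> 2 * (ennreal M + emeasure lborel {c<..<c + \<mu>})" by (intro traj_Eint_le u) auto
 also have "\<dots> = ennreal (2 * \<mu> + 2 * M)" using mu_pos M_nonneg by (simp add: ennreal_plus distrib_left ennreal_mult add.commute)
 finally show ?thesis .
next
 case False
 then have "Eint \<beta> {c<..<c + \<mu>} u \<le> ennreal M" using c u by (auto simp: trajectory_def)
 also have "\<dots> \<le> ennreal (2 * \<mu> + 2 * M)" using mu_pos M_nonneg by (intro ennreal_leI) auto
 finally show ?thesis .
qed

lemma traj_bounded:
 assumes u: "traj u" and t: "0 \<le> t"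
 shows "E \<alpha> (u t) \<le> 2 * ennreal M + 2 * ennreal (lam1 powr (\<alpha> - \<beta>))"
proof -
 have "E \<alpha> (u t) \<le> 2 * E \<alpha> (\<lambda>k. u t k - p k) + 2 * E \<alpha> p" using E_add_le[of \<alpha> "\<lambda>k. u t k - p k" p] by simp
 also have "\<dots> \<le> 2 * ennreal M + 2 * ennreal (lam1 powr (\<alpha> - \<beta>))"
 proof (intro add_mono mult_left_mono p_Ea order_trans[OF traj_decay[OF u t]] ennreal_leI)
  show "M * (exp (- t))\<^sup>2 \<le> M" using M_nonneg t by (intro mult_right_le_one_le) (auto simp: power_le_one)
 qed auto
 finally show ?thesis .
qed

lemma traj_V: "traj u \<Longrightarrow> 0 \<le> t \<Longrightarrow> u t \<in> V L \<alpha>"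
 using le_less_trans[OF traj_bounded, of u t top] traj_sol by (simp add: V_iff ennreal_mult_less_top)

lemma traj_shift_Eint_finite:
 assumes u: "traj u" and I: "I \<in> sets borel" "I \<subseteq> {-\<mu> - c<..T}"
 shows "Eint \<beta> I (\<lambda>t. u (t + c)) < top"
proof -
 have "Eint \<beta> I (\<lambda>t. u (t + c)) \<le> Eint \<beta> {-\<mu><..T + c} u"
  unfolding Eint_shift[OF traj_borel[OF u] I(1)] by (rule Eint_subset) (use I(2) in force)
 then show ?thesis using traj_Eint_finite[OF u] by (rule le_less_trans)
qed

lemma traj_L2:
 assumes u: "traj u" and I: "I \<in> sets borel" "I \<subseteq> {-\<mu> - c<..T}"
 shows "(\<lambda>t. u (t + c)) \<in> L2_funs L \<beta> I"
 by (rule L2_funsI[where w = "\<lambda>t. u (t + c)"])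
   (use I borel_field_shift[OF traj_borel[OF u]] traj_sol[OF u] traj_shift_Eint_finite[OF u I] in auto)

lemma traj_history_finite:
 assumes u: "traj u" and c: "0 \<le> c"
 shows "Eint \<beta> {0..T} (\<lambda>t. u (t + c - \<mu>)) < top"
proof -
 have "{0<..T} \<subseteq> {-\<mu> - (c - \<mu>)<..T}" using c by auto
 then show ?thesis using traj_shift_Eint_finite[OF u, of "{0<..T}" "c - \<mu>" T] unfolding Eint_Icc by (simp add: add_diff_eq)
qed

lemma traj_present_finite:
 assumes u: "traj u" and c: "0 \<le> c"
 shows "Eint \<beta> {0..T} (\<lambda>t. u (t + c)) < top"
proof -
 have "{0..T} \<subseteq> {-\<mu> - c<..T}" using c mu_pos by auto
 then show ?thesis using traj_shift_Eint_finite[OF u, of "{0..T}" c T] by simp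
qed

lemma traj_forcing_integrable:
 assumes u: "traj u"
 shows "integrable lborel (\<lambda>s. indicator {0..t} s *\<^sub>R forcing f (\<lambda>t. u (t - \<mu>)) u s k)"
proof (rule integrable_forcing[where c = 0 and d = t])
 show "borel_field (\<lambda>t. u (t - \<mu>))" using borel_field_shift[OF traj_borel[OF u], of "- \<mu>"] by simp
 show "Eint \<beta> {0..t} (\<lambda>t. u (t - \<mu>)) < top" using traj_history_finite[OF u, of 0] by simp
 show "Eint \<alpha> {0..t} u < top"
  using traj_present_finite[OF u, of 0 t] by (intro Eint_embedding_finite[of \<alpha> \<beta>] traj_borel[OF u]) auto
qed (auto simp: traj_at_0[OF u] traj_borel[OF u])

lemma traj_coeff_continuous:
 assumes u: "traj u"
 shows "continuous_on {0..T} (\<lambda>t. u t k)"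
proof -
 let ?G = "forcing f (\<lambda>t. u (t - \<mu>)) u"
 have "mild \<nu> ?G u 0 T" using u by (simp add: trajectory_def)
 then have eq: "u t k = exp (- (\<nu> * lam k * t)) *\<^sub>R (u 0 k + (\<integral>s. indicator {0..t} s *\<^sub>R (exp (\<nu> * lam k * s) *\<^sub>R ?G s k) \<partial>lborel))"
  if "t \<in> {0..T}" for t
 proof -
  have "exp (\<nu> * lam k * t) *\<^sub>R u t k = u 0 k + (\<integral>s. indicator {0..t} s *\<^sub>R (exp (\<nu> * lam k * s) *\<^sub>R ?G s k) \<partial>lborel)"
   using \<open>mild \<nu> ?G u 0 T\<close>[unfolded mild_def, rule_format, OF that, of k] by (simp add: algebra_simps)
  then have "exp (- (\<nu> * lam k * t)) *\<^sub>R (exp (\<nu> * lam k * t) *\<^sub>R u t k) = exp (- (\<nu> * lam k * t)) *\<^sub>R (u 0 k + (\<integral>s. indicator {0..t} s *\<^sub>R (exp (\<nu> * lam k * s) *\<^sub>R ?G s k) \<partial>lborel))"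
   by (rule arg_cong)
  then show ?thesis by (simp add: exp_minus)
 qed
 have i: "integrable lborel (\<lambda>s. indicator {0..t} s *\<^sub>R (exp (\<nu> * lam k * s) *\<^sub>R ?G s k))" for t
  by (rule integrable_bounded_mult[where c = 0 and d = t, OF traj_forcing_integrable[OF u]]) (auto intro!: continuous_intros)
 have "continuous_on {0..T} (\<lambda>t. exp (- (\<nu> * lam k * t)) *\<^sub>R (u 0 k + (\<integral>s. indicator {0..t} s *\<^sub>R (exp (\<nu> * lam k * s) *\<^sub>R ?G s k) \<partial>lborel)))"
  by (intro continuous_intros continuous_on_indefinite_integral i)
 then show ?thesis by (subst continuous_on_cong[OF refl eq]) auto
qed

text \<open>
 Each coefficient is continuous by the variation of constants formula, and the supremum over time inside the sum \<open>Qa\<close> provides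
 the majorant for dominated convergence.
\<close>

lemma traj_continuous:
 assumes u: "traj u" and c: "0 \<le> c"
 shows "continuous_map (top_of_set {0..T}) (V_topology L \<alpha>) (\<lambda>t. u (t + c))"
proof (rule continuous_map_V_I)
 show "u (t + c) \<in> V L \<alpha>" if "t \<in> {0..T}" for t using that c by (intro traj_V[OF u]) auto
 obtain z where z: "perturbation z" "Q z \<le> ennreal M" "\<And>t. 0 \<le> t \<Longrightarrow> u t = (\<lambda>k. p k + exp (- t) *\<^sub>R z t k)"
  using traj_remainder[OF u] by blast
 fix X t assume X: "\<And>n. X n \<in> {0..T}" "X \<longlonglongrightarrow> t" and t: "t \<in> {0..T}"
 define G where "G k = (SUP t. ennreal (lam k powr \<alpha> * (norm (z t k))\<^sup>2))" for k
 have "(\<lambda>n. \<integral>\<^sup>+k. ennreal (lam k powr \<alpha> * (norm (u (X n + c) k - u (t + c) k))\<^sup>2) \<partial>count_space UNIV) \<longlonglongrightarrow> (\<integral>\<^sup>+k. 0 \<partial>count_space (UNIV :: (int ^ 3) set))"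
 proof (rule nn_integral_dominated_convergence[where w = "\<lambda>k. 2 * (G k + G k)"])
  have "(\<Sum>\<^sup>+k. 2 * (G k + G k)) = 2 * (Qa z + Qa z)"
   unfolding Qa_def G_def by (subst nn_integral_cmult, simp, subst nn_integral_add) auto
  also have "\<dots> \<le> 2 * (ennreal M + ennreal M)" by (intro mult_left_mono add_mono order_trans[OF Qa_le_Q z(2)]) auto
  also have "\<dots> < top" by (simp add: ennreal_mult_less_top)
  finally show "(\<Sum>\<^sup>+k. 2 * (G k + G k)) < \<infinity>" by simp
  have g: "ennreal (lam k powr \<alpha> * (norm (exp (- s) *\<^sub>R z s k))\<^sup>2) \<le> G k" if "0 \<le> s" for s k
  proof -
   have "norm (exp (- s) *\<^sub>R z s k) \<le> norm (z s k)" using that by (simp add: mult_left_le_one_le)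
   then have "ennreal (lam k powr \<alpha> * (norm (exp (- s) *\<^sub>R z s k))\<^sup>2) \<le> ennreal (lam k powr \<alpha> * (norm (z s k))\<^sup>2)"
    by (intro ennreal_leI mult_left_mono power_mono) auto
   also have "\<dots> \<le> G k" unfolding G_def by (rule SUP_upper) simp
   finally show ?thesis .
  qed
  have "ennreal (lam k powr \<alpha> * (norm (u (X n + c) k - u (t + c) k))\<^sup>2) \<le> 2 * (G k + G k)" for n k
  proof -
   have nn: "0 \<le> X n + c" "0 \<le> t + c" using X(1)[of n] t c by auto
   then have eq: "u (X n + c) k - u (t + c) k = exp (- (X n + c)) *\<^sub>R z (X n + c) k - exp (- (t + c)) *\<^sub>R z (t + c) k"
    by (simp add: z(3))
   have "ennreal (lam k powr \<alpha> * (norm (u (X n + c) k - u (t + c) k))\<^sup>2)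
    \<le> 2 * (ennreal (lam k powr \<alpha> * (norm (exp (- (X n + c)) *\<^sub>R z (X n + c) k))\<^sup>2) + ennreal (lam k powr \<alpha> * (norm (exp (- (t + c)) *\<^sub>R z (t + c) k))\<^sup>2))"
    unfolding eq by (rule ennreal_weighted_diff_le) simp
   also have "\<dots> \<le> 2 * (G k + G k)" by (intro mult_left_mono add_mono g nn) simp
   finally show ?thesis .
  qed
  then show "AE k in count_space UNIV. ennreal (lam k powr \<alpha> * (norm (u (X n + c) k - u (t + c) k))\<^sup>2) \<le> 2 * (G k + G k)" for n
   by simp
  have "(\<lambda>n. ennreal (lam k powr \<alpha> * (norm (u (X n + c) k - u (t + c) k))\<^sup>2)) \<longlonglongrightarrow> ennreal (lam k powr \<alpha> * (norm (u (t + c) k - u (t + c) k))\<^sup>2)" for k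
  proof (intro tendsto_ennrealI tendsto_mult tendsto_const tendsto_power tendsto_norm tendsto_diff)
   show "(\<lambda>n. u (X n + c) k) \<longlonglongrightarrow> u (t + c) k" by (rule continuous_on_tendsto_compose[OF traj_coeff_continuous[OF u, of "T + c" k]])
      (use X t c in \<open>auto intro!: tendsto_add\<close>)
  qed
  then show "AE k in count_space UNIV. (\<lambda>n. ennreal (lam k powr \<alpha> * (norm (u (X n + c) k - u (t + c) k))\<^sup>2)) \<longlonglongrightarrow> 0" by simp
 qed auto
 then show "(\<lambda>n. E \<alpha> (\<lambda>k. u (X n + c) k - u (t + c) k)) \<longlonglongrightarrow> 0" by (simp add: E_def)
qed

lemma traj_weak:
 assumes u: "traj u" and c: "0 \<le> c" and J: "J \<in> sets borel" "J \<subseteq> {0<..}"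
 shows "weak_equation L \<alpha> \<nu> f J (\<lambda>t. u (t + c - \<mu>)) (\<lambda>t. u (t + c))"
proof (rule mild_imp_weak[where c = 0, OF J f_V])
 let ?a = "\<lambda>t. u (t + c - \<mu>)" and ?u = "\<lambda>t. u (t + c)"
 have ab: "borel_field ?a" "borel_field ?u"
  using borel_field_shift[OF traj_borel[OF u], of "c - \<mu>"] borel_field_shift[OF traj_borel[OF u], of c] by (simp_all add: add_diff_eq)
 note [measurable] = borel_field_E[OF ab(1)] borel_field_E[OF borel_PB[OF ab]]
 show "borel_field ?a" "borel_field ?u" by (rule ab)+
 show "u (t + c - \<mu>) 0 = 0" "u (t + c) 0 = 0" "solenoidal (u (t + c))" for t by (simp_all add: traj_at_0[OF u] traj_sol[OF u])
 have "AE t in lborel. \<forall>n. E \<beta> (?a t) * indicator {0..real n} t \<noteq> \<infinity>" unfolding AE_all_countable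
 proof
  fix n show "AE t in lborel. E \<beta> (?a t) * indicator {0..real n} t \<noteq> \<infinity>"
   by (rule nn_integral_PInf_AE) (use traj_history_finite[OF u c, of "real n"] in \<open>auto simp: Eint_def\<close>)
 qed
 then show "AE t in lborel. t \<in> J \<longrightarrow> ?a t \<in> V L \<beta>"
 proof eventually_elim
  case (elim t)
  obtain n where "t \<le> real n" using real_arch_simple by blast
  then show ?case using elim[rule_format, of n] J(2) traj_sol[OF u] by (auto simp: V_iff top.not_eq_extremum)
 qed
 show "Eint \<beta> {0..T} ?a < top" "Eint \<beta> {0..T} ?u < top" for T
  by (rule traj_history_finite[OF u c], rule traj_present_finite[OF u c])
 define C where "C = 2 * ennreal M + 2 * ennreal (lam1 powr (\<alpha> - \<beta>))"
 have C: "C < top" by (simp add: C_def ennreal_mult_less_top)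
 show "Eint (\<alpha> - 1) {0..T} (\<lambda>t. PB (?a t) (?u t)) < top" for T
 proof -
  have "Eint (\<alpha> - 1) {0..T} (\<lambda>t. PB (?a t) (?u t)) \<le> (\<integral>\<^sup>+t. ennreal K * C * (E \<beta> (?a t) * indicator {0..T} t) \<partial>lborel)"
   unfolding Eint_def
  proof (rule nn_integral_mono)
   fix t
   show "E (\<alpha> - 1) (PB (?a t) (?u t)) * indicator {0..T} t \<le> ennreal K * C * (E \<beta> (?a t) * indicator {0..T} t)"
   proof (cases "t \<in> {0..T}")
    case True
    have "E (\<alpha> - 1) (PB (?a t) (?u t)) \<le> ennreal K * (E \<beta> (?a t) * E \<alpha> (?u t))" by (intro E_PB_le) (simp_all add: traj_at_0[OF u])
    also have "\<dots> \<le> ennreal K * (E \<beta> (?a t) * C)" unfolding C_def using True c by (intro mult_left_mono traj_bounded[OF u]) auto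
    finally show ?thesis using True by (simp add: mult_ac)
   qed simp
  qed
  also have "\<dots> = ennreal K * C * Eint \<beta> {0..T} ?a" unfolding Eint_def by (rule nn_integral_cmult) measurable
  also have "\<dots> < top" using C traj_history_finite[OF u c] by (simp add: ennreal_mult_less_top)
  finally show ?thesis .
 qed
 show "mild \<nu> (forcing f ?a ?u) ?u 0 T" for T
 proof -
  have "mild \<nu> (\<lambda>t. forcing f (\<lambda>t. u (t - \<mu>)) u (t + c)) ?u 0 T"
  proof (rule mild_shift[OF _ c _ traj_forcing_integrable[OF u]])
   show "mild \<nu> (forcing f (\<lambda>t. u (t - \<mu>)) u) u 0 (T + c)" using u by (simp add: trajectory_def)
   show "borel_field (forcing f (\<lambda>t. u (t - \<mu>)) u)"
    using borel_forcing[OF borel_field_shift[OF traj_borel[OF u], of "- \<mu>"] traj_borel[OF u]] by simp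
  qed
  moreover have "(\<lambda>t. forcing f (\<lambda>t. u (t - \<mu>)) u (t + c)) = forcing f ?a ?u" by (simp add: forcing_def fun_eq_iff)
  ultimately show ?thesis by simp
 qed
qed

end

section \<open>Attractors that consist of one point\<close>

lemma semidistance_singleton_le:
 assumes "\<And>x. x \<in> X \<Longrightarrow> d x P \<le> r"
 shows "semidistance d X {P} \<le> ennreal r"
 unfolding semidistance_def using assms by (auto intro!: SUP_least ennreal_leI)

text \<open>
 For the uniqueness, a point of an invariant set is the image at time \<open>t\<close> of some point of that set for every
 \<open>t\<close>, so its distance to \<open>P\<close> is at most \<open>r t\<close> for all large \<open>t\<close>.
\<close>

lemma singleton_local_attractor:
 assumes M: "Metric_space M d" and P: "P \<in> B" "P \<in> M" "\<And>t. 0 \<le> t \<Longrightarrow> S t P = P"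
  and decay: "\<And>x t. x \<in> B \<Longrightarrow> \<tau> \<le> t \<Longrightarrow> d (S t x) P \<le> r t" and r: "(r \<longlongrightarrow> 0) at_top"
  and sep: "\<And>a. a \<in> B \<Longrightarrow> d a P \<le> 0 \<Longrightarrow> a = P"
 shows "local_attractor M d S B {P}" and "local_attractor M d S B A \<Longrightarrow> A = {P}"
proof -
 have "((\<lambda>t. semidistance d (S t ` B) {P}) \<longlongrightarrow> 0) at_top"
 proof (rule tendsto_sandwich[OF _ _ tendsto_const])
  show "\<forall>\<^sub>F t in at_top. 0 \<le> semidistance d (S t ` B) {P}" by simp
  show "\<forall>\<^sub>F t in at_top. semidistance d (S t ` B) {P} \<le> ennreal (r t)"
   using eventually_ge_at_top[of \<tau>] by eventually_elim (auto intro!: semidistance_singleton_le decay)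
  show "((\<lambda>t. ennreal (r t)) \<longlongrightarrow> 0) at_top" using tendsto_ennrealI[OF r] by simp
 qed
 then show "local_attractor M d S B {P}"
  unfolding local_attractor_def using P by (auto simp: Metric_space.topspace_mtopology[OF M])
 assume A: "local_attractor M d S B A"
 have "a = P" if a: "a \<in> A" for a
 proof (rule sep)
  show "a \<in> B" using A a by (auto simp: local_attractor_def)
  have "\<forall>\<^sub>F t in at_top. d a P \<le> r t" using eventually_ge_at_top[of \<tau>] eventually_ge_at_top[of 0]
  proof eventually_elim
   case (elim t)
   then obtain x where "x \<in> A" "a = S t x" using A a unfolding local_attractor_def by blast
   then show ?case using A elim by (auto simp: local_attractor_def intro!: decay)
  qed
  then show "d a P \<le> 0" by (rule tendsto_lowerbound[OF r]) simp
 qed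
 then show "A = {P}" using A by (auto simp: local_attractor_def)
qed

lemma singleton_discrete_local_attractor:
 assumes M: "Metric_space M d" and P: "P \<in> B" "P \<in> M" "U P = P"
  and decay: "\<And>x n. x \<in> B \<Longrightarrow> 1 \<le> n \<Longrightarrow> d ((U ^^ n) x) P \<le> r n" and r: "r \<longlonglongrightarrow> 0"
  and sep: "\<And>a. a \<in> B \<Longrightarrow> d a P \<le> 0 \<Longrightarrow> a = P"
 shows "discrete_local_attractor M d U B {P}" and "discrete_local_attractor M d U B A \<Longrightarrow> A = {P}"
proof -
 have "(\<lambda>n. semidistance d ((U ^^ n) ` B) {P}) \<longlonglongrightarrow> 0"
 proof (rule tendsto_sandwich[OF _ _ tendsto_const])
  show "\<forall>\<^sub>F n in sequentially. 0 \<le> semidistance d ((U ^^ n) ` B) {P}" by simp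
  show "\<forall>\<^sub>F n in sequentially. semidistance d ((U ^^ n) ` B) {P} \<le> ennreal (r n)"
   using eventually_ge_at_top[of 1] by eventually_elim (auto intro!: semidistance_singleton_le decay)
  show "(\<lambda>n. ennreal (r n)) \<longlonglongrightarrow> 0" using tendsto_ennrealI[OF r] by simp
 qed
 then show "discrete_local_attractor M d U B {P}"
  unfolding discrete_local_attractor_def using P by (auto simp: Metric_space.topspace_mtopology[OF M])
 assume A: "discrete_local_attractor M d U B A"
 have inv: "(U ^^ n) ` A = A" for n
 proof (induction n)
  case (Suc n)
  have "(U ^^ Suc n) ` A = U ` ((U ^^ n) ` A)" by (simp add: image_image)
  then show ?case using Suc A by (simp add: discrete_local_attractor_def)
 qed simp
 have "a = P" if a: "a \<in> A" for a
 proof (rule sep)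
  show "a \<in> B" using A a by (auto simp: discrete_local_attractor_def)
  have "\<forall>\<^sub>F n in sequentially. d a P \<le> r n" using eventually_ge_at_top[of 1]
  proof eventually_elim
   case (elim n)
   then obtain x where "x \<in> A" "a = (U ^^ n) x" using inv[of n] a by blast
   then show ?case using A elim by (auto simp: discrete_local_attractor_def intro!: decay)
  qed
  then show "d a P \<le> 0" by (rule tendsto_lowerbound[OF r]) simp
 qed
 then show "A = {P}" using A by (auto simp: discrete_local_attractor_def)
qed

section \<open>The metric of the phase spaces\<close>

lemma equiv_L2_rel: "equiv (L2_funs L s I) (L2_rel L s I)"
proof (rule equivI)
 show "L2_rel L s I \<subseteq> L2_funs L s I \<times> L2_funs L s I" by (auto simp: L2_rel_def)
 show "refl_on (L2_funs L s I) (L2_rel L s I)" by (auto simp: refl_on_def L2_rel_def)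
 show "sym (L2_rel L s I)" by (auto simp: sym_def L2_rel_def)
 show "trans (L2_rel L s I)"
 proof (rule transI)
  fix u v w assume "(u, v) \<in> L2_rel L s I" "(v, w) \<in> L2_rel L s I"
  then have uvw: "u \<in> L2_funs L s I" "w \<in> L2_funs L s I" "AE t in lebesgue_on I. u t = v t" "AE t in lebesgue_on I. v t = w t"
   by (auto simp: L2_rel_def)
  have "AE t in lebesgue_on I. u t = w t" using uvw(3,4) by eventually_elim simp
  then show "(u, w) \<in> L2_rel L s I" using uvw(1,2) by (simp add: L2_rel_def)
 qed
qed

lemma L2_class_in_space: "u \<in> L2_funs L s I \<Longrightarrow> L2_class L s I u \<in> L2_space L s I"
 unfolding L2_class_def L2_space_def by (rule quotientI)

context torus
begin

lemma L2_class_cong: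
 assumes I: "I \<in> sets borel" and u: "u \<in> L2_funs L s I" "v \<in> L2_funs L s I" and ae: "AE t in lborel. t \<in> I \<longrightarrow> u t = v t"
 shows "L2_class L s I u = L2_class L s I v"
 unfolding L2_class_def by (rule equiv_class_eq[OF equiv_L2_rel]) (use u ae AE_lebesgue_on_iff[OF I] in \<open>simp add: L2_rel_def\<close>)

lemma L2_class_mem:
 assumes "u \<in> L2_funs L s I"
 shows "u \<in> L2_class L s I u"
 unfolding L2_class_def by (rule equiv_class_self[OF equiv_L2_rel assms])

lemma L2_class_memD:
 assumes "v \<in> L2_class L s I u" "I \<in> sets borel"
 shows "v \<in> L2_funs L s I" "AE t in lborel. t \<in> I \<longrightarrow> v t = u t"
 using assms AE_lebesgue_on_iff[of I "\<lambda>t. u t = v t"] by (auto simp: L2_class_def L2_rel_def eq_commute)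

lemma rep_L2_class:
 assumes "u \<in> L2_funs L s I" "I \<in> sets borel"
 shows "AE t in lborel. t \<in> I \<longrightarrow> rep (L2_class L s I u) t = u t"
proof -
 have "rep (L2_class L s I u) \<in> L2_class L s I u"
  unfolding rep_def using L2_class_mem[OF assms(1)] by (rule someI[where P = "\<lambda>v. v \<in> L2_class L s I u"])
 then show ?thesis by (rule L2_class_memD) (rule assms)
qed

lemma L2_space_borel_rep:
 assumes X: "X \<in> L2_space L s I" and I: "I \<in> sets borel"
 obtains w where "borel_field w" "\<And>t. w t \<in> V L s" "Eint s I w < top" "w \<in> L2_funs L s I" "X = L2_class L s I w"
proof -
 obtain u where u: "u \<in> L2_funs L s I" "X = L2_class L s I u" using X by (auto simp: L2_space_def L2_class_def quotient_def)
 obtain w where w: "borel_field w" "\<And>t. w t \<in> V L s" "AE t in lborel. t \<in> I \<longrightarrow> u t = w t" "Eint s I w < top"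
  by (rule L2_funs_borel_rep[OF u(1) I]) blast
 have wf: "w \<in> L2_funs L s I" by (rule L2_funsI[OF I w(1) _ w(4)]) (use w(2) in \<open>auto simp: V_iff\<close>)
 show ?thesis by (rule that[OF w(1,2,4) wf]) (simp only: u(2) L2_class_cong[OF I u(1) wf w(3)])
qed

lemma L2_norm_class:
 assumes "borel_field w" "Eint s I w < top" "w \<in> L2_funs L s I" "I \<in> sets borel"
 shows "ennreal ((L2_norm L s I (L2_class L s I w))\<^sup>2) = ennreal (L ^ 3) * Eint s I w"
 unfolding L2_norm_def by (rule L2_norm_integral[OF assms(4,1) rep_L2_class[OF assms(3,4)] assms(2)])

lemma L2_dist_class:
 assumes u: "borel_field u" "u \<in> L2_funs L s I" and v: "borel_field v" "v \<in> L2_funs L s I"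
  and fin: "Eint s I (\<lambda>t k. u t k - v t k) < top" and I: "I \<in> sets borel"
 shows "ennreal ((L2_dist L s I (L2_class L s I u) (L2_class L s I v))\<^sup>2) = ennreal (L ^ 3) * Eint s I (\<lambda>t k. u t k - v t k)"
 unfolding L2_dist_def V_dist_def
proof (rule L2_norm_integral[OF I borel_field_diff[OF u(1) v(1)] _ fin])
 show "AE t in lborel. t \<in> I \<longrightarrow> (\<lambda>k. rep (L2_class L s I u) t k - rep (L2_class L s I v) t k) = (\<lambda>k. u t k - v t k)"
  using rep_L2_class[OF u(2) I] rep_L2_class[OF v(2) I] by eventually_elim auto
qed

lemma Eint_diff_finite:
 assumes u: "borel_field u" "Eint s I u < top" and v: "borel_field v" "Eint s I v < top" and I [measurable]: "I \<in> sets borel"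
 shows "Eint s I (\<lambda>t k. u t k - v t k) < top"
proof -
 note [measurable] = borel_field_E[OF u(1)] borel_field_E[OF v(1)]
 have "Eint s I (\<lambda>t k. u t k - v t k) \<le> (\<integral>\<^sup>+t. 2 * (E s (u t) * indicator I t) + 2 * (E s (v t) * indicator I t) \<partial>lborel)"
  unfolding Eint_def by (intro nn_integral_mono) (auto intro!: E_diff_le split: split_indicator)
 also have "\<dots> = 2 * Eint s I u + 2 * Eint s I v" unfolding Eint_def by (subst nn_integral_add) (auto simp: nn_integral_cmult)
 also have "\<dots> < top" using u v by (simp add: ennreal_mult_less_top)
 finally show ?thesis .
qed

lemma L2_dist_eq_0:
 assumes X: "X \<in> L2_space L s I" and Y: "Y \<in> L2_space L s I" and I [measurable]: "I \<in> sets borel" and 0: "L2_dist L s I X Y = 0"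
 shows "X = Y"
proof -
 obtain u where u: "borel_field u" "\<And>t. u t \<in> V L s" "Eint s I u < top" "u \<in> L2_funs L s I" "X = L2_class L s I u"
  by (rule L2_space_borel_rep[OF X I]) blast
 obtain v where v: "borel_field v" "\<And>t. v t \<in> V L s" "Eint s I v < top" "v \<in> L2_funs L s I" "Y = L2_class L s I v"
  by (rule L2_space_borel_rep[OF Y I]) blast
 let ?d = "\<lambda>t k. u t k - v t k"
 have db: "borel_field ?d" by (rule borel_field_diff[OF u(1) v(1)])
 note [measurable] = borel_field_E[OF db]
 have "ennreal (L ^ 3) * Eint s I ?d = 0"
  using L2_dist_class[OF u(1,4) v(1,4) Eint_diff_finite[OF u(1,3) v(1,3) I] I] 0 by (simp add: u(5) v(5))
 then have "Eint s I ?d = 0" using L_pos by simp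
 then have "AE t in lborel. E s (?d t) * indicator I t = 0" unfolding Eint_def by (subst (asm) nn_integral_0_iff_AE) auto
 then have "AE t in lborel. t \<in> I \<longrightarrow> u t = v t"
 proof eventually_elim
  case (elim t)
  show ?case
  proof (intro impI ext)
   fix k assume "t \<in> I"
   then have "E s (?d t) = 0" using elim by simp
   then show "u t k = v t k"
    using E_eq_0[of s "?d t" k] u(2)[of t] v(2)[of t] by (cases "k = 0") (auto simp: V_iff solenoidal_at_0)
  qed
 qed
 then show ?thesis unfolding u(5) v(5) by (rule L2_class_cong[OF I u(4) v(4)])
qed

lemma L2_dist_triangle:
 assumes X: "X \<in> L2_space L s I" and Y: "Y \<in> L2_space L s I" and W: "W \<in> L2_space L s I" and I [measurable]: "I \<in> sets borel"
 shows "L2_dist L s I X W \<le> L2_dist L s I X Y + L2_dist L s I Y W"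
proof (rule Minkowski_criterion)
 obtain u where u: "borel_field u" "\<And>t. u t \<in> V L s" "Eint s I u < top" "u \<in> L2_funs L s I" "X = L2_class L s I u"
  by (rule L2_space_borel_rep[OF X I]) blast
 obtain v where v: "borel_field v" "\<And>t. v t \<in> V L s" "Eint s I v < top" "v \<in> L2_funs L s I" "Y = L2_class L s I v"
  by (rule L2_space_borel_rep[OF Y I]) blast
 obtain w where w: "borel_field w" "\<And>t. w t \<in> V L s" "Eint s I w < top" "w \<in> L2_funs L s I" "W = L2_class L s I w"
  by (rule L2_space_borel_rep[OF W I]) blast
 have d: "ennreal ((L2_dist L s I X Y)\<^sup>2) = ennreal (L ^ 3) * Eint s I (\<lambda>t k. u t k - v t k)"
  "ennreal ((L2_dist L s I Y W)\<^sup>2) = ennreal (L ^ 3) * Eint s I (\<lambda>t k. v t k - w t k)"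
  "ennreal ((L2_dist L s I X W)\<^sup>2) = ennreal (L ^ 3) * Eint s I (\<lambda>t k. u t k - w t k)"
  unfolding u(5) v(5) w(5) by (intro L2_dist_class u v w Eint_diff_finite I)+
 have db: "borel_field (\<lambda>t k. u t k - v t k)" "borel_field (\<lambda>t k. v t k - w t k)" by (intro borel_field_diff u v w)+
 note [measurable] = borel_field_E[OF db(1)] borel_field_E[OF db(2)]
 fix c :: real assume c: "0 < c"
 have "Eint s I (\<lambda>t k. u t k - w t k) \<le> (\<integral>\<^sup>+t. ennreal (1 + c) * (E s (\<lambda>k. u t k - v t k) * indicator I t) + ennreal (1 + 1 / c) * (E s (\<lambda>k. v t k - w t k) * indicator I t) \<partial>lborel)"
  unfolding Eint_def
 proof (rule nn_integral_mono)
  fix t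
  show "E s (\<lambda>k. u t k - w t k) * indicator I t \<le> ennreal (1 + c) * (E s (\<lambda>k. u t k - v t k) * indicator I t) + ennreal (1 + 1 / c) * (E s (\<lambda>k. v t k - w t k) * indicator I t)"
   using E_add_weighted_le[OF c, of s "\<lambda>k. u t k - v t k" "\<lambda>k. v t k - w t k"] by (auto split: split_indicator)
 qed
 also have "\<dots> = ennreal (1 + c) * Eint s I (\<lambda>t k. u t k - v t k) + ennreal (1 + 1 / c) * Eint s I (\<lambda>t k. v t k - w t k)"
  unfolding Eint_def by (subst nn_integral_add) (auto simp: nn_integral_cmult)
 finally have "ennreal (L ^ 3) * Eint s I (\<lambda>t k. u t k - w t k)
   \<le> ennreal (L ^ 3) * (ennreal (1 + c) * Eint s I (\<lambda>t k. u t k - v t k) + ennreal (1 + 1 / c) * Eint s I (\<lambda>t k. v t k - w t k))"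
  by (rule mult_left_mono) simp
 also have "\<dots> = ennreal (1 + c) * (ennreal (L ^ 3) * Eint s I (\<lambda>t k. u t k - v t k)) + ennreal (1 + 1 / c) * (ennreal (L ^ 3) * Eint s I (\<lambda>t k. v t k - w t k))"
  by (simp add: distrib_left mult_ac)
 also have "\<dots> = ennreal ((1 + c) * (L2_dist L s I X Y)\<^sup>2 + (1 + 1 / c) * (L2_dist L s I Y W)\<^sup>2)"
  unfolding d[symmetric] using c by (subst ennreal_plus) (auto simp: ennreal_mult)
 finally show "(L2_dist L s I X W)\<^sup>2 \<le> (1 + c) * (L2_dist L s I X Y)\<^sup>2 + (1 + 1 / c) * (L2_dist L s I Y W)\<^sup>2"
  unfolding d(3)[symmetric] using c by (subst (asm) ennreal_le_iff) auto
qed (simp_all add: L2_dist_def integral_nonneg_AE)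

lemma Metric_space_L2:
 assumes I: "I \<in> sets borel"
 shows "Metric_space (L2_space L s I) (L2_dist L s I)"
proof
 show "L2_dist L s I X Y = L2_dist L s I Y X" for X Y by (simp add: L2_dist_def V_dist_commute)
 show "L2_dist L s I X Y = 0 \<longleftrightarrow> X = Y" if "X \<in> L2_space L s I" "Y \<in> L2_space L s I" for X Y
  using L2_dist_eq_0[OF that I] by (auto simp: L2_dist_def V_dist_def V_norm_eq)
qed (auto simp: L2_dist_def integral_nonneg_AE intro: L2_dist_triangle[OF _ _ _ I, unfolded L2_dist_def])

lemma Metric_space_phase:
 assumes "I \<in> sets borel"
 shows "Metric_space (phase_space L \<alpha> I) (phase_dist L \<alpha> I)"
 unfolding phase_space_def phase_dist_def
 by (intro Metric_space12.prod_metric Metric_space12.intro Metric_space_L2 Metric_space_V assms)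

end

context steady_regime
begin

section \<open>The two dynamical systems along trajectories\<close>

definition steady :: "real set \<Rightarrow> state" where
 "steady I = (L2_class L \<beta> I (\<lambda>t. p), p)"

lemma steady_separated:
 assumes a: "a \<in> phase_space L \<alpha> I" and I: "I \<in> sets borel" and P: "(\<lambda>t. p) \<in> L2_funs L \<beta> I"
  and d: "phase_dist L \<alpha> I a (steady I) \<le> 0"
 shows "a = steady I"
proof -
 obtain X v where av: "a = (X, v)" "X \<in> L2_space L \<beta> I" "v \<in> V L \<alpha>" using a by (cases a) (auto simp: phase_space_def)
 have "sqrt ((L2_dist L \<beta> I X (L2_class L \<beta> I (\<lambda>t. p)))\<^sup>2 + (V_dist L \<alpha> v p)\<^sup>2) \<le> 0"
  using d by (simp add: phase_dist_def prod_dist_def av(1) steady_def)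
 then have "L2_dist L \<beta> I X (L2_class L \<beta> I (\<lambda>t. p)) = 0" "V_dist L \<alpha> v p = 0" by (simp_all add: sum_power2_le_zero_iff)
 then show ?thesis
  using L2_dist_eq_0[OF av(2) L2_class_in_space[OF P] I] V_dist_eq_0_iff[OF av(3) p_in_V(2)] by (simp add: av(1) steady_def)
qed

lemma steady_L2: "(\<lambda>t. p) \<in> L2_funs L \<beta> {a<..<b}" "Eint \<beta> {a<..<b} (\<lambda>t. p) = E \<beta> p * ennreal (b - a)" if "a \<le> b" for a b
proof -
 show e: "Eint \<beta> {a<..<b} (\<lambda>t. p) = E \<beta> p * ennreal (b - a)" unfolding Eint_def using that by (subst nn_integral_cmult) auto
 have "E \<beta> p < top" using le_less_trans[OF p_E ennreal_one_less_top] .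
 then show "(\<lambda>t. p) \<in> L2_funs L \<beta> {a<..<b}"
  by (intro L2_funsI[where w = "\<lambda>t. p"]) (auto simp: borel_field_def p_sol e ennreal_mult_less_top)
qed

lemma traj_phase_dist:
 assumes u: "traj u" and t: "\<mu> \<le> t"
 shows "phase_dist L \<alpha> {e<..<e + \<mu>} (L2_class L \<beta> {e<..<e + \<mu>} (\<lambda>s. u (s + (t - \<mu> - e))), u t) (steady {e<..<e + \<mu>})
   \<le> sqrt (2 * L ^ 3 * M) * exp (\<mu> - t)"
proof -
 let ?I = "{e<..<e + \<mu>}" and ?c = "t - \<mu> - e"
 let ?u = "\<lambda>s. u (s + ?c)" and ?d = "\<lambda>t k. u t k - p k"
 have pb: "borel_field (\<lambda>t. p)" by (simp add: borel_field_def)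
 have db: "borel_field ?d" by (rule borel_field_diff[OF traj_borel[OF u] pb])
 define r where "r = L ^ 3 * (M * (exp (\<mu> - t))\<^sup>2)"
 have r: "0 \<le> r" using L_pos M_nonneg by (simp add: r_def)
 have "Eint \<beta> ?I (\<lambda>s k. ?u s k - p k) = Eint \<beta> ((\<lambda>s. s + ?c) ` ?I) ?d" using Eint_shift[OF db, of ?I \<beta> ?c] by simp
 also have "\<dots> \<le> ennreal (M * (exp (- (t - \<mu>)))\<^sup>2)" by (rule traj_decay_Eint[OF u]) (use t in auto)
 finally have e1: "Eint \<beta> ?I (\<lambda>s k. ?u s k - p k) \<le> ennreal (M * (exp (\<mu> - t))\<^sup>2)" by simp
 have "ennreal ((L2_dist L \<beta> ?I (L2_class L \<beta> ?I ?u) (L2_class L \<beta> ?I (\<lambda>t. p)))\<^sup>2)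
   = ennreal (L ^ 3) * Eint \<beta> ?I (\<lambda>s k. ?u s k - p k)"
 proof (rule L2_dist_class)
  show "borel_field ?u" by (rule borel_field_shift[OF traj_borel[OF u]])
  show "?u \<in> L2_funs L \<beta> ?I" by (rule traj_L2[OF u, where T = "e + \<mu>"]) (use t mu_pos in auto)
  show "Eint \<beta> ?I (\<lambda>s k. ?u s k - p k) < top" using e1 by (rule le_less_trans) simp
 qed (use mu_pos in \<open>auto intro: pb steady_L2(1)\<close>)
 also have "\<dots> \<le> ennreal (L ^ 3) * ennreal (M * (exp (\<mu> - t))\<^sup>2)" by (rule mult_left_mono[OF e1]) simp
 also have "\<dots> = ennreal r" using L_pos M_nonneg by (simp add: r_def ennreal_mult)
 finally have d1: "(L2_dist L \<beta> ?I (L2_class L \<beta> ?I ?u) (L2_class L \<beta> ?I (\<lambda>t. p)))\<^sup>2 \<le> r" using r by (simp add: ennreal_le_iff)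
 have Ed: "E \<alpha> (?d t) \<le> ennreal (M * (exp (\<mu> - t))\<^sup>2)"
  using t mu_pos M_nonneg by (intro order_trans[OF traj_decay[OF u]] ennreal_leI mult_left_mono power_mono) auto
 have "ennreal ((V_dist L \<alpha> (u t) p)\<^sup>2) = ennreal (L ^ 3) * E \<alpha> (?d t)"
  unfolding V_dist_def by (rule V_norm_sq[OF le_less_trans[OF Ed]]) simp
 also have "\<dots> \<le> ennreal (L ^ 3) * ennreal (M * (exp (\<mu> - t))\<^sup>2)" by (rule mult_left_mono[OF Ed]) simp
 also have "\<dots> = ennreal r" using L_pos M_nonneg by (simp add: r_def ennreal_mult)
 finally have d2: "(V_dist L \<alpha> (u t) p)\<^sup>2 \<le> r" using r by (simp add: ennreal_le_iff)
 have "phase_dist L \<alpha> ?I (L2_class L \<beta> ?I ?u, u t) (steady ?I)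
  = sqrt ((L2_dist L \<beta> ?I (L2_class L \<beta> ?I ?u) (L2_class L \<beta> ?I (\<lambda>t. p)))\<^sup>2 + (V_dist L \<alpha> (u t) p)\<^sup>2)"
  by (simp add: phase_dist_def prod_dist_def steady_def)
 also have "\<dots> \<le> sqrt (r + r)" by (intro real_sqrt_le_mono add_mono d1 d2)
 also have "\<dots> = sqrt (2 * L ^ 3 * M * (exp (\<mu> - t))\<^sup>2)" by (simp add: r_def)
 also have "\<dots> = sqrt (2 * L ^ 3 * M) * exp (\<mu> - t)" by (simp add: real_sqrt_mult)
 finally show ?thesis .
qed

lemma traj_L2_0: "traj u \<Longrightarrow> I \<in> sets borel \<Longrightarrow> I \<subseteq> {-\<mu><..T} \<Longrightarrow> u \<in> L2_funs L \<beta> I"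
 using traj_L2[of u I 0 T] by simp

lemma traj_delayed_solution:
 assumes u: "traj u"
 shows "delayed_solution L \<mu> \<alpha> \<nu> f (L2_class L \<beta> {-\<mu><..<0} u) (u 0) u"
 unfolding delayed_solution_def
proof (intro conjI allI impI)
 show "u \<in> L2_class L \<beta> {-\<mu><..<0} u" by (intro L2_class_mem traj_L2_0[OF u, where T = 0]) auto
 show "continuous_map (top_of_set {0..T}) (V_topology L \<alpha>) u" for T using traj_continuous[OF u, of 0 T] by simp
 show "u \<in> L2_funs L \<beta> {-\<mu><..<T}" for T by (rule traj_L2_0[OF u, where T = T]) auto
 show "weak_equation L \<alpha> \<nu> f {0<..} (\<lambda>t. u (t - \<mu>)) u" using traj_weak[OF u, of 0 "{0<..}"] by simp
qed simp

lemma traj_borel_history: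
 assumes u: "traj u" and c: "\<mu> \<le> c \<or> c = 0"
 obtains a where "borel_field a" "\<And>t. a t \<in> V L \<beta>" "AE t in lborel. t \<in> {c<..<c + \<mu>} \<longrightarrow> u (t - \<mu>) = a t"
  "Eint \<beta> {c<..<c + \<mu>} a \<le> ennreal (2 * \<mu> + 2 * M)"
proof -
 let ?I = "{c<..<c + \<mu>}" and ?u = "\<lambda>t. u (t + - \<mu>)"
 have ub: "borel_field ?u" by (rule borel_field_shift[OF traj_borel[OF u]])
 have "?u \<in> L2_funs L \<beta> ?I" by (rule traj_L2[OF u, where T = "c + \<mu>"]) (use c mu_pos in auto)
 then obtain a where a: "borel_field a" "\<And>t. a t \<in> V L \<beta>" "AE t in lborel. t \<in> ?I \<longrightarrow> ?u t = a t"
  by (rule L2_funs_borel_rep[where I = ?I]) auto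
 have "Eint \<beta> ?I a = Eint \<beta> ?I ?u" unfolding Eint_def using a(3) by (intro nn_integral_cong_AE) (auto split: split_indicator)
 also have "\<dots> = Eint \<beta> ((\<lambda>t. t + - \<mu>) ` ?I) u" by (rule Eint_shift[OF traj_borel[OF u]]) simp
 also have "\<dots> \<le> Eint \<beta> {c - \<mu><..<c - \<mu> + \<mu>} u" by (rule Eint_subset) auto
 also have "\<dots> \<le> ennreal (2 * \<mu> + 2 * M)" by (rule traj_window[OF u]) (use c in auto)
 finally show ?thesis using a by (intro that) auto
qed

text \<open>
 Induction over the windows of length \<open>\<mu>\<close>: on each of them the delayed argument has already been identified.
\<close>

lemma delayed_solution_unique:
 assumes u: "traj u" and v: "delayed_solution L \<mu> \<alpha> \<nu> f (L2_class L \<beta> {-\<mu><..<0} u) (u 0) v"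
 shows "AE t in lborel. t \<in> {-\<mu><..<0} \<longrightarrow> v t = u t" and "0 \<le> t \<Longrightarrow> v t = u t"
proof -
 have vs: "v \<in> L2_class L \<beta> {-\<mu><..<0} u" "v 0 = u 0"
   "\<And>T. 0 < T \<Longrightarrow> continuous_map (top_of_set {0..T}) (V_topology L \<alpha>) v" "\<And>T. 0 < T \<Longrightarrow> v \<in> L2_funs L \<beta> {-\<mu><..<T}"
   "weak_equation L \<alpha> \<nu> f {0<..} (\<lambda>t. v (t - \<mu>)) v" using v by (auto simp: delayed_solution_def)
 show ae: "AE t in lborel. t \<in> {-\<mu><..<0} \<longrightarrow> v t = u t" using L2_class_memD(2)[OF vs(1)] by simp
 have L2sub: "w \<in> L2_funs L \<beta> {c<..<d}" if wL: "w \<in> L2_funs L \<beta> {-\<mu><..<d}" and c: "0 \<le> c" for w c d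
 proof -
  obtain wB where wB: "borel_field wB" "\<And>t. wB t \<in> V L \<beta>" "AE t in lborel. t \<in> {-\<mu><..<d} \<longrightarrow> w t = wB t" "Eint \<beta> {-\<mu><..<d} wB < top"
   by (rule L2_funs_borel_rep[OF wL borel_open[OF open_greaterThanLessThan]]) blast
  have sub: "{c<..<d} \<subseteq> {-\<mu><..<d}" using c mu_pos by auto
  show ?thesis
  proof (rule L2_funsI[OF _ wB(1)])
   show "Eint \<beta> {c<..<d} wB < top" using Eint_subset[OF sub] wB(4) by (rule le_less_trans)
   show "AE t in lborel. t \<in> {c<..<d} \<longrightarrow> w t = wB t" using wB(3) by eventually_elim (use sub in auto)
  qed (use wB(2) in \<open>auto simp: V_iff\<close>)
 qed
 have "\<forall>t\<in>{0..real n * \<mu>}. v t = u t" for n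
 proof (induction n)
  case 0
  then show ?case by (simp add: vs(2))
 next
  case (Suc n)
  let ?c = "real n * \<mu>"
  have c0: "0 \<le> ?c" using mu_pos by simp
  have c: "\<mu> \<le> ?c \<or> ?c = 0" using mu_pos by (cases n) auto
  obtain a where a: "borel_field a" "\<And>t. a t \<in> V L \<beta>" "AE t in lborel. t \<in> {?c<..<?c + \<mu>} \<longrightarrow> u (t - \<mu>) = a t"
   "Eint \<beta> {?c<..<?c + \<mu>} a \<le> ennreal (2 * \<mu> + 2 * M)" by (rule traj_borel_history[OF u c]) blast
  have va: "AE t in lborel. t \<in> {?c<..<?c + \<mu>} \<longrightarrow> v (t - \<mu>) = a t" using a(3) AE_lborel_shift[OF ae, of "- \<mu>"]
  proof eventually_elim
   case (elim t)
   show ?case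
   proof
    assume t: "t \<in> {?c<..<?c + \<mu>}"
    show "v (t - \<mu>) = a t"
    proof (cases "t < \<mu>")
     case True
     then show ?thesis using elim t c0 by auto
    next
     case False
     then have "v (t - \<mu>) = u (t - \<mu>)" using Suc t by auto
     then show ?thesis using elim t by simp
    qed
   qed
  qed
  have sub: "{?c..?c + \<mu>} \<subseteq> {0..?c + \<mu>}" using c0 by auto
  have cont: "continuous_map (top_of_set {?c..?c + \<mu>}) (V_topology L \<alpha>) w"
   if "continuous_map (top_of_set {0..?c + \<mu>}) (V_topology L \<alpha>) w" for w
   by (rule continuous_map_from_subtopology_mono[OF that sub])
  have "v t = u t" if "t \<in> {?c..?c + \<mu>}" for t
  proof (rule weak_window_unique[where u = v and v = u and a = a and J = "{0<..}" and J' = "{0<..}" and c = ?c and d = "?c + \<mu>" and A = "2 * \<mu> + 2 * M"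
     and au = "\<lambda>t. v (t - \<mu>)" and av = "\<lambda>t. u (t - \<mu>)"])
   show "weak_equation L \<alpha> \<nu> f {0<..} (\<lambda>t. v (t - \<mu>)) v" by (rule vs)
   show "weak_equation L \<alpha> \<nu> f {0<..} (\<lambda>t. u (t - \<mu>)) u" using traj_weak[OF u, of 0 "{0<..}"] by simp
   show "continuous_map (top_of_set {?c..?c + \<mu>}) (V_topology L \<alpha>) v" by (rule cont[OF vs(3)]) (use c0 mu_pos in linarith)
   show "continuous_map (top_of_set {?c..?c + \<mu>}) (V_topology L \<alpha>) u" using traj_continuous[OF u, of 0] by (intro cont) simp
   show "v \<in> L2_funs L \<beta> {?c<..<?c + \<mu>}" by (rule L2sub[OF vs(4) c0]) (use c0 mu_pos in linarith)
   show "u \<in> L2_funs L \<beta> {?c<..<?c + \<mu>}" by (rule L2sub[OF traj_L2_0[OF u, where T = "?c + \<mu>"] c0]) auto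
   show "{?c<..<?c + \<mu>} \<subseteq> {0<..}" by (rule subsetI, simp only: greaterThanLessThan_iff greaterThan_iff) (use c0 in linarith)
   then show "{?c<..<?c + \<mu>} \<subseteq> {0<..}" .
   show "v ?c = u ?c" using Suc c0 by auto
  qed (use a va small that nu_ge mu_pos M_nonneg c0 f_V in auto)
  then show ?case using Suc by (auto simp: algebra_simps)
 qed
 then show "v t = u t" if "0 \<le> t"
 proof -
  obtain n where "t / \<mu> \<le> real n" using real_arch_simple by blast
  then have "t \<le> real n * \<mu>" using mu_pos by (simp add: divide_le_eq)
  then show ?thesis using \<open>\<And>n. \<forall>t\<in>{0..real n * \<mu>}. v t = u t\<close> that by auto
 qed
qed

lemma delayed_flow_traj:
 assumes u: "traj u" and t: "0 \<le> t"
 shows "delayed_flow L \<mu> \<alpha> \<nu> f t (L2_class L \<beta> {-\<mu><..<0} u, u 0) = (L2_class L \<beta> {-\<mu><..<0} (\<lambda>s. u (s + t)), u t)"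
 unfolding delayed_flow_def split_conv
proof (rule the_equality)
 show "\<exists>v. delayed_solution L \<mu> \<alpha> \<nu> f (L2_class L \<beta> {-\<mu><..<0} u) (u 0) v \<and>
   (L2_class L \<beta> {-\<mu><..<0} (\<lambda>s. u (s + t)), u t) = (L2_class L \<beta> {-\<mu><..<0} (\<lambda>s. v (t + s)), v t)"
  using traj_delayed_solution[OF u] by (intro exI[of _ u]) (simp add: add.commute)
 fix y assume "\<exists>v. delayed_solution L \<mu> \<alpha> \<nu> f (L2_class L \<beta> {-\<mu><..<0} u) (u 0) v \<and>
   y = (L2_class L \<beta> {-\<mu><..<0} (\<lambda>s. v (t + s)), v t)"
 then obtain v where v: "delayed_solution L \<mu> \<alpha> \<nu> f (L2_class L \<beta> {-\<mu><..<0} u) (u 0) v"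
  "y = (L2_class L \<beta> {-\<mu><..<0} (\<lambda>s. v (t + s)), v t)" by blast
 have ae: "AE s in lborel. s \<in> {-\<mu><..<0} \<longrightarrow> v (t + s) = u (s + t)"
  using AE_lborel_shift[OF delayed_solution_unique(1)[OF u v(1)], of t]
 proof eventually_elim
  case (elim s)
  then show ?case using delayed_solution_unique(2)[OF u v(1), of "s + t"] t by (cases "s + t < 0") (auto simp: add.commute)
 qed
 have uL: "(\<lambda>s. u (s + t)) \<in> L2_funs L \<beta> {-\<mu><..<0}" by (rule traj_L2[OF u, where T = 0]) (use t in auto)
 have fin: "Eint \<beta> {-\<mu><..<0} (\<lambda>s. u (s + t)) < top" by (rule traj_shift_Eint_finite[OF u, where T = 0]) (use t in auto)
 have "(\<lambda>s. v (t + s)) \<in> L2_funs L \<beta> {-\<mu><..<0}" by (rule L2_funsI[where w = "\<lambda>s. u (s + t)"])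
    (use ae fin traj_sol[OF u] borel_field_shift[OF traj_borel[OF u]] in auto)
 then show "y = (L2_class L \<beta> {-\<mu><..<0} (\<lambda>s. u (s + t)), u t)"
  unfolding v(2) using L2_class_cong[OF _ _ uL ae] delayed_solution_unique(2)[OF u v(1) t] by simp
qed

text \<open>
 On its domain of length \<open>\<mu>\<close> the linearized problem, with one window of \<open>u\<close> as advecting field, is the
 delayed problem on the next window.
\<close>

lemma linearized_map_traj:
 assumes u: "traj u" and c: "\<mu> \<le> c \<or> c = 0"
 shows "linearized_map L \<mu> \<alpha> \<nu> f (L2_class L \<beta> {0<..<\<mu>} (\<lambda>s. u (s + (c - \<mu>))), u c)
   = (L2_class L \<beta> {0<..<\<mu>} (\<lambda>s. u (s + c)), u (c + \<mu>))" unfolding linearized_map_def split_conv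
proof (rule the_equality)
 let ?I = "{0<..<\<mu>}" and ?\<psi> = "\<lambda>s. u (s + (c - \<mu>))" and ?u = "\<lambda>s. u (s + c)"
 have c0: "0 \<le> c" using c mu_pos by auto
 have psiL: "?\<psi> \<in> L2_funs L \<beta> ?I" by (rule traj_L2[OF u, where T = \<mu>]) (use c0 in auto)
 have uL: "?u \<in> L2_funs L \<beta> ?I" by (rule traj_L2[OF u, where T = \<mu>]) (use c0 mu_pos in auto)
 have uw: "weak_equation L \<alpha> \<nu> f ?I ?\<psi> ?u" unfolding add_diff_eq by (rule traj_weak[OF u c0]) auto
 have uc: "continuous_map (top_of_set {0..\<mu>}) (V_topology L \<alpha>) ?u" by (rule traj_continuous[OF u c0])
 have us: "linearized_solution L \<mu> \<alpha> \<nu> f ?\<psi> (u c) ?u" unfolding linearized_solution_def using uL uw uc by simp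
 show "\<exists>\<psi>\<in>L2_class L \<beta> ?I ?\<psi>. \<exists>v. linearized_solution L \<mu> \<alpha> \<nu> f \<psi> (u c) v \<and>
   (L2_class L \<beta> ?I ?u, u (c + \<mu>)) = (L2_class L \<beta> ?I v, v \<mu>)"
  using L2_class_mem[OF psiL] us by (intro bexI[of _ ?\<psi>] exI[of _ ?u]) (auto simp: add.commute)
 fix y assume "\<exists>\<psi>\<in>L2_class L \<beta> ?I ?\<psi>. \<exists>v. linearized_solution L \<mu> \<alpha> \<nu> f \<psi> (u c) v \<and> y = (L2_class L \<beta> ?I v, v \<mu>)"
 then obtain \<psi> v where psi: "\<psi> \<in> L2_class L \<beta> ?I ?\<psi>" and v: "linearized_solution L \<mu> \<alpha> \<nu> f \<psi> (u c) v" and y: "y = (L2_class L \<beta> ?I v, v \<mu>)"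
  by blast
 obtain a where a: "borel_field a" "\<And>t. a t \<in> V L \<beta>" "AE t in lborel. t \<in> {c<..<c + \<mu>} \<longrightarrow> u (t - \<mu>) = a t"
  "Eint \<beta> {c<..<c + \<mu>} a \<le> ennreal (2 * \<mu> + 2 * M)" by (rule traj_borel_history[OF u c]) blast
 have psi_a: "AE t in lborel. t \<in> ?I \<longrightarrow> ?\<psi> t = a (t + c)"
  using AE_lborel_shift[OF a(3), of c] by eventually_elim (auto simp: add_diff_eq)
 have ea: "Eint \<beta> ?I (\<lambda>t. a (t + c)) \<le> ennreal (2 * \<mu> + 2 * M)"
  unfolding Eint_shift[OF a(1) borel_open[OF open_greaterThanLessThan]] by (rule order_trans[OF Eint_subset a(4)]) auto
 have vu: "v t = ?u t" if "t \<in> {0..\<mu>}" for t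
 proof (rule weak_window_unique[where u = v and v = ?u and a = "\<lambda>t. a (t + c)" and J = ?I and J' = ?I and c = 0 and d = \<mu> and A = "2 * \<mu> + 2 * M" and au = \<psi> and av = ?\<psi>])
  show "AE t in lborel. t \<in> ?I \<longrightarrow> \<psi> t = a (t + c)" using L2_class_memD(2)[OF psi] psi_a by auto
  show "borel_field (\<lambda>t. a (t + c))" by (rule borel_field_shift[OF a(1)])
 qed (use v psi_a ea uw uc uL a small that nu_ge mu_pos M_nonneg f_V in \<open>auto simp: linearized_solution_def\<close>)
 have "v \<in> L2_funs L \<beta> ?I" using v by (simp add: linearized_solution_def)
 then show "y = (L2_class L \<beta> ?I ?u, u (c + \<mu>))"
  unfolding y using L2_class_cong[OF _ _ uL, of v] vu mu_pos by (auto simp: add.commute)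
qed

lemma linearized_map_power_traj:
 assumes u: "traj u"
 shows "(linearized_map L \<mu> \<alpha> \<nu> f ^^ n) (L2_class L \<beta> {0<..<\<mu>} (\<lambda>s. u (s + (0 - \<mu>))), u 0)
   = (L2_class L \<beta> {0<..<\<mu>} (\<lambda>s. u (s + (real n * \<mu> - \<mu>))), u (real n * \<mu>))"
proof (induction n)
 case (Suc n)
 have "\<mu> \<le> real n * \<mu> \<or> real n * \<mu> = 0" using mu_pos by (cases n) auto
 from linearized_map_traj[OF u this] Suc show ?case by (simp add: algebra_simps)
qed simp

end

section \<open>The attractors at large viscosity\<close>

text \<open>
 The assumption \<open>start\<close> says that each point of the unit ball is the initial state of a trajectory. Initial states of the
 linearized system are included after shifting the history from \<open>(0, \<mu>)\<close> to \<open>(- \<mu>, 0)\<close>.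
\<close>

locale attracting_regime = steady_regime +
 assumes mu_le_M: "\<mu> \<le> M"
  and p_ball: "ennreal (L ^ 3) * (E \<beta> p * ennreal \<mu>) \<le> 1" "ennreal (L ^ 3) * E \<alpha> p \<le> 1"
  and start: "\<And>\<phi> u0. borel_field \<phi> \<Longrightarrow> (\<And>t. \<phi> t \<in> V L \<beta>) \<Longrightarrow> ennreal (L ^ 3) * Eint \<beta> {-\<mu><..<0} \<phi> \<le> 1 \<Longrightarrow>
    u0 \<in> V L \<alpha> \<Longrightarrow> ennreal (L ^ 3) * E \<alpha> u0 \<le> 1 \<Longrightarrow> \<exists>u. trajectory \<mu> \<nu> M f p u \<and> (\<forall>t<0. u t = \<phi> t) \<and> u 0 = u0"
begin

lemma unit_ball_cases:
 assumes x: "x \<in> phase_ball L \<alpha> I 1 1" and I: "I \<in> sets borel"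
 obtains w v where "x = (L2_class L \<beta> I w, v)" "borel_field w" "\<And>t. w t \<in> V L \<beta>"
  "ennreal (L ^ 3) * Eint \<beta> I w \<le> 1" "v \<in> V L \<alpha>" "ennreal (L ^ 3) * E \<alpha> v \<le> 1"
proof -
 obtain X v where X: "x = (X, v)" "X \<in> L2_space L \<beta> I" "L2_norm L \<beta> I X \<le> 1" "v \<in> V L \<alpha>" "V_norm L \<alpha> v \<le> 1"
  using x by (cases x) (auto simp: phase_ball_def)
 obtain w where w: "borel_field w" "\<And>t. w t \<in> V L \<beta>" "Eint \<beta> I w < top" "w \<in> L2_funs L \<beta> I" "X = L2_class L \<beta> I w"
  by (rule L2_space_borel_rep[OF X(2) I]) blast
 have "0 \<le> L2_norm L \<beta> I X" by (simp add: L2_norm_def integral_nonneg_AE)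
 then have "(L2_norm L \<beta> I X)\<^sup>2 \<le> 1" using X(3) by (simp add: power_le_one)
 then have "ennreal ((L2_norm L \<beta> I X)\<^sup>2) \<le> 1" by (simp add: ennreal_le_1)
 then have wE: "ennreal (L ^ 3) * Eint \<beta> I w \<le> 1" using L2_norm_class[OF w(1,3,4) I] w(5) by simp
 have vE: "ennreal (L ^ 3) * E \<alpha> v \<le> 1" using X(4,5) V_norm_le_iff[of \<alpha> v 1] by (simp add: V_iff)
 show ?thesis by (rule that[OF _ w(1,2) wE X(4) vE]) (simp add: X(1) w(5))
qed

lemma steady_in_ball: "steady {e<..<e + \<mu>} \<in> phase_ball L \<alpha> {e<..<e + \<mu>} 1 1"
proof -
 let ?I = "{e<..<e + \<mu>}"
 have P: "(\<lambda>t. p) \<in> L2_funs L \<beta> ?I" and eq: "Eint \<beta> ?I (\<lambda>t. p) = E \<beta> p * ennreal \<mu>" using steady_L2[of e "e + \<mu>"] mu_pos by auto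
 have fin: "Eint \<beta> ?I (\<lambda>t. p) < top" unfolding eq using p_in_V(1) by (simp add: V_iff ennreal_mult_less_top)
 have "ennreal ((L2_norm L \<beta> ?I (L2_class L \<beta> ?I (\<lambda>t. p)))\<^sup>2) = ennreal (L ^ 3) * Eint \<beta> ?I (\<lambda>t. p)"
  by (rule L2_norm_class[OF _ fin P]) (auto simp: borel_field_def)
 also have "\<dots> \<le> 1" unfolding eq by (rule p_ball)
 finally have "L2_norm L \<beta> ?I (L2_class L \<beta> ?I (\<lambda>t. p)) \<le> 1" by (simp add: ennreal_le_1 abs_square_le_1)
 moreover have "V_norm L \<alpha> p \<le> 1" using p_ball(2) p_in_V(2) V_norm_le_iff[of \<alpha> p 1] by (simp add: V_iff)
 ultimately show ?thesis using L2_class_in_space[OF P] p_in_V(2) by (simp add: phase_ball_def steady_def)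
qed

lemma traj_p: "traj (\<lambda>t. p)"
proof (rule trajectory_steady[OF p_sol p_E p_stat])
 have "Eint \<beta> {-\<mu><..<0} (\<lambda>t. p) = E \<beta> p * ennreal \<mu>" using steady_L2(2)[of "-\<mu>" 0] mu_pos by simp
 also have "\<dots> \<le> 1 * ennreal M" using mu_le_M by (intro mult_mono p_E ennreal_leI) auto
 finally show "Eint \<beta> {-\<mu><..<0} (\<lambda>t. p) \<le> ennreal M" by simp
qed

lemma delayed_attractor_iff: "delayed_attractor L \<mu> \<alpha> \<nu> f 1 1 A \<longleftrightarrow> A = {steady {-\<mu><..<0}}"
proof -
 let ?I = "{-\<mu><..<0}" and ?C = "sqrt (2 * L ^ 3 * M)"
 have I0: "{-\<mu><..<-\<mu> + \<mu>} = ?I" by simp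
 have ball: "phase_ball L \<alpha> ?I 1 1 \<subseteq> phase_space L \<alpha> ?I" by (auto simp: phase_ball_def phase_space_def)
 have PB: "steady ?I \<in> phase_ball L \<alpha> ?I 1 1" using steady_in_ball[of "-\<mu>"] by simp
 have fix_: "delayed_flow L \<mu> \<alpha> \<nu> f t (steady ?I) = steady ?I" if "0 \<le> t" for t
  using delayed_flow_traj[OF traj_p that] by (simp add: steady_def)
 have decay: "phase_dist L \<alpha> ?I (delayed_flow L \<mu> \<alpha> \<nu> f t x) (steady ?I) \<le> ?C * exp (\<mu> - t)"
  if x: "x \<in> phase_ball L \<alpha> ?I 1 1" and t: "\<mu> \<le> t" for x t
 proof -
  obtain w v where w: "x = (L2_class L \<beta> ?I w, v)" "borel_field w" "\<And>t. w t \<in> V L \<beta>"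
   "ennreal (L ^ 3) * Eint \<beta> ?I w \<le> 1" "v \<in> V L \<alpha>" "ennreal (L ^ 3) * E \<alpha> v \<le> 1" by (rule unit_ball_cases[OF x]) auto
  obtain u where u: "traj u" "\<And>t. t < 0 \<Longrightarrow> u t = w t" "u 0 = v" using start[OF w(2-6)] by blast
  have uL: "u \<in> L2_funs L \<beta> ?I" by (rule traj_L2_0[OF u(1), where T = 0]) auto
  have wL: "w \<in> L2_funs L \<beta> ?I"
  proof (rule L2_funsI[where w = u])
   show "Eint \<beta> ?I u < top" using u(1) by (auto simp: trajectory_def intro: le_less_trans)
  qed (use u traj_borel w(3) in \<open>auto simp: V_iff\<close>)
  have "x = (L2_class L \<beta> ?I u, u 0)" unfolding w(1) u(3) using L2_class_cong[OF _ wL uL] u(2) by simp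
  then have "delayed_flow L \<mu> \<alpha> \<nu> f t x = (L2_class L \<beta> ?I (\<lambda>s. u (s + t)), u t)"
   using delayed_flow_traj[OF u(1), of t] t mu_pos by simp
  then show ?thesis using traj_phase_dist[OF u(1) t, of "-\<mu>"] by simp
 qed
 have r: "((\<lambda>t. ?C * exp (\<mu> - t)) \<longlongrightarrow> 0) at_top"
 proof -
  have "((\<lambda>t. ?C * exp \<mu> * exp (- t)) \<longlongrightarrow> ?C * exp \<mu> * 0) at_top"
   by (intro tendsto_mult tendsto_const filterlim_compose[OF exp_at_bot] filterlim_uminus_at_bot_at_top)
  then show ?thesis by (simp add: exp_diff exp_minus field_simps)
 qed
 have sep: "a = steady ?I" if "a \<in> phase_ball L \<alpha> ?I 1 1" "phase_dist L \<alpha> ?I a (steady ?I) \<le> 0" for a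
  by (rule steady_separated) (use that ball steady_L2(1)[of "-\<mu>" 0] mu_pos in auto)
 have M: "Metric_space (phase_space L \<alpha> ?I) (phase_dist L \<alpha> ?I)" by (rule Metric_space_phase) simp
 note attr = singleton_local_attractor[where S = "delayed_flow L \<mu> \<alpha> \<nu> f" and \<tau> = \<mu> and r = "\<lambda>t. ?C * exp (\<mu> - t)",
   OF M PB subsetD[OF ball PB] fix_ decay r sep]
 show ?thesis unfolding delayed_attractor_def using attr by blast
qed

lemma linearized_attractor_iff: "linearized_attractor L \<mu> \<alpha> \<nu> f 1 1 A \<longleftrightarrow> A = {steady {0<..<\<mu>}}"
proof -
 let ?I = "{0<..<\<mu>}" and ?C = "sqrt (2 * L ^ 3 * M)" and ?U = "linearized_map L \<mu> \<alpha> \<nu> f"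
 have ball: "phase_ball L \<alpha> ?I 1 1 \<subseteq> phase_space L \<alpha> ?I" by (auto simp: phase_ball_def phase_space_def)
 have PB: "steady ?I \<in> phase_ball L \<alpha> ?I 1 1" using steady_in_ball[of 0] by simp
 have fix_: "?U (steady ?I) = steady ?I" using linearized_map_power_traj[OF traj_p, of 1] by (simp add: steady_def)
 have decay: "phase_dist L \<alpha> ?I ((?U ^^ n) x) (steady ?I) \<le> ?C * exp (\<mu> - real n * \<mu>)"
  if x: "x \<in> phase_ball L \<alpha> ?I 1 1" and n: "1 \<le> n" for x n
 proof -
  obtain w v where w: "x = (L2_class L \<beta> ?I w, v)" "borel_field w" "\<And>t. w t \<in> V L \<beta>"
   "ennreal (L ^ 3) * Eint \<beta> ?I w \<le> 1" "v \<in> V L \<alpha>" "ennreal (L ^ 3) * E \<alpha> v \<le> 1" by (rule unit_ball_cases[OF x]) auto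
  have "(\<lambda>t. t + \<mu>) ` {-\<mu><..<0} = ?I"
  proof (intro set_eqI iffI)
   fix x assume "x \<in> ?I"
   then show "x \<in> (\<lambda>t. t + \<mu>) ` {-\<mu><..<0}" by (intro image_eqI[of _ _ "x - \<mu>"]) auto
  qed auto
  then have "Eint \<beta> {-\<mu><..<0} (\<lambda>t. w (t + \<mu>)) = Eint \<beta> ?I w" using Eint_shift[OF w(2), of "{-\<mu><..<0}" \<beta> \<mu>] by simp
  then obtain u where u: "traj u" "\<And>t. t < 0 \<Longrightarrow> u t = w (t + \<mu>)" "u 0 = v"
   using start[OF borel_field_shift[OF w(2), of \<mu>] w(3) _ w(5,6)] w(4) by auto
  have uL: "(\<lambda>s. u (s + (0 - \<mu>))) \<in> L2_funs L \<beta> ?I" by (rule traj_L2[OF u(1), where T = \<mu>]) auto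
  have wL: "w \<in> L2_funs L \<beta> ?I"
  proof (rule L2_funsI[OF _ w(2)])
   have "ennreal (L ^ 3) * Eint \<beta> ?I w < top" using w(4) by (rule le_less_trans) simp
   then show "Eint \<beta> ?I w < top" using L_pos by (auto simp: ennreal_mult_less_top)
  qed (use w(3) in \<open>auto simp: V_iff\<close>)
  have "x = (L2_class L \<beta> ?I (\<lambda>s. u (s + (0 - \<mu>))), u 0)" unfolding w(1) u(3) using L2_class_cong[OF _ wL uL] u(2) by simp
  then have "(?U ^^ n) x = (L2_class L \<beta> ?I (\<lambda>s. u (s + (real n * \<mu> - \<mu>))), u (real n * \<mu>))"
   using linearized_map_power_traj[OF u(1), of n] by simp
  moreover have "\<mu> \<le> real n * \<mu>" using n mu_pos by simp
  ultimately show ?thesis using traj_phase_dist[OF u(1), of "real n * \<mu>" 0] by simp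
 qed
 have r: "(\<lambda>n. ?C * exp (\<mu> - real n * \<mu>)) \<longlonglongrightarrow> 0"
 proof -
  have "(\<lambda>n. exp (- \<mu>) ^ n) \<longlonglongrightarrow> 0" using mu_pos by (intro LIMSEQ_realpow_zero) auto
  then have "(\<lambda>n. ?C * exp \<mu> * exp (- \<mu>) ^ n) \<longlonglongrightarrow> ?C * exp \<mu> * 0" by (intro tendsto_mult tendsto_const)
  moreover have "?C * exp \<mu> * exp (- \<mu>) ^ n = ?C * exp (\<mu> - real n * \<mu>)" for n
   by (simp add: exp_of_nat_mult[symmetric] exp_add[symmetric])
  ultimately show ?thesis by simp
 qed
 have sep: "a = steady ?I" if "a \<in> phase_ball L \<alpha> ?I 1 1" "phase_dist L \<alpha> ?I a (steady ?I) \<le> 0" for a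
  by (rule steady_separated) (use that ball steady_L2(1)[of 0 \<mu>] mu_pos in auto)
 have M: "Metric_space (phase_space L \<alpha> ?I) (phase_dist L \<alpha> ?I)" by (rule Metric_space_phase) simp
 note attr = singleton_discrete_local_attractor[where U = ?U and r = "\<lambda>n. ?C * exp (\<mu> - real n * \<mu>)",
   OF M PB subsetD[OF ball PB] fix_ decay r sep]
 show ?thesis unfolding linearized_attractor_def using attr by blast
qed

end

context torus
begin

lemma trajectory_start:
 assumes \<mu>: "0 < \<mu>" and f: "f \<in> V L \<alpha>" and p: "solenoidal p" "E \<beta> p \<le> 1" "stationary \<nu> f p"
  and m_def: "m = 1 + 2 / L ^ 3 + 2 * \<mu> + 2 * lam1 powr (\<alpha> - \<beta>)"
  and ex: "\<And>h w. borel_field h \<Longrightarrow> (\<And>t. solenoidal (h t)) \<Longrightarrow> Eint \<beta> UNIV h \<le> ennreal m \<Longrightarrow> solenoidal w \<Longrightarrow> E \<alpha> w \<le> ennreal m \<Longrightarrow>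
    \<exists>z. perturbation z \<and> Q z \<le> ennreal (4 * m) \<and> evolve \<nu> \<mu> p h w z = z"
  and \<phi>: "borel_field \<phi>" "\<And>t. \<phi> t \<in> V L \<beta>" "ennreal (L ^ 3) * Eint \<beta> {-\<mu><..<0} \<phi> \<le> 1"
  and u0: "u0 \<in> V L \<alpha>" "ennreal (L ^ 3) * E \<alpha> u0 \<le> 1"
 shows "\<exists>u. trajectory \<mu> \<nu> (4 * m) f p u \<and> (\<forall>t<0. u t = \<phi> t) \<and> u 0 = u0"
proof -
 have m0: "0 \<le> m" and mm: "2 / L ^ 3 + 2 * \<mu> \<le> m" "2 / L ^ 3 + 2 * lam1 powr (\<alpha> - \<beta>) \<le> m"
  using L_pos \<mu> by (auto simp: m_def intro!: add_nonneg_nonneg)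
 have "1 / L ^ 3 \<le> 2 / L ^ 3" using L_pos by (intro divide_right_mono) auto
 then have m4: "1 / L ^ 3 \<le> 4 * m" using m0 mm(1) \<mu> by linarith
 have div: "x \<le> ennreal (1 / L ^ 3)" if "ennreal (L ^ 3) * x \<le> 1" for x
 proof -
  have "ennreal (1 / L ^ 3) * (ennreal (L ^ 3) * x) \<le> ennreal (1 / L ^ 3) * 1" by (rule mult_left_mono[OF that]) simp
  moreover have "ennreal (1 / L ^ 3) * ennreal (L ^ 3) = 1" using L_pos by (simp add: ennreal_mult[symmetric])
  ultimately show ?thesis by (simp add: mult.assoc[symmetric])
 qed
 define h where "h = (\<lambda>t k. (indicator {-\<mu><..<0} t * exp t) *\<^sub>R (\<phi> t k - p k))"
 have [measurable]: "(\<lambda>t. \<phi> t k) \<in> borel_measurable borel" for k using \<phi>(1) by (simp add: borel_field_def)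
 have hb: "borel_field h" unfolding borel_field_def h_def by measurable
 have \<phi>s: "solenoidal (\<phi> t)" for t using \<phi>(2) by (simp add: V_iff)
 have hs: "solenoidal (h t)" for t unfolding h_def by (intro solenoidal_scaleR solenoidal_diff \<phi>s p) simp
 note [measurable] = borel_field_E[OF \<phi>(1)]
 have "Eint \<beta> UNIV h \<le> (\<integral>\<^sup>+t. 2 * (E \<beta> (\<phi> t) * indicator {-\<mu><..<0} t) + 2 * indicator {-\<mu><..<0} t \<partial>lborel)" unfolding Eint_def
 proof (rule nn_integral_mono)
  fix t
  show "E \<beta> (h t) * indicator UNIV t \<le> 2 * (E \<beta> (\<phi> t) * indicator {-\<mu><..<0} t) + 2 * indicator {-\<mu><..<0} t"
  proof (cases "t \<in> {-\<mu><..<0}")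
   case True
   then have "E \<beta> (h t) \<le> E \<beta> (\<lambda>k. \<phi> t k - p k)" unfolding h_def by (intro E_mono) (simp add: mult_left_le_one_le)
   also have "\<dots> \<le> 2 * E \<beta> (\<phi> t) + 2 * E \<beta> p" by (rule E_diff_le)
   also have "\<dots> \<le> 2 * E \<beta> (\<phi> t) + 2 * 1" by (intro add_mono mult_left_mono p(2)) auto
   finally show ?thesis using True by simp
  qed (simp add: h_def)
 qed
 also have "\<dots> = 2 * Eint \<beta> {-\<mu><..<0} \<phi> + 2 * ennreal \<mu>"
  unfolding Eint_def using \<mu> by (subst nn_integral_add) (auto simp: nn_integral_cmult)
 also have "\<dots> \<le> 2 * ennreal (1 / L ^ 3) + 2 * ennreal \<mu>" by (intro add_mono mult_left_mono div \<phi>) auto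
 also have "\<dots> = ennreal (2 / L ^ 3 + 2 * \<mu>)" using L_pos \<mu> by (simp add: ennreal_plus ennreal_mult[of 2, symmetric, simplified])
 also have "\<dots> \<le> ennreal m" by (rule ennreal_leI[OF mm(1)])
 finally have hE: "Eint \<beta> UNIV h \<le> ennreal m" .
 have us: "solenoidal u0" using u0 by (simp add: V_iff)
 have "E \<alpha> (\<lambda>k. u0 k - p k) \<le> 2 * E \<alpha> u0 + 2 * E \<alpha> p" by (rule E_diff_le)
 also have "\<dots> \<le> 2 * ennreal (1 / L ^ 3) + 2 * (ennreal (lam1 powr (\<alpha> - \<beta>)) * E \<beta> p)"
  by (intro add_mono mult_left_mono div u0 E_embedding) auto
 also have "\<dots> \<le> 2 * ennreal (1 / L ^ 3) + 2 * (ennreal (lam1 powr (\<alpha> - \<beta>)) * 1)" by (intro add_mono mult_left_mono p) auto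
 also have "\<dots> = ennreal (2 / L ^ 3 + 2 * lam1 powr (\<alpha> - \<beta>))"
  using L_pos by (simp add: ennreal_plus ennreal_mult[of 2, symmetric, simplified])
 also have "\<dots> \<le> ennreal m" by (rule ennreal_leI[OF mm(2)])
 finally have wE: "E \<alpha> (\<lambda>k. u0 k - p k) \<le> ennreal m" .
 obtain z where z: "perturbation z" "Q z \<le> ennreal (4 * m)" "evolve \<nu> \<mu> p h (\<lambda>k. u0 k - p k) z = z"
  using ex[OF hb hs hE solenoidal_diff[OF us p(1)] wE] by blast
 have "Eint \<beta> {-\<mu><..<0} \<phi> \<le> ennreal (4 * m)" by (rule order_trans[OF div[OF \<phi>(3)] ennreal_leI[OF m4]])
 then show ?thesis
  by (intro trajectory_from_perturbation[where h = h and m = m and z = z]) (use p \<mu> \<phi>(1) \<phi>s us m0 h_def hb hs hE z in auto)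
qed

text \<open>
 Three thresholds are combined: one for a stationary solution small enough to put the steady state into both unit balls, one for the
 decaying perturbations of all data of size \<open>m\<close>, and one for uniqueness on windows.
\<close>

lemma exists_attracting_regime:
 assumes \<mu>: "0 < \<mu>" and f: "f \<in> V L \<alpha>"
 shows "\<exists>\<nu>\<^sub>0\<ge>1. \<forall>\<nu>\<ge>\<nu>\<^sub>0. \<exists>M p. attracting_regime L \<alpha> \<mu> \<nu> M f p"
proof -
 define c1 where "c1 = lam1 powr (\<alpha> - \<beta>)"
 define m where "m = 1 + 2 / L ^ 3 + 2 * \<mu> + 2 * c1"
 \<comment> \<open>Small enough for the constant history \<open>p\<close> and the value \<open>p\<close> to lie in the unit balls.\<close>
 define \<delta> where "\<delta> = 1 / (1 + L ^ 3 * \<mu> + L ^ 3 * c1)"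
 have c1: "0 \<le> c1" by (simp add: c1_def)
 have m1: "1 \<le> m" "\<mu> \<le> 4 * m" using L_pos \<mu> c1 by (auto simp: m_def)
 have dpos: "0 < 1 + L ^ 3 * \<mu> + L ^ 3 * c1" using L_pos \<mu> c1 by (intro add_pos_nonneg) auto
 have \<delta>: "0 < \<delta>" "\<delta> \<le> 1" "L ^ 3 * (\<delta> * \<mu>) \<le> 1" "L ^ 3 * (c1 * \<delta>) \<le> 1"
  using dpos L_pos \<mu> c1 by (auto simp: \<delta>_def divide_le_eq mult_ac intro: add_nonneg_nonneg)
 obtain \<nu>a where \<nu>a: "1 \<le> \<nu>a" "\<And>\<nu>. \<nu> \<ge> \<nu>a \<Longrightarrow> \<exists>p. solenoidal p \<and> E \<beta> p \<le> ennreal \<delta> \<and> stationary \<nu> f p"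
  using exists_stationary[OF f \<delta>(1)] by blast
 obtain \<nu>b where \<nu>b: "1 \<le> \<nu>b" "\<And>\<nu> p h w. \<nu> \<ge> \<nu>b \<Longrightarrow> solenoidal p \<Longrightarrow> E \<beta> p \<le> 1 \<Longrightarrow> borel_field h \<Longrightarrow> (\<And>t. solenoidal (h t)) \<Longrightarrow>
   Eint \<beta> UNIV h \<le> ennreal m \<Longrightarrow> solenoidal w \<Longrightarrow> E \<alpha> w \<le> ennreal m \<Longrightarrow>
   \<exists>z. perturbation z \<and> Q z \<le> ennreal (4 * m) \<and> evolve \<nu> \<mu> p h w z = z" using exists_perturbation[OF m1(1), of \<mu>] by metis
 have "\<exists>M p. attracting_regime L \<alpha> \<mu> \<nu> M f p" if \<nu>: "\<nu> \<ge> max (max \<nu>a \<nu>b) (2 * (K * (2 * \<mu> + 2 * (4 * m))))" for \<nu>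
 proof -
  obtain p where p: "solenoidal p" "E \<beta> p \<le> ennreal \<delta>" "stationary \<nu> f p" using \<nu>a(2)[of \<nu>] \<nu> by auto
  have p1: "E \<beta> p \<le> 1" using p(2) \<delta>(2) ennreal_leI[of \<delta> 1] by (auto intro: order_trans)
  have "attracting_regime L \<alpha> \<mu> \<nu> (4 * m) f p"
  proof unfold_locales
   show "1 \<le> \<nu>" "0 < \<mu>" "0 \<le> 4 * m" "f \<in> V L \<alpha>" "\<mu> \<le> 4 * m" using \<nu> \<nu>a(1) \<mu> m1 f by auto
   show "solenoidal p" "E \<beta> p \<le> 1" "stationary \<nu> f p" by (rule p p1)+
   show "K * (2 * \<mu> + 2 * (4 * m)) \<le> \<nu> / 2" using \<nu> by simp
   have "ennreal (L ^ 3) * (E \<beta> p * ennreal \<mu>) \<le> ennreal (L ^ 3) * (ennreal \<delta> * ennreal \<mu>)"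
    by (intro mult_left_mono mult_right_mono p) auto
   also have "\<dots> = ennreal (L ^ 3 * (\<delta> * \<mu>))" using L_pos \<mu> \<delta>(1) by (simp add: ennreal_mult)
   also have "\<dots> \<le> 1" using \<delta>(3) by (simp add: ennreal_le_1)
   finally show "ennreal (L ^ 3) * (E \<beta> p * ennreal \<mu>) \<le> 1" .
   have "E \<alpha> p \<le> ennreal c1 * E \<beta> p" unfolding c1_def by (rule E_embedding) simp
   also have "\<dots> \<le> ennreal c1 * ennreal \<delta>" by (intro mult_left_mono p) simp
   finally have "ennreal (L ^ 3) * E \<alpha> p \<le> ennreal (L ^ 3) * (ennreal c1 * ennreal \<delta>)" by (rule mult_left_mono) simp
   also have "\<dots> = ennreal (L ^ 3 * (c1 * \<delta>))" using L_pos c1 \<delta>(1) by (simp add: ennreal_mult)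
   also have "\<dots> \<le> 1" using \<delta>(4) by (simp add: ennreal_le_1)
   finally show "ennreal (L ^ 3) * E \<alpha> p \<le> 1" .
   show "\<exists>u. trajectory \<mu> \<nu> (4 * m) f p u \<and> (\<forall>t<0. u t = \<phi> t) \<and> u 0 = u0"
    if "borel_field \<phi>" "\<And>t. \<phi> t \<in> V L \<beta>" "ennreal (L ^ 3) * Eint \<beta> {-\<mu><..<0} \<phi> \<le> 1"
     "u0 \<in> V L \<alpha>" "ennreal (L ^ 3) * E \<alpha> u0 \<le> 1" for \<phi> u0
    by (rule trajectory_start[OF \<mu> f p(1) p1 p(3) m_def[unfolded c1_def] \<nu>b(2)[OF _ p(1) p1] that]) (use \<nu> in auto)
  qed
  then show ?thesis by blast
 qed
 then show ?thesis using \<nu>a(1) by (intro exI[of _ "max (max \<nu>a \<nu>b) (2 * (K * (2 * \<mu> + 2 * (4 * m))))"]) auto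
qed

end

theorem theorem6p3:
 fixes L \<mu> \<alpha> :: real and f :: field
 assumes "L > 0" and "\<mu> > 0" and "\<alpha> > 1 / 2" and "f \<in> V L \<alpha>"
 shows "\<exists>\<nu>\<^sub>0>0. \<exists>R \<rho> :: real \<Rightarrow> real.
      (\<forall>\<nu>\<ge>\<nu>\<^sub>0. R \<nu> > 0 \<and> \<rho> \<nu> > 0 \<and>
       (\<exists>!A. delayed_attractor L \<mu> \<alpha> \<nu> f (R \<nu>) (\<rho> \<nu>) A)) \<and>
      (\<exists>\<nu>\<^sub>1\<ge>\<nu>\<^sub>0. \<forall>\<nu>\<ge>\<nu>\<^sub>1.
       (\<exists>!A. linearized_attractor L \<mu> \<alpha> \<nu> f (R \<nu>) (\<rho> \<nu>) A) \<and>
       (\<exists>p. linearized_attractor L \<mu> \<alpha> \<nu> f (R \<nu>) (\<rho> \<nu>) {p}) \<and>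
       (\<exists>p. delayed_attractor L \<mu> \<alpha> \<nu> f (R \<nu>) (\<rho> \<nu>) {p}))"
proof -
 interpret torus L \<alpha> using assms(1,3) by unfold_locales
 obtain \<nu>\<^sub>0 where \<nu>\<^sub>0: "1 \<le> \<nu>\<^sub>0" "\<And>\<nu>. \<nu> \<ge> \<nu>\<^sub>0 \<Longrightarrow> \<exists>M p. attracting_regime L \<alpha> \<mu> \<nu> M f p"
  using exists_attracting_regime[OF assms(2,4)] by blast
 have "(\<exists>P. \<forall>A. delayed_attractor L \<mu> \<alpha> \<nu> f 1 1 A \<longleftrightarrow> A = {P}) \<and> (\<exists>P. \<forall>A. linearized_attractor L \<mu> \<alpha> \<nu> f 1 1 A \<longleftrightarrow> A = {P})"
  if \<nu>: "\<nu> \<ge> \<nu>\<^sub>0" for \<nu>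
 proof -
  obtain M p where "attracting_regime L \<alpha> \<mu> \<nu> M f p" using \<nu>\<^sub>0(2)[OF \<nu>] by blast
  then interpret attracting_regime L \<alpha> \<mu> \<nu> M f p .
  show ?thesis using delayed_attractor_iff linearized_attractor_iff by blast
 qed
 then show ?thesis using \<nu>\<^sub>0(1) by (intro exI[of _ \<nu>\<^sub>0] exI[of _ "\<lambda>_. 1"] conjI) (auto, metis+)
qed

end
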